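(* Let $G_1$ and $G_2$ be countable discrete groups, let $(X,\mu)$ be a standard probability space, and let $\alpha$ be a measure-preserving action of $G_1*G_2$ on $(X,\mu)$ whose restrictions to $G_1$ and $G_2$ are approximation regular. Then $\alpha$ is approximation regular and $$s(G_1*G_2,X)=s(G_1,X)+s(G_2,X).$$
   Context: Dimensions take values in $[-\infty,\infty]$; a sum involving both $-\infty$ and $+\infty$ is read as $-\infty$. A discrete measurable groupoid is a groupoid $\mathcal{G}$ (source map $\mathfrak{s}$, range map $\mathfrak{r}$, unit space $\mathcal{G}^0$; $xy$ is defined when $\mathfrak{s}(x)=\mathfrak{r}(y)$) with the structure of a standard Borel space such that $\mathcal{G}^0$ is Borel, the source, range, multiplication and inversion maps are Borel, and $\mathfrak{s}^{-1}(x)$ is countable for every $x\in\mathcal{G}^0$. A probability-measure-preserving (p.m.p.) groupoid is a discrete measurable groupoid together with a Borel probability measure $\mu$ on $\mathcal{G}^0$ such that $\int_{\mathcal{G}^0}|\mathfrak{s}^{-1}(x)\cap B|\,d\mu(x)=\int_{\mathcal{G}^0}|\mathfrak{r}^{-1}(x)\cap B|\,d\mu(x)$ for every Borel $B\subseteq\mathcal{G}$; this common value defines a $\sigma$-finite Borel measure on $\mathcal{G}$, again denoted $\mu$. For a Borel set $B\subseteq\mathcal{G}$ on which $\mathfrak{s}$ and $\mathfrak{r}$ are injective, $s_B$ is the partial isometry on $L^2(\mathcal{G},\mu)$ given by $s_B\xi(x)=\xi(y^{-1})$ if $y$ is the element of $\mathfrak{r}^{-1}(\mathfrak{s}(x))$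 with $xy\in B$, and $s_B\xi(x)=0$ if there is no such $y$. $I_{\mathcal{G}}$ is the set of all such $s_B$; it is an inverse semigroup with inverse $s\mapsto s^*$. $\mathrm{VN}(\mathcal{G})$ is the von Neumann algebra generated by $I_{\mathcal{G}}$, with trace $\tau(a)=\langle a1_{\mathcal{G}^0},1_{\mathcal{G}^0}\rangle$ and $\|a\|_2=\tau(a^*a)^{1/2}$. $I_d$ is the set of partial permutation matrices in $M_d=M_d(\mathbb{C})$ (partial isometries with all entries $0$ or $1$), $\mathrm{tr}$ is the normalized trace on $M_d$, and $\|a\|_2=\mathrm{tr}(a^*a)^{1/2}$ on $M_d$. For $\Omega\subseteq I_{\mathcal{G}}$: $\Omega^*=\{s^*:s\in\Omega\}$; $\Omega^n$ is the set of products $s_1\cdots s_n$ with $s_i\in\Omega$; $\Omega^{\le n}=\bigcup_{k=1}^n\Omega^k$; $[\Omega]$ is the linear span of $\Omega$ in $\mathrm{VN}(\mathcal{G})$. For a finite set $F\subseteq I_{\mathcal{G}}$, $n,d\in\mathbb{N}$ and $\delta>0$, $\mathrm{SA}(F,n,\delta,d)$ is the set of all linear maps $\varphi:[I_{\mathcal{G}}]\to M_d$ such that (1) $\|\varphi(s_1\cdots s_k)-\varphi(s_1)\cdots\varphi(s_k)\|_2<\delta$ for all $k=1,\dots,n$ and $s_1,\dots,s_k\in F\cup F^*$, (2) $\varphi((F\cup F^* )^{\le n})\subseteq I_d$, (3) $|\mathrm{tr}\circ\varphi(s)-\tau(s)|<\delta$ for all $s\in(F\cup F^* )^{\le n}$.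 For a set $\mathcal{Y}$ of maps, $|\mathcal{Y}|_E$ denotes the cardinality of the set of restrictions $\{\varphi|_E:\varphi\in\mathcal{Y}\}$. For finite $E,F\subseteq I_{\mathcal{G}}$ set $s_E(F,n,\delta)=\limsup_{d\to\infty}\frac{1}{d\log d}\log|\mathrm{SA}(F,n,\delta,d)|_E$ (with $\log 0=-\infty$) and $s_E(F)=\inf_{n\in\mathbb{N}}\inf_{\delta>0}s_E(F,n,\delta)$. The sofic dimension is $s(\mathcal{G})=\sup_E\inf_F s_E(F)$, with $E$ and $F$ ranging over the finite subsets of $I_{\mathcal{G}}$; the lower sofic dimension $\underline{s}(\mathcal{G})$ is defined in the same way with $\liminf_{d\to\infty}$ in place of $\limsup_{d\to\infty}$. For a measure-preserving action of a countable discrete group $G$ on a standard probability space $(X,\mu)$, the associated p.m.p. groupoid is $\mathcal{G}=G\times X$ with unit space $\{e\}\times X\cong X$ (carrying $\mu$), source $(g,x)\mapsto x$, range $(g,x)\mapsto gx$, and product $(h,gx)(g,x)=(hg,x)$. One writes $s(G,X)=s(\mathcal{G})$ and $\underline{s}(G,X)=\underline{s}(\mathcal{G})$. The action is approximation regular if $s(G,X)=\underline{s}(G,X)$. For a subgroup, $s(G_i,X)$ refers to the restricted action. *)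

theory Defs
  imports
    "HOL-Probability.Probability"
    "HOL-Algebra.Group_Action"
    "Jordan_Normal_Form.Schur_Decomposition"
begin

section \<open>Standard probability spaces and measure-preserving actions\<close>

definition standard_borel :: "'a measure \<Rightarrow> bool" where
  "standard_borel M \<longleftrightarrow>
     (\<exists>T. topspace T = space M \<and> completely_metrizable_space T \<and> second_countable T \<and>
          sets M = sigma_sets (space M) {U. openin T U})"

definition standard_prob_space :: "'a measure \<Rightarrow> bool" where
  "standard_prob_space M \<longleftrightarrow> standard_borel M \<and> prob_space M"

definition mp_action :: "('g, 'm) monoid_scheme \<Rightarrow> 'x measure \<Rightarrow> ('g \<Rightarrow> 'x \<Rightarrow> 'x) \<Rightarrow> bool" where
  "mp_action G M \<alpha> \<longleftrightarrow> group_action G (space M) \<alpha> \<and>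
     (\<forall>g\<in>carrier G. \<alpha> g \<in> M \<rightarrow>\<^sub>M M \<and> distr M M (\<alpha> g) = M)"

lemma mp_action_compose_hom:
  assumes "group H" "f \<in> hom H G" "mp_action G M \<alpha>"
  shows "mp_action H M (\<lambda>h. \<alpha> (f h))"
proof -
  interpret A: group_action G "space M" \<alpha> using assms by (simp add: mp_action_def)
  have "\<alpha> \<circ> f \<in> hom H (BijGroup (space M))"
    using assms(2) group_hom.homh[OF A.group_hom] by (rule hom_compose)
  then have "group_hom H (BijGroup (space M)) (\<alpha> \<circ> f)"
    unfolding group_hom_def group_hom_axioms_def using assms(1) group_BijGroup by blast
  then have "group_action H (space M) (\<lambda>h. \<alpha> (f h))"
    unfolding group_action_def o_def .
  moreover have "f h \<in> carrier G" if "h \<in> carrier H" for h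
    using assms(2) that by (rule hom_in_carrier)
  ultimately show ?thesis
    using assms(3) unfolding mp_action_def by blast
qed

lemma second_countable_prod_topology:
  assumes "second_countable S" "second_countable T"
  shows "second_countable (prod_topology S T)"
proof -
  obtain A where "countable A \<and> (\<forall>V\<in>A. openin S V) \<and>
      (\<forall>U x. openin S U \<and> x \<in> U \<longrightarrow> (\<exists>V\<in>A. x \<in> V \<and> V \<subseteq> U))"
    using assms(1) unfolding second_countable_def by (rule exE)
  then have A: "countable A" "\<And>V. V \<in> A \<Longrightarrow> openin S V"
    "\<And>U x. openin S U \<Longrightarrow> x \<in> U \<Longrightarrow> \<exists>V\<in>A. x \<in> V \<and> V \<subseteq> U"
    by simp_all
  obtain B where "countable B \<and> (\<forall>V\<in>B. openin T V) \<and>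
      (\<forall>U x. openin T U \<and> x \<in> U \<longrightarrow> (\<exists>V\<in>B. x \<in> V \<and> V \<subseteq> U))"
    using assms(2) unfolding second_countable_def by (rule exE)
  then have B: "countable B" "\<And>V. V \<in> B \<Longrightarrow> openin T V"
    "\<And>U x. openin T U \<Longrightarrow> x \<in> U \<Longrightarrow> \<exists>V\<in>B. x \<in> V \<and> V \<subseteq> U"
    by simp_all
  show ?thesis
    unfolding second_countable_def
  proof (intro exI[of _ "(\<lambda>(U, V). U \<times> V) ` (A \<times> B)"] conjI ballI allI impI)
    show "countable ((\<lambda>(U, V). U \<times> V) ` (A \<times> B))" using A B by auto
    show "openin (prod_topology S T) W" if "W \<in> (\<lambda>(U, V). U \<times> V) ` (A \<times> B)" for W
      using that A(2) B(2) by (clarsimp simp: openin_prod_Times_iff)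
    show "\<exists>V\<in>(\<lambda>(U, V). U \<times> V) ` (A \<times> B). p \<in> V \<and> V \<subseteq> W"
      if W: "openin (prod_topology S T) W \<and> p \<in> W" for W p
    proof -
      obtain x y where p: "p = (x, y)" by force
      obtain U V where "openin S U" "openin T V" "x \<in> U" "y \<in> V" "U \<times> V \<subseteq> W"
        using W[THEN conjunct1, unfolded openin_prod_topology_alt, rule_format, of x y]
          W[THEN conjunct2] p by auto
      moreover obtain U' where "U' \<in> A" "x \<in> U'" "U' \<subseteq> U"
        using A(3)[of U x] calculation by blast
      moreover obtain V' where "V' \<in> B" "y \<in> V'" "V' \<subseteq> V"
        using B(3)[of V y] calculation by blast
      ultimately have "U' \<times> V' \<in> (\<lambda>(U, V). U \<times> V) ` (A \<times> B) \<and> p \<in> U' \<times> V' \<and> U' \<times> V' \<subseteq> W"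
        by (auto simp: p)
      then show ?thesis by blast
    qed
  qed
qed

lemma standard_borel_count_pair:
  assumes C: "countable C" and M: "standard_borel M"
  shows "standard_borel (count_space C \<Otimes>\<^sub>M M)"
proof -
  obtain T where T: "topspace T = space M" "completely_metrizable_space T" "second_countable T"
    "sets M = sigma_sets (space M) {U. openin T U}"
    using M unfolding standard_borel_def by blast
  let ?P = "prod_topology (discrete_topology C) T"
  let ?N = "sigma (C \<times> space M) {U. openin ?P U}"
  have sub: "{U. openin ?P U} \<subseteq> Pow (C \<times> space M)"
    using openin_subset T(1) by fastforce
  then have N: "space ?N = C \<times> space M" "sets ?N = sigma_sets (C \<times> space M) {U. openin ?P U}"
    by (auto simp: space_measure_of_conv)
  have op: "U \<in> sets ?N" if "openin ?P U" for U
    using that unfolding N(2) by blast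
  have spT: "openin T (space M)" using T(1) openin_topspace[of T] by simp
  have fst: "fst \<in> ?N \<rightarrow>\<^sub>M count_space C"
  proof (rule measurableI)
    fix A assume "A \<in> sets (count_space C)"
    then have "openin ?P (A \<times> space M)" using spT by (auto simp: openin_prod_Times_iff)
    moreover have "fst -` A \<inter> space ?N = A \<times> space M" using \<open>A \<in> _\<close> N by auto
    ultimately show "fst -` A \<inter> space ?N \<in> sets ?N" using op by simp
  qed (use N in auto)
  have snd: "snd \<in> ?N \<rightarrow>\<^sub>M M"
  proof (rule measurable_sigma_sets[OF T(4)])
    fix A assume "A \<in> {U. openin T U}"
    then have "openin ?P (C \<times> A)" by (auto simp: openin_prod_Times_iff)
    moreover have "snd -` A \<inter> space ?N = C \<times> A" using \<open>A \<in> _\<close> N T(1) openin_subset by fastforce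
    ultimately show "snd -` A \<inter> space ?N \<in> sets ?N" using op by simp
  qed (use N T(1) openin_subset in \<open>force+\<close>)
  have "sets (count_space C \<Otimes>\<^sub>M M) \<subseteq> sets ?N"
  proof (rule sets_pair_in_sets)
    fix a b assume ab: "a \<in> sets (count_space C)" "b \<in> sets M"
    have "(fst -` a \<inter> space ?N) \<inter> (snd -` b \<inter> space ?N) \<in> sets ?N"
      using measurable_sets[OF fst ab(1)] measurable_sets[OF snd ab(2)] by blast
    also have "(fst -` a \<inter> space ?N) \<inter> (snd -` b \<inter> space ?N) = a \<times> b"
      using ab sets.sets_into_space[OF ab(2)] N by auto
    finally show "a \<times> b \<in> sets ?N" .
  qed
  moreover have "U \<in> sets (count_space C \<Otimes>\<^sub>M M)" if U: "openin ?P U" for U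
  proof -
    have "{x. (g, x) \<in> U} \<in> sets M" for g
    proof -
      have "openin T {x. (g, x) \<in> U}"
      proof (subst openin_subopen, intro ballI)
        fix x assume "x \<in> {x. (g, x) \<in> U}"
        then have "(g, x) \<in> U" by simp
        then obtain A B where "openin T B" "g \<in> A" "x \<in> B" "A \<times> B \<subseteq> U"
          using U[unfolded openin_prod_topology_alt, rule_format, of g x] by auto
        then show "\<exists>B. openin T B \<and> x \<in> B \<and> B \<subseteq> {x. (g, x) \<in> U}"
          by (intro exI[of _ B]) auto
      qed
      then show ?thesis using T(4) by auto
    qed
    then have "(\<Union>g\<in>C. {g} \<times> {x. (g, x) \<in> U}) \<in> sets (count_space C \<Otimes>\<^sub>M M)"
      using C by (intro sets.countable_UN' pair_measureI) auto
    also have "(\<Union>g\<in>C. {g} \<times> {x. (g, x) \<in> U}) = U"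
      using openin_subset[OF U] by auto
    finally show ?thesis .
  qed
  then have "sets ?N \<subseteq> sets (count_space C \<Otimes>\<^sub>M M)"
    unfolding N(2) using sets.sigma_sets_subset[of "{U. openin ?P U}" "count_space C \<Otimes>\<^sub>M M"]
    by (auto simp: space_pair_measure)
  ultimately have "sets (count_space C \<Otimes>\<^sub>M M) = sigma_sets (C \<times> space M) {U. openin ?P U}"
    using N(2) by blast
  moreover have "second_countable ?P" "completely_metrizable_space ?P"
    using T C by (auto simp: second_countable_prod_topology second_countable_discrete_topology
      completely_metrizable_space_prod_topology completely_metrizable_space_discrete_topology)
  ultimately show ?thesis
    unfolding standard_borel_def using T(1) by (intro exI[of _ ?P]) (auto simp: space_pair_measure)
qed


section \<open>Discrete measurable groupoids\<close>

text \<open>The measure component of \<open>arrows\<close> is irrelevant: only its space and its \<open>\<sigma>\<close>-algebra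
  are used. The space \<open>unit_space\<close> carries the measure on the units. The functions are
  meaningful only on arrows, and \<open>gmul x y\<close> only if \<open>gsrc x = grng y\<close>.\<close>

record 'a measured_groupoid =
  arrows :: "'a measure"
  unit_space :: "'a measure"
  gsrc :: "'a \<Rightarrow> 'a"
  grng :: "'a \<Rightarrow> 'a"
  gmul :: "'a \<Rightarrow> 'a \<Rightarrow> 'a"
  ginv :: "'a \<Rightarrow> 'a"

locale discrete_measurable_groupoid =
  fixes \<G> :: "'a measured_groupoid"
  assumes standard_borel_arrows: "standard_borel (arrows \<G>)"
    and units_Borel: "space (unit_space \<G>) \<in> sets (arrows \<G>)"
    and sets_unit_space:
      "sets (unit_space \<G>) = sets (restrict_space (arrows \<G>) (space (unit_space \<G>)))"
    and src_measurable: "gsrc \<G> \<in> arrows \<G> \<rightarrow>\<^sub>M unit_space \<G>"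
    and rng_measurable: "grng \<G> \<in> arrows \<G> \<rightarrow>\<^sub>M unit_space \<G>"
    and inv_measurable: "ginv \<G> \<in> arrows \<G> \<rightarrow>\<^sub>M arrows \<G>"
    and mul_measurable: "(\<lambda>(x, y). gmul \<G> x y) \<in>
      restrict_space (arrows \<G> \<Otimes>\<^sub>M arrows \<G>) {(x, y). gsrc \<G> x = grng \<G> y} \<rightarrow>\<^sub>M arrows \<G>"
    and src_unit: "u \<in> space (unit_space \<G>) \<Longrightarrow> gsrc \<G> u = u"
    and rng_unit: "u \<in> space (unit_space \<G>) \<Longrightarrow> grng \<G> u = u"
    and src_mul: "\<lbrakk>x \<in> space (arrows \<G>); y \<in> space (arrows \<G>); gsrc \<G> x = grng \<G> y\<rbrakk>
      \<Longrightarrow> gsrc \<G> (gmul \<G> x y) = gsrc \<G> y"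
    and rng_mul: "\<lbrakk>x \<in> space (arrows \<G>); y \<in> space (arrows \<G>); gsrc \<G> x = grng \<G> y\<rbrakk>
      \<Longrightarrow> grng \<G> (gmul \<G> x y) = grng \<G> x"
    and mul_assoc: "\<lbrakk>x \<in> space (arrows \<G>); y \<in> space (arrows \<G>); z \<in> space (arrows \<G>);
      gsrc \<G> x = grng \<G> y; gsrc \<G> y = grng \<G> z\<rbrakk>
      \<Longrightarrow> gmul \<G> (gmul \<G> x y) z = gmul \<G> x (gmul \<G> y z)"
    and mul_src: "x \<in> space (arrows \<G>) \<Longrightarrow> gmul \<G> x (gsrc \<G> x) = x"
    and rng_mul_self: "x \<in> space (arrows \<G>) \<Longrightarrow> gmul \<G> (grng \<G> x) x = x"
    and src_inv: "x \<in> space (arrows \<G>) \<Longrightarrow> gsrc \<G> (ginv \<G> x) = grng \<G> x"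
    and rng_inv: "x \<in> space (arrows \<G>) \<Longrightarrow> grng \<G> (ginv \<G> x) = gsrc \<G> x"
    and inv_mul: "x \<in> space (arrows \<G>) \<Longrightarrow> gmul \<G> (ginv \<G> x) x = gsrc \<G> x"
    and mul_inv: "x \<in> space (arrows \<G>) \<Longrightarrow> gmul \<G> x (ginv \<G> x) = grng \<G> x"
    and countable_src_fibre: "u \<in> space (unit_space \<G>)
      \<Longrightarrow> countable {x \<in> space (arrows \<G>). gsrc \<G> x = u}"

locale pmp_groupoid = discrete_measurable_groupoid \<G> + prob_space "unit_space \<G>"
  for \<G> :: "'a measured_groupoid" +
  assumes measure_preserving: "B \<in> sets (arrows \<G>) \<Longrightarrow>
    (\<integral>\<^sup>+ u. emeasure (count_space UNIV) {x \<in> B. gsrc \<G> x = u} \<partial>unit_space \<G>) =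
    (\<integral>\<^sup>+ u. emeasure (count_space UNIV) {x \<in> B. grng \<G> x = u} \<partial>unit_space \<G>)"

definition arrow_measure :: "'a measured_groupoid \<Rightarrow> 'a measure" where
  "arrow_measure \<G> = measure_of (space (arrows \<G>)) (sets (arrows \<G>))
     (\<lambda>B. \<integral>\<^sup>+ u. emeasure (count_space UNIV) {x \<in> B. gsrc \<G> x = u} \<partial>unit_space \<G>)"


section \<open>The Hilbert space of a groupoid\<close>

text \<open>Vectors of the Hilbert space are classes of square-integrable functions modulo almost
  everywhere equality; operators on it are extensional functions on the set of classes.
  Operations on classes are computed on a representative picked by \<open>l2_rep\<close>; they respect
  almost everywhere equality, so the choice does not matter.\<close>

definition l2_functions :: "'a measured_groupoid \<Rightarrow> ('a \<Rightarrow> complex) set" where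
  "l2_functions \<G> = {f \<in> borel_measurable (arrow_measure \<G>).
     integrable (arrow_measure \<G>) (\<lambda>x. (cmod (f x))\<^sup>2)}"

definition l2_class :: "'a measured_groupoid \<Rightarrow> ('a \<Rightarrow> complex) \<Rightarrow> ('a \<Rightarrow> complex) set" where
  "l2_class \<G> f = {g \<in> l2_functions \<G>. AE x in arrow_measure \<G>. g x = f x}"

definition l2_space :: "'a measured_groupoid \<Rightarrow> ('a \<Rightarrow> complex) set set" where
  "l2_space \<G> = l2_class \<G> ` l2_functions \<G>"

definition l2_rep :: "('a \<Rightarrow> complex) set \<Rightarrow> 'a \<Rightarrow> complex" where
  "l2_rep \<xi> = (SOME f. f \<in> \<xi>)"

definition l2_add ::
  "'a measured_groupoid \<Rightarrow> ('a \<Rightarrow> complex) set \<Rightarrow> ('a \<Rightarrow> complex) set \<Rightarrow> ('a \<Rightarrow> complex) set" where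
  "l2_add \<G> \<xi> \<eta> = l2_class \<G> (\<lambda>x. l2_rep \<xi> x + l2_rep \<eta> x)"

definition l2_scale ::
  "'a measured_groupoid \<Rightarrow> complex \<Rightarrow> ('a \<Rightarrow> complex) set \<Rightarrow> ('a \<Rightarrow> complex) set" where
  "l2_scale \<G> c \<xi> = l2_class \<G> (\<lambda>x. c * l2_rep \<xi> x)"

definition l2_inner ::
  "'a measured_groupoid \<Rightarrow> ('a \<Rightarrow> complex) set \<Rightarrow> ('a \<Rightarrow> complex) set \<Rightarrow> complex" where
  "l2_inner \<G> \<xi> \<eta> = (LINT x|arrow_measure \<G>. l2_rep \<xi> x * cnj (l2_rep \<eta> x))"

type_synonym 'a l2_op = "('a \<Rightarrow> complex) set \<Rightarrow> ('a \<Rightarrow> complex) set"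

definition op_zero :: "'a measured_groupoid \<Rightarrow> 'a l2_op" where
  "op_zero \<G> = (\<lambda>\<xi>\<in>l2_space \<G>. l2_class \<G> (\<lambda>_. 0))"

definition op_one :: "'a measured_groupoid \<Rightarrow> 'a l2_op" where
  "op_one \<G> = (\<lambda>\<xi>\<in>l2_space \<G>. \<xi>)"

definition op_add :: "'a measured_groupoid \<Rightarrow> 'a l2_op \<Rightarrow> 'a l2_op \<Rightarrow> 'a l2_op" where
  "op_add \<G> a b = (\<lambda>\<xi>\<in>l2_space \<G>. l2_add \<G> (a \<xi>) (b \<xi>))"

definition op_scale :: "'a measured_groupoid \<Rightarrow> complex \<Rightarrow> 'a l2_op \<Rightarrow> 'a l2_op" where
  "op_scale \<G> c a = (\<lambda>\<xi>\<in>l2_space \<G>. l2_scale \<G> c (a \<xi>))"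

definition op_prod :: "'a measured_groupoid \<Rightarrow> 'a l2_op list \<Rightarrow> 'a l2_op" where
  "op_prod \<G> as = foldr (compose (l2_space \<G>)) as (op_one \<G>)"

definition op_adjoint :: "'a measured_groupoid \<Rightarrow> 'a l2_op \<Rightarrow> 'a l2_op" where
  "op_adjoint \<G> a = (THE b. b \<in> l2_space \<G> \<rightarrow>\<^sub>E l2_space \<G> \<and>
     (\<forall>\<xi>\<in>l2_space \<G>. \<forall>\<eta>\<in>l2_space \<G>. l2_inner \<G> (a \<xi>) \<eta> = l2_inner \<G> \<xi> (b \<eta>)))"

definition op_trace :: "'a measured_groupoid \<Rightarrow> 'a l2_op \<Rightarrow> complex" where
  "op_trace \<G> a = (let \<delta> = l2_class \<G> (indicator (space (unit_space \<G>))) in l2_inner \<G> (a \<delta>) \<delta>)"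

text \<open>The span of a subset of \<open>VN(\<G>)\<close> is the same whether formed in \<open>VN(\<G>)\<close> or among all
  operators; the latter is used.\<close>

inductive_set op_span :: "'a measured_groupoid \<Rightarrow> 'a l2_op set \<Rightarrow> 'a l2_op set"
  for \<G> :: "'a measured_groupoid" and \<Omega> :: "'a l2_op set" where
  zero: "op_zero \<G> \<in> op_span \<G> \<Omega>"
| base: "a \<in> \<Omega> \<Longrightarrow> a \<in> op_span \<G> \<Omega>"
| add: "\<lbrakk>a \<in> op_span \<G> \<Omega>; b \<in> op_span \<G> \<Omega>\<rbrakk> \<Longrightarrow> op_add \<G> a b \<in> op_span \<G> \<Omega>"
| scale: "a \<in> op_span \<G> \<Omega> \<Longrightarrow> op_scale \<G> c a \<in> op_span \<G> \<Omega>"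


section \<open>The inverse semigroup of a groupoid\<close>

definition bisections :: "'a measured_groupoid \<Rightarrow> 'a set set" where
  "bisections \<G> = {B \<in> sets (arrows \<G>). inj_on (gsrc \<G>) B \<and> inj_on (grng \<G>) B}"

definition bisection_op :: "'a measured_groupoid \<Rightarrow> 'a set \<Rightarrow> 'a l2_op" where
  "bisection_op \<G> B = (\<lambda>\<xi>\<in>l2_space \<G>. l2_class \<G> (\<lambda>x.
     let P = (\<lambda>y. y \<in> space (arrows \<G>) \<and> grng \<G> y = gsrc \<G> x \<and> gmul \<G> x y \<in> B)
     in if \<exists>y. P y then l2_rep \<xi> (ginv \<G> (THE y. P y)) else 0))"

definition inv_semigroup :: "'a measured_groupoid \<Rightarrow> 'a l2_op set" where
  "inv_semigroup \<G> = bisection_op \<G> ` bisections \<G>"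

definition op_powers_upto :: "'a measured_groupoid \<Rightarrow> 'a l2_op set \<Rightarrow> nat \<Rightarrow> 'a l2_op set" where
  "op_powers_upto \<G> \<Omega> n = {op_prod \<G> ss |ss. 1 \<le> length ss \<and> length ss \<le> n \<and> set ss \<subseteq> \<Omega>}"


section \<open>Matrices\<close>

definition mat_ntr :: "complex mat \<Rightarrow> complex" where
  "mat_ntr A = (\<Sum>i<dim_row A. A $$ (i, i)) / of_nat (dim_row A)"

definition mat_norm2 :: "complex mat \<Rightarrow> real" where
  "mat_norm2 A = sqrt (Re (mat_ntr (mat_adjoint A * A)))"

definition partial_perm_mats :: "nat \<Rightarrow> complex mat set" where
  "partial_perm_mats d = {A \<in> carrier_mat d d. A * mat_adjoint A * A = A \<and>
     (\<forall>i<d. \<forall>j<d. A $$ (i, j) \<in> {0, 1})}"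


section \<open>Sofic dimension\<close>

definition linear_maps :: "'a measured_groupoid \<Rightarrow> nat \<Rightarrow> ('a l2_op \<Rightarrow> complex mat) set" where
  "linear_maps \<G> d = {\<phi> \<in> op_span \<G> (inv_semigroup \<G>) \<rightarrow>\<^sub>E carrier_mat d d.
     (\<forall>a\<in>op_span \<G> (inv_semigroup \<G>). \<forall>b\<in>op_span \<G> (inv_semigroup \<G>).
        \<phi> (op_add \<G> a b) = \<phi> a + \<phi> b) \<and>
     (\<forall>c. \<forall>a\<in>op_span \<G> (inv_semigroup \<G>). \<phi> (op_scale \<G> c a) = c \<cdot>\<^sub>m \<phi> a)}"

definition SA :: "'a measured_groupoid \<Rightarrow> 'a l2_op set \<Rightarrow> nat \<Rightarrow> real \<Rightarrow> nat
    \<Rightarrow> ('a l2_op \<Rightarrow> complex mat) set" where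
  "SA \<G> F n \<delta> d = (let F' = F \<union> op_adjoint \<G> ` F in {\<phi> \<in> linear_maps \<G> d.
     (\<forall>ss. 1 \<le> length ss \<and> length ss \<le> n \<and> set ss \<subseteq> F' \<longrightarrow>
        mat_norm2 (\<phi> (op_prod \<G> ss) - foldr (*) (map \<phi> ss) (1\<^sub>m d)) < \<delta>) \<and>
     \<phi> ` op_powers_upto \<G> F' n \<subseteq> partial_perm_mats d \<and>
     (\<forall>s\<in>op_powers_upto \<G> F' n. cmod (mat_ntr (\<phi> s) - op_trace \<G> s) < \<delta>)})"

text \<open>\<open>card\<close> is \<open>0\<close> on infinite sets, so they are treated separately. The set of restrictions
  to \<open>E\<close> may be infinite if \<open>E\<close> is not covered by \<open>F\<close>.\<close>

definition log_card :: "'b set \<Rightarrow> ereal" where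
  "log_card A = (if infinite A then \<infinity> else if A = {} then -\<infinity> else ereal (ln (real (card A))))"

definition log_card_SA :: "'a measured_groupoid \<Rightarrow> 'a l2_op set \<Rightarrow> 'a l2_op set
    \<Rightarrow> nat \<Rightarrow> real \<Rightarrow> nat \<Rightarrow> ereal" where
  "log_card_SA \<G> E F n \<delta> d =
     log_card ((\<lambda>\<phi>. restrict \<phi> E) ` SA \<G> F n \<delta> d) / ereal (real d * ln (real d))"

text \<open>The parameter \<open>L\<close> is \<open>limsup\<close> or \<open>liminf\<close>.\<close>

definition sofic_dim_along ::
  "((nat \<Rightarrow> ereal) \<Rightarrow> ereal) \<Rightarrow> 'a measured_groupoid \<Rightarrow> ereal" where
  "sofic_dim_along L \<G> =
     (SUP E \<in> {E. finite E \<and> E \<subseteq> inv_semigroup \<G>}.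
      INF F \<in> {F. finite F \<and> F \<subseteq> inv_semigroup \<G>}.
      INF n \<in> {1..}. INF \<delta> \<in> {0<..}. L (log_card_SA \<G> E F n \<delta>))"

definition sofic_dim :: "'a measured_groupoid \<Rightarrow> ereal" where
  "sofic_dim = sofic_dim_along limsup"

definition lower_sofic_dim :: "'a measured_groupoid \<Rightarrow> ereal" where
  "lower_sofic_dim = sofic_dim_along liminf"

text \<open>In contrast to \<open>+\<close> on \<^typ>\<open>ereal\<close>, here \<open>-\<infinity>\<close> absorbs \<open>\<infinity>\<close>.\<close>

definition dim_add :: "ereal \<Rightarrow> ereal \<Rightarrow> ereal" where
  "dim_add a b = (if a = -\<infinity> \<or> b = -\<infinity> then -\<infinity> else a + b)"


section \<open>The groupoid of an action\<close>

definition action_groupoid ::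
  "('g, 'm) monoid_scheme \<Rightarrow> 'x measure \<Rightarrow> ('g \<Rightarrow> 'x \<Rightarrow> 'x) \<Rightarrow> ('g \<times> 'x) measured_groupoid" where
  "action_groupoid G M \<alpha> =
     \<lparr>arrows = count_space (carrier G) \<Otimes>\<^sub>M M,
      unit_space = distr M
        (restrict_space (count_space (carrier G) \<Otimes>\<^sub>M M) ({\<one>\<^bsub>G\<^esub>} \<times> space M)) (Pair \<one>\<^bsub>G\<^esub>),
      gsrc = (\<lambda>(g, x). (\<one>\<^bsub>G\<^esub>, x)),
      grng = (\<lambda>(g, x). (\<one>\<^bsub>G\<^esub>, \<alpha> g x)),
      gmul = (\<lambda>(h, y) (g, x). (h \<otimes>\<^bsub>G\<^esub> g, x)),
      ginv = (\<lambda>(g, x). (inv\<^bsub>G\<^esub> g, \<alpha> g x))\<rparr>"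

lemma emeasure_count_image:
  "inj_on f A \<Longrightarrow> emeasure (count_space UNIV) (f ` A) = emeasure (count_space UNIV) A"
  by (cases "finite A") (auto simp: card_image finite_image_iff)

lemma borel_measurable_nn_integral_count_space:
  assumes "countable I" and k: "\<And>i. i \<in> I \<Longrightarrow> k i \<in> borel_measurable M"
  shows "(\<lambda>x. \<integral>\<^sup>+ i. k i x \<partial>count_space I) \<in> borel_measurable M"
proof -
  have "(\<lambda>(i, x). k i x) \<in> borel_measurable (count_space I \<Otimes>\<^sub>M M)"
    using assms by (intro measurable_pair_measure_countable1) auto
  from measurable_compose[OF measurable_pair_swap' this]
  have "(\<lambda>(x, i). k i x) \<in> borel_measurable (M \<Otimes>\<^sub>M count_space I)"
    by (simp add: case_prod_beta')
  then show ?thesis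
    by (rule sigma_finite_measure.borel_measurable_nn_integral
        [OF sigma_finite_measure_count_space_countable[OF assms(1)]])
qed

lemma pmp_groupoid_action_groupoid:
  assumes G: "group G" "countable (carrier G)" and M: "standard_prob_space M"
    and act: "mp_action G M \<alpha>"
  shows "pmp_groupoid (action_groupoid G M \<alpha>)"
proof -
  interpret G: group G by fact
  interpret M: prob_space M using M by (simp add: standard_prob_space_def)
  interpret A: group_action G "space M" \<alpha> using act by (simp add: mp_action_def)
  note [measurable_cong] = sets_restrict_space_cong
  let ?C = "count_space (carrier G)"
  let ?A = "?C \<Otimes>\<^sub>M M"
  let ?R = "restrict_space ?A ({\<one>\<^bsub>G\<^esub>} \<times> space M)"
  let ?U = "distr M ?R (Pair \<one>\<^bsub>G\<^esub>)"
  have am [measurable]: "\<alpha> g \<in> M \<rightarrow>\<^sub>M M" if "g \<in> carrier G" for g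
    using that act by (auto simp: mp_action_def)
  have pres: "distr M M (\<alpha> g) = M" if "g \<in> carrier G" for g
    using that act by (auto simp: mp_action_def)
  have cl [simp]: "\<alpha> g x \<in> space M" if "g \<in> carrier G" "x \<in> space M" for g x
    using A.element_image that by blast
  have a1 [simp]: "\<alpha> \<one>\<^bsub>G\<^esub> x = x" if "x \<in> space M" for x
    using A.id_eq_one that by (metis restrict_apply')
  have ai [simp]: "\<alpha> (inv\<^bsub>G\<^esub> g) (\<alpha> g x) = x" "\<alpha> g (\<alpha> (inv\<^bsub>G\<^esub> g) x) = x"
    if "g \<in> carrier G" "x \<in> space M" for g x
    using that A.composition_rule[of x "inv\<^bsub>G\<^esub> g" g] A.composition_rule[of x g "inv\<^bsub>G\<^esub> g"] by simp_all
  have spA: "space ?A = carrier G \<times> space M" by (simp add: space_pair_measure)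
  have unitA: "{\<one>\<^bsub>G\<^esub>} \<times> space M \<in> sets ?A" by (intro pair_measureI) auto
  have spR: "space ?R = {\<one>\<^bsub>G\<^esub>} \<times> space M" by (auto simp: space_restrict_space spA)
  have emb: "Pair \<one>\<^bsub>G\<^esub> \<in> M \<rightarrow>\<^sub>M ?R"
    by (intro measurable_restrict_space2) auto
  have sel: "gsrc (action_groupoid G M \<alpha>) = (\<lambda>(g, x). (\<one>\<^bsub>G\<^esub>, x))"
    "grng (action_groupoid G M \<alpha>) = (\<lambda>(g, x). (\<one>\<^bsub>G\<^esub>, \<alpha> g x))"
    "gmul (action_groupoid G M \<alpha>) = (\<lambda>(h, y) (g, x). (h \<otimes>\<^bsub>G\<^esub> g, x))"
    "ginv (action_groupoid G M \<alpha>) = (\<lambda>(g, x). (inv\<^bsub>G\<^esub> g, \<alpha> g x))"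
    "arrows (action_groupoid G M \<alpha>) = ?A" "unit_space (action_groupoid G M \<alpha>) = ?U"
    by (simp_all add: action_groupoid_def)
  have inv: "\<alpha> (inv\<^bsub>G\<^esub> g) \<in> M \<rightarrow>\<^sub>M M" if "g \<in> carrier G" for g using that by auto
  have src: "(\<lambda>(g, x). (\<one>\<^bsub>G\<^esub>, x)) \<in> ?A \<rightarrow>\<^sub>M ?U"
    unfolding measurable_distr_eq2
    by (intro measurable_restrict_space2) (auto simp: spA intro!: measurable_pair_measure_countable1 G)
  have rng: "(\<lambda>(g, x). (\<one>\<^bsub>G\<^esub>, \<alpha> g x)) \<in> ?A \<rightarrow>\<^sub>M ?U"
    unfolding measurable_distr_eq2
    by (intro measurable_restrict_space2) (auto simp: spA intro!: measurable_pair_measure_countable1 G)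
  have invm: "(\<lambda>(g, x). (inv\<^bsub>G\<^esub> g, \<alpha> g x)) \<in> ?A \<rightarrow>\<^sub>M ?A"
    by (auto intro!: measurable_pair_measure_countable1 G)
  have "(\<lambda>(a, b). a \<otimes>\<^bsub>G\<^esub> b) \<in> ?C \<Otimes>\<^sub>M ?C \<rightarrow>\<^sub>M ?C"
    by (auto intro!: measurable_pair_measure_countable1 G)
  moreover have "(\<lambda>p. (fst (fst p), fst (snd p))) \<in> ?A \<Otimes>\<^sub>M ?A \<rightarrow>\<^sub>M ?C \<Otimes>\<^sub>M ?C"
    by measurable
  ultimately have "(\<lambda>p. fst (fst p) \<otimes>\<^bsub>G\<^esub> fst (snd p)) \<in> ?A \<Otimes>\<^sub>M ?A \<rightarrow>\<^sub>M ?C"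
    using measurable_compose by fastforce
  then have "(\<lambda>p. (fst (fst p) \<otimes>\<^bsub>G\<^esub> fst (snd p), snd (snd p))) \<in> ?A \<Otimes>\<^sub>M ?A \<rightarrow>\<^sub>M ?A"
    by measurable
  then have mul: "(\<lambda>(p, q). (case p of (h, y) \<Rightarrow> \<lambda>(g, x). (h \<otimes>\<^bsub>G\<^esub> g, x)) q) \<in> ?A \<Otimes>\<^sub>M ?A \<rightarrow>\<^sub>M ?A"
    by (simp add: case_prod_beta')
  have pmp: "(\<integral>\<^sup>+ u. emeasure (count_space UNIV) {p \<in> B. (case p of (g, x) \<Rightarrow> (\<one>\<^bsub>G\<^esub>, x)) = u} \<partial>?U) =
    (\<integral>\<^sup>+ u. emeasure (count_space UNIV) {p \<in> B. (case p of (g, x) \<Rightarrow> (\<one>\<^bsub>G\<^esub>, \<alpha> g x)) = u} \<partial>?U)"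
    (is "nn_integral _ ?f = nn_integral _ ?h") if B [measurable]: "B \<in> sets ?A" for B
  proof -
    have BG: "B \<subseteq> carrier G \<times> space M" using sets.sets_into_space[OF B] by (simp add: spA)
    have Bm [measurable]: "(\<lambda>x. indicator B (g, x) :: ennreal) \<in> borel_measurable M" if "g \<in> carrier G" for g
      using that by (intro measurable_compose[OF measurable_Pair1' borel_measurable_indicator[OF B]]) auto
    have cnt: "emeasure (count_space UNIV) {g \<in> carrier G. P g} = (\<integral>\<^sup>+ g. indicator {g. P g} g \<partial>?C)" for P
    proof -
      have "(\<integral>\<^sup>+ g. indicator {g. P g} g \<partial>?C) = (\<integral>\<^sup>+ g. indicator {g \<in> carrier G. P g} g \<partial>?C)"
        by (intro nn_integral_cong) (auto simp: indicator_def)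
      then show ?thesis by (cases "finite {g \<in> carrier G. P g}") (auto simp: emeasure_count_space)
    qed
    have f: "?f (\<one>\<^bsub>G\<^esub>, x) = (\<integral>\<^sup>+ g. indicator B (g, x) \<partial>?C)" if "x \<in> space M" for x
    proof -
      have "{p \<in> B. (case p of (g, x) \<Rightarrow> (\<one>\<^bsub>G\<^esub>, x)) = (\<one>\<^bsub>G\<^esub>, x)} =
        (\<lambda>g. (g, x)) ` {g \<in> carrier G. (g, x) \<in> B}" using BG by auto
      then have "?f (\<one>\<^bsub>G\<^esub>, x) = emeasure (count_space UNIV) {g \<in> carrier G. (g, x) \<in> B}"
        by (simp add: emeasure_count_image inj_on_def)
      also have "\<dots> = (\<integral>\<^sup>+ g. indicator B (g, x) \<partial>?C)"
        unfolding cnt by (intro nn_integral_cong) (auto simp: indicator_def)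
      finally show ?thesis .
    qed
    have h: "?h (\<one>\<^bsub>G\<^esub>, x) = (\<integral>\<^sup>+ g. indicator B (g, \<alpha> (inv\<^bsub>G\<^esub> g) x) \<partial>?C)" if x: "x \<in> space M" for x
    proof -
      have "{p \<in> B. (case p of (g, x) \<Rightarrow> (\<one>\<^bsub>G\<^esub>, \<alpha> g x)) = (\<one>\<^bsub>G\<^esub>, x)} =
        (\<lambda>g. (g, \<alpha> (inv\<^bsub>G\<^esub> g) x)) ` {g \<in> carrier G. (g, \<alpha> (inv\<^bsub>G\<^esub> g) x) \<in> B}" using BG x by force
      then have "?h (\<one>\<^bsub>G\<^esub>, x) = emeasure (count_space UNIV) {g \<in> carrier G. (g, \<alpha> (inv\<^bsub>G\<^esub> g) x) \<in> B}"
        by (simp add: emeasure_count_image inj_on_def)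
      also have "\<dots> = (\<integral>\<^sup>+ g. indicator B (g, \<alpha> (inv\<^bsub>G\<^esub> g) x) \<partial>?C)"
        unfolding cnt by (intro nn_integral_cong) (auto simp: indicator_def)
      finally show ?thesis .
    qed
    have U: "integral\<^sup>N ?U k = (\<integral>\<^sup>+ x. k (\<one>\<^bsub>G\<^esub>, x) \<partial>M)"
      if "(\<lambda>x. k (\<one>\<^bsub>G\<^esub>, x)) \<in> borel_measurable M" for k :: "'a \<times> 'c \<Rightarrow> ennreal"
    proof (rule nn_integral_distr[OF emb])
      have "(\<lambda>p. k (\<one>\<^bsub>G\<^esub>, snd p)) \<in> borel_measurable ?R"
        by (rule measurable_restrict_space1[OF measurable_compose[OF measurable_snd that]])
      then have "k \<in> borel_measurable ?R"
        by (rule measurable_cong[THEN iffD1, rotated]) (auto simp: spR)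
      then show "k \<in> borel_measurable ?U"
        by (simp only: measurable_distr_eq1)
    qed
    have fm: "(\<lambda>x. ?f (\<one>\<^bsub>G\<^esub>, x)) \<in> borel_measurable M"
      by (rule measurable_cong[OF f, THEN iffD2])
         (assumption | intro borel_measurable_nn_integral_count_space G Bm)+
    have hm': "(\<lambda>x. indicator B (g, \<alpha> (inv\<^bsub>G\<^esub> g) x) :: ennreal) \<in> borel_measurable M" if "g \<in> carrier G" for g
      using measurable_compose[OF inv[OF that] Bm[OF that]] .
    have hm: "(\<lambda>x. ?h (\<one>\<^bsub>G\<^esub>, x)) \<in> borel_measurable M"
      by (rule measurable_cong[OF h, THEN iffD2])
         (assumption | intro borel_measurable_nn_integral_count_space G hm')+
    have "nn_integral ?U ?f = (\<integral>\<^sup>+ x. \<integral>\<^sup>+ g. indicator B (g, x) \<partial>?C \<partial>M)"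
      unfolding U[of ?f, OF fm] by (rule nn_integral_cong) (rule f)
    also have "\<dots> = (\<integral>\<^sup>+ g. \<integral>\<^sup>+ x. indicator B (g, x) \<partial>M \<partial>?C)"
      by (intro nn_integral_count_space_nn_integral G Bm)
    also have "\<dots> = (\<integral>\<^sup>+ g. \<integral>\<^sup>+ x. indicator B (g, \<alpha> (inv\<^bsub>G\<^esub> g) x) \<partial>M \<partial>?C)"
    proof (rule nn_integral_cong)
      fix g assume "g \<in> space ?C"
      then have g: "g \<in> carrier G" "inv\<^bsub>G\<^esub> g \<in> carrier G" by auto
      have "(\<integral>\<^sup>+ x. indicator B (g, x) \<partial>distr M M (\<alpha> (inv\<^bsub>G\<^esub> g))) =
        (\<integral>\<^sup>+ x. indicator B (g, \<alpha> (inv\<^bsub>G\<^esub> g) x) \<partial>M)"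
        by (intro nn_integral_distr inv g) (simp only: measurable_distr_eq1 Bm g)
      then show "(\<integral>\<^sup>+ x. indicator B (g, x) \<partial>M) = (\<integral>\<^sup>+ x. indicator B (g, \<alpha> (inv\<^bsub>G\<^esub> g) x) \<partial>M)"
        by (simp add: pres g)
    qed
    also have "\<dots> = (\<integral>\<^sup>+ x. \<integral>\<^sup>+ g. indicator B (g, \<alpha> (inv\<^bsub>G\<^esub> g) x) \<partial>?C \<partial>M)"
      by (intro nn_integral_count_space_nn_integral[symmetric] G hm')
    also have "\<dots> = nn_integral ?U ?h"
      unfolding U[of ?h, OF hm] by (rule nn_integral_cong) (rule h[symmetric])
    finally show ?thesis .
  qed
  have prob: "prob_space ?U" by (rule M.prob_space_distr[OF emb])
  have cf: "countable {p \<in> space ?A. (case p of (g, x) \<Rightarrow> (\<one>\<^bsub>G\<^esub>, x)) = u}" for u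
  proof (rule countable_subset)
    show "{p \<in> space ?A. (case p of (g, x) \<Rightarrow> (\<one>\<^bsub>G\<^esub>, x)) = u} \<subseteq> (\<lambda>g. (g, snd u)) ` carrier G"
      by (auto simp: spA)
  qed (use G in auto)
  have sb: "standard_borel ?A"
    using G M by (auto intro: standard_borel_count_pair simp: standard_prob_space_def)
  have spU: "space ?U = {\<one>\<^bsub>G\<^esub>} \<times> space M" by (simp only: space_distr spR)
  have "discrete_measurable_groupoid (action_groupoid G M \<alpha>)"
  proof (rule discrete_measurable_groupoid.intro, unfold sel spU spA, goal_cases)
    case 1 show ?case by (rule sb)
  next
    case 2 show ?case by (rule unitA)
  next
    case 3 show ?case by (simp only: sets_distr)
  next
    case 4 show ?case by (rule src)
  next
    case 5 show ?case by (rule rng)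
  next
    case 6 show ?case by (rule invm)
  next
    case 7 show ?case by (rule measurable_restrict_space1[OF mul])
  next
    case (19 u) show ?case using cf[of u] by (simp only: spA)
  qed (auto simp: G.m_assoc A.composition_rule)
  then show ?thesis
    unfolding pmp_groupoid_def pmp_groupoid_axioms_def sel
    using prob pmp by blast
qed

definition action_sofic_dim ::
  "('g, 'm) monoid_scheme \<Rightarrow> 'x measure \<Rightarrow> ('g \<Rightarrow> 'x \<Rightarrow> 'x) \<Rightarrow> ereal" where
  "action_sofic_dim G M \<alpha> = sofic_dim (action_groupoid G M \<alpha>)"

definition action_lower_sofic_dim ::
  "('g, 'm) monoid_scheme \<Rightarrow> 'x measure \<Rightarrow> ('g \<Rightarrow> 'x \<Rightarrow> 'x) \<Rightarrow> ereal" where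
  "action_lower_sofic_dim G M \<alpha> = lower_sofic_dim (action_groupoid G M \<alpha>)"

definition approximation_regular ::
  "('g, 'm) monoid_scheme \<Rightarrow> 'x measure \<Rightarrow> ('g \<Rightarrow> 'x \<Rightarrow> 'x) \<Rightarrow> bool" where
  "approximation_regular G M \<alpha> \<longleftrightarrow> action_sofic_dim G M \<alpha> = action_lower_sofic_dim G M \<alpha>"


section \<open>Free products of groups\<close>

text \<open>The free product is realised by reduced words: alternating lists of nontrivial elements
  of the two factors.\<close>

fun fp_letter :: "('a, 'm) monoid_scheme \<Rightarrow> ('b, 'n) monoid_scheme \<Rightarrow> 'a + 'b \<Rightarrow> bool" where
  "fp_letter G H (Inl g) \<longleftrightarrow> g \<in> carrier G \<and> g \<noteq> \<one>\<^bsub>G\<^esub>"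
| "fp_letter G H (Inr h) \<longleftrightarrow> h \<in> carrier H \<and> h \<noteq> \<one>\<^bsub>H\<^esub>"

definition fp_reduced :: "('a, 'm) monoid_scheme \<Rightarrow> ('b, 'n) monoid_scheme \<Rightarrow> ('a + 'b) list \<Rightarrow> bool" where
  "fp_reduced G H w \<longleftrightarrow> list_all (fp_letter G H) w \<and> successively (\<lambda>x y. isl x \<noteq> isl y) w"

fun fp_cons :: "('a, 'm) monoid_scheme \<Rightarrow> ('b, 'n) monoid_scheme
    \<Rightarrow> 'a + 'b \<Rightarrow> ('a + 'b) list \<Rightarrow> ('a + 'b) list" where
  "fp_cons G H (Inl g) (Inl g' # w) =
     (if g \<otimes>\<^bsub>G\<^esub> g' = \<one>\<^bsub>G\<^esub> then w else Inl (g \<otimes>\<^bsub>G\<^esub> g') # w)"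
| "fp_cons G H (Inr h) (Inr h' # w) =
     (if h \<otimes>\<^bsub>H\<^esub> h' = \<one>\<^bsub>H\<^esub> then w else Inr (h \<otimes>\<^bsub>H\<^esub> h') # w)"
| "fp_cons G H x w = x # w"

definition free_product ::
  "('a, 'm) monoid_scheme \<Rightarrow> ('b, 'n) monoid_scheme \<Rightarrow> ('a + 'b) list monoid" where
  "free_product G H = \<lparr>carrier = {w. fp_reduced G H w}, mult = foldr (fp_cons G H), one = []\<rparr>"

definition fp_inl :: "('a, 'm) monoid_scheme \<Rightarrow> 'a \<Rightarrow> ('a + 'b) list" where
  "fp_inl G g = (if g = \<one>\<^bsub>G\<^esub> then [] else [Inl g])"

definition fp_inr :: "('b, 'n) monoid_scheme \<Rightarrow> 'b \<Rightarrow> ('a + 'b) list" where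
  "fp_inr H h = (if h = \<one>\<^bsub>H\<^esub> then [] else [Inr h])"

lemma fp_cons_Nil [simp]: "fp_cons G H x [] = [x]"
  by (cases x) auto

lemma fp_reduced_Nil [simp]: "fp_reduced G H []"
  by (simp add: fp_reduced_def)

lemma fp_reduced_Cons:
  "fp_reduced G H (x # w) \<longleftrightarrow>
     fp_letter G H x \<and> fp_reduced G H w \<and> (w \<noteq> [] \<longrightarrow> isl x \<noteq> isl (hd w))"
  by (cases w) (auto simp: fp_reduced_def)

lemma fp_cons_reduced:
  assumes "group G" "group H" "fp_letter G H x" "fp_reduced G H w"
  shows "fp_reduced G H (fp_cons G H x w)"
proof -
  interpret G: group G by fact
  interpret H: group H by fact
  show ?thesis
    using assms(3,4) by (cases "(G, H, x, w)" rule: fp_cons.cases) (auto simp: fp_reduced_Cons)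
qed

lemma fp_mult_reduced:
  assumes "group G" "group H" "fp_reduced G H u" "fp_reduced G H v"
  shows "fp_reduced G H (foldr (fp_cons G H) u v)"
  using assms(3) by (induction u) (auto simp: fp_reduced_Cons intro: fp_cons_reduced assms)

lemma fp_cons_cons_Inl:
  assumes "group G" "group H" "fp_letter G H (Inl a)" "fp_letter G H (Inl b)" "fp_reduced G H w"
  shows "fp_cons G H (Inl a) (fp_cons G H (Inl b) w) =
    (if a \<otimes>\<^bsub>G\<^esub> b = \<one>\<^bsub>G\<^esub> then w else fp_cons G H (Inl (a \<otimes>\<^bsub>G\<^esub> b)) w)"
proof -
  interpret G: group G by fact
  interpret H: group H by fact
  have [simp]: "a \<in> carrier G" "b \<in> carrier G" "a \<noteq> \<one>\<^bsub>G\<^esub>" "b \<noteq> \<one>\<^bsub>G\<^esub>" using assms by auto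
  show ?thesis
  proof (cases w)
    case Nil then show ?thesis by simp
  next
    case (Cons y v)
    show ?thesis
    proof (cases y)
      case (Inr h) then show ?thesis using Cons by simp
    next
      case (Inl c)
      have c [simp]: "c \<in> carrier G" "c \<noteq> \<one>\<^bsub>G\<^esub>" and v: "fp_reduced G H v" "v \<noteq> [] \<Longrightarrow> \<not> isl (hd v)"
        using assms(5) by (auto simp: Cons Inl fp_reduced_Cons)
      have cv: "fp_cons G H (Inl a) v = Inl a # v" for a
        using v by (cases v rule: list.exhaust; cases "hd v") (auto)
      have *: "a \<otimes>\<^bsub>G\<^esub> (b \<otimes>\<^bsub>G\<^esub> c) = (a \<otimes>\<^bsub>G\<^esub> b) \<otimes>\<^bsub>G\<^esub> c" by (simp add: G.m_assoc)
      show ?thesis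
      proof (cases "b \<otimes>\<^bsub>G\<^esub> c = \<one>\<^bsub>G\<^esub>")
        case True
        then have "a \<otimes>\<^bsub>G\<^esub> b \<otimes>\<^bsub>G\<^esub> c = a" using * by simp
        moreover have "a = c" if "a \<otimes>\<^bsub>G\<^esub> b = \<one>\<^bsub>G\<^esub>" using that calculation by simp
        ultimately show ?thesis using True by (simp add: Cons Inl cv)
      next
        case False
        then show ?thesis using * by (auto simp: Cons Inl)
      qed
    qed
  qed
qed

lemma fp_cons_cons_Inr:
  assumes "group G" "group H" "fp_letter G H (Inr a)" "fp_letter G H (Inr b)" "fp_reduced G H w"
  shows "fp_cons G H (Inr a) (fp_cons G H (Inr b) w) =
    (if a \<otimes>\<^bsub>H\<^esub> b = \<one>\<^bsub>H\<^esub> then w else fp_cons G H (Inr (a \<otimes>\<^bsub>H\<^esub> b)) w)"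
proof -
  interpret G: group G by fact
  interpret H: group H by fact
  have [simp]: "a \<in> carrier H" "b \<in> carrier H" "a \<noteq> \<one>\<^bsub>H\<^esub>" "b \<noteq> \<one>\<^bsub>H\<^esub>" using assms by auto
  show ?thesis
  proof (cases w)
    case Nil then show ?thesis by simp
  next
    case (Cons y v)
    show ?thesis
    proof (cases y)
      case (Inl h) then show ?thesis using Cons by simp
    next
      case (Inr c)
      have c [simp]: "c \<in> carrier H" "c \<noteq> \<one>\<^bsub>H\<^esub>" and v: "fp_reduced G H v" "v \<noteq> [] \<Longrightarrow> isl (hd v)"
        using assms(5) by (auto simp: Cons Inr fp_reduced_Cons)
      have cv: "fp_cons G H (Inr a) v = Inr a # v" for a
        using v by (cases v rule: list.exhaust; cases "hd v") (auto)
      have *: "a \<otimes>\<^bsub>H\<^esub> (b \<otimes>\<^bsub>H\<^esub> c) = (a \<otimes>\<^bsub>H\<^esub> b) \<otimes>\<^bsub>H\<^esub> c" by (simp add: H.m_assoc)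
      show ?thesis
      proof (cases "b \<otimes>\<^bsub>H\<^esub> c = \<one>\<^bsub>H\<^esub>")
        case True
        then have "a \<otimes>\<^bsub>H\<^esub> b \<otimes>\<^bsub>H\<^esub> c = a" using * by simp
        moreover have "a = c" if "a \<otimes>\<^bsub>H\<^esub> b = \<one>\<^bsub>H\<^esub>" using that calculation by simp
        ultimately show ?thesis using True by (simp add: Cons Inr cv)
      next
        case False
        then show ?thesis using * by (auto simp: Cons Inr)
      qed
    qed
  qed
qed

lemma fp_cons_mult:
  assumes "group G" "group H" "fp_letter G H x" "fp_reduced G H u" "fp_reduced G H v"
  shows "foldr (fp_cons G H) (fp_cons G H x u) v = fp_cons G H x (foldr (fp_cons G H) u v)"
proof (cases u)
  case (Cons y w)
  have y: "fp_letter G H y" and w: "fp_reduced G H (foldr (fp_cons G H) w v)"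
    using assms by (auto simp: Cons fp_reduced_Cons intro: fp_mult_reduced)
  show ?thesis
    using assms y w by (cases x; cases y) (auto simp: Cons fp_cons_cons_Inl fp_cons_cons_Inr simp del: fp_letter.simps)
qed simp

lemma fp_mult_assoc:
  assumes "group G" "group H" "fp_reduced G H u" "fp_reduced G H v" "fp_reduced G H w"
  shows "foldr (fp_cons G H) (foldr (fp_cons G H) u v) w =
         foldr (fp_cons G H) u (foldr (fp_cons G H) v w)"
  using assms(3)
  by (induction u) (auto simp: fp_reduced_Cons fp_cons_mult fp_mult_reduced assms)

lemma fp_mult_one: "fp_reduced G H u \<Longrightarrow> foldr (fp_cons G H) u [] = u"
proof (induction u)
  case (Cons x u)
  then show ?case
    by (cases x; cases u rule: list.exhaust; cases "hd u") (auto simp: fp_reduced_Cons)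
qed simp

lemma group_free_product:
  assumes "group G" "group H"
  shows "group (free_product G H)"
proof -
  interpret G: group G by fact
  interpret H: group H by fact
  have inv: "\<exists>v. fp_reduced G H v \<and> foldr (fp_cons G H) v u = []" if "fp_reduced G H u" for u
    using that
  proof (induction u)
    case Nil
    show ?case by (rule exI[of _ "[]"]) simp
  next
    case (Cons x u)
    then obtain v where v: "fp_reduced G H v" "foldr (fp_cons G H) v u = []"
      by (auto simp: fp_reduced_Cons)
    obtain y where y: "fp_letter G H y" "fp_cons G H y (x # u) = u"
    proof (cases x)
      case (Inl g)
      show ?thesis by (rule that[of "Inl (inv\<^bsub>G\<^esub> g)"]) (use Cons.prems Inl in \<open>auto simp: fp_reduced_Cons\<close>)
    next
      case (Inr g)
      show ?thesis by (rule that[of "Inr (inv\<^bsub>H\<^esub> g)"]) (use Cons.prems Inr in \<open>auto simp: fp_reduced_Cons\<close>)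
    qed
    have y': "fp_reduced G H [y]" using y by (simp add: fp_reduced_Cons)
    have "foldr (fp_cons G H) (foldr (fp_cons G H) v [y]) (x # u) = []"
      by (subst fp_mult_assoc) (use assms v y y' Cons.prems in auto)
    then show ?case using fp_mult_reduced[OF assms v(1) y'] by blast
  qed
  show ?thesis
    by (rule groupI) (auto simp: free_product_def fp_mult_reduced fp_mult_assoc inv assms)
qed

lemma fp_inl_hom: "fp_inl G \<in> hom G (free_product G H)" if "group G"
proof -
  interpret group G by fact
  show ?thesis by (auto simp: hom_def fp_inl_def free_product_def fp_reduced_Cons)
qed

lemma fp_inr_hom: "fp_inr H \<in> hom H (free_product G H)" if "group H"
proof -
  interpret group H by fact
  show ?thesis by (auto simp: hom_def fp_inr_def free_product_def fp_reduced_Cons)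
qed

lemma free_product_universal:
  assumes "group G" "group H" "group K" "f \<in> hom G K" "h \<in> hom H K"
  shows "\<exists>\<phi> \<in> hom (free_product G H) K.
    (\<forall>x\<in>carrier G. \<phi> (fp_inl G x) = f x) \<and> (\<forall>x\<in>carrier H. \<phi> (fp_inr H x) = h x)"
proof -
  interpret G: group G by fact
  interpret H: group H by fact
  interpret K: group K by fact
  interpret f: group_hom G K f by unfold_locales fact
  interpret h: group_hom H K h by unfold_locales fact
  let ?c = "\<lambda>x. case_sum f h x"
  define \<phi> where "\<phi> = foldr (\<lambda>x k. ?c x \<otimes>\<^bsub>K\<^esub> k)"
  let ?\<phi> = "\<lambda>w. \<phi> w \<one>\<^bsub>K\<^esub>"
  have c: "?c x \<in> carrier K" if "fp_letter G H x" for x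
    using that by (cases x) auto
  have cl: "?\<phi> w \<in> carrier K" if "fp_reduced G H w" for w
    using that by (induction w) (auto simp: \<phi>_def fp_reduced_Cons c)
  have one: "?\<phi> (fp_cons G H x w) = ?c x \<otimes>\<^bsub>K\<^esub> ?\<phi> w" if x: "fp_letter G H x" and w: "fp_reduced G H w" for x w
  proof (cases w)
    case Nil
    then show ?thesis by (simp add: \<phi>_def)
  next
    case (Cons y v)
    have y: "fp_letter G H y" and v: "?\<phi> v \<in> carrier K"
      using w cl by (auto simp: Cons fp_reduced_Cons)
    have cons: "?\<phi> (z # v) = ?c z \<otimes>\<^bsub>K\<^esub> ?\<phi> v" for z
      by (simp add: \<phi>_def)
    have *: "?\<phi> (x # y # v) = ?c x \<otimes>\<^bsub>K\<^esub> ?c y \<otimes>\<^bsub>K\<^esub> ?\<phi> v" "?\<phi> (x # y # v) = ?c x \<otimes>\<^bsub>K\<^esub> ?\<phi> (y # v)"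
      using c[OF x] c[OF y] v by (simp_all add: \<phi>_def K.m_assoc)
    show ?thesis
    proof (cases "isl x = isl y")
      case False
      then show ?thesis using * by (cases x; cases y) (auto simp: Cons)
    next
      case True
      show ?thesis
      proof (cases x)
        case (Inl g)
        with True obtain g' where y': "y = Inl g'" by (cases y) auto
        have "?c x \<otimes>\<^bsub>K\<^esub> ?c y = f (g \<otimes>\<^bsub>G\<^esub> g')"
          using x y by (simp add: Inl y')
        then show ?thesis unfolding Cons *(2)[symmetric] *(1) using v by (auto simp: Inl y' cons)
      next
        case (Inr g)
        with True obtain g' where y': "y = Inr g'" by (cases y) auto
        have "?c x \<otimes>\<^bsub>K\<^esub> ?c y = h (g \<otimes>\<^bsub>H\<^esub> g')"
          using x y by (simp add: Inr y')
        then show ?thesis unfolding Cons *(2)[symmetric] *(1) using v by (auto simp: Inr y' cons)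
      qed
    qed
  qed
  have mul: "?\<phi> (foldr (fp_cons G H) u v) = ?\<phi> u \<otimes>\<^bsub>K\<^esub> ?\<phi> v"
    if "fp_reduced G H u" "fp_reduced G H v" for u v
    using that(1)
  proof (induction u)
    case Nil then show ?case using cl that by (auto simp: \<phi>_def)
  next
    case (Cons x u)
    have *: "?\<phi> (x # u) = ?c x \<otimes>\<^bsub>K\<^esub> ?\<phi> u" by (simp add: \<phi>_def)
    have r: "fp_letter G H x" "fp_reduced G H u" using Cons.prems by (auto simp: fp_reduced_Cons)
    show ?case
      unfolding * using Cons.IH r that(2)
      by (simp add: one fp_mult_reduced assms K.m_assoc c cl)
  qed
  have "?\<phi> \<in> hom (free_product G H) K"
    by (auto simp: hom_def free_product_def cl mul)
  moreover have "\<forall>x\<in>carrier G. ?\<phi> (fp_inl G x) = f x"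
    by (simp add: \<phi>_def fp_inl_def)
  moreover have "\<forall>x\<in>carrier H. ?\<phi> (fp_inr H x) = h x"
    by (simp add: \<phi>_def fp_inr_def)
  ultimately show ?thesis
    by (intro bexI[of _ ?\<phi>] conjI)
qed

end

theory Submission
  imports Defs "HOL-Real_Asymp.Real_Asymp"
begin

text \<open>
  Sofic dimension counts approximately multiplicative maps into matrices. For the groupoid of an
  action the same growth rate is obtained by counting combinatorial objects. A model of the action
  on \<open>{..<d}\<close> consists of maps \<open>\<sigma> g\<close> and a colouring \<open>\<kappa>\<close> of the points which, near all but few points,
  multiply as in the group, have no fixed points for \<open>g\<close> other than the unit, and show a pattern of
  colours that some point of the space shows for a given finite measurable colouring \<open>c\<close>.
  \<open>model_dim\<close> is the growth rate of the number of models, restricted to finitely many group elements,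
  in the scale \<open>d * ln d\<close>. In this scale a factor \<open>K ^ d\<close> is invisible, and altering
  \<open>\<beta> * d\<close> of the points costs at most \<open>\<beta>\<close>.

  Both dimensions agree (\<open>sofic_dim_eq_model_dim\<close>). The matrices that a sofic approximation assigns
  to group elements and to pieces of the space are partial permutations, and these form a model; the
  matrix of any other bisection is, up to few columns, read off from the model once one of finitely
  many group elements has been selected for each column. Conversely a model gives an approximation: a
  bisection moves a good point as it moves a point of the space with the same pattern of colours.
  Linearity is the delicate point, as the isometries of the groupoid are linearly dependent; it is
  obtained by averaging over colour classes, which makes sense for every operator in the span.

  A model of a free product restricts to models of the factors, and at a good point a reduced word
  acts as the composition of its letters. This bounds the upper dimension
  (\<open>model_dim_free_product_le\<close>).

  For the lower dimension (\<open>model_dim_free_product_ge\<close>) two models of the factors have to be joined.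
  There are only exponentially many colourings, and two colourings with almost the same statistics
  agree after a permutation up to few points, so both models may be taken to carry the same colouring
  \<open>\<kappa>\<close>. The second model is then conjugated by a uniformly random permutation \<open>f\<close> that preserves
  \<open>\<kappa>\<close>. Colours remain consistent along words; what could fail is freeness, when the walk along a
  reduced word returns to its start. If \<open>f\<close> is revealed only where the walk needs it, every step
  leads to a uniformly chosen point among linearly many, so a return has probability of order
  \<open>1 / d\<close> (\<open>returning_walk\<close>). Hence at least half of all \<open>f\<close> give a model of the free product
  (\<open>half_of_the_joins_are_models\<close>), one \<open>f\<close> serves half of all pairs of models, and for fixed \<open>f\<close> the
  pair can be recovered from the joined model.

  The upper bound concerns the limes superior and the lower bound the limes inferior; regularity of
  the factors makes them meet.
\<close>

section \<open>Measure-preserving actions and their bisections\<close>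

locale pmp_action =
  fixes G :: "('g, 'm) monoid_scheme" (structure) and M :: "'x measure" and \<alpha> :: "'g \<Rightarrow> 'x \<Rightarrow> 'x"
  assumes grp: "group G" and countable_carrier: "countable (carrier G)"
    and prob: "prob_space M" and action: "mp_action G M \<alpha>"
begin

sublocale group G by (rule grp)
sublocale M: prob_space M by (rule prob)
sublocale A: group_action G "space M" \<alpha> using action by (simp add: mp_action_def)

abbreviation groupoid :: "('g \<times> 'x) measured_groupoid" ("\<G>") where "\<G> \<equiv> action_groupoid G M \<alpha>"

abbreviation arrow :: "('g \<times> 'x) measure" ("\<A>") where "\<A> \<equiv> count_space (carrier G) \<Otimes>\<^sub>M M"

lemma act_measurable [measurable]: "g \<in> carrier G \<Longrightarrow> \<alpha> g \<in> M \<rightarrow>\<^sub>M M"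
  using action by (auto simp: mp_action_def)

lemma act_closed [simp]: "g \<in> carrier G \<Longrightarrow> x \<in> space M \<Longrightarrow> \<alpha> g x \<in> space M"
  using A.element_image by blast

lemma act_one [simp]: "x \<in> space M \<Longrightarrow> \<alpha> \<one> x = x"
  using A.id_eq_one by (metis restrict_apply')

lemma act_mult: "g \<in> carrier G \<Longrightarrow> h \<in> carrier G \<Longrightarrow> x \<in> space M \<Longrightarrow> \<alpha> (g \<otimes> h) x = \<alpha> g (\<alpha> h x)"
  by (rule A.composition_rule)

lemma act_inv [simp]:
  assumes "g \<in> carrier G" "x \<in> space M"
  shows "\<alpha> (inv g) (\<alpha> g x) = x" "\<alpha> g (\<alpha> (inv g) x) = x"
  using act_mult[of "inv g" g x] act_mult[of g "inv g" x] assms by simp_all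

lemma inv_mult_cancel [simp]:
  assumes "g \<in> carrier G" "h \<in> carrier G"
  shows "inv g \<otimes> (g \<otimes> h) = h" "g \<otimes> (inv g \<otimes> h) = h"
  using assms by (simp_all add: m_assoc[symmetric])

lemma groupoid_sel [simp]:
  "gsrc \<G> = (\<lambda>(g, x). (\<one>, x))"
  "grng \<G> = (\<lambda>(g, x). (\<one>, \<alpha> g x))"
  "gmul \<G> = (\<lambda>(h, y) (g, x). (h \<otimes> g, x))"
  "ginv \<G> = (\<lambda>(g, x). (inv g, \<alpha> g x))"
  "arrows \<G> = \<A>"
  by (simp_all add: action_groupoid_def)

lemma space_arrow: "space \<A> = carrier G \<times> space M"
  by (simp add: space_pair_measure)

lemma space_units: "space (unit_space \<G>) = {\<one>} \<times> space M"
  by (auto simp: action_groupoid_def space_restrict_space space_pair_measure)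

lemma measurable_arrow:
  assumes "\<And>g. g \<in> carrier G \<Longrightarrow> (\<lambda>x. f (g, x)) \<in> M \<rightarrow>\<^sub>M N"
  shows "f \<in> \<A> \<rightarrow>\<^sub>M N"
  by (rule measurable_pair_measure_countable1[OF countable_carrier assms])

abbreviation slice :: "('g \<times> 'x) set \<Rightarrow> 'g \<Rightarrow> 'x set" where
  "slice B g \<equiv> {x \<in> space M. (g, x) \<in> B}"

lemma sets_arrow_iff:
  "B \<in> sets \<A> \<longleftrightarrow> B \<subseteq> carrier G \<times> space M \<and> (\<forall>g\<in>carrier G. slice B g \<in> sets M)"
proof
  assume B: "B \<in> sets \<A>"
  have "slice B g \<in> sets M" if "g \<in> carrier G" for g
  proof -
    have "Pair g -` B \<inter> space M \<in> sets M"
      by (rule measurable_sets[OF measurable_Pair1' B]) (simp add: that)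
    also have "Pair g -` B \<inter> space M = slice B g" by auto
    finally show ?thesis .
  qed
  then show "B \<subseteq> carrier G \<times> space M \<and> (\<forall>g\<in>carrier G. slice B g \<in> sets M)"
    using sets.sets_into_space[OF B] by (simp add: space_arrow)
next
  assume B: "B \<subseteq> carrier G \<times> space M \<and> (\<forall>g\<in>carrier G. slice B g \<in> sets M)"
  have "(\<Union>g\<in>carrier G. {g} \<times> slice B g) \<in> sets \<A>"
    using B countable_carrier by (intro sets.countable_UN' pair_measureI) auto
  also have "(\<Union>g\<in>carrier G. {g} \<times> slice B g) = B" using B by auto
  finally show "B \<in> sets \<A>" .
qed

text \<open>Bisections of the groupoid of the action, described by their slices. The last two conditions express
  injectivity of the source and of the range map.\<close>

definition bis :: "('g \<times> 'x) set \<Rightarrow> bool" where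
  "bis B \<longleftrightarrow> B \<subseteq> carrier G \<times> space M \<and> (\<forall>g\<in>carrier G. slice B g \<in> sets M) \<and>
     (\<forall>g h x. (g, x) \<in> B \<longrightarrow> (h, x) \<in> B \<longrightarrow> g = h) \<and>
     (\<forall>g h x y. (g, x) \<in> B \<longrightarrow> (h, y) \<in> B \<longrightarrow> \<alpha> g x = \<alpha> h y \<longrightarrow> g = h)"

lemma bisD:
  assumes "bis B"
  shows "(g, x) \<in> B \<Longrightarrow> g \<in> carrier G" "(g, x) \<in> B \<Longrightarrow> x \<in> space M"
    "g \<in> carrier G \<Longrightarrow> slice B g \<in> sets M"
    "(g, x) \<in> B \<Longrightarrow> (h, x) \<in> B \<Longrightarrow> g = h"
    "(g, x) \<in> B \<Longrightarrow> (h, y) \<in> B \<Longrightarrow> \<alpha> g x = \<alpha> h y \<Longrightarrow> g = h"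
  using assms unfolding bis_def by blast+

lemma bisI:
  assumes "B \<subseteq> carrier G \<times> space M" "\<And>g. g \<in> carrier G \<Longrightarrow> slice B g \<in> sets M"
    "\<And>g h x. (g, x) \<in> B \<Longrightarrow> (h, x) \<in> B \<Longrightarrow> g = h"
    "\<And>g h x y. (g, x) \<in> B \<Longrightarrow> (h, y) \<in> B \<Longrightarrow> \<alpha> g x = \<alpha> h y \<Longrightarrow> g = h"
  shows "bis B"
  unfolding bis_def
proof (intro conjI ballI allI impI)
  show "B \<subseteq> carrier G \<times> space M" by (rule assms(1))
  show "slice B g \<in> sets M" if "g \<in> carrier G" for g using that by (rule assms(2))
  show "g = h" if "(g, x) \<in> B" "(h, x) \<in> B" for g h x using that by (rule assms(3))
  show "g = h" if "(g, x) \<in> B" "(h, y) \<in> B" "\<alpha> g x = \<alpha> h y" for g h x y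
    using that by (rule assms(4))
qed

lemma bis_rng_inj:
  assumes "bis B" "(g, x) \<in> B" "(h, y) \<in> B" "\<alpha> g x = \<alpha> h y"
  shows "x = y"
  using bisD[OF assms(1)] assms by (metis act_inv(1))

lemma bisections_eq: "bisections \<G> = Collect bis"
proof (intro Set.set_eqI iffI)
  fix B assume "B \<in> bisections \<G>"
  then have B: "B \<in> sets \<A>" and i: "inj_on (gsrc \<G>) B" "inj_on (grng \<G>) B"
    by (simp_all only: bisections_def groupoid_sel(5) mem_Collect_eq)
  have "g = h" if "(g, x) \<in> B" "(h, x) \<in> B" for g h x
    using inj_onD[OF i(1) _ that] by simp
  moreover have "g = h" if "(g, x) \<in> B" "(h, y) \<in> B" "\<alpha> g x = \<alpha> h y" for g h x y
    using inj_onD[OF i(2) _ that(1,2)] that(3) by simp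
  ultimately show "B \<in> Collect bis"
    using B unfolding bis_def sets_arrow_iff mem_Collect_eq by (intro conjI allI impI) simp_all
next
  fix B assume "B \<in> Collect bis"
  then have B: "bis B" by simp
  have "B \<in> sets \<A>" using B by (simp add: sets_arrow_iff bis_def)
  moreover have "inj_on (gsrc \<G>) B"
  proof (rule inj_onI)
    fix p q assume p: "p \<in> B" "q \<in> B" "gsrc \<G> p = gsrc \<G> q"
    obtain g x h y where pq: "p = (g, x)" "q = (h, y)" by (cases p, cases q)
    with p(3) have "x = y" by simp
    with p pq bisD(4)[OF B, of g x h] show "p = q" by simp
  qed
  moreover have "inj_on (grng \<G>) B"
  proof (rule inj_onI)
    fix p q assume p: "p \<in> B" "q \<in> B" "grng \<G> p = grng \<G> q"
    obtain g x h y where pq: "p = (g, x)" "q = (h, y)" by (cases p, cases q)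
    with p(3) have e: "\<alpha> g x = \<alpha> h y" by simp
    show "p = q"
      using bisD(5)[OF B _ _ e] bis_rng_inj[OF B _ _ e] p(1,2) unfolding pq by blast
  qed
  ultimately show "B \<in> bisections \<G>" by (simp only: bisections_def groupoid_sel(5) mem_Collect_eq)
qed

text \<open>The groupoid operations extended to sets of arrows; \<open>rect g Q\<close> is the restriction to \<open>Q\<close> of the
  transformation \<open>g\<close>.\<close>

definition bmul :: "('g \<times> 'x) set \<Rightarrow> ('g \<times> 'x) set \<Rightarrow> ('g \<times> 'x) set" where
  "bmul B C = {p. \<exists>k l x. p = (k \<otimes> l, x) \<and> (l, x) \<in> C \<and> (k, \<alpha> l x) \<in> B}"

definition binv :: "('g \<times> 'x) set \<Rightarrow> ('g \<times> 'x) set" where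
  "binv B = (\<lambda>(g, x). (inv g, \<alpha> g x)) ` B"

definition rect :: "'g \<Rightarrow> 'x set \<Rightarrow> ('g \<times> 'x) set" where
  "rect g Q = {g} \<times> Q"

abbreviation full :: "'g \<Rightarrow> ('g \<times> 'x) set" where "full g \<equiv> rect g (space M)"

abbreviation bone :: "('g \<times> 'x) set" where "bone \<equiv> rect \<one> (space M)"

lemma slice_rect: "Q \<subseteq> space M \<Longrightarrow> slice (rect g Q) h = (if g = h then Q else {})"
  by (auto simp: rect_def)

lemma bis_rect: assumes "g \<in> carrier G" "Q \<in> sets M" shows "bis (rect g Q)"
proof -
  have Q: "Q \<subseteq> space M" using assms(2) by (rule sets.sets_into_space)
  have "slice (rect g Q) h \<in> sets M" for h
    unfolding slice_rect[OF Q] using assms(2) by simp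
  then show ?thesis unfolding bis_def using assms(1) Q by (simp add: rect_def) blast
qed

lemma bis_empty: "bis {}" by (simp add: bis_def)

lemma bis_subset:
  assumes "bis B" "C \<subseteq> B" "\<And>g. g \<in> carrier G \<Longrightarrow> slice C g \<in> sets M"
  shows "bis C"
proof -
  have "B \<subseteq> carrier G \<times> space M" using assms(1) by (simp add: bis_def)
  moreover have "g = h" if "(g, x) \<in> C" "(h, x) \<in> C" for g h x
    using bisD(4)[OF assms(1)] that assms(2) by (meson subsetD)
  moreover have "g = h" if "(g, x) \<in> C" "(h, y) \<in> C" "\<alpha> g x = \<alpha> h y" for g h x y
    using bisD(5)[OF assms(1)] that assms(2) by (meson subsetD)
  ultimately show ?thesis unfolding bis_def using assms(2,3) by (meson order_trans)
qed

lemma mem_binv: "bis B \<Longrightarrow> (k, z) \<in> binv B \<longleftrightarrow> k \<in> carrier G \<and> z \<in> space M \<and> (inv k, \<alpha> k z) \<in> B"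
proof
  assume B: "bis B" and "(k, z) \<in> binv B"
  then obtain g x where gx: "(g, x) \<in> B" "k = inv g" "z = \<alpha> g x" unfolding binv_def by auto
  with bisD(1,2)[OF B gx(1)] show "k \<in> carrier G \<and> z \<in> space M \<and> (inv k, \<alpha> k z) \<in> B"
    by simp
next
  assume B: "bis B" and *: "k \<in> carrier G \<and> z \<in> space M \<and> (inv k, \<alpha> k z) \<in> B"
  then have "(k, z) = (\<lambda>(g, x). (inv g, \<alpha> g x)) (inv k, \<alpha> k z)" by simp
  then show "(k, z) \<in> binv B" unfolding binv_def using * by blast
qed

lemma measurable_translate:
  assumes "g \<in> carrier G" "Q \<in> sets M"
  shows "{x \<in> space M. \<alpha> g x \<in> Q} \<in> sets M"
  using measurable_sets[OF act_measurable[OF assms(1)] assms(2)] by (simp add: vimage_def Int_def conj_commute)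

lemma bis_binv: assumes "bis B" shows "bis (binv B)"
proof -
  have sl: "slice (binv B) g = {x \<in> space M. \<alpha> g x \<in> slice B (inv g)}" if "g \<in> carrier G" for g
    using that by (auto simp: mem_binv[OF assms])
  have "slice (binv B) g \<in> sets M" if "g \<in> carrier G" for g
    unfolding sl[OF that] by (intro measurable_translate bisD(3)[OF assms] that inv_closed)
  moreover have "g = h" if "(g, x) \<in> binv B" "(h, x) \<in> binv B" for g h x
  proof -
    have "inv g = inv h" using that bisD(5)[OF assms, of "inv g" "\<alpha> g x" "inv h" "\<alpha> h x"]
      by (auto simp: mem_binv[OF assms])
    then show ?thesis using that by (auto simp: mem_binv[OF assms])
  qed
  moreover have "g = h" if "(g, x) \<in> binv B" "(h, y) \<in> binv B" "\<alpha> g x = \<alpha> h y" for g h x y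
  proof -
    have "inv g = inv h" using that bisD(4)[OF assms, of "inv g" "\<alpha> g x" "inv h"]
      by (auto simp: mem_binv[OF assms])
    then show ?thesis using that by (auto simp: mem_binv[OF assms])
  qed
  moreover have "binv B \<subseteq> carrier G \<times> space M" by (auto simp: mem_binv[OF assms])
  ultimately show ?thesis by (intro bisI) blast+
qed

lemma mem_bmul:
  assumes "bis B" "bis C"
  shows "(m, x) \<in> bmul B C \<longleftrightarrow> (\<exists>l\<in>carrier G. m \<in> carrier G \<and> (l, x) \<in> C \<and> (m \<otimes> inv l, \<alpha> l x) \<in> B)"
proof
  assume "(m, x) \<in> bmul B C"
  then obtain k l where kl: "m = k \<otimes> l" "(l, x) \<in> C" "(k, \<alpha> l x) \<in> B" unfolding bmul_def by auto
  have "k \<in> carrier G" "l \<in> carrier G" using kl assms bisD(1) by blast+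
  then show "\<exists>l\<in>carrier G. m \<in> carrier G \<and> (l, x) \<in> C \<and> (m \<otimes> inv l, \<alpha> l x) \<in> B"
    using kl by (intro bexI[of _ l]) (simp_all add: m_assoc)
next
  assume "\<exists>l\<in>carrier G. m \<in> carrier G \<and> (l, x) \<in> C \<and> (m \<otimes> inv l, \<alpha> l x) \<in> B"
  then obtain l where l: "l \<in> carrier G" "m \<in> carrier G" "(l, x) \<in> C" "(m \<otimes> inv l, \<alpha> l x) \<in> B" by auto
  then have "m = (m \<otimes> inv l) \<otimes> l" by (simp add: m_assoc)
  then show "(m, x) \<in> bmul B C" unfolding bmul_def using l by auto
qed

lemma bis_bmul: assumes B: "bis B" and C: "bis C" shows "bis (bmul B C)"
proof -
  have "slice (bmul B C) m \<in> sets M" if m: "m \<in> carrier G" for m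
  proof -
    have "slice (bmul B C) m = (\<Union>l\<in>carrier G. slice C l \<inter> {x \<in> space M. \<alpha> l x \<in> slice B (m \<otimes> inv l)})"
      using m by (auto simp: mem_bmul[OF B C])
    also have "\<dots> \<in> sets M"
    proof (rule sets.countable_UN'[OF countable_carrier])
      have "slice C l \<inter> {x \<in> space M. \<alpha> l x \<in> slice B (m \<otimes> inv l)} \<in> sets M" if l: "l \<in> carrier G" for l
        by (intro sets.Int bisD(3)[OF C l] measurable_translate[OF l] bisD(3)[OF B] m_closed m inv_closed l)
      then show "(\<lambda>l. slice C l \<inter> {x \<in> space M. \<alpha> l x \<in> slice B (m \<otimes> inv l)}) ` carrier G \<subseteq> sets M"
        by blast
    qed
    finally show ?thesis .
  qed
  moreover have "g = h" if "(g, x) \<in> bmul B C" "(h, x) \<in> bmul B C" for g h x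
    using that bisD(4)[OF B] bisD(4)[OF C] unfolding bmul_def by blast
  moreover have "g = h" if gh: "(g, x) \<in> bmul B C" "(h, y) \<in> bmul B C" "\<alpha> g x = \<alpha> h y" for g h x y
  proof -
    obtain k l where kl: "g = k \<otimes> l" "(l, x) \<in> C" "(k, \<alpha> l x) \<in> B" using gh unfolding bmul_def by auto
    obtain k' l' where kl': "h = k' \<otimes> l'" "(l', y) \<in> C" "(k', \<alpha> l' y) \<in> B" using gh unfolding bmul_def by auto
    have c: "k \<in> carrier G" "l \<in> carrier G" "k' \<in> carrier G" "l' \<in> carrier G" "x \<in> space M" "y \<in> space M"
      using kl kl' bisD(1,2)[OF B] bisD(1,2)[OF C] by blast+
    have "\<alpha> k (\<alpha> l x) = \<alpha> k' (\<alpha> l' y)" using gh(3) kl kl' c by (simp add: act_mult)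
    then have "k = k'" "\<alpha> l x = \<alpha> l' y"
      using bisD(5)[OF B kl(3) kl'(3)] bis_rng_inj[OF B kl(3) kl'(3)] by auto
    then show ?thesis using bisD(5)[OF C kl(2) kl'(2)] kl kl' by simp
  qed
  moreover have "bmul B C \<subseteq> carrier G \<times> space M"
    using bisD(2)[OF C] by (auto simp: mem_bmul[OF B C])
  ultimately show ?thesis by (intro bisI) blast+
qed

lemma bmul_rect:
  assumes "g \<in> carrier G" "h \<in> carrier G" "P \<subseteq> space M" "Q \<subseteq> space M"
  shows "bmul (rect g P) (rect h Q) = rect (g \<otimes> h) {x \<in> Q. \<alpha> h x \<in> P}"
  using assms unfolding bmul_def rect_def by auto

lemma bmul_bone:
  assumes "bis B" shows "bmul B bone = B" "bmul bone B = B"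
proof -
  have "(g, x) \<in> bmul B bone \<longleftrightarrow> (g, x) \<in> B" for g x
  proof
    assume "(g, x) \<in> B"
    then show "(g, x) \<in> bmul B bone"
      using bisD(1,2)[OF assms] unfolding bmul_def rect_def by (intro CollectI exI[of _ g] exI[of _ \<one>] exI[of _ x]) auto
  next
    assume "(g, x) \<in> bmul B bone"
    then show "(g, x) \<in> B" using bisD(1)[OF assms] unfolding bmul_def rect_def by auto
  qed
  then show "bmul B bone = B" by auto
  have "(g, x) \<in> bmul bone B \<longleftrightarrow> (g, x) \<in> B" for g x
  proof
    assume "(g, x) \<in> B"
    then show "(g, x) \<in> bmul bone B"
      using bisD(1,2)[OF assms] unfolding bmul_def rect_def by (intro CollectI exI[of _ g] exI[of _ \<one>] exI[of _ x]) auto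
  next
    assume "(g, x) \<in> bmul bone B"
    then show "(g, x) \<in> B" using bisD(1)[OF assms] unfolding bmul_def rect_def by auto
  qed
  then show "bmul bone B = B" by auto
qed

end

context pmp_action begin

declare act_measurable [measurable del]

section \<open>The Hilbert space and the partial isometries\<close>

interpretation C: sigma_finite_measure "count_space (carrier G)"
  by (rule sigma_finite_measure_count_space_countable[OF countable_carrier])

interpretation P: pair_sigma_finite "count_space (carrier G)" M ..

lemma nn_integral_arrow:
  "f \<in> borel_measurable \<A> \<Longrightarrow>
    integral\<^sup>N \<A> f = (\<integral>\<^sup>+ x. \<integral>\<^sup>+ g. f (g, x) \<partial>count_space (carrier G) \<partial>M)"
  by (rule P.nn_integral_snd[symmetric])

text \<open>The source of the arrow \<open>(g, x)\<close> is \<open>x\<close>, so counting the arrows with source \<open>x\<close> means counting group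
  elements.\<close>

lemma arrow_measure_eq: "arrow_measure \<G> = \<A>"
proof -
  let ?R = "restrict_space \<A> ({\<one>} \<times> space M)"
  have emb: "Pair \<one> \<in> M \<rightarrow>\<^sub>M ?R" by (intro measurable_restrict_space2) auto
  have spR: "space ?R = {\<one>} \<times> space M" by (auto simp: space_restrict_space space_arrow)
  have "(\<integral>\<^sup>+ u. emeasure (count_space UNIV) {x \<in> B. gsrc \<G> x = u} \<partial>unit_space \<G>) = emeasure \<A> B"
    (is "nn_integral _ ?f = _") if B: "B \<in> sets \<A>" for B
  proof -
    have BG: "B \<subseteq> carrier G \<times> space M" using B by (simp add: sets_arrow_iff)
    have Bm: "(\<lambda>x. indicator B (g, x) :: ennreal) \<in> borel_measurable M" if "g \<in> carrier G" for g
      using that by (intro measurable_compose[OF measurable_Pair1' borel_measurable_indicator[OF B]]) auto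
    have f: "?f (\<one>, x) = (\<integral>\<^sup>+ g. indicator B (g, x) \<partial>count_space (carrier G))" if "x \<in> space M" for x
    proof -
      have "{p \<in> B. gsrc \<G> p = (\<one>, x)} = (\<lambda>g. (g, x)) ` {g \<in> carrier G. (g, x) \<in> B}"
        using BG by auto
      then have "?f (\<one>, x) = emeasure (count_space UNIV) {g \<in> carrier G. (g, x) \<in> B}"
        by (simp add: emeasure_count_image inj_on_def)
      also have "\<dots> = emeasure (count_space (carrier G)) {g \<in> carrier G. (g, x) \<in> B}"
        by (cases "finite {g \<in> carrier G. (g, x) \<in> B}") (auto simp: emeasure_count_space)
      also have "\<dots> = (\<integral>\<^sup>+ g. indicator {g \<in> carrier G. (g, x) \<in> B} g \<partial>count_space (carrier G))"
        by (rule nn_integral_indicator[symmetric]) auto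
      also have "\<dots> = (\<integral>\<^sup>+ g. indicator B (g, x) \<partial>count_space (carrier G))"
        by (intro nn_integral_cong) (auto simp: indicator_def)
      finally show ?thesis .
    qed
    have fm: "(\<lambda>x. ?f (\<one>, x)) \<in> borel_measurable M"
      by (rule measurable_cong[OF f, THEN iffD2])
         (assumption | intro borel_measurable_nn_integral_count_space countable_carrier Bm)+
    have "(\<lambda>p. ?f (\<one>, snd p)) \<in> borel_measurable ?R"
      by (rule measurable_restrict_space1[OF measurable_compose[OF measurable_snd fm]])
    then have "?f \<in> borel_measurable ?R"
      by (rule measurable_cong[THEN iffD1, rotated]) (auto simp: spR)
    then have "nn_integral (distr M ?R (Pair \<one>)) ?f = (\<integral>\<^sup>+ x. ?f (\<one>, x) \<partial>M)"
      by (intro nn_integral_distr[OF emb]) (simp only: measurable_distr_eq1)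
    moreover have "unit_space \<G> = distr M ?R (Pair \<one>)" by (simp add: action_groupoid_def)
    ultimately have "nn_integral (unit_space \<G>) ?f = (\<integral>\<^sup>+ x. ?f (\<one>, x) \<partial>M)" by simp
    also have "\<dots> = (\<integral>\<^sup>+ x. \<integral>\<^sup>+ g. indicator B (g, x) \<partial>count_space (carrier G) \<partial>M)"
      by (rule nn_integral_cong) (rule f)
    also have "\<dots> = (\<integral>\<^sup>+ z. indicator B z \<partial>\<A>)"
      by (rule nn_integral_arrow[symmetric]) (use B in simp)
    also have "\<dots> = emeasure \<A> B" by (rule nn_integral_indicator[OF B])
    finally show ?thesis .
  qed
  then have "arrow_measure \<G> = measure_of (space \<A>) (sets \<A>) (emeasure \<A>)"
    unfolding arrow_measure_def groupoid_sel(5)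
    by (intro measure_of_eq[OF sets.space_closed]) (simp add: sets.sigma_sets_eq)
  then show ?thesis by (simp add: measure_of_of_measure)
qed

abbreviation L2 :: "('g \<times> 'x \<Rightarrow> complex) set" where "L2 \<equiv> l2_functions \<G>"

lemma L2_iff: "f \<in> L2 \<longleftrightarrow> f \<in> borel_measurable \<A> \<and> integrable \<A> (\<lambda>x. (cmod (f x))\<^sup>2)"
  by (simp add: l2_functions_def arrow_measure_eq)

lemma L2_iff_nn: "f \<in> L2 \<longleftrightarrow> f \<in> borel_measurable \<A> \<and> (\<integral>\<^sup>+ x. ennreal ((cmod (f x))\<^sup>2) \<partial>\<A>) < \<infinity>"
  unfolding L2_iff by (auto simp: integrable_iff_bounded)

lemma L2_measurable: "f \<in> L2 \<Longrightarrow> f \<in> borel_measurable \<A>" by (simp add: L2_iff)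

lemma cnj_measurable [measurable (raw)]: "f \<in> borel_measurable N \<Longrightarrow> (\<lambda>x. cnj (f x)) \<in> borel_measurable N"
  by (rule measurable_compose[where g = cnj, OF _ borel_measurable_continuous_onI]) (auto intro: continuous_intros)

lemma L2_product_integrable:
  assumes "f \<in> L2" "g \<in> L2"
  shows "integrable \<A> (\<lambda>x. f x * cnj (g x))"
proof (rule Bochner_Integration.integrable_bound)
  show "integrable \<A> (\<lambda>x. (cmod (f x))\<^sup>2 + (cmod (g x))\<^sup>2)"
    using assms by (intro Bochner_Integration.integrable_add) (auto simp: L2_iff)
  show "(\<lambda>x. f x * cnj (g x)) \<in> borel_measurable \<A>"
    using L2_measurable[OF assms(1)] L2_measurable[OF assms(2)] by measurable
  have "a * b \<le> a\<^sup>2 + b\<^sup>2" if "a \<ge> 0" "b \<ge> 0" for a b :: real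
    using sum_squares_bound[of a b] mult_nonneg_nonneg[OF that] by linarith
  then show "AE x in \<A>. cmod (f x * cnj (g x)) \<le> norm ((cmod (f x))\<^sup>2 + (cmod (g x))\<^sup>2)"
    by (intro AE_I2) (simp add: norm_mult)
qed

lemma L2_add: assumes "f \<in> L2" "g \<in> L2" shows "(\<lambda>x. f x + g x) \<in> L2"
proof -
  have "integrable \<A> (\<lambda>x. (cmod (f x + g x))\<^sup>2)"
  proof (rule Bochner_Integration.integrable_bound)
    show "integrable \<A> (\<lambda>x. 2 * (cmod (f x))\<^sup>2 + 2 * (cmod (g x))\<^sup>2)"
      using assms by (intro Bochner_Integration.integrable_add) (auto simp: L2_iff)
    show "(\<lambda>x. (cmod (f x + g x))\<^sup>2) \<in> borel_measurable \<A>"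
      using L2_measurable[OF assms(1)] L2_measurable[OF assms(2)] by measurable
    have "(cmod (a + b))\<^sup>2 \<le> 2 * (cmod a)\<^sup>2 + 2 * (cmod b)\<^sup>2" for a b
    proof -
      have "(cmod (a + b))\<^sup>2 \<le> (cmod a + cmod b)\<^sup>2" by (intro power_mono norm_triangle_ineq) auto
      also have "\<dots> \<le> 2 * (cmod a)\<^sup>2 + 2 * (cmod b)\<^sup>2"
        using sum_squares_bound[of "cmod a" "cmod b"] by (simp add: power2_sum)
      finally show ?thesis .
    qed
    then show "AE x in \<A>. norm ((cmod (f x + g x))\<^sup>2) \<le> norm (2 * (cmod (f x))\<^sup>2 + 2 * (cmod (g x))\<^sup>2)"
      by (intro AE_I2) simp
  qed
  then show ?thesis
    unfolding L2_iff using borel_measurable_add[OF L2_measurable[OF assms(1)] L2_measurable[OF assms(2)]] by blast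
qed

lemma L2_scale: assumes "f \<in> L2" shows "(\<lambda>x. c * f x) \<in> L2"
proof -
  have "integrable \<A> (\<lambda>x. (cmod c)\<^sup>2 * (cmod (f x))\<^sup>2)"
    using assms unfolding L2_iff by (intro integrable_mult_right) blast
  then have "integrable \<A> (\<lambda>x. (cmod (c * f x))\<^sup>2)" by (simp add: norm_mult power_mult_distrib)
  moreover have "(\<lambda>x. c * f x) \<in> borel_measurable \<A>"
    by (intro borel_measurable_times borel_measurable_const L2_measurable assms)
  ultimately show ?thesis unfolding L2_iff by blast
qed

lemma L2_diff: assumes "f \<in> L2" "g \<in> L2" shows "(\<lambda>x. f x - g x) \<in> L2"
  using L2_add[OF assms(1) L2_scale[OF assms(2), of "-1"]] by simp

abbreviation cls :: "('g \<times> 'x \<Rightarrow> complex) \<Rightarrow> ('g \<times> 'x \<Rightarrow> complex) set" where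
  "cls \<equiv> l2_class \<G>"

abbreviation H :: "('g \<times> 'x \<Rightarrow> complex) set set" where "H \<equiv> l2_space \<G>"

lemma class_eq: "cls f = {g \<in> L2. AE x in \<A>. g x = f x}"
  unfolding l2_class_def arrow_measure_eq ..

lemma class_cong: "AE x in \<A>. f x = g x \<Longrightarrow> cls f = cls g"
  unfolding class_eq by (auto elim: eventually_elim2)

lemma class_cong_space: "(\<And>g x. g \<in> carrier G \<Longrightarrow> x \<in> space M \<Longrightarrow> f (g, x) = f' (g, x)) \<Longrightarrow> cls f = cls f'"
  by (intro class_cong AE_I2) (auto simp: space_arrow)

lemma rep_class:
  assumes "f \<in> L2"
  shows "l2_rep (cls f) \<in> L2" "AE x in \<A>. l2_rep (cls f) x = f x"
proof -
  have "f \<in> cls f" using assms by (simp add: class_eq)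
  then have "l2_rep (cls f) \<in> cls f" unfolding l2_rep_def by (rule someI[where P = "\<lambda>g. g \<in> cls f"])
  then show "l2_rep (cls f) \<in> L2" "AE x in \<A>. l2_rep (cls f) x = f x"
    by (auto simp: class_eq)
qed

lemma class_in_H: "f \<in> L2 \<Longrightarrow> cls f \<in> H" by (simp add: l2_space_def)

lemma H_rep:
  assumes "\<xi> \<in> H"
  shows "l2_rep \<xi> \<in> L2" "cls (l2_rep \<xi>) = \<xi>"
proof -
  obtain f where f: "f \<in> L2" "\<xi> = cls f" using assms by (auto simp: l2_space_def)
  then show "l2_rep \<xi> \<in> L2" using rep_class by simp
  show "cls (l2_rep \<xi>) = \<xi>" unfolding f(2) by (rule class_cong) (rule rep_class[OF f(1)])
qed

lemma inner_class:
  assumes "f \<in> L2" "g \<in> L2"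
  shows "l2_inner \<G> (cls f) (cls g) = (LINT x|\<A>. f x * cnj (g x))"
  unfolding l2_inner_def arrow_measure_eq
proof (rule integral_cong_AE)
  note [measurable] = L2_measurable[OF assms(1)] L2_measurable[OF assms(2)]
    L2_measurable[OF rep_class(1)[OF assms(1)]] L2_measurable[OF rep_class(1)[OF assms(2)]]
  show "(\<lambda>x. l2_rep (cls f) x * cnj (l2_rep (cls g) x)) \<in> borel_measurable \<A>" by measurable
  show "(\<lambda>x. f x * cnj (g x)) \<in> borel_measurable \<A>" by measurable
  show "AE x in \<A>. l2_rep (cls f) x * cnj (l2_rep (cls g) x) = f x * cnj (g x)"
    using rep_class(2)[OF assms(1)] rep_class(2)[OF assms(2)] by eventually_elim simp
qed

lemma add_class:
  assumes "f \<in> L2" "g \<in> L2" shows "l2_add \<G> (cls f) (cls g) = cls (\<lambda>x. f x + g x)"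
proof -
  have "AE x in \<A>. l2_rep (cls f) x + l2_rep (cls g) x = f x + g x"
    using rep_class(2)[OF assms(1)] rep_class(2)[OF assms(2)] by eventually_elim simp
  then show ?thesis unfolding l2_add_def by (rule class_cong)
qed

lemma scale_class: assumes "f \<in> L2" shows "l2_scale \<G> c (cls f) = cls (\<lambda>x. c * f x)"
proof -
  have "AE x in \<A>. c * l2_rep (cls f) x = c * f x"
    using rep_class(2)[OF assms(1)] by eventually_elim simp
  then show ?thesis unfolding l2_scale_def by (rule class_cong)
qed

lemma H_eq_if_inner_eq:
  assumes "\<eta> \<in> H" "\<eta>' \<in> H" "\<And>\<xi>. \<xi> \<in> H \<Longrightarrow> l2_inner \<G> \<xi> \<eta> = l2_inner \<G> \<xi> \<eta>'"
  shows "\<eta> = \<eta>'"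
proof -
  obtain u v where uv: "u \<in> L2" "v \<in> L2" "\<eta> = cls u" "\<eta>' = cls v"
    using assms(1,2) by (auto simp: l2_space_def)
  let ?f = "\<lambda>x. u x - v x"
  have f: "?f \<in> L2" using uv by (intro L2_diff)
  have "(LINT x|\<A>. ?f x * cnj (u x)) = (LINT x|\<A>. ?f x * cnj (v x))"
    using assms(3)[OF class_in_H[OF f]] uv f by (simp add: inner_class)
  then have "(LINT x|\<A>. ?f x * cnj (u x) - ?f x * cnj (v x)) = 0"
    using uv f by (subst Bochner_Integration.integral_diff) (auto intro: L2_product_integrable)
  moreover have "?f x * cnj (u x) - ?f x * cnj (v x) = complex_of_real ((cmod (?f x))\<^sup>2)" for x
    by (simp only: complex_norm_square complex_cnj_diff right_diff_distrib)
  ultimately have "(LINT x|\<A>. (cmod (?f x))\<^sup>2) = 0"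
    by (simp only: integral_complex_of_real of_real_eq_0_iff)
  moreover have "integrable \<A> (\<lambda>x. (cmod (?f x))\<^sup>2)" using f by (simp add: L2_iff)
  ultimately have "AE x in \<A>. (cmod (?f x))\<^sup>2 = 0"
    by (subst (asm) integral_nonneg_eq_0_iff_AE) auto
  then have "AE x in \<A>. u x = v x" by eventually_elim simp
  then show ?thesis unfolding uv by (rule class_cong)
qed

text \<open>\<open>arr B z\<close> is the group element of the arrow of \<open>B\<close> with range \<open>z\<close>, if there is one.\<close>

definition arr :: "('g \<times> 'x) set \<Rightarrow> 'x \<Rightarrow> 'g option" where
  "arr B z = (if \<exists>k. (k, \<alpha> (inv k) z) \<in> B then Some (THE k. (k, \<alpha> (inv k) z) \<in> B) else None)"

lemma arr_Some:
  assumes B: "bis B" and z: "z \<in> space M"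
  shows "arr B z = Some k \<longleftrightarrow> (k, \<alpha> (inv k) z) \<in> B"
proof -
  have uniq: "k = k'" if "(k, \<alpha> (inv k) z) \<in> B" "(k', \<alpha> (inv k') z) \<in> B" for k k'
    using bisD(5)[OF B that] bisD(1)[OF B that(1)] bisD(1)[OF B that(2)] z by simp
  show ?thesis
  proof (cases "\<exists>k. (k, \<alpha> (inv k) z) \<in> B")
    case True
    then obtain l where l: "(l, \<alpha> (inv l) z) \<in> B" by auto
    then have "(THE k. (k, \<alpha> (inv k) z) \<in> B) = l" using uniq by (intro the_equality) auto
    then have "arr B z = Some l" using True by (simp add: arr_def)
    then show ?thesis using l uniq by auto
  qed (auto simp: arr_def)
qed

lemma arr_carrier: "bis B \<Longrightarrow> z \<in> space M \<Longrightarrow> arr B z = Some k \<Longrightarrow> k \<in> carrier G"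
  using arr_Some bisD(1) by blast

lemma measurable_arr:
  assumes "bis B"
  shows "arr B \<in> M \<rightarrow>\<^sub>M count_space ({None} \<union> Some ` carrier G)"
proof (rule measurable_count_space_eq_countable[THEN iffD2])
  show "countable ({None} \<union> Some ` carrier G)" using countable_carrier by simp
  have r: "arr B \<in> space M \<rightarrow> {None} \<union> Some ` carrier G"
    using arr_carrier[OF assms] by (auto) (metis image_eqI not_None_eq)
  have S: "arr B -` {Some k} \<inter> space M \<in> sets M" if "k \<in> carrier G" for k
  proof -
    have "arr B -` {Some k} \<inter> space M = {z \<in> space M. \<alpha> (inv k) z \<in> slice B k}"
      using that by (auto simp: arr_Some[OF assms])
    then show ?thesis using measurable_translate[OF inv_closed[OF that] bisD(3)[OF assms that]] by simp
  qed
  have eq: "arr B -` {None} \<inter> space M = space M - (\<Union>k\<in>carrier G. arr B -` {Some k} \<inter> space M)"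
    using r by auto
  have "(\<Union>k\<in>carrier G. arr B -` {Some k} \<inter> space M) \<in> sets M"
    using S by (intro sets.countable_UN'[OF countable_carrier]) blast
  then have "arr B -` {None} \<inter> space M \<in> sets M" unfolding eq by (intro sets.Diff sets.top)
  then show "arr B \<in> space M \<rightarrow> {None} \<union> Some ` carrier G \<and>
    (\<forall>a\<in>{None} \<union> Some ` carrier G. arr B -` {a} \<inter> space M \<in> sets M)"
    using r S by auto
qed

text \<open>\<open>shift B p\<close> is the product of \<open>p\<close> with the inverse of the arrow of \<open>B\<close> that ends where \<open>p\<close> ends, and
  \<open>dom B\<close> is the set of \<open>p\<close> for which such an arrow exists. Thus \<open>tr B\<close> is the partial isometry of
  \<open>B\<close>, acting on functions instead of classes.\<close>

definition shift :: "('g \<times> 'x) set \<Rightarrow> 'g \<times> 'x \<Rightarrow> 'g \<times> 'x" where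
  "shift B = (\<lambda>(h, y). case arr B (\<alpha> h y) of None \<Rightarrow> (h, y) | Some k \<Rightarrow> (inv k \<otimes> h, y))"

definition dom :: "('g \<times> 'x) set \<Rightarrow> ('g \<times> 'x) set" where
  "dom B = {(h, y). h \<in> carrier G \<and> y \<in> space M \<and> arr B (\<alpha> h y) \<noteq> None}"

definition tr :: "('g \<times> 'x) set \<Rightarrow> ('g \<times> 'x \<Rightarrow> complex) \<Rightarrow> 'g \<times> 'x \<Rightarrow> complex" where
  "tr B f p = (if p \<in> dom B then f (shift B p) else 0)"

lemma dom_sets: assumes "bis B" shows "dom B \<in> sets \<A>"
  unfolding sets_arrow_iff
proof (intro conjI ballI)
  fix g assume g: "g \<in> carrier G"
  have "slice (dom B) g = (\<lambda>y. arr B (\<alpha> g y)) -` (Some ` carrier G) \<inter> space M"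
    using g arr_carrier[OF assms act_closed[OF g]] by (auto simp: dom_def image_iff)
  also have "\<dots> \<in> sets M"
    by (rule measurable_sets[OF measurable_compose[OF act_measurable[OF g] measurable_arr[OF assms]]]) auto
  finally show "slice (dom B) g \<in> sets M" .
qed (auto simp: dom_def)

lemma shift_measurable: assumes "bis B" shows "shift B \<in> \<A> \<rightarrow>\<^sub>M \<A>"
proof (rule measurable_arrow)
  fix h assume h: "h \<in> carrier G"
  have "(\<lambda>y. (\<lambda>i y. case i of None \<Rightarrow> (h, y) | Some k \<Rightarrow> (inv k \<otimes> h, y)) (arr B (\<alpha> h y)) y) \<in> M \<rightarrow>\<^sub>M \<A>"
  proof (rule measurable_compose_countable'[where I = "{None} \<union> Some ` carrier G"])
    show "(\<lambda>y. arr B (\<alpha> h y)) \<in> M \<rightarrow>\<^sub>M count_space ({None} \<union> Some ` carrier G)"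
      by (rule measurable_compose[OF act_measurable[OF h] measurable_arr[OF assms]])
    show "countable ({None} \<union> Some ` carrier G)" using countable_carrier by simp
    fix i assume "i \<in> {None} \<union> Some ` carrier G"
    then show "(\<lambda>y. case i of None \<Rightarrow> (h, y) | Some k \<Rightarrow> (inv k \<otimes> h, y)) \<in> M \<rightarrow>\<^sub>M \<A>"
      using h by auto
  qed
  then show "(\<lambda>y. shift B (h, y)) \<in> M \<rightarrow>\<^sub>M \<A>" by (simp add: shift_def)
qed

lemma arr_binv:
  assumes B: "bis B" and z: "z \<in> space M"
  shows "arr B z = Some k \<longleftrightarrow> k \<in> carrier G \<and> arr (binv B) (\<alpha> (inv k) z) = Some (inv k)"
proof (cases "k \<in> carrier G")
  case True
  then have "arr (binv B) (\<alpha> (inv k) z) = Some (inv k) \<longleftrightarrow> (inv k, \<alpha> k (\<alpha> (inv k) z)) \<in> binv B"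
    using z by (subst arr_Some[OF bis_binv[OF B]]) auto
  also have "\<dots> \<longleftrightarrow> (k, \<alpha> (inv k) z) \<in> B"
    using True z by (simp add: mem_binv[OF B])
  finally show ?thesis using True arr_Some[OF B z] by simp
next
  case False
  then show ?thesis using arr_carrier[OF B z] by auto
qed

lemma binv_binv: assumes "bis B" shows "binv (binv B) = B"
proof -
  have "(g, x) \<in> binv (binv B) \<longleftrightarrow> (g, x) \<in> B" for g x
    using bisD(1,2)[OF assms, of g x] by (auto simp: mem_binv[OF bis_binv[OF assms]] mem_binv[OF assms])
  then show ?thesis by auto
qed

lemma shift_binv:
  assumes B: "bis B" and p: "p \<in> dom B"
  shows "shift B p \<in> dom (binv B)" "shift (binv B) (shift B p) = p" "snd (shift B p) = snd p"
proof -
  obtain h y k where hy: "p = (h, y)" "h \<in> carrier G" "y \<in> space M" "arr B (\<alpha> h y) = Some k"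
    using p by (auto simp: dom_def)
  have z: "\<alpha> h y \<in> space M" using hy by simp
  have k: "k \<in> carrier G" "arr (binv B) (\<alpha> (inv k) (\<alpha> h y)) = Some (inv k)"
    using hy(4) arr_binv[OF B z] by auto
  have s: "shift B p = (inv k \<otimes> h, y)" using hy by (simp add: shift_def)
  have e: "\<alpha> (inv k \<otimes> h) y = \<alpha> (inv k) (\<alpha> h y)" using hy k by (simp add: act_mult)
  show "shift B p \<in> dom (binv B)" using s e k hy by (simp add: dom_def)
  show "shift (binv B) (shift B p) = p"
    unfolding s using e k hy by (simp add: shift_def)
  show "snd (shift B p) = snd p" using s hy by simp
qed

lemma dom_space: "p \<in> dom B \<Longrightarrow> p \<in> space \<A>" by (auto simp: dom_def space_arrow)

text \<open>For fixed source \<open>x\<close>, \<open>shift B\<close> is a bijection between the arrows in \<open>dom B\<close> and those in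
  \<open>dom (binv B)\<close>, so it preserves the fibrewise counting measure.\<close>

lemma nn_integral_shift:
  assumes B: "bis B" and f: "f \<in> borel_measurable \<A>"
  shows "(\<integral>\<^sup>+ p. f (shift B p) * indicator (dom B) p \<partial>\<A>) = (\<integral>\<^sup>+ p. f p * indicator (dom (binv B)) p \<partial>\<A>)"
proof -
  let ?D = "\<lambda>B x. {h \<in> carrier G. (h, x) \<in> dom B}"
  note [measurable] = f dom_sets[OF B] dom_sets[OF bis_binv[OF B]] shift_measurable[OF B]
  have bij: "bij_betw (\<lambda>h. fst (shift B (h, x))) (?D B x) (?D (binv B) x)" for x
  proof (rule bij_betw_byWitness[where f' = "\<lambda>h. fst (shift (binv B) (h, x))"])
    have *: "shift B (h, x) = (fst (shift B (h, x)), x)" if "(h, x) \<in> dom B" for B h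
      by (cases "arr B (\<alpha> h x)") (auto simp: shift_def)
    show "\<forall>a\<in>?D B x. fst (shift (binv B) (fst (shift B (a, x)), x)) = a"
      using * shift_binv(2)[OF B] by (metis (lifting) fst_conv mem_Collect_eq)
    show "\<forall>a\<in>?D (binv B) x. fst (shift B (fst (shift (binv B) (a, x)), x)) = a"
      using * shift_binv(2)[OF bis_binv[OF B]] binv_binv[OF B] by (metis (lifting) fst_conv mem_Collect_eq)
    have "fst (shift B (h, x)) \<in> ?D (binv B) x" if "bis B" "h \<in> ?D B x" for B h
      using shift_binv(1)[OF that(1), of "(h, x)"] that *[of h B] dom_space[of "shift B (h, x)" "binv B"]
      by (auto simp: space_arrow mem_Times_iff)
    from this[OF B] this[OF bis_binv[OF B]]
    show "(\<lambda>h. fst (shift B (h, x))) ` ?D B x \<subseteq> ?D (binv B) x"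
      "(\<lambda>h. fst (shift (binv B) (h, x))) ` ?D (binv B) x \<subseteq> ?D B x"
      unfolding binv_binv[OF B] by blast+
  qed
  have sub: "(\<integral>\<^sup>+ h. F h * indicator (dom C) (h, x) \<partial>count_space (carrier G)) = (\<integral>\<^sup>+ h. F h \<partial>count_space (?D C x))" for F :: "'g \<Rightarrow> ennreal" and C x
  proof -
    have "(\<integral>\<^sup>+ h. F h \<partial>count_space (?D C x)) = (\<integral>\<^sup>+ h. F h * indicator (?D C x) h \<partial>count_space UNIV)"
      by (rule nn_integral_count_space_indicator) simp
    also have "\<dots> = (\<integral>\<^sup>+ h. (F h * indicator (dom C) (h, x)) * indicator (carrier G) h \<partial>count_space UNIV)"
      by (rule nn_integral_cong) (auto simp: indicator_def)
    also have "\<dots> = (\<integral>\<^sup>+ h. F h * indicator (dom C) (h, x) \<partial>count_space (carrier G))"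
      by (rule nn_integral_count_space_indicator[symmetric]) simp
    finally show ?thesis by simp
  qed
  have "(\<integral>\<^sup>+ p. f (shift B p) * indicator (dom B) p \<partial>\<A>) =
     (\<integral>\<^sup>+ x. \<integral>\<^sup>+ h. f (shift B (h, x)) * indicator (dom B) (h, x) \<partial>count_space (carrier G) \<partial>M)"
    by (rule nn_integral_arrow) measurable
  also have "\<dots> = (\<integral>\<^sup>+ x. \<integral>\<^sup>+ h. f (h, x) * indicator (dom (binv B)) (h, x) \<partial>count_space (carrier G) \<partial>M)"
  proof (rule nn_integral_cong)
    fix x
    have "(\<integral>\<^sup>+ h. f (shift B (h, x)) * indicator (dom B) (h, x) \<partial>count_space (carrier G)) =
       (\<integral>\<^sup>+ h. f (fst (shift B (h, x)), x) \<partial>count_space (?D B x))"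
      unfolding sub by (rule nn_integral_cong) (auto simp: shift_def split: option.split)
    also have "\<dots> = (\<integral>\<^sup>+ h. f (h, x) \<partial>count_space (?D (binv B) x))"
      by (rule nn_integral_bij_count_space[OF bij, where f = "\<lambda>h. f (h, x)"])
    finally show "(\<integral>\<^sup>+ h. f (shift B (h, x)) * indicator (dom B) (h, x) \<partial>count_space (carrier G)) =
       (\<integral>\<^sup>+ h. f (h, x) * indicator (dom (binv B)) (h, x) \<partial>count_space (carrier G))"
      unfolding sub .
  qed
  also have "\<dots> = (\<integral>\<^sup>+ p. f p * indicator (dom (binv B)) p \<partial>\<A>)"
    by (rule nn_integral_arrow[symmetric]) measurable
  finally show ?thesis .
qed

end

context pmp_action begin

lemma tr_measurable:
  assumes B: "bis B" and f: "f \<in> borel_measurable \<A>"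
  shows "tr B f \<in> borel_measurable \<A>"
proof -
  have "(\<lambda>p. if p \<in> dom B then f (shift B p) else 0) \<in> borel_measurable \<A>"
  proof (rule measurable_If_set)
    show "(\<lambda>p. f (shift B p)) \<in> borel_measurable \<A>"
      by (rule measurable_compose[OF shift_measurable[OF B] f])
    show "dom B \<inter> space \<A> \<in> sets \<A>" by (intro sets.Int dom_sets[OF B] sets.top)
  qed simp
  then show ?thesis by (simp add: tr_def[abs_def])
qed

lemma nn_integral_tr:
  assumes B: "bis B" and f: "f \<in> borel_measurable \<A>"
  shows "(\<integral>\<^sup>+ p. ennreal ((cmod (tr B f p))\<^sup>2) \<partial>\<A>) \<le> (\<integral>\<^sup>+ p. ennreal ((cmod (f p))\<^sup>2) \<partial>\<A>)"
proof -
  have m: "(\<lambda>p. ennreal ((cmod (f p))\<^sup>2)) \<in> borel_measurable \<A>" using f by measurable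
  have "(\<integral>\<^sup>+ p. ennreal ((cmod (tr B f p))\<^sup>2) \<partial>\<A>) =
     (\<integral>\<^sup>+ p. ennreal ((cmod (f (shift B p)))\<^sup>2) * indicator (dom B) p \<partial>\<A>)"
    by (intro nn_integral_cong) (auto simp: tr_def indicator_def)
  also have "\<dots> = (\<integral>\<^sup>+ p. ennreal ((cmod (f p))\<^sup>2) * indicator (dom (binv B)) p \<partial>\<A>)"
    by (rule nn_integral_shift[OF B m])
  also have "\<dots> \<le> (\<integral>\<^sup>+ p. ennreal ((cmod (f p))\<^sup>2) \<partial>\<A>)"
    by (intro nn_integral_mono) (auto simp: indicator_def)
  finally show ?thesis .
qed

lemma tr_L2: assumes B: "bis B" and f: "f \<in> L2" shows "tr B f \<in> L2"
  unfolding L2_iff_nn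
  using tr_measurable[OF B L2_measurable[OF f]] f[unfolded L2_iff_nn, THEN conjunct2]
    order_le_less_trans[OF nn_integral_tr[OF B L2_measurable[OF f]]] by blast

lemma tr_diff: "tr B f p - tr B g p = tr B (\<lambda>p. f p - g p) p"
  by (simp add: tr_def)

lemma tr_AE:
  assumes B: "bis B" and f: "f \<in> borel_measurable \<A>" and g: "g \<in> borel_measurable \<A>"
    and e: "AE p in \<A>. f p = g p"
  shows "AE p in \<A>. tr B f p = tr B g p"
proof -
  let ?d = "\<lambda>p. f p - g p"
  have d: "?d \<in> borel_measurable \<A>" using f g by measurable
  have m: "(\<lambda>p. ennreal ((cmod (?d p))\<^sup>2)) \<in> borel_measurable \<A>"
    "(\<lambda>p. ennreal ((cmod (tr B ?d p))\<^sup>2)) \<in> borel_measurable \<A>"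
    using d tr_measurable[OF B d] by measurable
  have "(\<integral>\<^sup>+ p. ennreal ((cmod (?d p))\<^sup>2) \<partial>\<A>) = 0"
    unfolding nn_integral_0_iff_AE[OF m(1)] using e by eventually_elim simp
  then have "(\<integral>\<^sup>+ p. ennreal ((cmod (tr B ?d p))\<^sup>2) \<partial>\<A>) = 0"
    using nn_integral_tr[OF B d] by simp
  then have "AE p in \<A>. ennreal ((cmod (tr B ?d p))\<^sup>2) = 0"
    unfolding nn_integral_0_iff_AE[OF m(2)] .
  then show ?thesis by eventually_elim (simp add: tr_diff[symmetric])
qed

abbreviation s_op :: "('g \<times> 'x) set \<Rightarrow> ('g \<times> 'x) l2_op" where "s_op B \<equiv> bisection_op \<G> B"

lemma s_op_eq:
  assumes B: "bis B"
  shows "s_op B = (\<lambda>\<xi>\<in>H. cls (tr B (l2_rep \<xi>)))"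
proof -
  have "cls (\<lambda>x. let P = (\<lambda>y. y \<in> space (arrows \<G>) \<and> grng \<G> y = gsrc \<G> x \<and> gmul \<G> x y \<in> B)
     in if \<exists>y. P y then f (ginv \<G> (THE y. P y)) else 0) = cls (tr B f)" for f
  proof (rule class_cong_space)
    fix h y assume h: "h \<in> carrier G" and y: "y \<in> space M"
    let ?P = "\<lambda>p. p \<in> space (arrows \<G>) \<and> grng \<G> p = gsrc \<G> (h, y) \<and> gmul \<G> (h, y) p \<in> B"
    have z: "\<alpha> h y \<in> space M" using h y by simp
    have P: "?P (g, x) \<longleftrightarrow> g \<in> carrier G \<and> x \<in> space M \<and> \<alpha> g x = y \<and> (h \<otimes> g, x) \<in> B" for g x
      by (auto simp: space_arrow)
    have P_arr: "arr B (\<alpha> h y) = Some (h \<otimes> g)" if "?P (g, x)" for g x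
    proof -
      have "\<alpha> (inv (h \<otimes> g)) (\<alpha> h y) = x"
        using that h unfolding P by (auto simp: act_mult[symmetric])
      then show ?thesis unfolding arr_Some[OF B z] using that unfolding P by simp
    qed
    show "(let P = ?P in if \<exists>y. P y then f (ginv \<G> (THE y. P y)) else 0) = tr B f (h, y)"
    proof (cases "arr B (\<alpha> h y)")
      case None
      then have "\<not> ?P (g, x)" for g x using P_arr by fastforce
      then have "\<not> (\<exists>p. ?P p)" by fastforce
      then have "(let P = ?P in if \<exists>y. P y then f (ginv \<G> (THE y. P y)) else 0) = 0"
        unfolding Let_def by (simp only: if_False)
      then show ?thesis using None by (simp add: tr_def dom_def)
    next
      case (Some k)
      let ?q = "(inv h \<otimes> k, \<alpha> (inv k) (\<alpha> h y))"
      have k: "k \<in> carrier G" "(k, \<alpha> (inv k) (\<alpha> h y)) \<in> B"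
        using Some arr_carrier[OF B z] arr_Some[OF B z] by auto
      have q: "?P ?q" unfolding P using h y k by (simp add: act_mult)
      have "p = ?q" if "?P p" for p
      proof (cases p)
        case (Pair g x)
        then have gx: "?P (g, x)" using that by simp
        have "h \<otimes> g = k" using P_arr[OF gx] Some by simp
        then have "g = inv h \<otimes> k" using gx h unfolding P by auto
        moreover have "x = \<alpha> (inv k) (\<alpha> h y)" using \<open>h \<otimes> g = k\<close> gx h unfolding P by (auto simp: act_mult[symmetric])
        ultimately show ?thesis using Pair by simp
      qed
      then have "(THE p. ?P p) = ?q" using q by (intro the_equality) blast+
      moreover have "\<exists>p. ?P p" using q by blast
      moreover have "ginv \<G> ?q = (inv k \<otimes> h, y)"
        using h y k by (simp add: inv_mult_group act_mult)
      ultimately have "(let P = ?P in if \<exists>y. P y then f (ginv \<G> (THE y. P y)) else 0) = f (inv k \<otimes> h, y)"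
        unfolding Let_def by (simp only: if_True)
      then show ?thesis using Some h y by (simp add: tr_def dom_def shift_def)
    qed
  qed
  then show ?thesis unfolding bisection_op_def by simp
qed

lemma s_op_class:
  assumes B: "bis B" and f: "f \<in> L2"
  shows "s_op B (cls f) = cls (tr B f)"
  unfolding s_op_eq[OF B] using class_in_H[OF f]
  by (auto intro!: class_cong tr_AE[OF B] rep_class[OF f] L2_measurable f)

lemma s_op_H: "bis B \<Longrightarrow> \<xi> \<in> H \<Longrightarrow> s_op B \<xi> \<in> H"
  unfolding s_op_eq by (auto intro!: class_in_H tr_L2 H_rep)

lemma op_eqI:
  assumes "a \<in> extensional H" "b \<in> extensional H" "\<And>f. f \<in> L2 \<Longrightarrow> a (cls f) = b (cls f)"
  shows "a = b"
  using assms(1,2) by (rule extensionalityI) (use assms(3) in \<open>auto simp: l2_space_def\<close>)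

lemma s_op_extensional: "s_op B \<in> extensional H"
  by (auto simp: bisection_op_def)

lemma arr_bmul:
  assumes B: "bis B" and C: "bis C" and z: "z \<in> space M"
  shows "arr (bmul B C) z = Some m \<longleftrightarrow>
    (\<exists>k l. m = k \<otimes> l \<and> arr B z = Some k \<and> arr C (\<alpha> (inv k) z) = Some l)"
proof
  assume "arr (bmul B C) z = Some m"
  then have "(m, \<alpha> (inv m) z) \<in> bmul B C" unfolding arr_Some[OF bis_bmul[OF B C] z] .
  then obtain l where l: "l \<in> carrier G" "m \<in> carrier G" "(l, \<alpha> (inv m) z) \<in> C"
    "(m \<otimes> inv l, \<alpha> l (\<alpha> (inv m) z)) \<in> B" unfolding mem_bmul[OF B C] by auto
  have e: "\<alpha> (inv (m \<otimes> inv l)) z = \<alpha> l (\<alpha> (inv m) z)" using l z by (simp add: inv_mult_group act_mult)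
  have "arr B z = Some (m \<otimes> inv l)" unfolding arr_Some[OF B z] e by (rule l(4))
  moreover have "arr C (\<alpha> (inv (m \<otimes> inv l)) z) = Some l"
    unfolding e using l z by (subst arr_Some[OF C]) auto
  moreover have "m = m \<otimes> inv l \<otimes> l" using l by (simp add: m_assoc)
  ultimately show "\<exists>k l. m = k \<otimes> l \<and> arr B z = Some k \<and> arr C (\<alpha> (inv k) z) = Some l" by blast
next
  assume "\<exists>k l. m = k \<otimes> l \<and> arr B z = Some k \<and> arr C (\<alpha> (inv k) z) = Some l"
  then obtain k l where kl: "m = k \<otimes> l" "arr B z = Some k" "arr C (\<alpha> (inv k) z) = Some l" by auto
  have k: "k \<in> carrier G" "(k, \<alpha> (inv k) z) \<in> B" using kl arr_carrier[OF B z] arr_Some[OF B z] by auto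
  then have z': "\<alpha> (inv k) z \<in> space M" using z by simp
  have l: "l \<in> carrier G" "(l, \<alpha> (inv l) (\<alpha> (inv k) z)) \<in> C"
    using kl arr_carrier[OF C z'] arr_Some[OF C z'] by auto
  have e: "\<alpha> (inv m) z = \<alpha> (inv l) (\<alpha> (inv k) z)" using kl k l z by (simp add: inv_mult_group act_mult)
  have "(m, \<alpha> (inv m) z) \<in> bmul B C" unfolding mem_bmul[OF B C]
    using k l z kl(1) unfolding e by (intro bexI[of _ l]) (simp_all add: m_assoc)
  then show "arr (bmul B C) z = Some m" unfolding arr_Some[OF bis_bmul[OF B C] z] .
qed

lemma tr_tr:
  assumes B: "bis B" and C: "bis C" and h: "h \<in> carrier G" and y: "y \<in> space M"
  shows "tr B (tr C f) (h, y) = tr (bmul B C) f (h, y)"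
proof -
  have z: "\<alpha> h y \<in> space M" using h y by simp
  note a = arr_bmul[OF B C z]
  show ?thesis
  proof (cases "arr B (\<alpha> h y)")
    case None
    then have "arr (bmul B C) (\<alpha> h y) = None" using a by (metis not_None_eq)
    then show ?thesis using None by (simp add: tr_def dom_def)
  next
    case (Some k)
    have k: "k \<in> carrier G" using arr_carrier[OF B z Some] .
    have e: "\<alpha> (inv k \<otimes> h) y = \<alpha> (inv k) (\<alpha> h y)" using h y k by (simp add: act_mult)
    have z': "\<alpha> (inv k) (\<alpha> h y) \<in> space M" using z k by simp
    have 1: "tr B (tr C f) (h, y) = tr C f (inv k \<otimes> h, y)"
      using Some h y by (simp add: tr_def dom_def shift_def)
    show ?thesis
    proof (cases "arr C (\<alpha> (inv k) (\<alpha> h y))")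
      case None
      then have "arr (bmul B C) (\<alpha> h y) = None" using a Some by (metis not_None_eq option.inject)
      then show ?thesis unfolding 1 using None e by (simp add: tr_def dom_def)
    next
      case (Some l)
      have l: "l \<in> carrier G" using arr_carrier[OF C z' Some] .
      have "arr (bmul B C) (\<alpha> h y) = Some (k \<otimes> l)" using a Some \<open>arr B _ = Some k\<close> by blast
      then have "tr (bmul B C) f (h, y) = f (inv (k \<otimes> l) \<otimes> h, y)"
        using h y by (simp add: tr_def dom_def shift_def)
      moreover have "tr C f (inv k \<otimes> h, y) = f (inv l \<otimes> (inv k \<otimes> h), y)"
        using h y k Some e by (simp add: tr_def dom_def shift_def)
      ultimately show ?thesis unfolding 1 using h k l by (simp add: inv_mult_group m_assoc)
    qed
  qed
qed

lemma s_op_mult: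
  assumes B: "bis B" and C: "bis C"
  shows "compose H (s_op B) (s_op C) = s_op (bmul B C)"
proof (rule op_eqI)
  fix f assume f: "f \<in> L2"
  have "compose H (s_op B) (s_op C) (cls f) = cls (tr B (tr C f))"
    using class_in_H[OF f] by (simp add: compose_def s_op_class B C f tr_L2)
  also have "\<dots> = cls (tr (bmul B C) f)" by (intro class_cong_space tr_tr B C)
  also have "\<dots> = s_op (bmul B C) (cls f)" by (simp add: s_op_class bis_bmul B C f)
  finally show "compose H (s_op B) (s_op C) (cls f) = s_op (bmul B C) (cls f)" .
qed (auto simp: s_op_extensional compose_def)

lemma bis_bone: "bis bone" by (intro bis_rect) auto

lemma arr_bone: "z \<in> space M \<Longrightarrow> arr bone z = Some \<one>"
  by (subst arr_Some[OF bis_bone]) (auto simp: rect_def)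

lemma op_one_eq: "op_one \<G> = s_op bone"
proof (rule op_eqI)
  fix f assume f: "f \<in> L2"
  have "cls (tr bone f) = cls f"
    by (intro class_cong_space) (simp add: tr_def dom_def shift_def arr_bone)
  then show "op_one \<G> (cls f) = s_op bone (cls f)"
    using class_in_H[OF f] by (simp add: op_one_def s_op_class bis_bone f)
qed (auto simp: s_op_extensional op_one_def)

definition bprod :: "('g \<times> 'x) set list \<Rightarrow> ('g \<times> 'x) set" where
  "bprod Bs = foldr bmul Bs bone"

lemma bis_bprod: "set Bs \<subseteq> Collect bis \<Longrightarrow> bis (bprod Bs)"
  by (induction Bs) (auto simp: bprod_def bis_bone bis_bmul)

lemma op_prod_s_op: "set Bs \<subseteq> Collect bis \<Longrightarrow> op_prod \<G> (map s_op Bs) = s_op (bprod Bs)"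
proof (induction Bs)
  case Nil
  show ?case by (simp add: op_prod_def bprod_def op_one_eq)
next
  case (Cons B Bs)
  then have "op_prod \<G> (map s_op (B # Bs)) = compose H (s_op B) (s_op (bprod Bs))"
    by (simp add: op_prod_def)
  also have "\<dots> = s_op (bprod (B # Bs))"
    using Cons.prems by (subst s_op_mult) (auto simp: bis_bprod bprod_def intro: bis_bprod[unfolded bprod_def])
  finally show ?case .
qed

text \<open>Substitution along the measure-preserving bijection \<open>shift B\<close>.\<close>

lemma integral_tr_adjoint:
  assumes B: "bis B" and f: "f \<in> L2" and g: "g \<in> L2"
  shows "(LINT p|\<A>. tr B f p * cnj (g p)) = (LINT p|\<A>. f p * cnj (tr (binv B) g p))"
proof -
  let ?D = "dom B" and ?E = "dom (binv B)"
  let ?N = "restrict_space \<A> ?D" and ?K = "restrict_space \<A> ?E"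
  have D: "?D \<in> sets \<A>" and E: "?E \<in> sets \<A>" using dom_sets bis_binv B by auto
  have Ds: "?D \<inter> space \<A> \<in> sets \<A>" "?E \<inter> space \<A> \<in> sets \<A>" using D E by auto
  have sm: "shift B \<in> ?N \<rightarrow>\<^sub>M ?K"
    by (rule measurable_restrict_space3[OF shift_measurable[OF B]]) (use shift_binv[OF B] in auto)
  have distr: "distr ?N ?K (shift B) = ?K"
  proof (rule measure_eqI)
    fix A assume "A \<in> sets (distr ?N ?K (shift B))"
    then have A: "A \<in> sets ?K" by simp
    then have A': "A \<in> sets \<A>" "A \<subseteq> ?E" using sets_restrict_space_iff[OF Ds(2)] by auto
    have S: "shift B -` A \<inter> space ?N \<in> sets \<A>" "shift B -` A \<inter> space ?N \<subseteq> ?D"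
      using measurable_sets[OF sm A] sets_restrict_space_iff[OF Ds(1)] by auto
    have spN: "space ?N = ?D" using sets.sets_into_space[OF D] by (auto simp: space_restrict_space)
    have "emeasure (distr ?N ?K (shift B)) A = emeasure \<A> (shift B -` A \<inter> space ?N)"
      by (simp add: emeasure_distr[OF sm A] emeasure_restrict_space[OF Ds(1) S(2)])
    also have "\<dots> = (\<integral>\<^sup>+ p. indicator (shift B -` A \<inter> space ?N) p \<partial>\<A>)"
      by (rule nn_integral_indicator[symmetric, OF S(1)])
    also have "\<dots> = (\<integral>\<^sup>+ p. indicator A (shift B p) * indicator ?D p \<partial>\<A>)"
      by (intro nn_integral_cong) (auto simp: indicator_def spN)
    also have "\<dots> = (\<integral>\<^sup>+ p. indicator A p * indicator ?E p \<partial>\<A>)"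
      by (rule nn_integral_shift[OF B]) (use A' in simp)
    also have "\<dots> = (\<integral>\<^sup>+ p. indicator A p \<partial>\<A>)"
      using A' by (intro nn_integral_cong) (auto simp: indicator_def)
    also have "\<dots> = emeasure \<A> A" using A' by simp
    also have "\<dots> = emeasure ?K A" by (rule emeasure_restrict_space[OF Ds(2) A'(2), symmetric])
    finally show "emeasure (distr ?N ?K (shift B)) A = emeasure ?K A" .
  qed simp
  let ?F = "\<lambda>q. f q * cnj (g (shift (binv B) q))"
  have Fm: "?F \<in> borel_measurable \<A>"
    using L2_measurable[OF f] measurable_compose[OF shift_measurable[OF bis_binv[OF B]] L2_measurable[OF g]]
    by measurable
  have "(LINT p|\<A>. tr B f p * cnj (g p)) = (LINT p|\<A>. indicator ?D p *\<^sub>R ?F (shift B p))"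
    by (intro Bochner_Integration.integral_cong) (auto simp: tr_def indicator_def shift_binv[OF B])
  also have "\<dots> = (LINT p|?N. ?F (shift B p))" by (rule integral_restrict_space[OF Ds(1), symmetric])
  also have "\<dots> = (LINT q|distr ?N ?K (shift B). ?F q)"
    by (rule integral_distr[OF sm, symmetric]) (rule measurable_restrict_space1[OF Fm])
  also have "\<dots> = (LINT q|?K. ?F q)" unfolding distr ..
  also have "\<dots> = (LINT q|\<A>. indicator ?E q *\<^sub>R ?F q)" by (rule integral_restrict_space[OF Ds(2)])
  also have "\<dots> = (LINT p|\<A>. f p * cnj (tr (binv B) g p))"
    by (intro Bochner_Integration.integral_cong) (auto simp: tr_def indicator_def)
  finally show ?thesis .
qed

lemma op_adjoint_s_op:
  assumes B: "bis B"
  shows "op_adjoint \<G> (s_op B) = s_op (binv B)"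
  unfolding op_adjoint_def
proof (rule the_equality)
  have adj: "l2_inner \<G> (s_op B \<xi>) \<eta> = l2_inner \<G> \<xi> (s_op (binv B) \<eta>)" if "\<xi> \<in> H" "\<eta> \<in> H" for \<xi> \<eta>
  proof -
    obtain f g where fg: "f \<in> L2" "g \<in> L2" "\<xi> = cls f" "\<eta> = cls g"
      using \<open>\<xi> \<in> H\<close> \<open>\<eta> \<in> H\<close> by (auto simp: l2_space_def)
    show ?thesis
      by (simp add: fg s_op_class B bis_binv inner_class tr_L2 integral_tr_adjoint)
  qed
  show "s_op (binv B) \<in> H \<rightarrow>\<^sub>E H \<and> (\<forall>\<xi>\<in>H. \<forall>\<eta>\<in>H. l2_inner \<G> (s_op B \<xi>) \<eta> = l2_inner \<G> \<xi> (s_op (binv B) \<eta>))"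
    using adj s_op_H[OF bis_binv[OF B]] s_op_extensional by (auto simp: PiE_def)
  fix b assume b: "b \<in> H \<rightarrow>\<^sub>E H \<and> (\<forall>\<xi>\<in>H. \<forall>\<eta>\<in>H. l2_inner \<G> (s_op B \<xi>) \<eta> = l2_inner \<G> \<xi> (b \<eta>))"
  show "b = s_op (binv B)"
  proof (rule op_eqI)
    show "b \<in> extensional H" using b by (simp add: PiE_def)
    fix f assume "f \<in> L2"
    then have f: "cls f \<in> H" by (rule class_in_H)
    show "b (cls f) = s_op (binv B) (cls f)"
      using b f adj s_op_H[OF bis_binv[OF B] f] by (intro H_eq_if_inner_eq) (auto simp: PiE_def)
  qed (rule s_op_extensional)
qed

lemma indicator_L2:
  assumes "E \<in> sets \<A>" "emeasure \<A> E < \<infinity>"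
  shows "(indicator E :: _ \<Rightarrow> complex) \<in> L2"
proof -
  have "(\<integral>\<^sup>+ p. ennreal ((cmod (indicator E p))\<^sup>2) \<partial>\<A>) = (\<integral>\<^sup>+ p. indicator E p \<partial>\<A>)"
    by (intro nn_integral_cong) (auto simp: indicator_def)
  also have "\<dots> = emeasure \<A> E" by (rule nn_integral_indicator[OF assms(1)])
  finally show ?thesis using assms by (simp add: L2_iff_nn)
qed

lemma rect_sets: "g \<in> carrier G \<Longrightarrow> Q \<in> sets M \<Longrightarrow> rect g Q \<in> sets \<A>"
  unfolding rect_def by (intro pair_measureI) auto

lemma emeasure_rect:
  assumes "g \<in> carrier G" "Q \<in> sets M"
  shows "emeasure \<A> (rect g Q) = emeasure M Q"
proof -
  have "emeasure \<A> ({g} \<times> Q) = emeasure (count_space (carrier G)) {g} * emeasure M Q"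
    by (rule M.emeasure_pair_measure_Times) (use assms in auto)
  then show ?thesis using assms by (simp add: rect_def)
qed

lemma rect_L2: "g \<in> carrier G \<Longrightarrow> Q \<in> sets M \<Longrightarrow> (indicator (rect g Q) :: _ \<Rightarrow> complex) \<in> L2"
  by (intro indicator_L2 rect_sets) (auto simp: emeasure_rect M.emeasure_eq_measure)

abbreviation vac :: "('g \<times> 'x \<Rightarrow> complex) set" where "vac \<equiv> cls (indicator bone)"

lemma vac_L2: "(indicator bone :: _ \<Rightarrow> complex) \<in> L2"
  by (intro rect_L2) auto

lemma tr_indicator_bone:
  assumes B: "bis B" and h: "h \<in> carrier G" and y: "y \<in> space M"
  shows "tr B (indicator bone) (h, y) = (indicator B (h, y) :: complex)"
proof -
  have z: "\<alpha> h y \<in> space M" using h y by simp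
  have "(h, y) \<in> B \<longleftrightarrow> arr B (\<alpha> h y) = Some h" unfolding arr_Some[OF B z] using h y by simp
  moreover have "inv k \<otimes> h = \<one> \<longleftrightarrow> k = h" if "k \<in> carrier G" for k
    using that h by (metis inv_solve_left' one_closed r_one)
  ultimately show ?thesis
    using arr_carrier[OF B z] h y
    by (cases "arr B (\<alpha> h y)") (auto simp: tr_def dom_def shift_def rect_def indicator_def)
qed

text \<open>The isometry of \<open>B\<close> maps the trace vector to the indicator of \<open>B\<close>, so pairing with indicators of
  rectangles reveals the slices of \<open>B\<close>. The trace is the case of the unit rectangle.\<close>

lemma inner_s_op_rect:
  assumes B: "bis B" and g: "g \<in> carrier G" and Q: "Q \<in> sets M"
  shows "l2_inner \<G> (s_op B vac) (cls (indicator (rect g Q))) = complex_of_real (measure M (slice B g \<inter> Q))"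
proof -
  have S: "slice B g \<inter> Q \<in> sets M" using bisD(3)[OF B g] Q by auto
  have "l2_inner \<G> (s_op B vac) (cls (indicator (rect g Q))) =
     (LINT p|\<A>. tr B (indicator bone) p * cnj (indicator (rect g Q) p))"
    by (simp add: s_op_class B vac_L2 inner_class tr_L2 rect_L2 g Q)
  also have "\<dots> = (LINT p|\<A>. indicator (rect g (slice B g \<inter> Q)) p)"
  proof (rule Bochner_Integration.integral_cong)
    fix p assume "p \<in> space \<A>"
    then obtain h y where p: "p = (h, y)" "h \<in> carrier G" "y \<in> space M" by (auto simp: space_arrow)
    show "tr B (indicator bone) p * cnj (indicator (rect g Q) p) = indicator (rect g (slice B g \<inter> Q)) p"
      unfolding p(1) tr_indicator_bone[OF B p(2,3)] using p by (auto simp: indicator_def rect_def)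
  qed simp
  also have "\<dots> = (LINT p|\<A>. complex_of_real (indicator (rect g (slice B g \<inter> Q)) p))"
    by (intro Bochner_Integration.integral_cong) (auto simp: indicator_def)
  also have "\<dots> = complex_of_real (measure \<A> (rect g (slice B g \<inter> Q) \<inter> space \<A>))"
    by (simp only: integral_complex_of_real Bochner_Integration.integral_indicator)
  also have "rect g (slice B g \<inter> Q) \<inter> space \<A> = rect g (slice B g \<inter> Q)"
    using sets.sets_into_space[OF rect_sets[OF g S]] by blast
  also have "measure \<A> (rect g (slice B g \<inter> Q)) = measure M (slice B g \<inter> Q)"
    using emeasure_rect[OF g S] by (simp add: measure_def)
  finally show ?thesis .
qed

lemma op_trace_s_op: assumes "bis B" shows "op_trace \<G> (s_op B) = complex_of_real (measure M (slice B \<one>))"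
proof -
  have "slice B \<one> \<inter> space M = slice B \<one>" by auto
  moreover have "space (unit_space \<G>) = bone" by (simp add: space_units rect_def)
  ultimately show ?thesis
    using inner_s_op_rect[OF assms one_closed sets.top] by (simp only: op_trace_def Let_def)
qed

lemma op_zero_eq: "op_zero \<G> = s_op {}"
proof (rule op_eqI)
  fix f assume f: "f \<in> L2"
  have "arr {} z = None" for z by (simp add: arr_def)
  then have "tr {} f = (\<lambda>_. 0)" by (auto simp: tr_def dom_def)
  then show "op_zero \<G> (cls f) = s_op {} (cls f)"
    using class_in_H[OF f] by (simp add: op_zero_def s_op_class bis_empty f)
qed (auto simp: s_op_extensional op_zero_def)

lemma op_add_s_op:
  assumes B: "bis B" and C: "bis C" and BC: "bis (B \<union> C)" and disj: "B \<inter> C = {}"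
  shows "op_add \<G> (s_op B) (s_op C) = s_op (B \<union> C)"
proof (rule op_eqI)
  fix f assume f: "f \<in> L2"
  have "op_add \<G> (s_op B) (s_op C) (cls f) = cls (\<lambda>p. tr B f p + tr C f p)"
    using class_in_H[OF f] by (simp add: op_add_def s_op_class B C f add_class tr_L2)
  also have "\<dots> = cls (tr (B \<union> C) f)"
  proof (rule class_cong_space)
    fix h y assume h: "h \<in> carrier G" and y: "y \<in> space M"
    then have z: "\<alpha> h y \<in> space M" by simp
    have U: "arr (B \<union> C) (\<alpha> h y) = Some k \<longleftrightarrow> arr B (\<alpha> h y) = Some k \<or> arr C (\<alpha> h y) = Some k" for k
      using z by (simp add: arr_Some B C BC)
    have X: "arr B (\<alpha> h y) = Some k \<Longrightarrow> arr C (\<alpha> h y) = Some l \<Longrightarrow> False" for k l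
      using U[of k] U[of l] disj z by (auto simp: arr_Some B C)
    show "tr B f (h, y) + tr C f (h, y) = tr (B \<union> C) f (h, y)"
    proof (cases "arr B (\<alpha> h y)")
      case (Some k)
      then have "arr C (\<alpha> h y) = None" "arr (B \<union> C) (\<alpha> h y) = Some k" using X U by (auto) (metis not_None_eq)
      then show ?thesis using Some by (simp add: tr_def dom_def shift_def)
    next
      case None
      then have "arr (B \<union> C) (\<alpha> h y) = arr C (\<alpha> h y)" using U by (metis not_None_eq)
      then show ?thesis using None
        by (cases "arr C (\<alpha> h y)") (simp_all add: tr_def dom_def shift_def)
    qed
  qed
  also have "\<dots> = s_op (B \<union> C) (cls f)" by (simp add: s_op_class BC f)
  finally show "op_add \<G> (s_op B) (s_op C) (cls f) = s_op (B \<union> C) (cls f)" .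
qed (auto simp: s_op_extensional op_add_def)

abbreviation ispan :: "('g \<times> 'x) l2_op set" where "ispan \<equiv> op_span \<G> (inv_semigroup \<G>)"

lemma inv_semigroup_eq: "inv_semigroup \<G> = s_op ` Collect bis"
  by (simp add: inv_semigroup_def bisections_eq)

lemma s_op_span: "bis B \<Longrightarrow> s_op B \<in> ispan"
  by (intro op_span.base) (auto simp: inv_semigroup_eq)

lemma add_in_H: assumes "\<xi> \<in> H" "\<eta> \<in> H" shows "l2_add \<G> \<xi> \<eta> \<in> H"
  unfolding l2_add_def by (intro class_in_H L2_add H_rep assms)

lemma scale_in_H: assumes "\<xi> \<in> H" shows "l2_scale \<G> c \<xi> \<in> H"
  unfolding l2_scale_def by (intro class_in_H L2_scale H_rep assms)

lemma span_vac: "a \<in> ispan \<Longrightarrow> a vac \<in> H"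
proof (induction rule: op_span.induct)
  case zero
  show ?case unfolding op_zero_eq by (rule s_op_H[OF bis_empty class_in_H[OF vac_L2]])
next
  case (base a)
  then show ?case using s_op_H class_in_H[OF vac_L2] by (auto simp: inv_semigroup_eq)
next
  case (add a b)
  then show ?case using class_in_H[OF vac_L2] by (simp add: op_add_def add_in_H)
next
  case (scale a c)
  then show ?case using class_in_H[OF vac_L2] by (simp add: op_scale_def scale_in_H)
qed

text \<open>The mean over \<open>Q\<close> of the coefficient of \<open>a\<close> at the group element \<open>g\<close>. As it is defined by an inner
  product, it is linear in \<open>a\<close> without any choice of a basis of the span.\<close>

definition avg :: "'g \<Rightarrow> 'x set \<Rightarrow> ('g \<times> 'x) l2_op \<Rightarrow> complex" where
  "avg g Q a = l2_inner \<G> (a vac) (cls (indicator (rect g Q))) / complex_of_real (measure M Q)"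

lemma avg_s_op:
  "bis B \<Longrightarrow> g \<in> carrier G \<Longrightarrow> Q \<in> sets M \<Longrightarrow>
    avg g Q (s_op B) = complex_of_real (measure M (slice B g \<inter> Q) / measure M Q)"
  by (simp add: avg_def inner_s_op_rect)

lemma avg_add:
  assumes g: "g \<in> carrier G" and Q: "Q \<in> sets M" and a: "a \<in> ispan" and b: "b \<in> ispan"
  shows "avg g Q (op_add \<G> a b) = avg g Q a + avg g Q b"
proof -
  obtain u v where uv: "u \<in> L2" "v \<in> L2" "a vac = cls u" "b vac = cls v"
    using span_vac[OF a] span_vac[OF b] by (auto simp: l2_space_def)
  have "op_add \<G> a b vac = cls (\<lambda>p. u p + v p)"
    using class_in_H[OF vac_L2] uv by (simp add: op_add_def add_class)
  then show ?thesis
    unfolding avg_def using uv g Q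
    by (simp add: inner_class L2_add rect_L2 distrib_right add_divide_distrib
        Bochner_Integration.integral_add L2_product_integrable)
qed

lemma avg_scale:
  assumes g: "g \<in> carrier G" and Q: "Q \<in> sets M" and a: "a \<in> ispan"
  shows "avg g Q (op_scale \<G> c a) = c * avg g Q a"
proof -
  obtain u where u: "u \<in> L2" "a vac = cls u"
    using span_vac[OF a] by (auto simp: l2_space_def)
  have "op_scale \<G> c a vac = cls (\<lambda>p. c * u p)"
    using class_in_H[OF vac_L2] u by (simp add: op_scale_def scale_class)
  then show ?thesis
    unfolding avg_def using u g Q
    by (simp add: inner_class L2_scale rect_L2 mult.assoc)
qed

lemma SA_iff:
  assumes \<B>: "\<B> \<subseteq> Collect bis"
  shows "\<phi> \<in> SA \<G> (s_op ` \<B>) n \<delta> d \<longleftrightarrow> \<phi> \<in> linear_maps \<G> d \<and>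
    (\<forall>Bs. 1 \<le> length Bs \<longrightarrow> length Bs \<le> n \<longrightarrow> set Bs \<subseteq> \<B> \<union> binv ` \<B> \<longrightarrow>
       mat_norm2 (\<phi> (s_op (bprod Bs)) - foldr (*) (map (\<lambda>B. \<phi> (s_op B)) Bs) (1\<^sub>m d)) < \<delta> \<and>
       \<phi> (s_op (bprod Bs)) \<in> partial_perm_mats d \<and>
       cmod (mat_ntr (\<phi> (s_op (bprod Bs))) - complex_of_real (measure M (slice (bprod Bs) \<one>))) < \<delta>)"
    (is "?L \<longleftrightarrow> _ \<and> (\<forall>Bs. _ \<longrightarrow> _ \<longrightarrow> set Bs \<subseteq> ?\<B> \<longrightarrow> ?C Bs)")
proof -
  have B': "?\<B> \<subseteq> Collect bis" using \<B> bis_binv by auto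
  have "op_adjoint \<G> ` s_op ` \<B> = s_op ` binv ` \<B>"
    unfolding image_image by (rule image_cong[OF refl]) (use \<B> op_adjoint_s_op in blast)
  then have F': "s_op ` \<B> \<union> op_adjoint \<G> ` s_op ` \<B> = s_op ` ?\<B>"
    by (simp only: image_Un)
  have all: "(\<forall>ss. 1 \<le> length ss \<and> length ss \<le> n \<and> set ss \<subseteq> s_op ` ?\<B> \<longrightarrow> R ss) \<longleftrightarrow>
     (\<forall>Bs. 1 \<le> length Bs \<and> length Bs \<le> n \<and> set Bs \<subseteq> ?\<B> \<longrightarrow> R (map s_op Bs))" for R
  proof -
    have ex: "\<exists>Bs. set Bs \<subseteq> ?\<B> \<and> ss = map s_op Bs" if "set ss \<subseteq> s_op ` ?\<B>" for ss
    proof (intro exI[of _ "map (inv_into ?\<B> s_op) ss"] conjI)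
      show "set (map (inv_into ?\<B> s_op) ss) \<subseteq> ?\<B>"
        using that inv_into_into[of _ s_op ?\<B>] by (simp only: set_map) blast
      have "s_op (inv_into ?\<B> s_op x) = x" if "x \<in> set ss" for x
        using \<open>set ss \<subseteq> s_op ` ?\<B>\<close> that f_inv_into_f[of x s_op ?\<B>] by blast
      then show "ss = map s_op (map (inv_into ?\<B> s_op) ss)" by (simp add: map_idI)
    qed
    show ?thesis
    proof (intro iffI allI impI)
      fix Bs assume *: "\<forall>ss. 1 \<le> length ss \<and> length ss \<le> n \<and> set ss \<subseteq> s_op ` ?\<B> \<longrightarrow> R ss"
        and Bs: "1 \<le> length Bs \<and> length Bs \<le> n \<and> set Bs \<subseteq> ?\<B>"
      have "set (map s_op Bs) \<subseteq> s_op ` ?\<B>" using Bs by (simp only: set_map) blast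
      then show "R (map s_op Bs)" using * Bs by (simp only: length_map)
    next
      fix ss assume *: "\<forall>Bs. 1 \<le> length Bs \<and> length Bs \<le> n \<and> set Bs \<subseteq> ?\<B> \<longrightarrow> R (map s_op Bs)"
        and ss: "1 \<le> length ss \<and> length ss \<le> n \<and> set ss \<subseteq> s_op ` ?\<B>"
      obtain Bs where Bs: "set Bs \<subseteq> ?\<B>" "ss = map s_op Bs" using ex ss by blast
      then have "1 \<le> length Bs \<and> length Bs \<le> n" using ss by (simp only: length_map)
      then show "R ss" using * Bs by simp
    qed
  qed
  have pw: "op_powers_upto \<G> (s_op ` ?\<B>) n = {op_prod \<G> ss |ss. 1 \<le> length ss \<and> length ss \<le> n \<and> set ss \<subseteq> s_op ` ?\<B>}"
    by (simp add: op_powers_upto_def)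
  have prd: "op_prod \<G> (map s_op Bs) = s_op (bprod Bs)" "bis (bprod Bs)" if "set Bs \<subseteq> ?\<B>" for Bs
    using op_prod_s_op bis_bprod B' that by (meson order_trans)+
  have im: "(\<phi> ` op_powers_upto \<G> (s_op ` ?\<B>) n \<subseteq> X) \<longleftrightarrow>
     (\<forall>ss. 1 \<le> length ss \<and> length ss \<le> n \<and> set ss \<subseteq> s_op ` ?\<B> \<longrightarrow> \<phi> (op_prod \<G> ss) \<in> X)" for X
    unfolding pw by blast
  have ba: "(\<forall>s\<in>op_powers_upto \<G> (s_op ` ?\<B>) n. R s) \<longleftrightarrow>
     (\<forall>ss. 1 \<le> length ss \<and> length ss \<le> n \<and> set ss \<subseteq> s_op ` ?\<B> \<longrightarrow> R (op_prod \<G> ss))" for R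
    unfolding pw by blast
  have "?L \<longleftrightarrow> \<phi> \<in> linear_maps \<G> d \<and>
    (\<forall>Bs. 1 \<le> length Bs \<and> length Bs \<le> n \<and> set Bs \<subseteq> ?\<B> \<longrightarrow>
       mat_norm2 (\<phi> (op_prod \<G> (map s_op Bs)) - foldr (*) (map \<phi> (map s_op Bs)) (1\<^sub>m d)) < \<delta>) \<and>
    (\<forall>Bs. 1 \<le> length Bs \<and> length Bs \<le> n \<and> set Bs \<subseteq> ?\<B> \<longrightarrow> \<phi> (op_prod \<G> (map s_op Bs)) \<in> partial_perm_mats d) \<and>
    (\<forall>Bs. 1 \<le> length Bs \<and> length Bs \<le> n \<and> set Bs \<subseteq> ?\<B> \<longrightarrow>
       cmod (mat_ntr (\<phi> (op_prod \<G> (map s_op Bs))) - op_trace \<G> (op_prod \<G> (map s_op Bs))) < \<delta>)"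
    unfolding SA_def Let_def F' im ba all mem_Collect_eq ..
  also have "\<dots> \<longleftrightarrow> \<phi> \<in> linear_maps \<G> d \<and>
    (\<forall>Bs. 1 \<le> length Bs \<longrightarrow> length Bs \<le> n \<longrightarrow> set Bs \<subseteq> ?\<B> \<longrightarrow> ?C Bs)"
    using prd op_trace_s_op by (simp add: o_def) blast
  finally show ?thesis .
qed

end

section \<open>Partial permutation matrices\<close>

text \<open>The 0/1 matrix of a partial function: column \<open>i\<close> has its entry in row \<open>f i\<close>. For partial
  permutation matrices \<open>colf\<close> below is the inverse operation.\<close>

definition pmat :: "nat \<Rightarrow> (nat \<Rightarrow> nat option) \<Rightarrow> complex mat" where
  "pmat d f = mat d d (\<lambda>(j, i). if f i = Some j then 1 else 0)"

definition pfun :: "nat \<Rightarrow> (nat \<Rightarrow> nat option) \<Rightarrow> bool" where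
  "pfun d f \<longleftrightarrow> (\<forall>i<d. \<forall>j. f i = Some j \<longrightarrow> j < d)"

definition pinj :: "nat \<Rightarrow> (nat \<Rightarrow> nat option) \<Rightarrow> bool" where
  "pinj d f \<longleftrightarrow> (\<forall>i<d. \<forall>k<d. \<forall>j. f i = Some j \<longrightarrow> f k = Some j \<longrightarrow> i = k)"

lemma pmat_carrier [simp]: "pmat d f \<in> carrier_mat d d" by (simp add: pmat_def)

lemma pmat_dim [simp]: "dim_row (pmat d f) = d" "dim_col (pmat d f) = d" by (simp_all add: pmat_def)

lemma pmat_index [simp]: "j < d \<Longrightarrow> i < d \<Longrightarrow> pmat d f $$ (j, i) = (if f i = Some j then 1 else 0)"
  by (simp add: pmat_def)

lemma mat_adjoint_index:
  assumes "i < dim_col A" "j < dim_row A"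
  shows "mat_adjoint (A :: complex mat) $$ (i, j) = cnj (A $$ (j, i))"
  using assms by (simp add: mat_adjoint_def mat_of_rows_index)

lemma mat_adjoint_dims: "dim_row (mat_adjoint (A :: complex mat)) = dim_col A" "dim_col (mat_adjoint A) = dim_row A"
  by (simp_all add: mat_adjoint_def)

lemma mat_norm2_eq:
  assumes A: "A \<in> carrier_mat d d"
  shows "mat_norm2 A = sqrt ((\<Sum>i<d. \<Sum>j<d. (cmod (A $$ (j, i)))\<^sup>2) / real d)"
proof -
  have dims: "dim_row A = d" "dim_col A = d" using A by auto
  have e: "(mat_adjoint A * A) $$ (i, i) = complex_of_real (\<Sum>j<d. (cmod (A $$ (j, i)))\<^sup>2)" if i: "i < d" for i
  proof -
    have "(mat_adjoint A * A) $$ (i, i) = (\<Sum>j<d. mat_adjoint A $$ (i, j) * A $$ (j, i))"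
      using i by (simp add: scalar_prod_def mat_adjoint_dims dims atLeast0LessThan)
    also have "\<dots> = (\<Sum>j<d. complex_of_real ((cmod (A $$ (j, i)))\<^sup>2))"
      using i by (intro sum.cong refl)
        (simp add: mat_adjoint_index dims complex_norm_square mult.commute del: of_real_power)
    finally show ?thesis by simp
  qed
  have "mat_ntr (mat_adjoint A * A) = (\<Sum>i<d. complex_of_real (\<Sum>j<d. (cmod (A $$ (j, i)))\<^sup>2)) / of_nat d"
  proof -
    have "(\<Sum>i<d. (mat_adjoint A * A) $$ (i, i)) = (\<Sum>i<d. complex_of_real (\<Sum>j<d. (cmod (A $$ (j, i)))\<^sup>2))"
      by (intro sum.cong refl e) simp
    moreover have "dim_row (mat_adjoint A * A) = d" by (simp add: mat_adjoint_dims dims)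
    ultimately show ?thesis unfolding mat_ntr_def by (simp only:)
  qed
  also have "\<dots> = complex_of_real ((\<Sum>i<d. \<Sum>j<d. (cmod (A $$ (j, i)))\<^sup>2) / real d)" by simp
  finally show ?thesis unfolding mat_norm2_def by simp
qed

text \<open>A column in which the two functions differ contributes 1 or 2 to the squared distance. So the
  normalised 2-norm and the proportion of differing columns control each other.\<close>

lemma pmat_diff_norm:
  assumes f: "pfun d f" and g: "pfun d g" and d: "d > 0"
  shows "real (card {i. i < d \<and> f i \<noteq> g i}) \<le> (mat_norm2 (pmat d f - pmat d g))\<^sup>2 * real d"
    "(mat_norm2 (pmat d f - pmat d g))\<^sup>2 * real d \<le> 2 * real (card {i. i < d \<and> f i \<noteq> g i})"
proof -
  let ?e = "\<lambda>i j. (cmod ((pmat d f - pmat d g) $$ (j, i)))\<^sup>2"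
  have e: "?e i j = (if (f i = Some j) = (g i = Some j) then 0 else 1)" if "i < d" "j < d" for i j
    using that by simp
  have eq: "(mat_norm2 (pmat d f - pmat d g))\<^sup>2 * real d = (\<Sum>i<d. \<Sum>j<d. ?e i j)"
    using d by (subst mat_norm2_eq[of _ d]) (auto simp: sum_nonneg minus_carrier_mat)
  have lo: "(if f i \<noteq> g i then 1 else 0) \<le> (\<Sum>j<d. ?e i j)" if i: "i < d" for i
  proof (cases "f i = g i")
    case False
    then obtain j where j: "(f i = Some j) \<noteq> (g i = Some j)" by (metis not_None_eq)
    then have "j < d" using f g i unfolding pfun_def by metis
    then have "?e i j \<le> (\<Sum>j<d. ?e i j)" by (intro member_le_sum) auto
    then show ?thesis using e[OF i \<open>j < d\<close>] j False by simp
  qed (simp add: sum_nonneg)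
  have hi: "(\<Sum>j<d. ?e i j) \<le> (if f i \<noteq> g i then 2 else 0)" if i: "i < d" for i
  proof -
    have c: "(\<Sum>j<d. if h = Some j then 1 else 0) \<le> (1 :: real)" for h
      by (cases h) auto
    have "(\<Sum>j<d. ?e i j) \<le> (\<Sum>j<d. (if f i = Some j then 1 else 0) + (if g i = Some j then 1 else 0))"
      by (intro sum_mono) (use e[OF i] in auto)
    also have "\<dots> \<le> 2" unfolding sum.distrib using c[of "f i"] c[of "g i"] by linarith
    moreover have "(\<Sum>j<d. ?e i j) = 0" if "f i = g i" using e[OF i] that by simp
    ultimately show ?thesis by auto
  qed
  have card: "(\<Sum>i<d. if f i \<noteq> g i then a else 0) = a * real (card {i. i < d \<and> f i \<noteq> g i})" for a :: real
  proof -
    have "(\<Sum>i<d. if f i \<noteq> g i then a else 0) = (\<Sum>i\<in>{i \<in> {..<d}. f i \<noteq> g i}. a)"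
      by (rule sum.inter_filter[symmetric]) simp
    then show ?thesis by (simp add: mult.commute)
  qed
  show "real (card {i. i < d \<and> f i \<noteq> g i}) \<le> (mat_norm2 (pmat d f - pmat d g))\<^sup>2 * real d"
    unfolding eq using card[of 1] sum_mono[of "{..<d}" "\<lambda>i. if f i \<noteq> g i then 1 else 0" "\<lambda>i. \<Sum>j<d. ?e i j"] lo
    by simp
  show "(mat_norm2 (pmat d f - pmat d g))\<^sup>2 * real d \<le> 2 * real (card {i. i < d \<and> f i \<noteq> g i})"
    unfolding eq card[of 2, symmetric] by (intro sum_mono hi) simp
qed

lemma pmat_trace: "mat_ntr (pmat d f) = complex_of_real (real (card {i. i < d \<and> f i = Some i}) / real d)"
proof -
  have "(\<Sum>i<d. pmat d f $$ (i, i)) = (\<Sum>i<d. if f i = Some i then 1 else 0)"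
    by (intro sum.cong) auto
  also have "\<dots> = (\<Sum>i\<in>{i \<in> {..<d}. f i = Some i}. 1)" by (rule sum.inter_filter[symmetric]) simp
  finally show ?thesis by (simp add: mat_ntr_def)
qed

lemma pmat_mult:
  assumes g: "pfun d g"
  shows "pmat d f * pmat d g = pmat d (\<lambda>i. Option.bind (g i) f)"
proof (rule eq_matI)
  fix j i assume "j < dim_row (pmat d (\<lambda>i. Option.bind (g i) f))" "i < dim_col (pmat d (\<lambda>i. Option.bind (g i) f))"
  then have ij: "j < d" "i < d" by auto
  have "(pmat d f * pmat d g) $$ (j, i) = (\<Sum>k<d. (if f k = Some j then 1 else 0) * (if g i = Some k then 1 else 0))"
    using ij by (simp add: scalar_prod_def atLeast0LessThan)
  also have "\<dots> = (if Option.bind (g i) f = Some j then 1 else 0)"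
  proof (cases "g i")
    case (Some k)
    then have "k < d" using g ij unfolding pfun_def by blast
    have "(\<Sum>l<d. (if f l = Some j then 1 else 0) * (if g i = Some l then 1 else 0 :: complex)) =
       (\<Sum>l<d. if l = k then (if f k = Some j then 1 else 0) else 0)"
      by (intro sum.cong) (auto simp: Some)
    then show ?thesis using Some \<open>k < d\<close> by simp
  qed simp
  finally show "(pmat d f * pmat d g) $$ (j, i) = pmat d (\<lambda>i. Option.bind (g i) f) $$ (j, i)"
    using ij by simp
qed auto

lemma pmat_one: "1\<^sub>m d = pmat d Some"
  by (rule eq_matI) auto

lemma pmat_partial_perm:
  assumes f: "pfun d f" and i: "pinj d f"
  shows "pmat d f \<in> partial_perm_mats d"
proof -
  define g where "g j = (if \<exists>i<d. f i = Some j then Some (THE i. i < d \<and> f i = Some j) else None)" for j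
  have g: "g j = Some k \<longleftrightarrow> k < d \<and> f k = Some j" for j k
  proof (cases "\<exists>i<d. f i = Some j")
    case True
    then obtain l where l: "l < d" "f l = Some j" by auto
    then have "(THE i. i < d \<and> f i = Some j) = l"
      using i unfolding pinj_def by (intro the_equality) blast+
    then have "g j = Some l" using True by (simp add: g_def)
    then show ?thesis using l i unfolding pinj_def by auto
  qed (auto simp: g_def)
  have pg: "pfun d g" unfolding pfun_def using g by blast
  have adj: "mat_adjoint (pmat d f) = pmat d g"
    by (rule eq_matI) (auto simp: mat_adjoint_index mat_adjoint_dims g)
  have "pmat d f * pmat d g * pmat d f = pmat d (\<lambda>i. Option.bind (f i) (\<lambda>j. Option.bind (g j) f))"
    by (simp add: pmat_mult[OF pg] pmat_mult[OF f])
  also have "\<dots> = pmat d f"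
  proof (rule eq_matI)
    fix j k assume "j < dim_row (pmat d f)" "k < dim_col (pmat d f)"
    then have jk: "j < d" "k < d" by auto
    have "Option.bind (f k) (\<lambda>j. Option.bind (g j) f) = f k"
    proof (cases "f k")
      case (Some l)
      then have "g l = Some k" using g jk by simp
      then show ?thesis using Some by simp
    qed simp
    then show "pmat d (\<lambda>i. Option.bind (f i) (\<lambda>j. Option.bind (g j) f)) $$ (j, k) = pmat d f $$ (j, k)"
      using jk by simp
  qed auto
  finally have "pmat d f * mat_adjoint (pmat d f) * pmat d f = pmat d f" unfolding adj .
  moreover have "pmat d f $$ (k, j) \<in> {0, 1}" if "k < d" "j < d" for k j using that by simp
  ultimately show ?thesis unfolding partial_perm_mats_def by simp
qed

definition colf :: "nat \<Rightarrow> complex mat \<Rightarrow> nat \<Rightarrow> nat option" where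
  "colf d A i = (if \<exists>j<d. A $$ (j, i) = 1 then Some (SOME j. j < d \<and> A $$ (j, i) = 1) else None)"

lemma partial_perm_unique:
  assumes A: "A \<in> partial_perm_mats d" and ij: "i < d" "j < d" "A $$ (i, j) = 1"
    and kl: "k < d" "l < d" "A $$ (k, l) = 1" and ik: "i = k \<or> j = l"
  shows "i = k \<and> j = l"
proof (rule ccontr)
  assume ne: "\<not> (i = k \<and> j = l)"
  have C: "A \<in> carrier_mat d d" and AAA: "A * mat_adjoint A * A = A"
    and E: "\<And>i j. i < d \<Longrightarrow> j < d \<Longrightarrow> A $$ (i, j) \<in> {0, 1}"
    using A unfolding partial_perm_mats_def by auto
  define a where "a i j = Re (A $$ (i, j))" for i j
  have a01: "a i j = 0 \<or> a i j = 1" if "i < d" "j < d" for i j using E[OF that] by (auto simp: a_def)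
  have Aa: "A $$ (i, j) = complex_of_real (a i j)" if "i < d" "j < d" for i j
    using E[OF that] by (auto simp: a_def)
  have dims: "dim_row A = d" "dim_col A = d" using C by auto
  have "(A * mat_adjoint A * A) $$ (i, j) = (\<Sum>m<d. (\<Sum>n<d. A $$ (i, n) * cnj (A $$ (m, n))) * A $$ (m, j))"
    using ij by (simp add: scalar_prod_def mat_adjoint_dims dims atLeast0LessThan mat_adjoint_index)
  also have "\<dots> = complex_of_real (\<Sum>m<d. \<Sum>n<d. a i n * a m n * a m j)"
    using ij by (simp add: Aa sum_distrib_right)
  finally have "1 = complex_of_real (\<Sum>m<d. \<Sum>n<d. a i n * a m n * a m j)" unfolding AAA ij(3) .
  from this[symmetric] have s: "(\<Sum>m<d. \<Sum>n<d. a i n * a m n * a m j) = 1"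
    by (simp only: of_real_eq_1_iff)
  have nn: "0 \<le> a i n * a m n * a m j" if "m < d" "n < d" for m n
    using a01[of i n] a01[of m n] a01[of m j] that ij by auto
  have le: "a i j * a i j * a i j + a i l * a k l * a k j \<le> (\<Sum>m<d. \<Sum>n<d. a i n * a m n * a m j)"
  proof -
    have "(\<Sum>(m, n)\<in>{(i, j), (k, l)}. a i n * a m n * a m j) \<le> (\<Sum>(m, n)\<in>{..<d} \<times> {..<d}. a i n * a m n * a m j)"
      by (rule sum_mono2) (use ij kl nn in auto)
    then show ?thesis using ne by (auto simp: sum.cartesian_product)
  qed
  have "a i j = 1" "a k l = 1" using ij kl by (auto simp: a_def)
  moreover have "a i l * a k l * a k j = 1" using ik calculation by auto
  ultimately show False using le s by simp
qed

lemma colf_pmat: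
  assumes A: "A \<in> partial_perm_mats d"
  shows "A = pmat d (colf d A)" "pfun d (colf d A)" "pinj d (colf d A)"
proof -
  have C: "A \<in> carrier_mat d d" and E: "\<And>i j. i < d \<Longrightarrow> j < d \<Longrightarrow> A $$ (i, j) \<in> {0, 1}"
    using A unfolding partial_perm_mats_def by auto
  have c: "colf d A i = Some j \<longleftrightarrow> j < d \<and> A $$ (j, i) = 1" if i: "i < d" for i j
  proof
    assume "colf d A i = Some j"
    then have ex: "\<exists>j<d. A $$ (j, i) = 1" and "j = (SOME j. j < d \<and> A $$ (j, i) = 1)"
      by (auto simp: colf_def split: if_splits)
    then show "j < d \<and> A $$ (j, i) = 1" using someI_ex[of "\<lambda>j. j < d \<and> A $$ (j, i) = 1"] by blast
  next
    assume j: "j < d \<and> A $$ (j, i) = 1"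
    have "(SOME j. j < d \<and> A $$ (j, i) = 1) = j"
      using partial_perm_unique[OF A _ i _ _ i] j by (intro some_equality) blast+
    then show "colf d A i = Some j" using j by (auto simp: colf_def)
  qed
  show "pfun d (colf d A)" unfolding pfun_def using c by blast
  show "pinj d (colf d A)" unfolding pinj_def using c partial_perm_unique[OF A] by metis
  show "A = pmat d (colf d A)"
    using C E by (intro eq_matI) (auto simp: c)
qed

lemma pmat_eq_iff:
  assumes "pfun d f" "pfun d g"
  shows "pmat d f = pmat d g \<longleftrightarrow> (\<forall>i<d. f i = g i)"
proof
  assume e: "pmat d f = pmat d g"
  show "\<forall>i<d. f i = g i"
  proof (intro allI impI)
    fix i assume i: "i < d"
    have "f i = Some j \<longleftrightarrow> g i = Some j" for j
    proof (cases "j < d")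
      case True
      have "(if f i = Some j then 1 else 0 :: complex) = (if g i = Some j then 1 else 0)"
        using arg_cong[OF e, of "\<lambda>A. A $$ (j, i)"] True i by simp
      then show ?thesis by (cases "f i = Some j"; cases "g i = Some j") simp_all
    next
      case False
      then show ?thesis using assms i unfolding pfun_def by blast
    qed
    then show "f i = g i" by (metis not_None_eq)
  qed
qed (auto intro!: eq_matI)

section \<open>Counting up to small Hamming distance\<close>

text \<open>The members of \<open>S\<close> related to the same \<open>t\<close> lie in a Hamming ball, and a member of the ball is
  determined by the set of coordinates at which it differs from the centre and by its values there.\<close>

lemma hamming_card:
  fixes S :: "('i \<Rightarrow> 'y) set"
  assumes I: "finite I" and Y: "finite Y" "Y \<noteq> {}" and S: "S \<subseteq> I \<rightarrow>\<^sub>E Y" and T: "finite T"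
    and ex: "\<And>s. s \<in> S \<Longrightarrow> \<exists>t\<in>T. R s t"
    and near: "\<And>s s' t. s \<in> S \<Longrightarrow> s' \<in> S \<Longrightarrow> R s t \<Longrightarrow> R s' t \<Longrightarrow> card {i\<in>I. s i \<noteq> s' i} \<le> m"
  shows "card S \<le> card T * (2 ^ card I * card Y ^ m)"
proof -
  have fin: "finite S" using S finite_PiE[OF I] Y(1) by (meson finite_subset)
  have fibre: "card {s\<in>S. R s t} \<le> 2 ^ card I * card Y ^ m" for t
  proof (cases "{s\<in>S. R s t} = {}")
    case True then show ?thesis by (simp only: card.empty le0)
  next
    case False
    then obtain s0 where s0: "s0 \<in> S" "R s0 t" by auto
    let ?D = "\<lambda>s. {i\<in>I. s i \<noteq> s0 i}"
    let ?X = "SIGMA D : {D. D \<subseteq> I \<and> card D \<le> m}. D \<rightarrow>\<^sub>E Y"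
    let ?F = "\<lambda>s. (?D s, restrict s (?D s))"
    have inj: "inj_on ?F {s\<in>S. R s t}"
    proof (rule inj_onI)
      fix s s' assume s: "s \<in> {s\<in>S. R s t}" "s' \<in> {s\<in>S. R s t}" and e: "?F s = ?F s'"
      have e1: "?D s = ?D s'" and e2: "restrict s (?D s) = restrict s' (?D s')" using e by auto
      show "s = s'"
      proof (rule extensionalityI[of _ I])
        fix i assume i: "i \<in> I"
        show "s i = s' i"
        proof (cases "i \<in> ?D s")
          case True
          then show ?thesis using fun_cong[OF e2, of i] e1 by (auto simp: restrict_def split: if_splits)
        next
          case False
          then have "s i = s0 i" "s' i = s0 i" using i e1 by auto
          then show ?thesis by simp
        qed
      qed (use s S in \<open>auto simp: PiE_def\<close>)
    qed
    have "?F s \<in> ?X" if s: "s \<in> {s\<in>S. R s t}" for s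
    proof -
      have "card (?D s) \<le> m" using near[OF _ s0(1) _ s0(2), of s] s by blast
      moreover have "restrict s (?D s) \<in> ?D s \<rightarrow>\<^sub>E Y"
        unfolding restrict_PiE_iff using s S by (auto simp: PiE_iff)
      ultimately show ?thesis by auto
    qed
    then have "?F ` {s\<in>S. R s t} \<subseteq> ?X" by blast
    moreover have finX: "finite ?X"
      using I Y(1) by (intro finite_SigmaI) (auto intro: finite_PiE finite_subset)
    ultimately have "card (?F ` {s\<in>S. R s t}) \<le> card ?X" by (intro card_mono)
    then have "card {s\<in>S. R s t} \<le> card ?X" unfolding card_image[OF inj] .
    also have "\<dots> = (\<Sum>D\<in>{D. D \<subseteq> I \<and> card D \<le> m}. card (D \<rightarrow>\<^sub>E Y))"
      using I Y(1) by (intro card_SigmaI) (auto intro: finite_PiE finite_subset)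
    also have "\<dots> \<le> (\<Sum>D\<in>{D. D \<subseteq> I \<and> card D \<le> m}. card Y ^ m)"
    proof (rule sum_mono)
      fix D assume D: "D \<in> {D. D \<subseteq> I \<and> card D \<le> m}"
      then have "card (D \<rightarrow>\<^sub>E Y) = card Y ^ card D"
        using I by (subst card_PiE) (auto intro: finite_subset)
      also have "\<dots> \<le> card Y ^ m"
        using D Y by (intro power_increasing) (auto simp: Suc_le_eq card_gt_0_iff)
      finally show "card (D \<rightarrow>\<^sub>E Y) \<le> card Y ^ m" .
    qed
    also have "\<dots> = card {D. D \<subseteq> I \<and> card D \<le> m} * card Y ^ m" by simp
    also have "\<dots> \<le> card (Pow I) * card Y ^ m"
      using I by (intro mult_right_mono card_mono) auto
    finally show ?thesis using I by (simp add: card_Pow)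
  qed
  have "S = (\<Union>t\<in>T. {s\<in>S. R s t})" using ex by auto
  then have "card S \<le> (\<Sum>t\<in>T. card {s\<in>S. R s t})" using card_UN_le[OF T] by metis
  also have "\<dots> \<le> (\<Sum>t\<in>T. 2 ^ card I * card Y ^ m)" by (intro sum_mono fibre)
  finally show ?thesis by simp
qed

definition log_rate :: "nat \<Rightarrow> 'b set \<Rightarrow> ereal" where
  "log_rate d A = log_card A / ereal (real d * ln (real d))"

lemma log_rate_real:
  assumes "d \<ge> 2" "finite A" "A \<noteq> {}"
  shows "log_rate d A = ereal (ln (real (card A)) / (real d * ln (real d)))"
proof -
  have "real d * ln (real d) \<noteq> 0" using assms(1) by simp
  then show ?thesis using assms by (simp add: log_rate_def log_card_def)
qed

lemma log_rate_empty: "d \<ge> 2 \<Longrightarrow> log_rate d {} = -\<infinity>"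
  by (simp add: log_rate_def log_card_def)

lemma log_rate_Times:
  assumes "d \<ge> 2" "finite A" "finite B" "A \<noteq> {}" "B \<noteq> {}"
  shows "log_rate d (A \<times> B) = log_rate d A + log_rate d B"
proof -
  have "real (card A) > 0" "real (card B) > 0" using assms by (simp_all add: card_gt_0_iff)
  then have "ln (real (card (A \<times> B))) = ln (real (card A)) + ln (real (card B))"
    by (simp add: card_cartesian_product ln_mult)
  then show ?thesis using assms by (simp add: log_rate_real add_divide_distrib)
qed

text \<open>After division by \<open>d * ln d\<close> the factor \<open>K ^ d\<close> disappears, and the other factor contributes \<open>\<beta>\<close>
  in the limit.\<close>

lemma eventually_log_rate_le:
  fixes K \<beta> \<epsilon> :: real
  assumes K: "K \<ge> 1" and \<beta>: "\<beta> < \<epsilon>"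
  shows "\<forall>\<^sub>F d in sequentially. \<forall>(A :: 'a set) (B :: 'b set). finite A \<longrightarrow> finite B \<longrightarrow>
    real (card A) \<le> real (card B) * (K ^ d * (real d + 1) powr (\<beta> * real d)) \<longrightarrow>
    log_rate d A \<le> log_rate d B + ereal \<epsilon>"
proof -
  have "((\<lambda>d. ln K / ln (real d) + \<beta> * (ln (real d + 1) / ln (real d))) \<longlongrightarrow> 0 + \<beta> * 1) sequentially"
    by (intro tendsto_add tendsto_mult tendsto_const) real_asymp+
  then have ev: "\<forall>\<^sub>F d in sequentially. ln K / ln (real d) + \<beta> * (ln (real d + 1) / ln (real d)) < \<epsilon>"
    using \<beta> by (auto dest!: order_tendstoD(2))
  show ?thesis
    using ev eventually_ge_at_top[of 2]
  proof eventually_elim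
    case (elim d)
    have ld: "ln (real d) > 0" "real d > 0" using elim(2) by auto
    show ?case
    proof (intro allI impI)
      fix A :: "'a set" and B :: "'b set"
      assume fin: "finite A" "finite B"
        and le: "real (card A) \<le> real (card B) * (K ^ d * (real d + 1) powr (\<beta> * real d))"
      show "log_rate d A \<le> log_rate d B + ereal \<epsilon>"
      proof (cases "A = {}")
        case True
        then show ?thesis using elim(2) by (simp add: log_rate_empty)
      next
        case False
        then have cA: "real (card A) > 0" using fin by (simp add: card_gt_0_iff)
        then have "B \<noteq> {}" using le by auto
        then have cB: "real (card B) > 0" using fin by (simp add: card_gt_0_iff)
        have p: "K ^ d > 0" "(real d + 1) powr (\<beta> * real d) > 0" using K by auto
        have "ln (real (card A)) \<le> ln (real (card B) * (K ^ d * (real d + 1) powr (\<beta> * real d)))"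
          using cA cB p le by (subst ln_le_cancel_iff) auto
        also have "\<dots> = ln (real (card B)) + (real d * ln K + \<beta> * real d * ln (real d + 1))"
          using cB p K by (simp add: ln_mult ln_powr ln_realpow)
        finally have "ln (real (card A)) / (real d * ln (real d)) \<le>
           ln (real (card B)) / (real d * ln (real d)) + (real d * ln K + \<beta> * real d * ln (real d + 1)) / (real d * ln (real d))"
          using ld by (simp add: add_divide_distrib[symmetric] divide_right_mono)
        also have "(real d * ln K + \<beta> * real d * ln (real d + 1)) / (real d * ln (real d)) =
            ln K / ln (real d) + \<beta> * (ln (real d + 1) / ln (real d))"
          using ld by (simp add: field_simps)
        finally have "ln (real (card A)) / (real d * ln (real d)) \<le> ln (real (card B)) / (real d * ln (real d)) + \<epsilon>"
          using elim(1) by linarith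
        then show ?thesis using elim(2) fin False \<open>B \<noteq> {}\<close> by (simp add: log_rate_real)
      qed
    qed
  qed
qed

section \<open>Combinatorial models of an action\<close>

lemma measurable_colour_iff:
  "(c :: 'x \<Rightarrow> nat) \<in> M \<rightarrow>\<^sub>M count_space UNIV \<longleftrightarrow> (\<forall>v. {x \<in> space M. c x = v} \<in> sets M)"
proof -
  have "c -` {v} \<inter> space M = {x \<in> space M. c x = v}" for v by auto
  then show ?thesis by (simp add: measurable_count_space_eq_countable)
qed

context pmp_action begin

text \<open>At a good point the maps multiply as group elements, the window \<open>V\<close> acts freely, and the colours
  of the orbit are those of the orbit of an actual point of the space.\<close>

definition good_pt :: "('g \<Rightarrow> nat \<Rightarrow> nat) \<Rightarrow> (nat \<Rightarrow> nat) \<Rightarrow> 'g set \<Rightarrow> ('x \<Rightarrow> nat) \<Rightarrow> nat \<Rightarrow> bool" where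
  "good_pt \<sigma> \<kappa> V c i \<longleftrightarrow>
     (\<forall>g\<in>V. \<forall>h\<in>V. g \<otimes> h \<in> V \<longrightarrow> \<sigma> g (\<sigma> h i) = \<sigma> (g \<otimes> h) i) \<and>
     (\<forall>g\<in>V. \<sigma> g i = i \<longrightarrow> g = \<one>) \<and>
     (\<exists>x\<in>space M. \<forall>g\<in>V. \<kappa> (\<sigma> g i) = c (\<alpha> g x))"

text \<open>The statistics of the colouring are compared on all sets of colours at once, so that the error does
  not grow with the number of colours in the set.\<close>

definition model :: "'g set \<Rightarrow> ('x \<Rightarrow> nat) \<Rightarrow> real \<Rightarrow> nat \<Rightarrow> ('g \<Rightarrow> nat \<Rightarrow> nat) \<Rightarrow> (nat \<Rightarrow> nat) \<Rightarrow> bool" where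
  "model V c \<epsilon> d \<sigma> \<kappa> \<longleftrightarrow> (\<forall>g. \<forall>i<d. \<sigma> g i < d) \<and> (\<forall>i<d. \<sigma> \<one> i = i) \<and> (\<forall>i<d. \<kappa> i \<in> c ` space M) \<and>
     real (card {i. i < d \<and> \<not> good_pt \<sigma> \<kappa> V c i}) \<le> \<epsilon> * real d \<and>
     (\<forall>Q. \<bar>real (card {i. i < d \<and> \<kappa> i \<in> Q}) - real d * measure M {x \<in> space M. c x \<in> Q}\<bar> \<le> \<epsilon> * real d)"

definition models :: "'g set \<Rightarrow> ('x \<Rightarrow> nat) \<Rightarrow> real \<Rightarrow> nat \<Rightarrow> ('g \<Rightarrow> nat \<Rightarrow> nat) set" where
  "models V c \<epsilon> d = {\<sigma>. \<exists>\<kappa>. model V c \<epsilon> d \<sigma> \<kappa>}"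

definition restr :: "'g set \<Rightarrow> nat \<Rightarrow> ('g \<Rightarrow> nat \<Rightarrow> nat) \<Rightarrow> 'g \<times> nat \<Rightarrow> nat" where
  "restr W d \<sigma> = restrict (\<lambda>(g, i). \<sigma> g i) (W \<times> {..<d})"

definition params :: "('g set \<times> ('x \<Rightarrow> nat) \<times> real) set" where
  "params = {(V, c, \<epsilon>). finite V \<and> V \<subseteq> carrier G \<and> c \<in> M \<rightarrow>\<^sub>M count_space UNIV \<and>
     finite (c ` space M) \<and> \<epsilon> > 0}"

definition model_count :: "'g set \<Rightarrow> 'g set \<Rightarrow> ('x \<Rightarrow> nat) \<Rightarrow> real \<Rightarrow> nat \<Rightarrow> ('g \<times> nat \<Rightarrow> nat) set" where
  "model_count W V c \<epsilon> d = restr W d ` models V c \<epsilon> d"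

definition model_dim :: "((nat \<Rightarrow> ereal) \<Rightarrow> ereal) \<Rightarrow> ereal" where
  "model_dim L = (SUP W\<in>{W. finite W \<and> W \<subseteq> carrier G}. INF (V, c, \<epsilon>)\<in>params.
     L (\<lambda>d. log_rate d (model_count W V c \<epsilon> d)))"

lemma restr_PiE: "\<sigma> \<in> models V c \<epsilon> d \<Longrightarrow> restr W d \<sigma> \<in> (W \<times> {..<d}) \<rightarrow>\<^sub>E {..<d}"
  by (auto simp: models_def model_def restr_def)

lemma finite_model_count: assumes "finite W" shows "finite (model_count W V c \<epsilon> d)"
  unfolding model_count_def
proof (rule finite_subset)
  show "restr W d ` models V c \<epsilon> d \<subseteq> (W \<times> {..<d}) \<rightarrow>\<^sub>E {..<d}" by (intro image_subsetI restr_PiE)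
  show "finite ((W \<times> {..<d}) \<rightarrow>\<^sub>E {..<d})" using assms by (intro finite_PiE) simp_all
qed

lemma null_colour_set:
  assumes c: "c \<in> M \<rightarrow>\<^sub>M count_space UNIV" "finite (c ` space M)"
  shows "measure M {x \<in> space M. (c x :: nat) \<in> {v. measure M {x \<in> space M. c x = v} = 0}} = 0"
    (is "measure M ?N = 0")
proof -
  let ?m = "\<lambda>v. measure M {x \<in> space M. c x = v}" and ?S = "{v \<in> c ` space M. measure M {x \<in> space M. c x = v} = 0}"
  have sets: "{x \<in> space M. c x = v} \<in> sets M" for v
    using c(1) unfolding measurable_colour_iff by blast
  have "?N = (\<Union>v\<in>?S. {x \<in> space M. c x = v})" by auto
  then have "measure M ?N \<le> (\<Sum>v\<in>?S. ?m v)" using measure_UNION_le[of ?S "\<lambda>v. {x \<in> space M. c x = v}" M] c(2) sets by simp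
  also have "\<dots> = 0" by (rule sum.neutral) simp
  finally show ?thesis using measure_nonneg[of M ?N] by linarith
qed

lemma good_pt_mono: "good_pt \<sigma> \<kappa> V' c i \<Longrightarrow> V \<subseteq> V' \<Longrightarrow> good_pt \<sigma> \<kappa> V c i"
  unfolding good_pt_def by (meson subsetD)

lemma model_mono:
  assumes m: "model V' c \<epsilon>' d \<sigma> \<kappa>" and V: "V \<subseteq> V'" and \<epsilon>: "\<epsilon>' \<le> \<epsilon>"
  shows "model V c \<epsilon> d \<sigma> \<kappa>"
proof -
  have "card {i. i < d \<and> \<not> good_pt \<sigma> \<kappa> V c i} \<le> card {i. i < d \<and> \<not> good_pt \<sigma> \<kappa> V' c i}"
    using good_pt_mono[OF _ V] by (intro card_mono) auto
  moreover have e: "\<epsilon>' * real d \<le> \<epsilon> * real d" using \<epsilon> by (intro mult_right_mono) auto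
  moreover have "\<bar>real (card {i. i < d \<and> \<kappa> i \<in> Q}) - real d * measure M {x \<in> space M. c x \<in> Q}\<bar> \<le> \<epsilon> * real d" for Q
    using m e order_trans unfolding model_def by blast
  ultimately show ?thesis using m unfolding model_def by auto
qed

end

text \<open>The only property of upper and lower limits that the comparison with models uses.\<close>

definition limit_like :: "((nat \<Rightarrow> ereal) \<Rightarrow> ereal) \<Rightarrow> bool" where
  "limit_like L \<longleftrightarrow> (\<forall>f g \<epsilon>. (\<forall>\<^sub>F d in sequentially. f d \<le> g d + ereal \<epsilon>) \<longrightarrow> L f \<le> L g + ereal \<epsilon>)"

lemma limit_like_limsup: "limit_like limsup"
  unfolding limit_like_def
proof (intro allI impI)
  fix f g :: "nat \<Rightarrow> ereal" and \<epsilon>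
  assume "\<forall>\<^sub>F d in sequentially. f d \<le> g d + ereal \<epsilon>"
  then have "limsup f \<le> limsup (\<lambda>d. g d + ereal \<epsilon>)" by (rule Limsup_mono)
  also have "\<dots> = limsup g + ereal \<epsilon>" by (rule Limsup_add_ereal_right) auto
  finally show "limsup f \<le> limsup g + ereal \<epsilon>" .
qed

lemma limit_like_liminf: "limit_like liminf"
  unfolding limit_like_def
proof (intro allI impI)
  fix f g :: "nat \<Rightarrow> ereal" and \<epsilon>
  assume "\<forall>\<^sub>F d in sequentially. f d \<le> g d + ereal \<epsilon>"
  then have "liminf f \<le> liminf (\<lambda>d. g d + ereal \<epsilon>)" by (rule Liminf_mono)
  also have "\<dots> = liminf g + ereal \<epsilon>" by (rule Liminf_add_ereal_right) auto
  finally show "liminf f \<le> liminf g + ereal \<epsilon>" .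
qed

section \<open>From operator approximations to models\<close>

text \<open>Words of length two suffice to extract a model from an approximation.\<close>

locale operator_approx = pmp_action G M \<alpha>
  for G :: "('g, 'm) monoid_scheme" (structure) and M :: "'x measure" and \<alpha> +
  fixes \<B> :: "('g \<times> 'x) set set" and \<delta> :: real and d :: nat and \<phi> :: "('g \<times> 'x) l2_op \<Rightarrow> complex mat"
  assumes \<phi>: "\<phi> \<in> SA \<G> (s_op ` \<B>) 2 \<delta> d"
    and \<B>: "\<B> \<subseteq> Collect bis" "finite \<B>" and \<delta>: "0 < \<delta>" "\<delta> \<le> 1" and d: "d > 0"
begin

definition pm :: "('g \<times> 'x) set \<Rightarrow> nat \<Rightarrow> nat option" where
  "pm B = colf d (\<phi> (s_op B))"

lemma \<phi>_linear: "\<phi> \<in> linear_maps \<G> d"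
  using \<phi> unfolding SA_iff[OF \<B>(1)] by blast

lemma \<phi>_words:
  assumes "1 \<le> length Bs" "length Bs \<le> 2" "set Bs \<subseteq> \<B>"
  shows "mat_norm2 (\<phi> (s_op (bprod Bs)) - foldr (*) (map (\<lambda>B. \<phi> (s_op B)) Bs) (1\<^sub>m d)) < \<delta>"
    "\<phi> (s_op (bprod Bs)) \<in> partial_perm_mats d"
    "cmod (mat_ntr (\<phi> (s_op (bprod Bs))) - complex_of_real (measure M (slice (bprod Bs) \<one>))) < \<delta>"
proof -
  have "set Bs \<subseteq> \<B> \<union> binv ` \<B>" using assms(3) by blast
  then show "mat_norm2 (\<phi> (s_op (bprod Bs)) - foldr (*) (map (\<lambda>B. \<phi> (s_op B)) Bs) (1\<^sub>m d)) < \<delta>"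
    "\<phi> (s_op (bprod Bs)) \<in> partial_perm_mats d"
    "cmod (mat_ntr (\<phi> (s_op (bprod Bs))) - complex_of_real (measure M (slice (bprod Bs) \<one>))) < \<delta>"
    using \<phi> assms(1,2) unfolding SA_iff[OF \<B>(1)] by blast+
qed

lemma bprod1: "B \<in> \<B> \<Longrightarrow> bprod [B] = B"
  using \<B>(1) by (simp add: bprod_def bmul_bone subset_iff)

lemma bprod2: "C \<in> \<B> \<Longrightarrow> bprod [B, C] = bmul B C"
  using \<B>(1) by (simp add: bprod_def bmul_bone subset_iff)

lemma pm_ppm: "B \<in> \<B> \<Longrightarrow> \<phi> (s_op B) \<in> partial_perm_mats d"
  using \<phi>_words(2)[of "[B]"] by (simp add: bprod1)

lemma pm_ppm2: "B \<in> \<B> \<Longrightarrow> C \<in> \<B> \<Longrightarrow> \<phi> (s_op (bmul B C)) \<in> partial_perm_mats d"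
  using \<phi>_words(2)[of "[B, C]"] by (simp add: bprod2)

lemma pm_trace:
  assumes "B \<in> \<B>"
  shows "\<bar>real (card {i. i < d \<and> pm B i = Some i}) - real d * measure M (slice B \<one>)\<bar> \<le> \<delta> * real d"
proof -
  have "\<phi> (s_op B) = pmat d (pm B)" using colf_pmat(1)[OF pm_ppm[OF assms]] by (simp add: pm_def)
  then have "cmod (complex_of_real (real (card {i. i < d \<and> pm B i = Some i}) / real d - measure M (slice B \<one>))) < \<delta>"
    using \<phi>_words(3)[of "[B]"] assms by (simp add: bprod1 pmat_trace)
  then have "\<bar>real (card {i. i < d \<and> pm B i = Some i}) / real d - measure M (slice B \<one>)\<bar> < \<delta>"
    by (simp only: norm_of_real)
  then have "\<bar>real (card {i. i < d \<and> pm B i = Some i}) / real d - measure M (slice B \<one>)\<bar> * real d \<le> \<delta> * real d"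
    by (intro mult_right_mono) auto
  moreover have "\<bar>real (card {i. i < d \<and> pm B i = Some i}) / real d - measure M (slice B \<one>)\<bar> * real d =
      \<bar>(real (card {i. i < d \<and> pm B i = Some i}) / real d - measure M (slice B \<one>)) * real d\<bar>"
    by (simp add: abs_mult)
  moreover have "(real (card {i. i < d \<and> pm B i = Some i}) / real d - measure M (slice B \<one>)) * real d =
      real (card {i. i < d \<and> pm B i = Some i}) - real d * measure M (slice B \<one>)"
    using d by (simp add: left_diff_distrib)
  ultimately show ?thesis by simp
qed

lemma pm_mult:
  assumes B: "B \<in> \<B>" and C: "C \<in> \<B>"
  shows "real (card {i. i < d \<and> pm (bmul B C) i \<noteq> Option.bind (pm C i) (pm B)}) \<le> \<delta> * real d"
proof -
  note cB = colf_pmat[OF pm_ppm[OF B], folded pm_def] and cC = colf_pmat[OF pm_ppm[OF C], folded pm_def]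
    and cBC = colf_pmat[OF pm_ppm2[OF B C], folded pm_def]
  let ?g = "\<lambda>i. Option.bind (pm C i) (pm B)"
  have pg: "pfun d ?g"
    unfolding pfun_def
  proof (intro allI impI)
    fix i j assume i: "i < d" and "?g i = Some j"
    then obtain k where k: "pm C i = Some k" "pm B k = Some j" by (cases "pm C i") auto
    then show "j < d" using cB(2) cC(2) i unfolding pfun_def by blast
  qed
  have "foldr (*) (map (\<lambda>B. \<phi> (s_op B)) [B, C]) (1\<^sub>m d) = pmat d (pm B) * pmat d (pm C)"
    using cB(1) cC(1) by simp
  also have "\<dots> = pmat d ?g" by (rule pmat_mult[OF cC(2)])
  finally have "mat_norm2 (pmat d (pm (bmul B C)) - pmat d ?g) < \<delta>"
    using \<phi>_words(1)[of "[B, C]"] B C cBC(1) bprod2[OF C, of B] by simp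
  moreover have "0 \<le> mat_norm2 (pmat d (pm (bmul B C)) - pmat d ?g)"
    by (subst mat_norm2_eq[of _ d]) (auto intro!: sum_nonneg divide_nonneg_nonneg)
  ultimately have "(mat_norm2 (pmat d (pm (bmul B C)) - pmat d ?g))\<^sup>2 \<le> \<delta>\<^sup>2" by (intro power_mono) auto
  also have "\<dots> \<le> \<delta>" using \<delta> by (simp add: power2_eq_square mult_left_le)
  finally have "(mat_norm2 (pmat d (pm (bmul B C)) - pmat d ?g))\<^sup>2 * real d \<le> \<delta> * real d"
    by (intro mult_right_mono) auto
  then show ?thesis using pmat_diff_norm(1)[OF cBC(2) pg d] by linarith
qed

lemma \<phi>_add:
  assumes "bis B" "bis C" "bis (B \<union> C)" "B \<inter> C = {}"
  shows "\<phi> (s_op (B \<union> C)) = \<phi> (s_op B) + \<phi> (s_op C)"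
  using \<phi>_linear op_add_s_op[OF assms] s_op_span[OF assms(1)] s_op_span[OF assms(2)]
  unfolding linear_maps_def by force

lemma \<phi>_carrier: "bis B \<Longrightarrow> \<phi> (s_op B) \<in> carrier_mat d d"
  using \<phi>_linear s_op_span[of B] unfolding linear_maps_def by (auto simp: PiE_def)

lemma \<phi>_empty:
  assumes "i < d" "j < d"
  shows "\<phi> (s_op {}) $$ (j, i) = 0"
proof -
  have "\<phi> (s_op {}) = \<phi> (s_op {}) + \<phi> (s_op {})" using \<phi>_add[of "{}" "{}"] bis_empty by simp
  then have "\<phi> (s_op {}) $$ (j, i) = \<phi> (s_op {}) $$ (j, i) + \<phi> (s_op {}) $$ (j, i)"
    using assms \<phi>_carrier[OF bis_empty] by (metis carrier_matD index_add_mat(1))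
  then show ?thesis by simp
qed

lemma pm_empty: "i < d \<Longrightarrow> pm {} i = None"
  using \<phi>_empty by (auto simp: pm_def colf_def)

lemma \<phi>_Union:
  assumes "finite P" "\<And>p. p \<in> P \<Longrightarrow> bis (F p)" "\<And>p q. p \<in> P \<Longrightarrow> q \<in> P \<Longrightarrow> p \<noteq> q \<Longrightarrow> F p \<inter> F q = {}"
    and "bis (\<Union>p\<in>P. F p)" and ij: "i < d" "j < d"
  shows "\<phi> (s_op (\<Union>p\<in>P. F p)) $$ (j, i) = (\<Sum>p\<in>P. \<phi> (s_op (F p)) $$ (j, i))"
  using assms(1-4)
proof (induction P rule: finite_induct)
  case empty
  then show ?case using \<phi>_empty[OF ij] by simp
next
  case (insert p P)
  have bp: "bis (F p)" using insert.prems(1) by simp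
  have bP: "bis (\<Union>q\<in>P. F q)"
  proof (rule bis_subset[OF insert.prems(3)])
    fix g assume g: "g \<in> carrier G"
    have "slice (\<Union>q\<in>P. F q) g = (\<Union>q\<in>P. slice (F q) g)" by auto
    also have "\<dots> \<in> sets M" using insert.hyps(1) insert.prems(1) bisD(3) g by (intro sets.finite_UN) auto
    finally show "slice (\<Union>q\<in>P. F q) g \<in> sets M" .
  qed auto
  have "F p \<inter> (\<Union>q\<in>P. F q) = {}" using insert.prems(2)[of p] insert.hyps(2) by fastforce
  then have "\<phi> (s_op (\<Union>q\<in>insert p P. F q)) = \<phi> (s_op (F p)) + \<phi> (s_op (\<Union>q\<in>P. F q))"
    using \<phi>_add[OF bp bP] insert.prems(3) by simp
  moreover have "\<phi> (s_op (\<Union>q\<in>P. F q)) $$ (j, i) = (\<Sum>p\<in>P. \<phi> (s_op (F p)) $$ (j, i))"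
    using insert.prems bP by (intro insert.IH) auto
  ultimately show ?case
    using ij \<phi>_carrier[OF bp] \<phi>_carrier[OF bP] insert.hyps by (simp add: carrier_matD)
qed

text \<open>Linearity makes the matrix of a disjoint union the sum of the matrices. As all of them have entries
  0 and 1, each nonzero entry of the sum comes from exactly one summand.\<close>

lemma pm_Union:
  assumes P: "finite P" and F: "\<And>p. p \<in> P \<Longrightarrow> F p \<in> \<B>"
    and disj: "\<And>p q. p \<in> P \<Longrightarrow> q \<in> P \<Longrightarrow> p \<noteq> q \<Longrightarrow> F p \<inter> F q = {}"
    and U: "(\<Union>p\<in>P. F p) = B" "B \<in> \<B>" and ij: "i < d"
  shows "pm B i = Some j \<longleftrightarrow> (\<exists>p\<in>P. pm (F p) i = Some j)"
    "p \<in> P \<Longrightarrow> q \<in> P \<Longrightarrow> pm (F p) i = Some j \<Longrightarrow> pm (F q) i = Some j \<Longrightarrow> p = q"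
proof -
  let ?J = "{p\<in>P. pm (F p) i = Some j}"
  have ent: "\<phi> (s_op C) $$ (j, i) = (if pm C i = Some j then 1 else 0)" if "C \<in> \<B>" "j < d" for C
    using colf_pmat(1)[OF pm_ppm[OF that(1)]] that(2) ij pmat_index[of j d i "colf d (\<phi> (s_op C))"]
    by (simp add: pm_def)
  have bis: "bis C" if "C \<in> \<B>" for C using that \<B> by auto
  have sum: "(if pm B i = Some j then 1 else 0) = (of_nat (card ?J) :: complex)" if j: "j < d"
  proof -
    have "(if pm B i = Some j then 1 else 0) = \<phi> (s_op (\<Union>p\<in>P. F p)) $$ (j, i)"
      unfolding U(1) using ent[OF U(2) j] by simp
    also have "\<dots> = (\<Sum>p\<in>P. \<phi> (s_op (F p)) $$ (j, i))"
      by (rule \<phi>_Union[OF P _ disj _ ij j]) (use F bis U in auto)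
    also have "\<dots> = (\<Sum>p\<in>P. if pm (F p) i = Some j then 1 else 0)"
      by (intro sum.cong refl ent F j)
    also have "\<dots> = (\<Sum>p\<in>?J. 1)" by (rule sum.inter_filter[symmetric, OF P])
    finally show ?thesis by simp
  qed
  then have sum': "(if pm B i = Some j then 1 else 0) = card ?J" if j: "j < d"
  proof -
    have "of_nat (if pm B i = Some j then 1 else 0) = (of_nat (card ?J) :: complex)"
      using sum[OF j] by (cases "pm B i = Some j") simp_all
    then show ?thesis by (simp only: of_nat_eq_iff)
  qed
  have jd: "j < d" if "C \<in> \<B>" "pm C i = Some j" for C
    using colf_pmat(2)[OF pm_ppm[OF that(1)]] that(2) ij unfolding pm_def pfun_def by blast
  show "pm B i = Some j \<longleftrightarrow> (\<exists>p\<in>P. pm (F p) i = Some j)"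
  proof (cases "j < d")
    case True
    have "finite ?J" using P by simp
    then have ne: "card ?J = 0 \<longleftrightarrow> \<not> (\<exists>p\<in>P. pm (F p) i = Some j)"
      unfolding card_eq_0_iff by blast
    show ?thesis
    proof (cases "pm B i = Some j")
      case yes: True
      have "card ?J = 1" using sum'[OF True] unfolding if_P[OF yes] by (rule sym)
      then have "card ?J \<noteq> 0" by linarith
      then have ex: "\<exists>p\<in>P. pm (F p) i = Some j" unfolding ne by (rule notnotD)
      show ?thesis by (intro iffI ex yes)
    next
      case no: False
      have "card ?J = 0" using sum'[OF True] unfolding if_not_P[OF no] by (rule sym)
      then have nex: "\<not> (\<exists>p\<in>P. pm (F p) i = Some j)" unfolding ne .
      show ?thesis by (simp only: no nex)
    qed
  next
    case False
    then show ?thesis using jd F U(2) by blast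
  qed
  show "p = q" if pq: "p \<in> P" "q \<in> P" "pm (F p) i = Some j" "pm (F q) i = Some j"
  proof -
    have "j < d" using jd F pq by blast
    then have "card ?J \<le> 1" using sum' by (metis le_numeral_extra(4) zero_le_one)
    then show ?thesis using pq P by (auto simp: card_le_Suc0_iff_eq)
  qed
qed

lemma pm_mono:
  assumes "B \<in> \<B>" "C \<in> \<B>" "B - C \<in> \<B>" "C \<subseteq> B" "i < d" "pm C i = Some j"
  shows "pm B i = Some j"
proof -
  have "pm B i = Some j \<longleftrightarrow> (\<exists>p\<in>{True, False}. pm (if p then C else B - C) i = Some j)"
  proof (rule pm_Union(1))
    show "(\<Union>p\<in>{True, False}. if p then C else B - C) = B" using assms(4) by auto
  qed (use assms in auto)
  then show ?thesis using assms(6) by simp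
qed

lemma pm_inj: "B \<in> \<B> \<Longrightarrow> i < d \<Longrightarrow> k < d \<Longrightarrow> pm B i = Some j \<Longrightarrow> pm B k = Some j \<Longrightarrow> i = k"
  using colf_pmat(3)[OF pm_ppm] unfolding pm_def pinj_def by blast

lemma pm_lt: "pm B i = Some j \<Longrightarrow> j < d"
  unfolding pm_def colf_def by (auto split: if_splits intro: someI2)

abbreviation proj :: "'x set \<Rightarrow> ('g \<times> 'x) set" where "proj Q \<equiv> rect \<one> Q"

text \<open>Points at which the matrix of \<open>g\<close> has no entry are left fixed. There are few of them, and they are
  collected in \<open>bad1\<close>.\<close>

definition perm :: "'g \<Rightarrow> nat \<Rightarrow> nat" where
  "perm g i = (if g = \<one> then i else case pm (full g) i of Some j \<Rightarrow> j | None \<Rightarrow> i)"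

text \<open>A point is bad if the matrix of the unit space does not fix it, if multiplicativity fails there, or if a
  nontrivial group element of the window fixes it. In \<open>bad\<close> the points one step away from these are added.\<close>

definition bad1 :: "'g set \<Rightarrow> nat set" where
  "bad1 V = {i. i < d \<and> (pm bone i \<noteq> Some i \<or>
     (\<exists>B\<in>\<B>. \<exists>C\<in>\<B>. pm (bmul B C) i \<noteq> Option.bind (pm C i) (pm B)) \<or>
     (\<exists>g\<in>V - {\<one>}. pm (full g) i = Some i))}"

definition bad :: "'g set \<Rightarrow> nat set" where
  "bad V = bad1 V \<union> (\<Union>g\<in>V. {i. i < d \<and> i \<notin> bad1 V \<and> perm g i \<in> bad1 V})"

lemma perm_lt: "i < d \<Longrightarrow> perm g i < d"
  unfolding perm_def by (auto split: option.split dest: pm_lt)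

text \<open>Multiplicativity in the 2-norm bounds the number of columns where it fails; fixed points are
  controlled by the trace, as the isometry of a nontrivial group element has trace 0.\<close>

lemma card_bad1:
  assumes V: "finite V" "V \<subseteq> carrier G" "\<And>g. g \<in> V \<Longrightarrow> full g \<in> \<B>" and b1: "bone \<in> \<B>"
  shows "real (card (bad1 V)) \<le> (1 + (real (card \<B>))\<^sup>2 + real (card V)) * \<delta> * real d"
proof -
  let ?A0 = "{i. i < d \<and> pm bone i \<noteq> Some i}"
  let ?A1 = "\<lambda>(B, C). {i. i < d \<and> pm (bmul B C) i \<noteq> Option.bind (pm C i) (pm B)}"
  let ?A2 = "\<lambda>g. {i. i < d \<and> pm (full g) i = Some i}"
  have "bad1 V \<subseteq> ?A0 \<union> (\<Union>p\<in>\<B> \<times> \<B>. ?A1 p) \<union> (\<Union>g\<in>V - {\<one>}. ?A2 g)"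
    unfolding bad1_def by auto
  moreover have fin: "finite (?A0 \<union> (\<Union>p\<in>\<B> \<times> \<B>. ?A1 p) \<union> (\<Union>g\<in>V - {\<one>}. ?A2 g))"
    using V \<B> by auto
  ultimately have "card (bad1 V) \<le> card (?A0 \<union> (\<Union>p\<in>\<B> \<times> \<B>. ?A1 p) \<union> (\<Union>g\<in>V - {\<one>}. ?A2 g))"
    by (intro card_mono)
  also have "\<dots> \<le> card ?A0 + card (\<Union>p\<in>\<B> \<times> \<B>. ?A1 p) + card (\<Union>g\<in>V - {\<one>}. ?A2 g)"
    by (meson add_le_mono1 card_Un_le order_trans)
  also have "\<dots> \<le> card ?A0 + (\<Sum>p\<in>\<B> \<times> \<B>. card (?A1 p)) + (\<Sum>g\<in>V - {\<one>}. card (?A2 g))"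
    using V \<B> by (intro add_mono card_UN_le order_refl) auto
  finally have "real (card (bad1 V)) \<le> real (card ?A0 + (\<Sum>p\<in>\<B> \<times> \<B>. card (?A1 p)) + (\<Sum>g\<in>V - {\<one>}. card (?A2 g)))"
    by (rule of_nat_mono)
  also have "\<dots> = real (card ?A0) + (\<Sum>p\<in>\<B> \<times> \<B>. real (card (?A1 p))) + (\<Sum>g\<in>V - {\<one>}. real (card (?A2 g)))"
    by (simp only: of_nat_add of_nat_sum)
  also have "\<dots> \<le> \<delta> * real d + (\<Sum>p\<in>\<B> \<times> \<B>. \<delta> * real d) + (\<Sum>g\<in>V - {\<one>}. \<delta> * real d)"
  proof (intro add_mono sum_mono)
    have "{i. i < d \<and> pm bone i = Some i} \<union> ?A0 = {..<d}" by auto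
    then have "real d = real (card {i. i < d \<and> pm bone i = Some i}) + real (card ?A0)"
      by (subst of_nat_add[symmetric], subst card_Un_disjoint[symmetric]) auto
    moreover have "slice bone \<one> = space M" by (auto simp: rect_def)
    ultimately show "real (card ?A0) \<le> \<delta> * real d"
      using pm_trace[OF b1] M.prob_space by simp
  next
    fix p assume "p \<in> \<B> \<times> \<B>"
    then show "real (card (?A1 p)) \<le> \<delta> * real d" using pm_mult by auto
  next
    fix g assume g: "g \<in> V - {\<one>}"
    then have "slice (full g) \<one> = {}" by (auto simp: rect_def)
    then have m0: "measure M (slice (full g) \<one>) = 0" by (simp only: measure_empty)
    have "full g \<in> \<B>" using V(3) g by blast
    from pm_trace[OF this] show "real (card (?A2 g)) \<le> \<delta> * real d" unfolding m0 by simp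
  qed
  also have "\<dots> = (1 + (real (card \<B>))\<^sup>2 + real (card (V - {\<one>}))) * \<delta> * real d"
    by (simp add: card_cartesian_product power2_eq_square algebra_simps)
  also have "\<dots> \<le> (1 + (real (card \<B>))\<^sup>2 + real (card V)) * \<delta> * real d"
    using \<delta> V by (intro mult_right_mono) (auto intro: card_mono)
  finally show ?thesis .
qed

lemma pm_perm:
  assumes g: "g \<in> carrier G" "full g \<in> \<B>" "full (inv g) \<in> \<B>" and i: "i < d" "i \<notin> bad1 V"
  shows "pm (full g) i = Some (perm g i)"
proof -
  have "bmul (full (inv g)) (full g) = bone"
    using g by (subst bmul_rect) (auto intro!: arg_cong[where f = "rect \<one>"])
  then have "pm bone i = Option.bind (pm (full g) i) (pm (full (inv g)))"
    using i g unfolding bad1_def by fastforce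
  moreover have b: "pm bone i = Some i" using i unfolding bad1_def by blast
  ultimately obtain j where "pm (full g) i = Some j" by (cases "pm (full g) i") auto
  then show ?thesis using b by (auto simp: perm_def)
qed

lemma card_bad:
  assumes V: "finite V" "V \<subseteq> carrier G"
    and VB: "\<And>g. g \<in> V \<Longrightarrow> full g \<in> \<B> \<and> full (inv g) \<in> \<B>" and b1: "bone \<in> \<B>"
  shows "real (card (bad V)) \<le> (1 + real (card V)) * ((1 + (real (card \<B>))\<^sup>2 + real (card V)) * \<delta>) * real d"
proof -
  let ?N = "bad1 V"
  have fN: "finite ?N" by (rule finite_subset[of _ "{..<d}"]) (auto simp: bad1_def)
  have "card {i. i < d \<and> i \<notin> ?N \<and> perm g i \<in> ?N} \<le> card ?N" if g: "g \<in> V" for g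
  proof (rule card_inj_on_le[of "perm g"])
    have gB: "g \<in> carrier G" "full g \<in> \<B>" "full (inv g) \<in> \<B>" using g V VB by auto
    show "inj_on (perm g) {i. i < d \<and> i \<notin> ?N \<and> perm g i \<in> ?N}"
    proof (rule inj_onI)
      fix i k assume ik: "i \<in> {i. i < d \<and> i \<notin> ?N \<and> perm g i \<in> ?N}" "k \<in> {i. i < d \<and> i \<notin> ?N \<and> perm g i \<in> ?N}"
        and e: "perm g i = perm g k"
      show "i = k"
      proof (rule pm_inj[OF gB(2)])
        show "i < d" "k < d" using ik by simp_all
        show "pm (full g) i = Some (perm g i)" using ik by (intro pm_perm[where V = V, OF gB]) simp_all
        show "pm (full g) k = Some (perm g i)" unfolding e using ik by (intro pm_perm[where V = V, OF gB]) simp_all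
      qed
    qed
  qed (use fN in auto)
  then have "(\<Sum>g\<in>V. card {i. i < d \<and> i \<notin> ?N \<and> perm g i \<in> ?N}) \<le> card V * card ?N"
    using sum_bounded_above[of V "\<lambda>g. card {i. i < d \<and> i \<notin> ?N \<and> perm g i \<in> ?N}" "card ?N"] by simp
  moreover have "card (bad V) \<le> card ?N + (\<Sum>g\<in>V. card {i. i < d \<and> i \<notin> ?N \<and> perm g i \<in> ?N})"
    unfolding bad_def by (intro order_trans[OF card_Un_le] add_mono card_UN_le V order_refl)
  ultimately have "card (bad V) \<le> (1 + card V) * card ?N" by simp
  then have "real (card (bad V)) \<le> real ((1 + card V) * card ?N)" by (rule of_nat_mono)
  also have "\<dots> = (1 + real (card V)) * real (card ?N)" by (simp only: of_nat_mult of_nat_add of_nat_1)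
  also have "\<dots> \<le> (1 + real (card V)) * ((1 + (real (card \<B>))\<^sup>2 + real (card V)) * \<delta> * real d)"
    using card_bad1[OF V _ b1] VB by (intro mult_left_mono) auto
  finally show ?thesis by (simp only: mult.assoc)
qed

end

section \<open>Finite algebras of measurable sets\<close>

text \<open>\<open>ty \<S> x\<close> names the atom containing \<open>x\<close> of the algebra generated by the finite family \<open>\<S>\<close>, and
  \<open>sat \<S> X\<close> is that algebra: the sets which are unions of atoms.\<close>

definition ty :: "'a set set \<Rightarrow> 'a \<Rightarrow> 'a set set" where
  "ty \<S> x = {S\<in>\<S>. x \<in> S}"

definition sat :: "'a set set \<Rightarrow> 'a set \<Rightarrow> 'a set set" where
  "sat \<S> X = {Q. Q \<subseteq> X \<and> (\<forall>x\<in>X. \<forall>y\<in>X. ty \<S> x = ty \<S> y \<longrightarrow> x \<in> Q \<longrightarrow> y \<in> Q)}"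

lemma ty_eqD: "ty \<S> x = ty \<S> y \<Longrightarrow> A \<in> \<S> \<Longrightarrow> x \<in> A \<longleftrightarrow> y \<in> A"
  unfolding ty_def by blast

lemma ty_measurable:
  assumes "finite \<S>" "\<S> \<subseteq> sets M"
  shows "ty \<S> \<in> M \<rightarrow>\<^sub>M count_space (Pow \<S>)"
proof (rule measurable_count_space_eq2[THEN iffD2])
  show "finite (Pow \<S>)" using assms by simp
  have "ty \<S> -` {a} \<inter> space M \<in> sets M" if "a \<in> Pow \<S>" for a
  proof -
    have "ty \<S> -` {a} \<inter> space M = {x \<in> space M. \<forall>S\<in>\<S>. x \<in> S \<longleftrightarrow> S \<in> a}"
    proof -
      have "ty \<S> x = a \<longleftrightarrow> (\<forall>S\<in>\<S>. x \<in> S \<longleftrightarrow> S \<in> a)" for x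
        using that unfolding ty_def by blast
      then show ?thesis by blast
    qed
    also have "\<dots> \<in> sets M"
    proof (rule sets.sets_Collect_finite_All[OF _ assms(1)])
      fix S assume S: "S \<in> \<S>"
      have "{x \<in> space M. x \<in> S \<longleftrightarrow> S \<in> a} = (if S \<in> a then S \<inter> space M else space M - S)" by auto
      then show "{x \<in> space M. x \<in> S \<longleftrightarrow> S \<in> a} \<in> sets M" using S assms(2) by auto
    qed
    finally show ?thesis .
  qed
  then show "ty \<S> \<in> space M \<rightarrow> Pow \<S> \<and> (\<forall>a\<in>Pow \<S>. ty \<S> -` {a} \<inter> space M \<in> sets M)"
    by (auto simp: ty_def)
qed

lemma sat_eq: "Q \<in> sat \<S> X \<Longrightarrow> Q = {x\<in>X. ty \<S> x \<in> ty \<S> ` Q}"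
  unfolding sat_def by blast

lemma sat_sets:
  assumes "finite \<S>" "\<S> \<subseteq> sets M" "Q \<in> sat \<S> (space M)"
  shows "Q \<in> sets M"
proof -
  have "ty \<S> -` (ty \<S> ` Q) \<inter> space M \<in> sets M"
    by (rule measurable_sets[OF ty_measurable[OF assms(1,2)]]) (auto simp: ty_def)
  moreover have "Q = ty \<S> -` (ty \<S> ` Q) \<inter> space M" using sat_eq[OF assms(3)] by blast
  ultimately show ?thesis by simp
qed

lemma finite_sat: assumes "finite \<S>" shows "finite (sat \<S> X)"
proof (rule inj_on_finite)
  show "inj_on (\<lambda>Q. ty \<S> ` Q) (sat \<S> X)"
  proof (rule inj_onI)
    fix Q R assume "Q \<in> sat \<S> X" "R \<in> sat \<S> X" "ty \<S> ` Q = ty \<S> ` R"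
    then show "Q = R" using sat_eq[of Q \<S> X] sat_eq[of R \<S> X] by simp
  qed
  show "(\<lambda>Q. ty \<S> ` Q) ` sat \<S> X \<subseteq> Pow (Pow \<S>)" by (auto simp: ty_def)
qed (use assms in simp)

lemma sat_member: "S \<in> \<S> \<Longrightarrow> S \<subseteq> X \<Longrightarrow> S \<in> sat \<S> X"
  unfolding sat_def ty_def by blast

context pmp_action begin

definition tail :: "('g \<times> 'x) set \<Rightarrow> 'g set \<Rightarrow> 'x set" where
  "tail B W = {x \<in> space M. \<exists>g. g \<notin> W \<and> (g, x) \<in> B}"

lemma tail_sets: assumes "bis B" shows "tail B W \<in> sets M"
proof -
  have "tail B W = (\<Union>g\<in>carrier G - W. slice B g)"
    using bisD(1)[OF assms] by (auto simp: tail_def)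
  also have "\<dots> \<in> sets M"
    using countable_carrier bisD(3)[OF assms] by (intro sets.countable_UN') auto
  finally show ?thesis .
qed

text \<open>The slices of a bisection are disjoint subsets of a space of measure 1, so all but finitely many of
  the countably many slices have small total measure.\<close>

lemma finite_window_single:
  assumes B: "bis B" and \<rho>: "\<rho> > 0"
  shows "\<exists>W. finite W \<and> W \<subseteq> carrier G \<and> measure M (tail B W) < \<rho>"
proof -
  define F where "F n = from_nat_into (carrier G) ` {..n}" for n :: nat
  have F: "finite (F n)" "F n \<subseteq> carrier G" for n
    unfolding F_def using from_nat_into[of "carrier G"] one_closed by blast+
  have dec: "decseq (\<lambda>n. tail B (F n))"
    unfolding decseq_def tail_def F_def by (force simp: image_iff)
  have "(\<Inter>n. tail B (F n)) = {}"
  proof -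
    have "x \<notin> tail B (F (to_nat_on (carrier G) g))" if "(g, x) \<in> B" for g x
      using that bisD(4)[OF B that] bisD(1)[OF B that] from_nat_into_to_nat_on[OF countable_carrier]
      unfolding tail_def F_def by force
    note out = this
    show ?thesis
    proof (rule equals0I)
      fix x assume x: "x \<in> (\<Inter>n. tail B (F n))"
      then have "x \<in> tail B (F 0)" by (rule INT_D) simp
      then obtain g where g: "(g, x) \<in> B" unfolding tail_def by blast
      have "x \<in> tail B (F (to_nat_on (carrier G) g))" using x by (rule INT_D) simp
      then show False using out[OF g] by simp
    qed
  qed
  moreover have "(\<lambda>n. measure M (tail B (F n))) \<longlonglongrightarrow> measure M (\<Inter>n. tail B (F n))"
    by (rule M.finite_Lim_measure_decseq[OF _ dec]) (use tail_sets[OF B] in auto)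
  ultimately have "(\<lambda>n. measure M (tail B (F n))) \<longlonglongrightarrow> 0" by simp
  then have "\<forall>\<^sub>F n in sequentially. measure M (tail B (F n)) < \<rho>"
    using \<rho> by (rule order_tendstoD(2))
  then obtain n where "measure M (tail B (F n)) < \<rho>" by (auto simp: eventually_sequentially)
  then show ?thesis using F by blast
qed

lemma finite_window:
  assumes "finite \<E>" "\<E> \<subseteq> Collect bis" "\<rho> > 0"
  shows "\<exists>W. finite W \<and> W \<subseteq> carrier G \<and> (\<forall>B\<in>\<E>. measure M (tail B W) < \<rho>)"
proof -
  have "\<forall>B\<in>\<E>. \<exists>W. finite W \<and> W \<subseteq> carrier G \<and> measure M (tail B W) < \<rho>"
    using finite_window_single assms by blast
  then obtain w where w: "\<And>B. B \<in> \<E> \<Longrightarrow> finite (w B) \<and> w B \<subseteq> carrier G \<and> measure M (tail B (w B)) < \<rho>"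
    by metis
  have "measure M (tail B (\<Union>(w ` \<E>))) < \<rho>" if B: "B \<in> \<E>" for B
  proof -
    have "measure M (tail B (\<Union>(w ` \<E>))) \<le> measure M (tail B (w B))"
      using B assms(2) by (intro M.finite_measure_mono tail_sets) (auto simp: tail_def)
    then show ?thesis using w[OF B] by linarith
  qed
  moreover have "finite (\<Union>(w ` \<E>))" "\<Union>(w ` \<E>) \<subseteq> carrier G" using w assms(1) by auto
  ultimately show ?thesis by blast
qed

end

text \<open>The family \<open>\<S>\<close> is fine enough to determine all colour patterns on the window, also those seen from a
  translated point, and the approximation is tested on all projections onto members of the algebra.\<close>

locale approx_data = operator_approx G M \<alpha> \<B> \<delta> d \<phi>
  for G :: "('g, 'm) monoid_scheme" (structure) and M :: "'x measure" and \<alpha> \<B> \<delta> d \<phi> +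
  fixes V :: "'g set" and c :: "'x \<Rightarrow> nat" and \<S> :: "'x set set"
  assumes V: "finite V" "V \<subseteq> carrier G" "\<one> \<in> V"
    and VB: "\<And>g. g \<in> V \<Longrightarrow> full g \<in> \<B> \<and> full (inv g) \<in> \<B>"
    and c: "finite (c ` space M)"
    and projB: "\<And>Q. Q \<in> sat \<S> (space M) \<Longrightarrow> proj Q \<in> \<B>"
    and typ_c: "\<And>x y g h. \<lbrakk>x \<in> space M; y \<in> space M; ty \<S> x = ty \<S> y; g \<in> V; h \<in> V\<rbrakk>
      \<Longrightarrow> c (\<alpha> (g \<otimes> inv h) x) = c (\<alpha> (g \<otimes> inv h) y)"
begin

text \<open>\<open>pat x\<close> is the pattern of colours on the window seen from \<open>x\<close>, \<open>piece p\<close> the set of points with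
  pattern \<open>p\<close>, and \<open>moved g p\<close> its image under \<open>g\<close>.\<close>

definition pat :: "'x \<Rightarrow> 'g \<Rightarrow> nat" where
  "pat x = restrict (\<lambda>g. c (\<alpha> g x)) V"

definition piece :: "('g \<Rightarrow> nat) \<Rightarrow> 'x set" where
  "piece p = {x \<in> space M. pat x = p}"

definition moved :: "'g \<Rightarrow> ('g \<Rightarrow> nat) \<Rightarrow> 'x set" where
  "moved g p = {y \<in> space M. pat (\<alpha> (inv g) y) = p}"

abbreviation fixes_at :: "'x set \<Rightarrow> nat \<Rightarrow> bool" where
  "fixes_at Q i \<equiv> pm (proj Q) i = Some i"

lemma satI: "(\<And>x y. x \<in> space M \<Longrightarrow> y \<in> space M \<Longrightarrow> ty \<S> x = ty \<S> y \<Longrightarrow> P x \<Longrightarrow> P y) \<Longrightarrow>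
    {x \<in> space M. P x} \<in> sat \<S> (space M)"
  unfolding sat_def by blast

lemma finite_pat: "finite (pat ` space M)"
proof (rule finite_subset)
  show "pat ` space M \<subseteq> V \<rightarrow>\<^sub>E c ` space M"
    using V by (intro image_subsetI) (auto simp: pat_def)
  show "finite (V \<rightarrow>\<^sub>E c ` space M)" using V c by (intro finite_PiE) simp_all
qed

lemma pat_moved:
  assumes "x \<in> space M" "y \<in> space M" "ty \<S> x = ty \<S> y" "h \<in> V"
  shows "pat (\<alpha> (inv h) x) = pat (\<alpha> (inv h) y)"
proof (rule ext)
  fix g show "pat (\<alpha> (inv h) x) g = pat (\<alpha> (inv h) y) g"
  proof (cases "g \<in> V")
    case True
    then have "g \<in> carrier G" "h \<in> carrier G" using V assms by auto
    then show ?thesis using typ_c[OF assms(1,2,3) True assms(4)] assms True by (simp add: pat_def act_mult)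
  qed (simp add: pat_def)
qed

lemma pat_typ: "x \<in> space M \<Longrightarrow> y \<in> space M \<Longrightarrow> ty \<S> x = ty \<S> y \<Longrightarrow> pat x = pat y"
  using pat_moved[of x y \<one>] V by simp

lemma pieces_sat:
  "piece p \<in> sat \<S> (space M)"
  "h \<in> V \<Longrightarrow> moved h p \<in> sat \<S> (space M)"
  "h \<in> V \<Longrightarrow> moved h p \<inter> piece q \<in> sat \<S> (space M)"
  "h \<in> V \<Longrightarrow> piece q - moved h p \<inter> piece q \<in> sat \<S> (space M)"
  "{x \<in> space M. c x \<in> Q} \<in> sat \<S> (space M)"
proof -
  show "piece p \<in> sat \<S> (space M)" unfolding piece_def
  proof (rule satI)
    fix x y assume "x \<in> space M" "y \<in> space M" "ty \<S> x = ty \<S> y" "pat x = p"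
    then show "pat y = p" using pat_typ by metis
  qed
  show "moved h p \<in> sat \<S> (space M)" if h: "h \<in> V" for h p
    unfolding moved_def
  proof (rule satI)
    fix x y assume "x \<in> space M" "y \<in> space M" "ty \<S> x = ty \<S> y" "pat (\<alpha> (inv h) x) = p"
    then show "pat (\<alpha> (inv h) y) = p" using pat_moved[of x y h] h by metis
  qed
  have two: "{x \<in> space M. P (pat (\<alpha> (inv h) x)) \<and> pat x = q} \<in> sat \<S> (space M)" if h: "h \<in> V" for h q P
  proof (rule satI)
    fix x y assume *: "x \<in> space M" "y \<in> space M" "ty \<S> x = ty \<S> y" "P (pat (\<alpha> (inv h) x)) \<and> pat x = q"
    have "pat (\<alpha> (inv h) x) = pat (\<alpha> (inv h) y)" "pat x = pat y"
      using pat_moved[OF *(1-3) h] pat_typ[OF *(1-3)] by blast+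
    then show "P (pat (\<alpha> (inv h) y)) \<and> pat y = q" using *(4) by (simp only:)
  qed
  have "moved h p \<inter> piece q = {x \<in> space M. pat (\<alpha> (inv h) x) = p \<and> pat x = q}" for h q p
    unfolding moved_def piece_def by blast
  then show "moved h p \<inter> piece q \<in> sat \<S> (space M)" if "h \<in> V" for h q
    using two[OF that, of "\<lambda>r. r = p" q] by (simp only:)
  have "piece q - moved h p \<inter> piece q = {x \<in> space M. pat (\<alpha> (inv h) x) \<noteq> p \<and> pat x = q}" for h q p
    unfolding moved_def piece_def by blast
  then show "piece q - moved h p \<inter> piece q \<in> sat \<S> (space M)" if "h \<in> V" for h q
    using two[OF that, of "\<lambda>r. r \<noteq> p" q] by (simp only:)
  show "{x \<in> space M. c x \<in> Q} \<in> sat \<S> (space M)"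
  proof (rule satI)
    fix x y assume *: "x \<in> space M" "y \<in> space M" "ty \<S> x = ty \<S> y" "c x \<in> Q"
    then have "c x = c y" using typ_c[OF *(1-3) V(3) V(3)] by simp
    then show "c y \<in> Q" using *(4) by simp
  qed
qed

lemma bone_B: "bone \<in> \<B>" using VB[OF V(3)] by blast

lemma bad1_bone: "i < d \<Longrightarrow> i \<notin> bad1 V \<Longrightarrow> pm bone i = Some i"
  unfolding bad1_def by blast

lemma bad1_mult: "i < d \<Longrightarrow> i \<notin> bad1 V \<Longrightarrow> B \<in> \<B> \<Longrightarrow> C \<in> \<B> \<Longrightarrow> pm (bmul B C) i = Option.bind (pm C i) (pm B)"
  unfolding bad1_def by blast

lemma perm_pm: "g \<in> V \<Longrightarrow> i < d \<Longrightarrow> i \<notin> bad1 V \<Longrightarrow> pm (full g) i = Some (perm g i)"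
  using pm_perm V VB by blast

lemma proj_disj: "Q \<inter> R = {} \<Longrightarrow> proj Q \<inter> proj R = {}" by (auto simp: rect_def)

lemma proj_UN: "(\<Union>p\<in>P. proj (F p)) = proj (\<Union>p\<in>P. F p)" by (auto simp: rect_def)

lemma fixes_Union:
  assumes P: "finite P" and F: "\<And>p. p \<in> P \<Longrightarrow> F p \<in> sat \<S> (space M)"
    and disj: "\<And>p q. p \<in> P \<Longrightarrow> q \<in> P \<Longrightarrow> p \<noteq> q \<Longrightarrow> F p \<inter> F q = {}"
    and U: "(\<Union>p\<in>P. F p) = Q" "Q \<in> sat \<S> (space M)" and i: "i < d"
  shows "fixes_at Q i \<longleftrightarrow> (\<exists>p\<in>P. fixes_at (F p) i)"
    "p \<in> P \<Longrightarrow> q \<in> P \<Longrightarrow> fixes_at (F p) i \<Longrightarrow> fixes_at (F q) i \<Longrightarrow> p = q"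
proof -
  have 1: "proj (F p) \<in> \<B>" if "p \<in> P" for p using projB[OF F[OF that]] .
  have 2: "proj (F p) \<inter> proj (F q) = {}" if "p \<in> P" "q \<in> P" "p \<noteq> q" for p q
    using proj_disj[OF disj[OF that]] .
  have 3: "(\<Union>p\<in>P. proj (F p)) = proj Q" using proj_UN[of F P] U(1) by (simp only:)
  show "fixes_at Q i \<longleftrightarrow> (\<exists>p\<in>P. fixes_at (F p) i)"
    by (rule pm_Union(1)[where F = "\<lambda>p. proj (F p)", OF P 1 2 3 projB[OF U(2)] i])
  show "p \<in> P \<Longrightarrow> q \<in> P \<Longrightarrow> fixes_at (F p) i \<Longrightarrow> fixes_at (F q) i \<Longrightarrow> p = q"
    by (rule pm_Union(2)[where F = "\<lambda>p. proj (F p)", OF P 1 2 3 projB[OF U(2)] i])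
qed

lemma space_sat: "space M \<in> sat \<S> (space M)" unfolding sat_def by blast

lemma pat_exists:
  assumes i: "i < d" "i \<notin> bad1 V"
  shows "\<exists>p\<in>pat ` space M. fixes_at (piece p) i"
    "p \<in> pat ` space M \<Longrightarrow> q \<in> pat ` space M \<Longrightarrow> fixes_at (piece p) i \<Longrightarrow> fixes_at (piece q) i \<Longrightarrow> p = q"
proof -
  have U: "(\<Union>p\<in>pat ` space M. piece p) = space M" by (auto simp: piece_def)
  have D: "piece p \<inter> piece q = {}" if "p \<noteq> q" for p q using that by (auto simp: piece_def)
  note f = fixes_Union[OF finite_pat pieces_sat(1) D U space_sat i(1)]
  show "\<exists>p\<in>pat ` space M. fixes_at (piece p) i" using f(1) bad1_bone[OF i] by blast
  show "p \<in> pat ` space M \<Longrightarrow> q \<in> pat ` space M \<Longrightarrow> fixes_at (piece p) i \<Longrightarrow> fixes_at (piece q) i \<Longrightarrow> p = q"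
    using f(2) by blast
qed

text \<open>The projections onto the pieces sum to the projection onto the unit space, so outside the bad set
  exactly one of them fixes \<open>i\<close>. Its pattern at the unit is the colour of \<open>i\<close>; the default is some
  colour that occurs.\<close>

definition col :: "nat \<Rightarrow> nat" where
  "col i = (if \<exists>p\<in>pat ` space M. fixes_at (piece p) i
     then (SOME p. p \<in> pat ` space M \<and> fixes_at (piece p) i) \<one> else c (SOME x. x \<in> space M))"

lemma col_eq:
  assumes i: "i < d" "i \<notin> bad1 V" and p: "p \<in> pat ` space M" "fixes_at (piece p) i"
  shows "col i = p \<one>"
proof -
  have "(SOME p. p \<in> pat ` space M \<and> fixes_at (piece p) i) = p"
    using p pat_exists(2)[OF i] by (intro some_equality) blast+
  then show ?thesis unfolding col_def using p by auto
qed

lemma col_range: "col i \<in> c ` space M"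
proof (cases "\<exists>p\<in>pat ` space M. fixes_at (piece p) i")
  case True
  then have "(SOME p. p \<in> pat ` space M \<and> fixes_at (piece p) i) \<in> pat ` space M"
    using someI_ex[of "\<lambda>p. p \<in> pat ` space M \<and> fixes_at (piece p) i"] by blast
  then obtain x where x: "x \<in> space M" "(SOME p. p \<in> pat ` space M \<and> fixes_at (piece p) i) = pat x" by blast
  then show ?thesis using True V by (auto simp: col_def pat_def)
next
  case False
  have "(SOME x. x \<in> space M) \<in> space M" using M.not_empty by (intro some_in_eq[THEN iffD2])
  then show ?thesis using False by (auto simp: col_def)
qed

lemma bad1_subset: "bad1 V \<subseteq> bad V" by (auto simp: bad_def)

text \<open>For the colours: \<open>g\<close> carries the piece of \<open>i\<close> to its image under \<open>g\<close>, and by multiplicativity the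
  projection onto that image fixes \<open>perm g i\<close>. So the image meets the piece of \<open>perm g i\<close>, and a common
  point of both relates the two patterns.\<close>

lemma good_pt_outside_bad:
  assumes i: "i < d" "i \<notin> bad V"
  shows "good_pt perm col V c i"
  unfolding good_pt_def
proof (intro conjI ballI impI)
  have i1: "i \<notin> bad1 V" using i bad1_subset by blast
  have j1: "perm g i < d" "perm g i \<notin> bad1 V" if "g \<in> V" for g
    using i that perm_lt[OF i(1)] i1 unfolding bad_def by blast+
  show "perm g (perm h i) = perm (g \<otimes> h) i" if g: "g \<in> V" and h: "h \<in> V" and gh: "g \<otimes> h \<in> V" for g h
  proof -
    have gc: "g \<in> carrier G" "h \<in> carrier G" using g h V by auto
    have "bmul (full g) (full h) = full (g \<otimes> h)"
      using gc by (subst bmul_rect) (auto intro!: arg_cong[where f = "rect _"])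
    then have "Some (perm (g \<otimes> h) i) = pm (bmul (full g) (full h)) i"
      using perm_pm[OF gh i(1) i1] by simp
    also have "\<dots> = pm (full g) (perm h i)"
      using bad1_mult[OF i(1) i1] VB[OF g] VB[OF h] perm_pm[OF h i(1) i1] by simp
    also have "\<dots> = Some (perm g (perm h i))" using perm_pm[OF g j1[OF h]] .
    finally show ?thesis by simp
  qed
  show "g = \<one>" if g: "g \<in> V" and f: "perm g i = i" for g
  proof (rule ccontr)
    assume ne: "g \<noteq> \<one>"
    have "pm (full g) i = Some i" using perm_pm[OF g i(1) i1] f by simp
    then show False using i(1) i1 g ne unfolding bad1_def by blast
  qed
  obtain p where p: "p \<in> pat ` space M" "fixes_at (piece p) i" using pat_exists(1)[OF i(1) i1] by blast
  then obtain x where x: "x \<in> space M" "p = pat x" by blast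
  show "\<exists>x\<in>space M. \<forall>g\<in>V. col (perm g i) = c (\<alpha> g x)"
  proof (intro bexI[of _ x] ballI x)
    fix g assume g: "g \<in> V"
    then have gc: "g \<in> carrier G" using V by auto
    let ?j = "perm g i"
    note j = j1[OF g]
    have sub: "piece p \<subseteq> space M" "moved g p \<subseteq> space M" by (auto simp: piece_def moved_def)
    have "bmul (full g) (proj (piece p)) = rect g (piece p)"
      using gc sub by (subst bmul_rect) (auto intro!: arg_cong[where f = "rect _"])
    moreover have "bmul (proj (moved g p)) (full g) = rect g (piece p)"
      using gc sub by (subst bmul_rect) (auto intro!: arg_cong[where f = "rect _"] simp: moved_def piece_def)
    ultimately have "pm (bmul (full g) (proj (piece p))) i = pm (bmul (proj (moved g p)) (full g)) i"
      by simp
    then have fm: "fixes_at (moved g p) ?j"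
      using bad1_mult[OF i(1) i1] VB[OF g] projB pieces_sat(1,2) g p(2) perm_pm[OF g i(1) i1] by simp
    have "(\<Union>q\<in>pat ` space M. moved g p \<inter> piece q) = moved g p" by (auto simp: moved_def piece_def)
    note U = this
    have D: "(moved g p \<inter> piece q) \<inter> (moved g p \<inter> piece r) = {}" if "q \<noteq> r" for q r
      using that by (auto simp: piece_def)
    have "fixes_at (moved g p) ?j \<longleftrightarrow> (\<exists>q\<in>pat ` space M. fixes_at (moved g p \<inter> piece q) ?j)"
      by (rule fixes_Union(1)[where F = "\<lambda>q. moved g p \<inter> piece q",
            OF finite_pat pieces_sat(3)[OF g] D U pieces_sat(2)[OF g] j(1)])
    then obtain q where q: "q \<in> pat ` space M" "fixes_at (moved g p \<inter> piece q) ?j"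
      using fm by blast
    have "proj (piece q) - proj (moved g p \<inter> piece q) = proj (piece q - moved g p \<inter> piece q)"
      by (auto simp: rect_def)
    then have "fixes_at (piece q) ?j"
      using pm_mono[OF projB projB _ _ j(1) q(2), of "piece q"] projB pieces_sat(1,3,4) g
      by (simp add: rect_def Sigma_mono)
    then have cj: "col ?j = q \<one>" using col_eq[OF j q(1)] by simp
    have "moved g p \<inter> piece q \<noteq> {}"
      using q(2) pm_empty[OF j(1)] by (auto simp: rect_def)
    then obtain y where y: "y \<in> space M" "pat (\<alpha> (inv g) y) = p" "pat y = q" by (auto simp: moved_def piece_def)
    have "q \<one> = c y" using y V by (auto simp: pat_def)
    also have "\<dots> = p g" using y gc g by (auto simp: pat_def)
    also have "\<dots> = c (\<alpha> g x)" using x g by (simp add: pat_def)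
    finally show "col ?j = c (\<alpha> g x)" unfolding cj .
  qed
qed

text \<open>The trace of the projection onto a set of colours counts the points it fixes.\<close>

lemma card_col:
  "\<bar>real (card {i. i < d \<and> col i \<in> Q}) - real d * measure M {x \<in> space M. c x \<in> Q}\<bar>
     \<le> real (card (bad V)) + \<delta> * real d"
proof -
  let ?Z = "{x \<in> space M. c x \<in> Q}"
  let ?F = "{i. i < d \<and> fixes_at ?Z i}"
  let ?C = "{i. i < d \<and> col i \<in> Q}"
  have sl: "slice (proj ?Z) \<one> = ?Z" by (auto simp: rect_def)
  have t: "\<bar>real (card ?F) - real d * measure M ?Z\<bar> \<le> \<delta> * real d"
    using pm_trace[OF projB[OF pieces_sat(5)[of Q]]] unfolding sl .
  have eq: "col i \<in> Q \<longleftrightarrow> fixes_at ?Z i" if i: "i < d" "i \<notin> bad V" for i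
  proof -
    have i1: "i \<notin> bad1 V" using i bad1_subset by blast
    let ?P = "{p \<in> pat ` space M. p \<one> \<in> Q}"
    have pc: "pat x \<one> = c x" if "x \<in> space M" for x using that V by (simp add: pat_def)
    have "(\<Union>p\<in>?P. piece p) = {x \<in> space M. pat x \<one> \<in> Q}" by (auto simp: piece_def)
    also have "\<dots> = ?Z" using pc by (intro Collect_cong conj_cong refl) simp
    finally have "(\<Union>p\<in>?P. piece p) = ?Z" .
    moreover have "piece p \<inter> piece q = {}" if "p \<noteq> q" for p q using that by (auto simp: piece_def)
    ultimately have f: "fixes_at ?Z i \<longleftrightarrow> (\<exists>p\<in>?P. fixes_at (piece p) i)"
      using finite_pat by (intro fixes_Union(1) pieces_sat i(1)) auto
    obtain p where p: "p \<in> pat ` space M" "fixes_at (piece p) i" using pat_exists(1)[OF i(1) i1] by blast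
    show ?thesis
      unfolding f col_eq[OF i(1) i1 p]
    proof
      assume "p \<one> \<in> Q"
      then show "\<exists>p\<in>?P. fixes_at (piece p) i" using p by (intro bexI[of _ p]) simp_all
    next
      assume "\<exists>p\<in>?P. fixes_at (piece p) i"
      then obtain q where q: "q \<in> ?P" "fixes_at (piece q) i" by (rule bexE)
      then have "q = p" using pat_exists(2)[OF i(1) i1 _ p(1) q(2) p(2)] by simp
      then show "p \<one> \<in> Q" using q(1) by simp
    qed
  qed
  have fb: "finite (bad V)" by (rule finite_subset[of _ "{..<d}"]) (auto simp: bad_def bad1_def)
  have "card A \<le> card B + card (bad V)" if "A \<subseteq> B \<union> bad V" "finite B" for A B :: "nat set"
    using card_mono[OF _ that(1)] card_Un_le[of B "bad V"] that(2) fb by (meson finite_UnI order_trans)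
  then have "card ?C \<le> card ?F + card (bad V)"
    "card ?F \<le> card ?C + card (bad V)"
  proof -
    assume le: "\<And>A B. A \<subseteq> B \<union> bad V \<Longrightarrow> finite B \<Longrightarrow> card A \<le> card B + card (bad V)"
    show "card ?C \<le> card ?F + card (bad V)"
      by (rule le) (use eq in blast, simp)
    show "card ?F \<le> card ?C + card (bad V)"
      by (rule le) (use eq in blast, simp)
  qed
  then show ?thesis using t by linarith
qed

lemma perm_model:
  assumes "real (card (bad V)) + \<delta> * real d \<le> \<epsilon> * real d"
  shows "model V c \<epsilon> d perm col"
proof -
  have "bad V \<subseteq> {..<d}" by (auto simp: bad_def bad1_def)
  then have "finite (bad V)" by (rule finite_subset) simp
  moreover have "{i. i < d \<and> \<not> good_pt perm col V c i} \<subseteq> bad V" using good_pt_outside_bad by blast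
  ultimately have "card {i. i < d \<and> \<not> good_pt perm col V c i} \<le> card (bad V)" by (rule card_mono)
  moreover have "0 \<le> \<delta> * real d" using \<delta> by simp
  moreover have "\<bar>real (card {i. i < d \<and> col i \<in> Q}) - real d * measure M {x \<in> space M. c x \<in> Q}\<bar> \<le> \<epsilon> * real d" for Q
    using card_col[of Q] assms by linarith
  ultimately show ?thesis
    unfolding model_def using assms perm_lt col_range by (auto simp: perm_def)
qed

text \<open>Off a small set, the column of an arbitrary bisection is read off from the permutations and
  the projections onto its pieces.\<close>

definition select :: "('g \<times> 'x) set \<Rightarrow> 'g set \<Rightarrow> nat \<Rightarrow> 'g set" where
  "select B W i = {g \<in> W. fixes_at (slice B g) i}"

lemma pm_select:
  assumes i: "i < d" "i \<notin> bad V" and B: "B \<in> \<B>" and W: "W \<subseteq> V"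
    and sl: "\<And>g. g \<in> W \<Longrightarrow> slice B g \<in> sat \<S> (space M)" "tail B W \<in> sat \<S> (space M)"
    and pc: "\<And>g. g \<in> W \<Longrightarrow> rect g (slice B g) \<in> \<B> \<and> B - rect g (slice B g) \<in> \<B>"
    and t: "\<not> fixes_at (tail B W) i"
  shows "select B W i = {} \<Longrightarrow> pm B i = None" "g \<in> select B W i \<Longrightarrow> pm B i = Some (perm g i)"
proof -
  have i1: "i \<notin> bad1 V" using i bad1_subset by blast
  have bB: "bis B" using B \<B> by auto
  show "pm B i = Some (perm g i)" if g: "g \<in> select B W i"
  proof -
    have gW: "g \<in> W" "g \<in> V" "g \<in> carrier G" and f: "fixes_at (slice B g) i"
      using g W V by (auto simp: select_def)
    have "bmul (full g) (proj (slice B g)) = rect g (slice B g)"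
      using gW by (subst bmul_rect) (auto intro!: arg_cong[where f = "rect _"])
    then have "pm (rect g (slice B g)) i = Option.bind (pm (proj (slice B g)) i) (pm (full g))"
      using bad1_mult[OF i(1) i1, of "full g" "proj (slice B g)"] VB[OF gW(2)] projB[OF sl(1)[OF gW(1)]] by simp
    then have "pm (rect g (slice B g)) i = Some (perm g i)"
      using f perm_pm[OF gW(2) i(1) i1] by simp
    moreover have "rect g (slice B g) \<subseteq> B" by (auto simp: rect_def)
    ultimately show ?thesis using pm_mono[OF B _ _ _ i(1)] pc[OF gW(1)] by blast
  qed
  show "pm B i = None" if e: "select B W i = {}"
  proof -
    let ?R = "{x \<in> space M. \<forall>g. (g, x) \<notin> B}"
    let ?F = "\<lambda>k. case k of None \<Rightarrow> tail B W | Some None \<Rightarrow> ?R | Some (Some g) \<Rightarrow> slice B g"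
    let ?P = "{None, Some None} \<union> (\<lambda>g. Some (Some g)) ` W"
    have R: "?R \<in> sat \<S> (space M)"
    proof (rule satI)
      fix x y assume xy: "x \<in> space M" "y \<in> space M" "ty \<S> x = ty \<S> y" "\<forall>g. (g, x) \<notin> B"
      show "\<forall>g. (g, y) \<notin> B"
      proof (rule ccontr)
        assume "\<not> (\<forall>g. (g, y) \<notin> B)"
        then obtain g where "(g, y) \<in> B" by blast
        then have "y \<in> tail B W \<or> (g \<in> W \<and> y \<in> slice B g)" using xy by (auto simp: tail_def)
        then have "x \<in> tail B W \<or> x \<in> slice B g"
          using sl(2) sl(1)[of g] xy(1,2) xy(3)[symmetric] unfolding sat_def by blast
        then show False using xy(4) by (auto simp: tail_def)
      qed
    qed
    have "finite W" using W V(1) by (rule finite_subset)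
    then have fin: "finite ?P" by simp
    have sat: "?F k \<in> sat \<S> (space M)" if "k \<in> ?P" for k using that sl R by auto
    have disj: "?F k \<inter> ?F l = {}" if "k \<in> ?P" "l \<in> ?P" "k \<noteq> l" for k l
      using that bisD(4)[OF bB] by (auto simp: tail_def split: option.splits)
    have U: "(\<Union>k\<in>?P. ?F k) = space M" by (auto simp: tail_def)
    have "\<exists>k\<in>?P. fixes_at (?F k) i"
      using fixes_Union(1)[OF fin sat disj U space_sat i(1)] bad1_bone[OF i(1) i1] by blast
    then have fR: "fixes_at ?R i" using t e by (auto simp: select_def)
    have "bmul B (proj ?R) = {}" by (auto simp: bmul_def rect_def)
    moreover have "pm (bmul B (proj ?R)) i = Option.bind (pm (proj ?R) i) (pm B)"
      by (rule bad1_mult[OF i(1) i1 B projB[OF R]])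
    ultimately have "pm {} i = pm B i" using fR by simp
    then show ?thesis using pm_empty[OF i(1)] by simp
  qed
qed

end

context pmp_action begin

abbreviation pick :: "('b \<Rightarrow> nat \<Rightarrow> 'g set) \<Rightarrow> ('g \<Rightarrow> nat \<Rightarrow> nat) \<Rightarrow> 'b \<Rightarrow> nat \<Rightarrow> nat option" where
  "pick \<eta> \<sigma> B i \<equiv> (if \<eta> B i = {} then None else Some (\<sigma> (SOME g. g \<in> \<eta> B i) i))"

text \<open>The operators to be tested are those of the enlarged window, all projections of the finite algebra
  that it generates, and the slices and complements needed to read off the members of \<open>\<E>\<close>.
  Here \<open>\<eta> B i\<close> is the set of group elements by which \<open>B\<close> moves \<open>i\<close>.\<close>

lemma SA_model:
  assumes \<E>: "finite \<E>" "\<E> \<subseteq> Collect bis" and W: "finite W" "W \<subseteq> carrier G"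
    and p: "(V, c, \<epsilon>) \<in> params" and \<rho>: "\<rho> > 0"
    and tl: "\<And>B. B \<in> \<E> \<Longrightarrow> measure M (tail B W) < \<rho>"
  obtains \<B> \<delta> where "finite \<B>" "\<B> \<subseteq> Collect bis" "\<delta> > 0" "\<And>d \<phi>. d > 0 \<Longrightarrow> \<phi> \<in> SA \<G> (s_op ` \<B>) 2 \<delta> d \<Longrightarrow>
    (\<forall>B\<in>\<E>. \<phi> (s_op B) \<in> partial_perm_mats d) \<and>
    (\<exists>\<sigma>\<in>models V c \<epsilon> d. \<exists>\<eta>. (\<forall>B i. \<eta> B i \<subseteq> W) \<and> (\<forall>B\<in>\<E>.
      real (card {i. i < d \<and> colf d (\<phi> (s_op B)) i \<noteq> pick \<eta> \<sigma> B i})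
        \<le> 2 * \<rho> * real d))"
proof -
  have V: "finite V" "V \<subseteq> carrier G" and c: "c \<in> M \<rightarrow>\<^sub>M count_space UNIV" "finite (c ` space M)" and \<epsilon>: "\<epsilon> > 0"
    using p by (auto simp: params_def)
  define V' where "V' = V \<union> W \<union> {\<one>}"
  have V': "finite V'" "V' \<subseteq> carrier G" "\<one> \<in> V'" "V \<subseteq> V'" "W \<subseteq> V'" using V W by (auto simp: V'_def)
  define \<S> where "\<S> = (\<lambda>(g, h, v). {x \<in> space M. c (\<alpha> (g \<otimes> inv h) x) = v}) ` (V' \<times> V' \<times> c ` space M)
     \<union> (\<lambda>(B, g). slice B g) ` (\<E> \<times> W) \<union> (\<lambda>B. tail B W) ` \<E>"
  have finS: "finite \<S>"
  proof -
    have "finite (V' \<times> V' \<times> c ` space M)" "finite (\<E> \<times> W)" using V'(1) c(2) \<E>(1) W(1) by blast+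
    then show ?thesis unfolding \<S>_def using \<E>(1) by blast
  qed
  have mS: "\<S> \<subseteq> sets M"
  proof -
    have "{x \<in> space M. c (\<alpha> g x) = v} \<in> sets M" if "g \<in> carrier G" for g v
      using measurable_compose[OF act_measurable[OF that] c(1)] unfolding measurable_colour_iff by blast
    then show ?thesis
      unfolding \<S>_def using V' \<E> W bisD(3) tail_sets by (auto simp: subset_iff)
  qed
  define \<B> where "\<B> = (\<lambda>g. full g) ` (V' \<union> (\<lambda>g. inv g) ` V') \<union> rect \<one> ` sat \<S> (space M) \<union> \<E>
     \<union> (\<lambda>(B, g). rect g (slice B g)) ` (\<E> \<times> W) \<union> (\<lambda>(B, g). B - rect g (slice B g)) ` (\<E> \<times> W)"
  have finB: "finite \<B>" unfolding \<B>_def using V' \<E> W finite_sat[OF finS]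
    by (intro finite_UnI finite_imageI finite_cartesian_product) auto
  have bisB: "\<B> \<subseteq> Collect bis"
  proof -
    have "bis (B - rect g (slice B g))" if B: "bis B" and g: "g \<in> carrier G" for B g
    proof (rule bis_subset[OF B])
      fix h assume "h \<in> carrier G"
      have "slice (B - rect g (slice B g)) h = (if h = g then {} else slice B h)" by (auto simp: rect_def)
      then show "slice (B - rect g (slice B g)) h \<in> sets M" using bisD(3)[OF B \<open>h \<in> carrier G\<close>] by simp
    qed auto
    moreover have "bis (rect g (slice B g))" if "bis B" "g \<in> carrier G" for B g
      using that by (intro bis_rect bisD(3))
    moreover have "bis (rect \<one> Q)" if "Q \<in> sat \<S> (space M)" for Q
      using sat_sets[OF finS mS that] by (intro bis_rect) auto
    moreover have "bis (full g)" if "g \<in> carrier G" for g using that by (intro bis_rect) auto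
    moreover have "inv g \<in> carrier G" if "g \<in> V'" for g using V' that by auto
    ultimately show ?thesis unfolding \<B>_def using V' \<E> W
      by (simp only: Un_subset_iff image_subset_iff) (fastforce simp only: mem_Collect_eq split_beta mem_Times_iff subset_iff Un_iff image_iff)
  qed
  \<comment> \<open>The factor by which the bad set exceeds \<open>\<delta> * d\<close>, see \<open>card_bad\<close>.\<close>
  define n2 where "n2 = (1 + real (card V')) * (1 + (real (card \<B>))\<^sup>2 + real (card V'))"
  have n2: "n2 \<ge> 0" unfolding n2_def by (intro mult_nonneg_nonneg add_nonneg_nonneg) auto
  define \<delta> where "\<delta> = min 1 (min (\<epsilon> / (n2 + 1)) (\<rho> / (n2 + 1)))"
  have \<delta>: "0 < \<delta>" "\<delta> \<le> 1" using n2 \<epsilon> \<rho> by (auto simp: \<delta>_def)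
  have d1: "(n2 + 1) * \<delta> \<le> \<epsilon>" "(n2 + 1) * \<delta> \<le> \<rho>"
  proof -
    have "(n2 + 1) * \<delta> \<le> (n2 + 1) * (\<epsilon> / (n2 + 1))" "(n2 + 1) * \<delta> \<le> (n2 + 1) * (\<rho> / (n2 + 1))"
      using n2 by (intro mult_left_mono; simp add: \<delta>_def)+
    then show "(n2 + 1) * \<delta> \<le> \<epsilon>" "(n2 + 1) * \<delta> \<le> \<rho>" using n2 by auto
  qed
  show thesis
  proof (rule that[OF finB bisB \<delta>(1)], intro conjI)
    fix d :: nat and \<phi> assume d: "d > 0" and \<phi>: "\<phi> \<in> SA \<G> (s_op ` \<B>) 2 \<delta> d"
    interpret approx_data G M \<alpha> \<B> \<delta> d \<phi> V' c \<S>
    proof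
      show "\<phi> \<in> SA \<G> (s_op ` \<B>) 2 \<delta> d" by fact
      show "\<B> \<subseteq> Collect bis" "finite \<B>" "0 < \<delta>" "\<delta> \<le> 1" "0 < d" by fact+
      show "finite V'" "V' \<subseteq> carrier G" "\<one> \<in> V'" "finite (c ` space M)" by fact+
      show "full g \<in> \<B> \<and> full (inv g) \<in> \<B>" if "g \<in> V'" for g
        using that unfolding \<B>_def by blast
      show "rect \<one> Q \<in> \<B>" if "Q \<in> sat \<S> (space M)" for Q using that unfolding \<B>_def by blast
      fix x y g h assume *: "x \<in> space M" "y \<in> space M" "ty \<S> x = ty \<S> y" "g \<in> V'" "h \<in> V'"
      have gh: "g \<otimes> inv h \<in> carrier G" using * V' by auto
      let ?S = "{z \<in> space M. c (\<alpha> (g \<otimes> inv h) z) = c (\<alpha> (g \<otimes> inv h) x)}"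
      have "?S = (\<lambda>(g, h, v). {x \<in> space M. c (\<alpha> (g \<otimes> inv h) x) = v}) (g, h, c (\<alpha> (g \<otimes> inv h) x))" by simp
      moreover have "(g, h, c (\<alpha> (g \<otimes> inv h) x)) \<in> V' \<times> V' \<times> c ` space M"
        using * act_closed[OF gh *(1)] by blast
      ultimately have "?S \<in> \<S>" unfolding \<S>_def by blast
      from ty_eqD[OF *(3) this] have "x \<in> ?S \<longleftrightarrow> y \<in> ?S" .
      then show "c (\<alpha> (g \<otimes> inv h) x) = c (\<alpha> (g \<otimes> inv h) y)" using * by simp
    qed
    have bd: "real (card (bad V')) \<le> n2 * \<delta> * real d"
      using card_bad[OF V(1,2) VB bone_B] unfolding n2_def by (simp only: mult.assoc)
    then have "real (card (bad V')) + \<delta> * real d \<le> (n2 + 1) * \<delta> * real d" by (simp add: algebra_simps)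
    also have le_\<epsilon>: "\<dots> \<le> \<epsilon> * real d" using d1 by (intro mult_right_mono) auto
    finally have "model V' c \<epsilon> d perm col" by (rule perm_model)
    then have m: "perm \<in> models V c \<epsilon> d" unfolding models_def using model_mono V'(4) by blast
    have sE: "slice B g \<in> sat \<S> (space M)" if "B \<in> \<E>" "g \<in> W" for B g
      using that unfolding \<S>_def by (intro sat_member) blast+
    have sT: "tail B W \<in> sat \<S> (space M)" if "B \<in> \<E>" for B
      using that unfolding \<S>_def by (intro sat_member) (blast, auto simp: tail_def)
    have EB: "B \<in> \<B>" if "B \<in> \<E>" for B using that unfolding \<B>_def by blast
    have pcs: "rect g (slice B g) \<in> \<B> \<and> B - rect g (slice B g) \<in> \<B>" if "B \<in> \<E>" "g \<in> W" for B g
      using that unfolding \<B>_def by blast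
    have "real (card {i. i < d \<and> colf d (\<phi> (s_op B)) i \<noteq>
        (if select B W i = {} then None else Some (perm (SOME g. g \<in> select B W i) i))}) \<le> 2 * \<rho> * real d" (is "real (card ?D) \<le> _")
      if B: "B \<in> \<E>" for B
    proof -
      let ?T = "{i. i < d \<and> fixes_at (tail B W) i}"
      have "?D \<subseteq> bad V' \<union> ?T"
      proof
        fix i assume i: "i \<in> ?D"
        show "i \<in> bad V' \<union> ?T"
        proof (rule ccontr)
          assume n: "i \<notin> bad V' \<union> ?T"
          have ps: "select B W i = {} \<Longrightarrow> pm B i = None" "g \<in> select B W i \<Longrightarrow> pm B i = Some (perm g i)" for g
            using pm_select[of i B W] i n EB[OF B] V'(5) sE[OF B] sT[OF B] pcs[OF B] by blast+
          show False
          proof (cases "select B W i = {}")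
            case True then show False using ps(1) i by (simp add: pm_def)
          next
            case False
            then have "(SOME g. g \<in> select B W i) \<in> select B W i" unfolding some_in_eq .
            from ps(2)[OF this] have eq: "pm B i = Some (perm (SOME g. g \<in> select B W i) i)" .
            have "pm B i \<noteq> (if select B W i = {} then None else Some (perm (SOME g. g \<in> select B W i) i))"
              using i unfolding pm_def by blast
            then show ?thesis unfolding if_not_P[OF False] using eq by (rule notE)
          qed
        qed
      qed
      moreover have "finite (bad V' \<union> ?T)"
        by (rule finite_subset[of _ "{..<d}"]) (auto simp: bad_def bad1_def)
      ultimately have "card ?D \<le> card (bad V') + card ?T"
        by (intro order_trans[OF card_mono card_Un_le])
      moreover have "real (card ?T) \<le> real d * \<rho> + \<delta> * real d"
      proof -
        have "slice (proj (tail B W)) \<one> = tail B W" by (auto simp: rect_def tail_def)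
        then have "real (card ?T) \<le> real d * measure M (tail B W) + \<delta> * real d"
          using pm_trace[OF projB[OF sT[OF B]]] by simp
        also have "\<dots> \<le> real d * \<rho> + \<delta> * real d" using tl[OF B] by (intro add_right_mono mult_left_mono) auto
        finally show ?thesis .
      qed
      moreover have "(n2 + 1) * \<delta> * real d \<le> \<rho> * real d" using d1 by (intro mult_right_mono) auto
      ultimately show ?thesis using bd by (simp add: algebra_simps)
    qed
    moreover have "select B W i \<subseteq> W" for B i by (auto simp: select_def)
    ultimately show "\<exists>\<sigma>\<in>models V c \<epsilon> d. \<exists>\<eta>. (\<forall>B i. \<eta> B i \<subseteq> W) \<and> (\<forall>B\<in>\<E>.
      real (card {i. i < d \<and> colf d (\<phi> (s_op B)) i \<noteq> pick \<eta> \<sigma> B i})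
        \<le> 2 * \<rho> * real d)"
      using m by (intro bexI[of _ perm] exI[of _ "\<lambda>B i. select B W i"]) blast+
    show "\<forall>B\<in>\<E>. \<phi> (s_op B) \<in> partial_perm_mats d" using pm_ppm EB by blast
  qed
qed

text \<open>An approximation on \<open>\<E>\<close> is close in Hamming distance to the data consisting of a model on \<open>W\<close> and
  a choice function with finitely many values, of which there are exponentially many.\<close>

lemma SA_card_le:
  assumes \<E>: "finite \<E>" "\<E> \<subseteq> Collect bis" and W: "finite W" "W \<subseteq> carrier G"
    and p: "(V, c, \<epsilon>) \<in> params" and \<beta>: "\<beta> > 0"
    and tl: "\<And>B. B \<in> \<E> \<Longrightarrow> measure M (tail B W) < \<beta> / (4 * (real (card \<E>) + 1))"
  obtains \<B> \<delta> where "finite \<B>" "\<B> \<subseteq> Collect bis" "\<delta> > 0" "\<And>d. d > 0 \<Longrightarrow>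
    finite ((\<lambda>\<phi>. restrict \<phi> (s_op ` \<E>)) ` SA \<G> (s_op ` \<B>) 2 \<delta> d) \<and>
    real (card ((\<lambda>\<phi>. restrict \<phi> (s_op ` \<E>)) ` SA \<G> (s_op ` \<B>) 2 \<delta> d)) \<le>
      real (card (model_count W V c \<epsilon> d)) *
      ((2 ^ card \<E> * 2 ^ (card W * card \<E>)) ^ d * (real d + 1) powr (\<beta> * real d))"
proof -
  let ?\<rho> = "\<beta> / (4 * (real (card \<E>) + 1))"
  have \<rho>: "?\<rho> > 0" using \<beta> by simp
  show thesis
  proof (rule SA_model[OF \<E> W p \<rho> tl])
  fix \<B> and \<delta> :: real assume \<B>: "finite \<B>" "\<B> \<subseteq> Collect bis" "\<delta> > 0" and key: "\<And>d \<phi>. d > 0 \<Longrightarrow> \<phi> \<in> SA \<G> (s_op ` \<B>) 2 \<delta> d \<Longrightarrow>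
    (\<forall>B\<in>\<E>. \<phi> (s_op B) \<in> partial_perm_mats d) \<and>
    (\<exists>\<sigma>\<in>models V c \<epsilon> d. \<exists>\<eta>. (\<forall>B i. \<eta> B i \<subseteq> W) \<and> (\<forall>B\<in>\<E>.
      real (card {i. i < d \<and> colf d (\<phi> (s_op B)) i \<noteq> pick \<eta> \<sigma> B i})
        \<le> 2 * ?\<rho> * real d))"
  show thesis
  proof (rule that[OF \<B>])
    fix d :: nat assume d: "d > 0"
    let ?SA = "SA \<G> (s_op ` \<B>) 2 \<delta> d"
    let ?I = "\<E> \<times> {..<d}" and ?Y = "{None} \<union> Some ` {..<d}"
    let ?e = "\<lambda>r. restrict (\<lambda>(B, i). colf d (r (s_op B)) i) ?I"
    let ?R = "(\<lambda>\<phi>. restrict \<phi> (s_op ` \<E>)) ` ?SA"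
    let ?val = "\<lambda>t \<eta>. (\<lambda>(B, i). if \<eta> (B, i) = {} then None else Some (t (SOME g. g \<in> \<eta> (B, i), i)))"
    define m where "m = nat \<lfloor>\<beta> * real d\<rfloor>"
    have mle: "real m \<le> \<beta> * real d" unfolding m_def using \<beta> by simp
    define Rel where "Rel s t\<eta> \<longleftrightarrow> (\<forall>B\<in>\<E>. real (card {i. i < d \<and> s (B, i) \<noteq> ?val (fst t\<eta>) (snd t\<eta>) (B, i)}) \<le> 2 * ?\<rho> * real d)"
      for s :: "('g \<times> 'x) set \<times> nat \<Rightarrow> nat option" and t\<eta> :: "('g \<times> nat \<Rightarrow> nat) \<times> (('g \<times> 'x) set \<times> nat \<Rightarrow> 'g set)"
    have ppm: "r (s_op B) \<in> partial_perm_mats d" if "r \<in> ?R" "B \<in> \<E>" for r B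
      using that key[OF d] by auto
    have inj: "inj_on ?e ?R"
    proof (rule inj_onI)
      fix r r' assume r: "r \<in> ?R" "r' \<in> ?R" and e: "?e r = ?e r'"
      show "r = r'"
      proof (rule extensionalityI[of _ "s_op ` \<E>"])
        fix a assume "a \<in> s_op ` \<E>"
        then obtain B where B: "B \<in> \<E>" "a = s_op B" by blast
        have "colf d (r (s_op B)) i = colf d (r' (s_op B)) i" if "i < d" for i
          using fun_cong[OF e, of "(B, i)"] B that by simp
        then have "pmat d (colf d (r (s_op B))) = pmat d (colf d (r' (s_op B)))"
          by (subst pmat_eq_iff) (use colf_pmat(2) ppm r B in auto)
        then show "r a = r' a" using colf_pmat(1)[OF ppm[OF r(1) B(1)]] colf_pmat(1)[OF ppm[OF r(2) B(1)]] B(2) by simp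
      qed (use r in auto)
    qed
    let ?T = "model_count W V c \<epsilon> d \<times> (?I \<rightarrow>\<^sub>E Pow W)"
    have I: "finite ?I" using \<E> by simp
    have "card (?e ` ?R) \<le> card ?T * (2 ^ card ?I * card ?Y ^ m)"
    proof (rule hamming_card[where R = Rel])
      show "finite ?I" by fact
      show "finite ?Y" "?Y \<noteq> {}" by auto
      show "finite ?T"
        by (intro finite_cartesian_product finite_model_count W(1) finite_PiE[OF I]) (simp add: W(1))
      show "?e ` ?R \<subseteq> ?I \<rightarrow>\<^sub>E ?Y"
      proof (rule image_subsetI)
        fix r assume r: "r \<in> ?R"
        have "colf d (r (s_op B)) i \<in> ?Y" if "B \<in> \<E>" "i < d" for B i
          using colf_pmat(2)[OF ppm[OF r that(1)]] that(2) unfolding pfun_def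
          by (cases "colf d (r (s_op B)) i") auto
        then show "?e r \<in> ?I \<rightarrow>\<^sub>E ?Y" unfolding restrict_PiE_iff by auto
      qed
      show "\<exists>t\<in>?T. Rel s t" if sR: "s \<in> ?e ` ?R" for s
      proof -
        obtain r where r: "s = ?e r" "r \<in> ?R" using sR by (rule imageE)
        from r(2) obtain \<phi> where \<phi>': "r = restrict \<phi> (s_op ` \<E>)" "\<phi> \<in> ?SA" by (rule imageE)
        have \<phi>: "\<phi> \<in> ?SA" "s = ?e (restrict \<phi> (s_op ` \<E>))" using r(1) \<phi>' by simp_all
        obtain \<sigma> where \<sigma>: "\<sigma> \<in> models V c \<epsilon> d" and ex: "\<exists>\<eta>. (\<forall>B i. \<eta> B i \<subseteq> W) \<and> (\<forall>B\<in>\<E>.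
          real (card {i. i < d \<and> colf d (\<phi> (s_op B)) i \<noteq> pick \<eta> \<sigma> B i})
          \<le> 2 * ?\<rho> * real d)"
          using conjunct2[OF key[OF d \<phi>(1)]] by (rule bexE)
        obtain \<eta> where \<eta>: "(\<forall>B i. \<eta> B i \<subseteq> W) \<and> (\<forall>B\<in>\<E>.
          real (card {i. i < d \<and> colf d (\<phi> (s_op B)) i \<noteq> pick \<eta> \<sigma> B i})
          \<le> 2 * ?\<rho> * real d)"
          using ex by (rule exE)
        have se2: "\<eta> B i \<subseteq> W" for B i using conjunct1[OF \<eta>] by blast
        note se = \<sigma> se2 bspec[OF conjunct2[OF \<eta>]]
        let ?t = "(restr W d \<sigma>, restrict (\<lambda>(B, i). \<eta> B i) ?I)"
        have "Rel s ?t"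
          unfolding Rel_def
        proof
          fix B assume B: "B \<in> \<E>"
          have "s (B, i) = colf d (\<phi> (s_op B)) i \<and> ?val (fst ?t) (snd ?t) (B, i) = pick \<eta> \<sigma> B i"
            if "i < d" for i
          proof -
            have "(SOME g. g \<in> \<eta> B i) \<in> W" if "\<eta> B i \<noteq> {}" using that se(2) some_in_eq by blast
            then show ?thesis using B that \<phi>(2) by (simp add: restr_def)
          qed
          then have "{i. i < d \<and> s (B, i) \<noteq> ?val (fst ?t) (snd ?t) (B, i)} =
            {i. i < d \<and> colf d (\<phi> (s_op B)) i \<noteq> pick \<eta> \<sigma> B i}"
            by (intro Collect_cong) (metis (no_types, lifting))
          then show "real (card {i. i < d \<and> s (B, i) \<noteq> ?val (fst ?t) (snd ?t) (B, i)}) \<le> 2 * ?\<rho> * real d"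
            using se(3)[OF B] by simp
        qed
        moreover have "?t \<in> ?T" using se by (auto simp: model_count_def)
        ultimately show ?thesis by blast
      qed
      fix s s' t assume s: "Rel s t" "Rel s' t"
      let ?D = "\<lambda>s B. {i. i < d \<and> s (B, i) \<noteq> ?val (fst t) (snd t) (B, i)}"
      have "{k \<in> ?I. s k \<noteq> s' k} \<subseteq> (\<Union>B\<in>\<E>. Pair B ` (?D s B \<union> ?D s' B))"
      proof (rule subsetI)
        fix k assume k: "k \<in> {k \<in> ?I. s k \<noteq> s' k}"
        obtain B i where Bi: "k = (B, i)" by (cases k)
        have B: "B \<in> \<E>" "i < d" "s (B, i) \<noteq> s' (B, i)" using k Bi by auto
        have "s (B, i) \<noteq> v \<or> s' (B, i) \<noteq> v" for v using B(3) by metis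
        from this[of "?val (fst t) (snd t) (B, i)"] have "i \<in> ?D s B \<union> ?D s' B" using B(2) by blast
        then show "k \<in> (\<Union>B\<in>\<E>. Pair B ` (?D s B \<union> ?D s' B))"
          unfolding Bi by (intro UN_I[OF B(1)] imageI)
      qed
      then have "card {k \<in> ?I. s k \<noteq> s' k} \<le> card (\<Union>B\<in>\<E>. Pair B ` (?D s B \<union> ?D s' B))"
        using \<E>(1) by (intro card_mono finite_UN_I finite_imageI) auto
      also have "\<dots> \<le> (\<Sum>B\<in>\<E>. card (Pair B ` (?D s B \<union> ?D s' B)))" by (rule card_UN_le[OF \<E>(1)])
      also have "\<dots> \<le> (\<Sum>B\<in>\<E>. card (?D s B) + card (?D s' B))"
        by (intro sum_mono order_trans[OF card_image_le card_Un_le]) auto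
      finally have "real (card {k \<in> ?I. s k \<noteq> s' k}) \<le> real (\<Sum>B\<in>\<E>. card (?D s B) + card (?D s' B))"
        by (simp only: of_nat_le_iff)
      also have "\<dots> = (\<Sum>B\<in>\<E>. real (card (?D s B)) + real (card (?D s' B)))" by simp
      also have "\<dots> \<le> (\<Sum>B\<in>\<E>. 2 * ?\<rho> * real d + 2 * ?\<rho> * real d)"
        using s unfolding Rel_def by (intro sum_mono add_mono) blast+
      also have "\<dots> = (real (card \<E>) / (real (card \<E>) + 1)) * (\<beta> * real d)"
      proof -
        have "N * (2 * (\<beta> / (4 * X)) * D + 2 * (\<beta> / (4 * X)) * D) = N / X * (\<beta> * D)" for N X D :: real by simp
        then show ?thesis by (simp only: sum_constant)
      qed
      also have "\<dots> \<le> 1 * (\<beta> * real d)" using \<beta> by (intro mult_right_mono) (auto simp: divide_simps)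
      finally show "card {k \<in> ?I. s k \<noteq> s' k} \<le> m" unfolding m_def by (simp add: le_nat_floor)
    qed
    moreover have "card (?e ` ?R) = card ?R" by (rule card_image[OF inj])
    moreover have "card ?I = card \<E> * d" by (simp add: card_cartesian_product)
    moreover have "card ?T = card (model_count W V c \<epsilon> d) * 2 ^ (card W * (card \<E> * d))"
      using I W by (simp add: card_cartesian_product card_PiE card_Pow power_mult)
    moreover have "card ?Y = d + 1"
      by (subst card_Un_disjoint) (auto simp: card_image)
    ultimately have "card ?R \<le> card (model_count W V c \<epsilon> d) * 2 ^ (card W * (card \<E> * d)) * (2 ^ (card \<E> * d) * (d + 1) ^ m)"
      by simp
    then have "real (card ?R) \<le> real (card (model_count W V c \<epsilon> d) * 2 ^ (card W * (card \<E> * d)) * (2 ^ (card \<E> * d) * (d + 1) ^ m))"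
      by (simp only: of_nat_le_iff)
    also have "\<dots> = real (card (model_count W V c \<epsilon> d)) * ((2 ^ card \<E> * 2 ^ (card W * card \<E>)) ^ d * (real d + 1) ^ m)"
      by (simp add: power_mult_distrib power_mult[symmetric] mult.assoc add.commute)
    also have "\<dots> \<le> real (card (model_count W V c \<epsilon> d)) * ((2 ^ card \<E> * 2 ^ (card W * card \<E>)) ^ d * (real d + 1) powr (\<beta> * real d))"
    proof (intro mult_left_mono)
      have "(real d + 1) ^ m = (real d + 1) powr real m" by (simp add: powr_realpow)
      also have "\<dots> \<le> (real d + 1) powr (\<beta> * real d)" using mle by (intro powr_mono) auto
      finally show "(real d + 1) ^ m \<le> (real d + 1) powr (\<beta> * real d)" .
    qed auto
    finally have le: "real (card ?R) \<le> real (card (model_count W V c \<epsilon> d)) * ((2 ^ card \<E> * 2 ^ (card W * card \<E>)) ^ d * (real d + 1) powr (\<beta> * real d))" .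
    have "finite ?R"
    proof (rule finite_imageD[OF _ inj])
      show "finite (?e ` ?R)"
      proof (rule finite_subset)
        show "?e ` ?R \<subseteq> ?I \<rightarrow>\<^sub>E ?Y"
        proof (rule image_subsetI)
          fix r assume r: "r \<in> ?R"
          have "colf d (r (s_op B)) i \<in> ?Y" if "B \<in> \<E>" "i < d" for B i
            using colf_pmat(2)[OF ppm[OF r that(1)]] that(2) unfolding pfun_def
            by (cases "colf d (r (s_op B)) i") auto
          then show "?e r \<in> ?I \<rightarrow>\<^sub>E ?Y" unfolding restrict_PiE_iff by auto
        qed
        show "finite (?I \<rightarrow>\<^sub>E ?Y)" using I by (intro finite_PiE) auto
      qed
    qed
    with le show "finite ?R \<and> real (card ?R) \<le> real (card (model_count W V c \<epsilon> d)) *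
      ((2 ^ card \<E> * 2 ^ (card W * card \<E>)) ^ d * (real d + 1) powr (\<beta> * real d))" by blast
  qed
qed
qed

lemma log_card_SA_eq: "log_card_SA \<G> E F n \<delta> d = log_rate d ((\<lambda>\<phi>. restrict \<phi> E) ` SA \<G> F n \<delta> d)"
  by (simp add: log_card_SA_def log_rate_def)

text \<open>For given \<open>\<E>\<close> the window \<open>W\<close> is chosen first, so large that the tails of the bisections are small.
  Then every parameter of the models is dominated by some choice of test operators.\<close>

theorem sofic_dim_le_model_dim:
  assumes L: "limit_like L"
  shows "sofic_dim_along L \<G> \<le> model_dim L"
  unfolding sofic_dim_along_def
proof (rule SUP_least)
  fix E assume "E \<in> {E. finite E \<and> E \<subseteq> inv_semigroup \<G>}"
  then obtain \<E> where \<E>: "finite \<E>" "\<E> \<subseteq> Collect bis" "E = s_op ` \<E>"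
    unfolding inv_semigroup_eq by (metis (no_types, lifting) finite_subset_image mem_Collect_eq)
  let ?X = "INF F\<in>{F. finite F \<and> F \<subseteq> inv_semigroup \<G>}. INF n\<in>{1..}. INF \<delta>\<in>{0<..}. L (log_card_SA \<G> E F n \<delta>)"
  show "?X \<le> model_dim L"
  proof (rule ereal_le_epsilon2)
    fix e :: real assume e: "e > 0"
    have "e / 2 / (4 * (real (card \<E>) + 1)) > 0" using e by simp
    from finite_window[OF \<E>(1,2) this] obtain W where W: "finite W" "W \<subseteq> carrier G"
      "\<And>B. B \<in> \<E> \<Longrightarrow> measure M (tail B W) < e / 2 / (4 * (real (card \<E>) + 1))" by blast
    have each: "?X \<le> L (\<lambda>d. log_rate d (model_count W V c \<epsilon> d)) + ereal e" if p: "(V, c, \<epsilon>) \<in> params" for V c \<epsilon>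
    proof -
      show ?thesis
      proof (rule SA_card_le[OF \<E>(1,2) W(1,2) p half_gt_zero[OF e] W(3)])
      fix \<B> and \<delta> :: real assume \<B>: "finite \<B>" "\<B> \<subseteq> Collect bis" "\<delta> > 0" and le: "\<And>d. d > 0 \<Longrightarrow>
        finite ((\<lambda>\<phi>. restrict \<phi> (s_op ` \<E>)) ` SA \<G> (s_op ` \<B>) 2 \<delta> d) \<and>
        real (card ((\<lambda>\<phi>. restrict \<phi> (s_op ` \<E>)) ` SA \<G> (s_op ` \<B>) 2 \<delta> d)) \<le>
          real (card (model_count W V c \<epsilon> d)) *
          ((2 ^ card \<E> * 2 ^ (card W * card \<E>)) ^ d * (real d + 1) powr (e / 2 * real d))"
      have "?X \<le> L (log_card_SA \<G> E (s_op ` \<B>) 2 \<delta>)"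
      proof -
        have "s_op ` \<B> \<in> {F. finite F \<and> F \<subseteq> inv_semigroup \<G>}"
          using \<B> unfolding inv_semigroup_eq by blast
        then have "?X \<le> (INF n\<in>{1..}. INF \<delta>\<in>{0<..}. L (log_card_SA \<G> E (s_op ` \<B>) n \<delta>))"
          by (rule INF_lower)
        also have "\<dots> \<le> (INF \<delta>\<in>{0<..}. L (log_card_SA \<G> E (s_op ` \<B>) 2 \<delta>))" by (rule INF_lower) simp
        also have "\<dots> \<le> L (log_card_SA \<G> E (s_op ` \<B>) 2 \<delta>)" by (rule INF_lower) (use \<B> in simp)
        finally show ?thesis .
      qed
      also have "\<dots> \<le> L (\<lambda>d. log_rate d (model_count W V c \<epsilon> d)) + ereal e"
      proof -
        have K: "(1::real) \<le> 2 ^ card \<E> * 2 ^ (card W * card \<E>)"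
          by (rule order_trans[OF _ mult_mono[of 1 _ 1]]) auto
        have "\<forall>\<^sub>F d in sequentially. log_card_SA \<G> E (s_op ` \<B>) 2 \<delta> d \<le> log_rate d (model_count W V c \<epsilon> d) + ereal e"
        proof -
          have "e / 2 < e" using e by simp
          from eventually_log_rate_le[OF K this, where 'a = "('g \<times> 'x) l2_op \<Rightarrow> complex mat" and 'b = "'g \<times> nat \<Rightarrow> nat"] eventually_gt_at_top[of 0] show ?thesis
          proof eventually_elim
            case (elim d)
            have "log_rate d ((\<lambda>\<phi>. restrict \<phi> (s_op ` \<E>)) ` SA \<G> (s_op ` \<B>) 2 \<delta> d)
               \<le> log_rate d (model_count W V c \<epsilon> d) + ereal e"
              using elim(1) le[OF elim(2)] finite_model_count[OF W(1)] by blast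
            then show ?case by (simp only: log_card_SA_eq \<E>(3))
          qed
        qed
        then show ?thesis by (rule L[unfolded limit_like_def, rule_format])
      qed
      finally show ?thesis .
      qed
    qed
    have "?X - ereal e \<le> (INF (V, c, \<epsilon>)\<in>params. L (\<lambda>d. log_rate d (model_count W V c \<epsilon> d)))"
    proof (rule INF_greatest)
      fix p assume "p \<in> params"
      then show "?X - ereal e \<le> (case p of (V, c, \<epsilon>) \<Rightarrow> L (\<lambda>d. log_rate d (model_count W V c \<epsilon> d)))"
        using each by (cases p) (auto simp: ereal_minus_le_iff add.commute)
    qed
    also have "\<dots> \<le> model_dim L"
      unfolding model_dim_def by (rule SUP_upper) (use W in blast)
    finally show "?X \<le> model_dim L + ereal e" by (simp add: ereal_minus_le_iff add.commute)
  qed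
qed

end

section \<open>From models to operator approximations\<close>

text \<open>The window \<open>V\<close> of the model contains quotients and products from \<open>W0\<close>, the group elements that the
  bisections in \<open>\<W>\<close> use up to a small tail, and the colouring \<open>c\<close> decides membership in their slices.\<close>

locale model_data = pmp_action G M \<alpha>
  for G :: "('g, 'm) monoid_scheme" (structure) and M :: "'x measure" and \<alpha> +
  fixes V W0 :: "'g set" and c :: "'x \<Rightarrow> nat" and \<epsilon> :: real and d :: nat
    and \<sigma> :: "'g \<Rightarrow> nat \<Rightarrow> nat" and \<kappa> :: "nat \<Rightarrow> nat" and \<W> :: "('g \<times> 'x) set set"
  assumes W0: "finite W0" "W0 \<subseteq> V" "\<one> \<in> W0" and V: "V \<subseteq> carrier G"
    and V_inv: "\<And>g. g \<in> W0 \<Longrightarrow> inv g \<in> V"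
    and V_mult: "\<And>g h. g \<in> W0 \<Longrightarrow> h \<in> W0 \<Longrightarrow> g \<otimes> h \<in> V"
    and V_inv_mult: "\<And>g h. g \<in> W0 \<Longrightarrow> h \<in> W0 \<Longrightarrow> inv g \<otimes> h \<in> V"
    and c: "c \<in> M \<rightarrow>\<^sub>M count_space UNIV" "finite (c ` space M)"
    and model: "model V c \<epsilon> d \<sigma> \<kappa>"
    and d: "d > 0"
    and \<W>: "\<W> \<subseteq> Collect bis"
    and slice_c: "\<And>C g x y. \<lbrakk>C \<in> \<W>; g \<in> W0; x \<in> space M; y \<in> space M; c x = c y; (g, x) \<in> C\<rbrakk> \<Longrightarrow> (g, y) \<in> C"
    and tail_c: "\<And>C x y. \<lbrakk>C \<in> \<W>; x \<in> space M; y \<in> space M; c x = c y; x \<in> tail C W0\<rbrakk> \<Longrightarrow> y \<in> tail C W0"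
    and tail_small: "\<And>C. C \<in> \<W> \<Longrightarrow> measure M (tail C W0) \<le> \<epsilon>"
begin

definition atom :: "nat \<Rightarrow> 'x set" where "atom q = {x \<in> space M. c x = q}"

definition Good :: "nat set" where
  "Good = {i. i < d \<and> good_pt \<sigma> \<kappa> V c i \<and> measure M (atom (\<kappa> i)) \<noteq> 0}"

text \<open>A point of the space that shows the pattern of colours around \<open>i\<close>; a good point is moved by a
  bisection as its base point is.\<close>

definition base :: "nat \<Rightarrow> 'x" where
  "base i = (SOME x. x \<in> space M \<and> (\<forall>g\<in>V. \<kappa> (\<sigma> g i) = c (\<alpha> g x)))"

lemma atom_sets: "atom q \<in> sets M"
  using c(1) unfolding measurable_colour_iff atom_def by blast

lemma Good_lt: "i \<in> Good \<Longrightarrow> i < d" by (simp add: Good_def)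

lemma Good_mult: "i \<in> Good \<Longrightarrow> g \<in> V \<Longrightarrow> h \<in> V \<Longrightarrow> g \<otimes> h \<in> V \<Longrightarrow> \<sigma> g (\<sigma> h i) = \<sigma> (g \<otimes> h) i"
  by (auto simp: Good_def good_pt_def)

lemma Good_free: "i \<in> Good \<Longrightarrow> g \<in> V \<Longrightarrow> \<sigma> g i = i \<Longrightarrow> g = \<one>"
  by (auto simp: Good_def good_pt_def)

lemma base:
  assumes "i \<in> Good"
  shows "base i \<in> space M" "g \<in> V \<Longrightarrow> \<kappa> (\<sigma> g i) = c (\<alpha> g (base i))"
proof -
  have "\<exists>x. x \<in> space M \<and> (\<forall>g\<in>V. \<kappa> (\<sigma> g i) = c (\<alpha> g x))"
    using assms by (auto simp: Good_def good_pt_def)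
  from someI_ex[OF this] show "base i \<in> space M" "g \<in> V \<Longrightarrow> \<kappa> (\<sigma> g i) = c (\<alpha> g (base i))"
    unfolding base_def by blast+
qed

lemma \<sigma>_one: "i < d \<Longrightarrow> \<sigma> \<one> i = i" using model by (simp add: model_def)

lemma \<sigma>_lt: "i < d \<Longrightarrow> \<sigma> g i < d" using model by (simp add: model_def)

lemma base_c: "i \<in> Good \<Longrightarrow> \<kappa> i = c (base i)"
proof -
  assume i: "i \<in> Good"
  have "\<one> \<in> V" using W0 by blast
  from base(2)[OF i this] show ?thesis using \<sigma>_one[OF Good_lt[OF i]] base(1)[OF i] by simp
qed

lemma W0_carrier: "g \<in> W0 \<Longrightarrow> g \<in> carrier G" using W0 V by auto

lemma W0_V: "g \<in> W0 \<Longrightarrow> g \<in> V" using W0 by auto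

lemma \<epsilon>_nonneg: "\<epsilon> \<ge> 0"
proof -
  have "0 \<le> real (card {i. i < d \<and> \<not> good_pt \<sigma> \<kappa> V c i})" by simp
  also have "\<dots> \<le> \<epsilon> * real d" using model by (simp add: model_def)
  finally show ?thesis using d by (simp add: zero_le_mult_iff)
qed

lemma card_\<kappa>: "\<bar>real (card {i. i < d \<and> \<kappa> i \<in> Q}) - real d * measure M {x \<in> space M. c x \<in> Q}\<bar> \<le> \<epsilon> * real d"
  using model unfolding model_def by blast

lemma card_not_Good: "real (card {i. i < d \<and> i \<notin> Good}) \<le> 2 * \<epsilon> * real d"
proof -
  let ?N = "{q. measure M (atom q) = 0}"
  let ?A = "{i. i < d \<and> \<not> good_pt \<sigma> \<kappa> V c i}" and ?B = "{i. i < d \<and> \<kappa> i \<in> ?N}"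
  have "{i. i < d \<and> i \<notin> Good} \<subseteq> ?A \<union> ?B"
    using model by (auto simp: Good_def model_def)
  then have "card {i. i < d \<and> i \<notin> Good} \<le> card ?A + card ?B"
    by (intro order_trans[OF card_mono card_Un_le]) auto
  moreover have "measure M {x \<in> space M. c x \<in> ?N} = 0" using null_colour_set[OF c] unfolding atom_def .
  then have "real (card ?B) \<le> \<epsilon> * real d" using card_\<kappa>[of ?N] by simp
  moreover have "real (card ?A) \<le> \<epsilon> * real d" using model by (simp add: model_def)
  ultimately show ?thesis by linarith
qed

definition pf :: "('g \<times> 'x) set \<Rightarrow> nat \<Rightarrow> nat option" where
  "pf C i = (if i \<in> Good \<and> (\<exists>g\<in>W0. (g, base i) \<in> C)
     then Some (\<sigma> (THE g. g \<in> W0 \<and> (g, base i) \<in> C) i) else None)"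

lemma pf_Some:
  assumes "bis C" "i \<in> Good" "g \<in> W0" "(g, base i) \<in> C"
  shows "pf C i = Some (\<sigma> g i)"
proof -
  have "(THE g. g \<in> W0 \<and> (g, base i) \<in> C) = g"
    using assms bisD(4)[OF assms(1)] by (intro the_equality) blast+
  then show ?thesis using assms by (auto simp: pf_def)
qed

lemma pf_SomeE:
  assumes "bis C" "pf C i = Some j"
  obtains g where "i \<in> Good" "g \<in> W0" "(g, base i) \<in> C" "j = \<sigma> g i"
proof -
  have "i \<in> Good" "\<exists>g\<in>W0. (g, base i) \<in> C" using assms(2) by (auto simp: pf_def split: if_splits)
  then obtain g where "i \<in> Good" "g \<in> W0" "(g, base i) \<in> C" by blast
  then show ?thesis using pf_Some[OF assms(1)] assms(2) that by auto
qed

lemma pf_pfun: "bis C \<Longrightarrow> pfun d (pf C)"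
  unfolding pfun_def by (auto elim!: pf_SomeE simp: \<sigma>_lt)

text \<open>If two good points had the same image, the range map of \<open>C\<close> would not be injective at their
  base points.\<close>

lemma pf_pinj: assumes C: "C \<in> \<W>" shows "pinj d (pf C)"
  unfolding pinj_def
proof (intro allI impI)
  fix i k j assume "pf C i = Some j" "pf C k = Some j"
  have bC: "bis C" using C \<W> by auto
  obtain g where g: "i \<in> Good" "g \<in> W0" "(g, base i) \<in> C" "j = \<sigma> g i" using \<open>pf C i = Some j\<close> pf_SomeE[OF bC] by metis
  obtain h where h: "k \<in> Good" "h \<in> W0" "(h, base k) \<in> C" "j = \<sigma> h k" using \<open>pf C k = Some j\<close> pf_SomeE[OF bC] by metis
  have gc: "g \<in> carrier G" "h \<in> carrier G" using g h W0_carrier by auto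
  have "i = \<sigma> (inv g) (\<sigma> g i)"
    using Good_mult[OF g(1) V_inv[OF g(2)] W0_V[OF g(2)]] gc W0_V[OF W0(3)] \<sigma>_one[OF Good_lt[OF g(1)]] by simp
  also have "\<dots> = \<sigma> (inv g \<otimes> h) k"
    using Good_mult[OF h(1) V_inv[OF g(2)] W0_V[OF h(2)] V_inv_mult[OF g(2) h(2)]] g(4) h(4) by simp
  finally have i: "i = \<sigma> (inv g \<otimes> h) k" .
  let ?y = "\<alpha> (inv g \<otimes> h) (base k)"
  have y: "?y \<in> space M" using gc base(1)[OF h(1)] by simp
  have "c (base i) = c ?y"
    using base_c[OF g(1)] base(2)[OF h(1) V_inv_mult[OF g(2) h(2)]] i by simp
  then have gy: "(g, ?y) \<in> C" using slice_c[OF C g(2) base(1)[OF g(1)] y] g(3) by blast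
  have "\<alpha> g ?y = \<alpha> h (base k)" using gc base(1)[OF h(1)] by (simp add: act_mult)
  then have "g = h" using bisD(5)[OF bC gy h(3)] by blast
  then show "i = k" using i gc \<sigma>_one[OF Good_lt[OF h(1)]] by simp
qed

text \<open>The matrix is given by averages over colour classes, which depend linearly on the operator. On the
  operators of interest the slices are unions of colour classes, so the averages are 0 or 1 and the
  matrix is \<open>pmat d (pf C)\<close>.\<close>

definition approx :: "('g \<times> 'x) l2_op \<Rightarrow> complex mat" where
  "approx = (\<lambda>a\<in>ispan. mat d d (\<lambda>(j, i). if i \<in> Good
     then \<Sum>g\<in>{g \<in> W0. \<sigma> g i = j}. avg g (atom (\<kappa> i)) a else 0))"

lemma approx_linear: "approx \<in> linear_maps \<G> d"
proof -
  have add: "op_add \<G> a b \<in> ispan" if "a \<in> ispan" "b \<in> ispan" for a b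
    using that by (rule op_span.add)
  have scale: "op_scale \<G> z a \<in> ispan" if "a \<in> ispan" for a z
    using that by (rule op_span.scale)
  have "approx (op_add \<G> a b) = approx a + approx b" if "a \<in> ispan" "b \<in> ispan" for a b
    using that add[OF that] W0_carrier atom_sets
    by (intro eq_matI) (auto simp: approx_def avg_add sum.distrib)
  moreover have "approx (op_scale \<G> z a) = z \<cdot>\<^sub>m approx a" if "a \<in> ispan" for a z
    using that scale[OF that] W0_carrier atom_sets
    by (intro eq_matI) (auto simp: approx_def avg_scale sum_distrib_left)
  moreover have "approx \<in> ispan \<rightarrow>\<^sub>E carrier_mat d d" by (auto simp: approx_def)
  ultimately show ?thesis unfolding linear_maps_def by blast
qed

lemma approx_s_op:
  assumes C: "bis C" and sc: "\<And>g x y. \<lbrakk>g \<in> W0; x \<in> space M; y \<in> space M; c x = c y; (g, x) \<in> C\<rbrakk> \<Longrightarrow> (g, y) \<in> C"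
  shows "approx (s_op C) = pmat d (pf C)"
proof (rule eq_matI)
  fix j i assume "j < dim_row (pmat d (pf C))" "i < dim_col (pmat d (pf C))"
  then have ij: "j < d" "i < d" by auto
  have "(if i \<in> Good then \<Sum>g\<in>{g \<in> W0. \<sigma> g i = j}. avg g (atom (\<kappa> i)) (s_op C) else 0) = (if pf C i = Some j then 1 else 0)"
  proof (cases "i \<in> Good")
    case True
    have av: "avg g (atom (\<kappa> i)) (s_op C) = (if (g, base i) \<in> C then 1 else 0)" if g: "g \<in> W0" for g
    proof -
      have "slice C g \<inter> atom (\<kappa> i) = (if (g, base i) \<in> C then atom (\<kappa> i) else {})"
        using sc[OF g _ base(1)[OF True]] sc[OF g base(1)[OF True]] base_c[OF True] by (auto simp: atom_def)
      moreover have "measure M (atom (\<kappa> i)) \<noteq> 0" using True by (simp add: Good_def)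
      ultimately show ?thesis using avg_s_op[OF C W0_carrier[OF g] atom_sets] by simp
    qed
    have "(\<Sum>g\<in>{g \<in> W0. \<sigma> g i = j}. avg g (atom (\<kappa> i)) (s_op C)) = (\<Sum>g\<in>{g \<in> W0. \<sigma> g i = j}. if (g, base i) \<in> C then 1 else 0)"
      by (intro sum.cong refl av) simp
    also have "\<dots> = (if pf C i = Some j then 1 else 0)"
    proof (cases "pf C i = Some j")
      case True
      then obtain g where g: "g \<in> W0" "(g, base i) \<in> C" "j = \<sigma> g i" by (auto elim: pf_SomeE[OF C])
      have "(\<Sum>h\<in>{h \<in> W0. \<sigma> h i = j}. if (h, base i) \<in> C then 1 else 0) = (\<Sum>h\<in>{h \<in> W0. \<sigma> h i = j}. if h = g then 1 else (0::complex))"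
        using g bisD(4)[OF C] by (intro sum.cong refl) auto
      then show ?thesis using g W0(1) True by simp
    next
      case False
      then have "(h, base i) \<notin> C" if "h \<in> W0" "\<sigma> h i = j" for h
        using pf_Some[OF C \<open>i \<in> Good\<close> that(1)] that(2) by auto
      then show ?thesis using False by simp
    qed
    finally show ?thesis using True by simp
  qed (simp add: pf_def)
  then show "approx (s_op C) $$ (j, i) = pmat d (pf C) $$ (j, i)"
    using ij s_op_span[OF C] by (simp add: approx_def)
qed (simp_all add: approx_def s_op_span[OF C])

lemma approx_\<W>: "C \<in> \<W> \<Longrightarrow> approx (s_op C) = pmat d (pf C)"
  using \<W> slice_c by (intro approx_s_op) blast+

lemma approx_rect:
  assumes g: "g \<in> W0"
  shows "approx (s_op (full g)) = pmat d (\<lambda>i. if i \<in> Good then Some (\<sigma> g i) else None)"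
proof -
  have b: "bis (full g)" using W0_carrier[OF g] by (intro bis_rect) auto
  have "pf (full g) i = (if i \<in> Good then Some (\<sigma> g i) else None)" for i
  proof (cases "i \<in> Good")
    case True
    then have "(g, base i) \<in> full g" using base(1) by (simp add: rect_def)
    then show ?thesis using pf_Some[OF b True g] True by simp
  qed (simp add: pf_def)
  then have "pf (full g) = (\<lambda>i. if i \<in> Good then Some (\<sigma> g i) else None)" by (rule ext)
  moreover have "approx (s_op (full g)) = pmat d (pf (full g))"
    by (rule approx_s_op[OF b]) (auto simp: rect_def)
  ultimately show ?thesis by simp
qed

definition tl_pts :: "('g \<times> 'x) set \<Rightarrow> nat set" where
  "tl_pts C = {i. i < d \<and> \<kappa> i \<in> c ` tail C W0}"

lemma card_tl: assumes C: "C \<in> \<W>" shows "real (card (tl_pts C)) \<le> 2 * \<epsilon> * real d"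
proof -
  have "x \<in> tail C W0 \<longleftrightarrow> c x \<in> c ` tail C W0" if x: "x \<in> space M" for x
  proof
    assume "c x \<in> c ` tail C W0"
    then obtain y where y: "c x = c y" "y \<in> tail C W0" by (rule imageE)
    then have "y \<in> space M" by (simp add: tail_def)
    from tail_c[OF C this x y(1)[symmetric] y(2)] show "x \<in> tail C W0" .
  qed (rule imageI)
  moreover have "tail C W0 \<subseteq> space M" by (auto simp: tail_def)
  ultimately have "{x \<in> space M. c x \<in> c ` tail C W0} = tail C W0" by blast
  then have "real (card (tl_pts C)) \<le> real d * measure M (tail C W0) + \<epsilon> * real d"
    using card_\<kappa>[of "c ` tail C W0"] by (simp add: tl_pts_def)
  also have "\<dots> \<le> real d * \<epsilon> + \<epsilon> * real d" using tail_small[OF C] by (intro add_right_mono mult_left_mono) auto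
  finally show ?thesis by simp
qed

lemma tl_ptsI: "C \<in> \<W> \<Longrightarrow> i \<in> Good \<Longrightarrow> g \<notin> W0 \<Longrightarrow> (g, base i) \<in> C \<Longrightarrow> i \<in> tl_pts C"
  unfolding tl_pts_def tail_def using base(1) base_c Good_lt by blast

text \<open>Multiplicativity can only fail at \<open>i\<close> if \<open>i\<close> or its image is not good, or if one of the bisections
  involved uses a group element outside \<open>W0\<close> there. These are five sets of at most \<open>2 * \<epsilon> * d\<close> points.\<close>

lemma pf_mult:
  assumes B: "B \<in> \<W>" and C: "C \<in> \<W>" and BC: "bmul B C \<in> \<W>"
  shows "real (card {i. i < d \<and> pf (bmul B C) i \<noteq> Option.bind (pf C i) (pf B)}) \<le> 10 * \<epsilon> * real d"
proof -
  let ?D = "{i. i < d \<and> pf (bmul B C) i \<noteq> Option.bind (pf C i) (pf B)}"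
  have b: "bis B" "bis C" "bis (bmul B C)" using B C BC \<W> by auto
  let ?N = "{i. i < d \<and> i \<notin> Good}"
  let ?pre = "\<lambda>Z. {i. i < d \<and> (\<exists>j\<in>Z. pf C i = Some j)}"
  let ?U = "?N \<union> ?pre ?N \<union> tl_pts (bmul B C) \<union> tl_pts C \<union> ?pre (tl_pts B)"
  have "?D \<subseteq>
     ?U"
  proof
    fix i assume "i \<in> ?D"
    then have i: "i < d" "pf (bmul B C) i \<noteq> Option.bind (pf C i) (pf B)" by auto
    show "i \<in> ?U"
    proof (rule ccontr)
      assume n: "i \<notin> ?U"
      then have iG: "i \<in> Good" using i by auto
      have outside: "k \<in> W0" if "(k, base i) \<in> C" for k using tl_ptsI[OF C iG _ that] n by blast
      have outside2: "k \<in> W0" if "(k, base i) \<in> bmul B C" for k using tl_ptsI[OF BC iG _ that] n by blast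
      show False
      proof (cases "pf C i")
        case None
        then have "(k, base i) \<notin> C" for k using outside pf_Some[OF b(2) iG] by fastforce
        then have "(k, base i) \<notin> bmul B C" for k unfolding bmul_def by auto
        then have "pf (bmul B C) i = None" by (simp add: pf_def)
        then show False using i None by simp
      next
        case (Some j)
        then obtain g where g: "g \<in> W0" "(g, base i) \<in> C" "j = \<sigma> g i" using pf_SomeE[OF b(2)] by metis
        have gc: "g \<in> carrier G" using W0_carrier[OF g(1)] .
        have j: "j < d" using g \<sigma>_lt i by simp
        have jG: "j \<in> Good" using n i j Some by blast
        have jt: "j \<notin> tl_pts B" using n i Some by blast
        let ?y = "\<alpha> g (base i)"
        have y: "?y \<in> space M" using gc base(1)[OF iG] by simp
        have cj: "c (base j) = c ?y" using base_c[OF jG] base(2)[OF iG W0_V[OF g(1)]] g(3) by simp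
        have outB: "h \<in> W0" if "(h, ?y) \<in> B" for h
        proof (rule ccontr)
          assume "h \<notin> W0"
          then have "?y \<in> tail B W0" using that y by (auto simp: tail_def)
          then have "j \<in> tl_pts B" unfolding tl_pts_def using j base_c[OF jG] cj by auto
          then show False using jt by blast
        qed
        show False
        proof (cases "\<exists>h. (h, ?y) \<in> B")
          case True
          then obtain h where h: "(h, ?y) \<in> B" by blast
          have hW: "h \<in> W0" using outB[OF h] .
          then have "(h, base j) \<in> B" using slice_c[OF B hW y base(1)[OF jG] cj[symmetric] h] by blast
          then have "Option.bind (pf C i) (pf B) = Some (\<sigma> h (\<sigma> g i))"
            using Some pf_Some[OF b(1) jG hW] g(3) by simp
          also have "\<dots> = Some (\<sigma> (h \<otimes> g) i)"
            using Good_mult[OF iG W0_V[OF hW] W0_V[OF g(1)] V_mult[OF hW g(1)]] by simp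
          also have "\<dots> = pf (bmul B C) i"
          proof (rule pf_Some[OF b(3) iG, symmetric])
            show *: "(h \<otimes> g, base i) \<in> bmul B C" unfolding bmul_def using g h by blast
            show "h \<otimes> g \<in> W0" by (rule outside2[OF *])
          qed
          finally show False using i(2) by simp
        next
          case False
          have "(h, base j) \<notin> B" if "h \<in> W0" for h
            using slice_c[OF B that base(1)[OF jG] y cj] False by blast
          then have 1: "pf B j = None" unfolding pf_def by auto
          have "(k, base i) \<notin> bmul B C" for k
            using False bisD(4)[OF b(2) g(2)] unfolding bmul_def by auto
          then have "pf (bmul B C) i = None" unfolding pf_def by auto
          then show False using i(2) Some 1 by simp
        qed
      qed
    qed
  qed
  moreover have fin: "finite (tl_pts X)" for X by (simp add: tl_pts_def)
  ultimately have "card ?D \<le>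
     card (?U)"
    by (intro card_mono) auto
  also have "\<dots> \<le> card ?N + card (?pre ?N) + card (tl_pts (bmul B C)) + card (tl_pts C) + card (?pre (tl_pts B))"
    by (intro order_trans[OF card_Un_le] add_mono order_refl)
  finally have le: "card ?D \<le>
    card ?N + card (?pre ?N) + card (tl_pts (bmul B C)) + card (tl_pts C) + card (?pre (tl_pts B))" .
  have pre: "card (?pre Z) \<le> card Z" if "finite Z" for Z
  proof (rule card_inj_on_le[of "\<lambda>i. the (pf C i)"])
    show "inj_on (\<lambda>i. the (pf C i)) (?pre Z)"
      using pf_pinj[OF C] unfolding pinj_def by (intro inj_onI) auto
  qed (use that in auto)
  have "real (card ?N) \<le> 2 * \<epsilon> * real d" "real (card (?pre ?N)) \<le> 2 * \<epsilon> * real d"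
    "real (card (tl_pts (bmul B C))) \<le> 2 * \<epsilon> * real d" "real (card (tl_pts C)) \<le> 2 * \<epsilon> * real d"
    "real (card (?pre (tl_pts B))) \<le> 2 * \<epsilon> * real d"
    using card_not_Good card_tl B C BC pre[of ?N] pre[OF fin[of B]] by (auto intro: order_trans[OF of_nat_mono])
  then show ?thesis using of_nat_mono[OF le, where 'a = real] by simp
qed

definition comp :: "('g \<times> 'x) set list \<Rightarrow> nat \<Rightarrow> nat option" where
  "comp Bs = foldr (\<lambda>B f i. Option.bind (f i) (pf B)) Bs Some"

lemma comp_pfun: "set Bs \<subseteq> Collect bis \<Longrightarrow> pfun d (comp Bs)"
proof (induction Bs)
  case Nil
  then show ?case by (simp add: comp_def pfun_def)
next
  case (Cons B Bs)
  show ?case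
    unfolding pfun_def
  proof (intro allI impI)
    fix i j assume i: "i < d" and e: "comp (B # Bs) i = Some j"
    then obtain k where "comp Bs i = Some k" "pf B k = Some j"
      by (cases "comp Bs i") (auto simp: comp_def)
    moreover have "pfun d (pf B)" using Cons.prems by (intro pf_pfun) simp
    moreover have "pfun d (comp Bs)" using Cons.prems by (intro Cons.IH) simp
    ultimately show "j < d" using i unfolding pfun_def by blast
  qed
qed

lemma comp_mat:
  "set Bs \<subseteq> Collect bis \<Longrightarrow> foldr (*) (map (\<lambda>B. pmat d (pf B)) Bs) (1\<^sub>m d) = pmat d (comp Bs)"
proof (induction Bs)
  case Nil
  show ?case by (simp add: comp_def pmat_one)
next
  case (Cons B Bs)
  then have "foldr (*) (map (\<lambda>B. pmat d (pf B)) (B # Bs)) (1\<^sub>m d) = pmat d (pf B) * pmat d (comp Bs)" by simp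
  also have "\<dots> = pmat d (\<lambda>i. Option.bind (comp Bs i) (pf B))"
    using Cons.prems by (intro pmat_mult comp_pfun) auto
  also have "(\<lambda>i. Option.bind (comp Bs i) (pf B)) = comp (B # Bs)" by (simp add: comp_def)
  finally show ?case .
qed

lemma comp_bprod:
  assumes "\<And>Cs. suffix Cs Bs \<Longrightarrow> bprod Cs \<in> \<W>" "set Bs \<subseteq> \<W>"
  shows "real (card {i. i < d \<and> pf (bprod Bs) i \<noteq> comp Bs i}) \<le> (real (length Bs) + 1) * (10 * \<epsilon> * real d)"
  using assms
proof (induction Bs)
  case Nil
  have b: "bis bone" by (rule bis_bone)
  have "pf bone i = Some i" if "i \<in> Good" for i
    using pf_Some[OF b that W0(3)] base(1)[OF that] \<sigma>_one[OF Good_lt[OF that]] by (simp add: rect_def)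
  then have "card {i. i < d \<and> pf (bprod []) i \<noteq> comp [] i} \<le> card {i. i < d \<and> i \<notin> Good}"
    by (intro card_mono) (auto simp: bprod_def comp_def)
  then have "real (card {i. i < d \<and> pf (bprod []) i \<noteq> comp [] i}) \<le> 2 * \<epsilon> * real d"
    using card_not_Good by linarith
  also have "\<dots> \<le> 10 * \<epsilon> * real d" using \<epsilon>_nonneg by (intro mult_right_mono) auto
  finally show ?case by simp
next
  case (Cons B Bs)
  let ?A = "{i. i < d \<and> pf (bprod Bs) i \<noteq> comp Bs i}"
  let ?B = "{i. i < d \<and> pf (bmul B (bprod Bs)) i \<noteq> Option.bind (pf (bprod Bs) i) (pf B)}"
  have "bprod (B # Bs) \<in> \<W>" "bprod Bs \<in> \<W>" "B \<in> \<W>" using Cons.prems(1)[of "B # Bs"] Cons.prems(1)[of Bs] Cons.prems(2) by (auto simp: suffix_Cons)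
  then have 1: "real (card ?B) \<le> 10 * \<epsilon> * real d" by (intro pf_mult) (auto simp: bprod_def)
  have 2: "real (card ?A) \<le> (real (length Bs) + 1) * (10 * \<epsilon> * real d)"
    using Cons.prems by (intro Cons.IH) (auto simp: suffix_Cons)
  have "{i. i < d \<and> pf (bprod (B # Bs)) i \<noteq> comp (B # Bs) i} \<subseteq> ?A \<union> ?B"
    by (auto simp: bprod_def comp_def)
  then have "card {i. i < d \<and> pf (bprod (B # Bs)) i \<noteq> comp (B # Bs) i} \<le> card ?A + card ?B"
    by (intro order_trans[OF card_mono card_Un_le]) auto
  then have "real (card {i. i < d \<and> pf (bprod (B # Bs)) i \<noteq> comp (B # Bs) i}) \<le> real (card ?A) + real (card ?B)"
    by linarith
  then show ?case using 1 2 by (simp add: algebra_simps)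
qed

text \<open>By freeness a good point is fixed precisely if the slice over the unit contains its base point, and
  this is visible from its colour.\<close>

lemma pf_trace:
  assumes C: "C \<in> \<W>"
  shows "\<bar>real (card {i. i < d \<and> pf C i = Some i}) - real d * measure M (slice C \<one>)\<bar> \<le> 3 * \<epsilon> * real d"
proof -
  have b: "bis C" using C \<W> by auto
  let ?A = "{i. i < d \<and> pf C i = Some i}" and ?B = "{i. i < d \<and> \<kappa> i \<in> c ` slice C \<one>}"
  let ?N = "{i. i < d \<and> i \<notin> Good}"
  have eq: "pf C i = Some i \<longleftrightarrow> \<kappa> i \<in> c ` slice C \<one>" if iG: "i \<in> Good" for i
  proof
    assume "pf C i = Some i"
    then obtain g where g: "g \<in> W0" "(g, base i) \<in> C" "i = \<sigma> g i" using pf_SomeE[OF b] by metis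
    then have "g = \<one>" using Good_free[OF iG W0_V] by metis
    then show "\<kappa> i \<in> c ` slice C \<one>" using g base(1)[OF iG] base_c[OF iG] by auto
  next
    assume "\<kappa> i \<in> c ` slice C \<one>"
    then obtain x where x: "x \<in> space M" "(\<one>, x) \<in> C" "c x = c (base i)" using base_c[OF iG] by auto
    then have "(\<one>, base i) \<in> C" using slice_c[OF C W0(3) x(1) base(1)[OF iG] x(3)] by blast
    then show "pf C i = Some i" using pf_Some[OF b iG W0(3)] \<sigma>_one[OF Good_lt[OF iG]] by simp
  qed
  have "card ?A \<le> card ?B + card ?N" "card ?B \<le> card ?A + card ?N"
    using eq by (intro order_trans[OF card_mono card_Un_le]; auto)+
  moreover have "(\<one>, x) \<in> C \<longleftrightarrow> c x \<in> c ` slice C \<one>" if x: "x \<in> space M" for x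
  proof
    assume "c x \<in> c ` slice C \<one>"
    then obtain y where y: "c x = c y" "y \<in> slice C \<one>" by (rule imageE)
    then have "y \<in> space M" "(\<one>, y) \<in> C" by simp_all
    from slice_c[OF C W0(3) this(1) x y(1)[symmetric] this(2)] show "(\<one>, x) \<in> C" .
  next
    assume "(\<one>, x) \<in> C"
    then show "c x \<in> c ` slice C \<one>" using x by (intro imageI) simp
  qed
  then have "{x \<in> space M. c x \<in> c ` slice C \<one>} = slice C \<one>" by blast
  then have "\<bar>real (card ?B) - real d * measure M (slice C \<one>)\<bar> \<le> \<epsilon> * real d"
    using card_\<kappa>[of "c ` slice C \<one>"] by simp
  ultimately show ?thesis using card_not_Good by linarith
qed

lemma approx_SA:
  assumes \<B>: "\<B> \<subseteq> Collect bis"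
    and words: "\<And>Bs. set Bs \<subseteq> \<B> \<union> binv ` \<B> \<Longrightarrow> length Bs \<le> n \<Longrightarrow> bprod Bs \<in> \<W>" "\<B> \<union> binv ` \<B> \<subseteq> \<W>"
    and \<delta>: "\<delta> > 0" "20 * \<epsilon> * (real n + 1) < \<delta>\<^sup>2" "3 * \<epsilon> < \<delta>"
  shows "approx \<in> SA \<G> (s_op ` \<B>) n \<delta> d"
  unfolding SA_iff[OF \<B>]
proof (intro conjI allI impI approx_linear)
  fix Bs assume Bs: "1 \<le> length Bs" "length Bs \<le> n" "set Bs \<subseteq> \<B> \<union> binv ` \<B>"
  have w: "bprod Bs \<in> \<W>" using words(1) Bs by blast
  then have a: "approx (s_op (bprod Bs)) = pmat d (pf (bprod Bs))" by (rule approx_\<W>)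
  have BW: "set Bs \<subseteq> \<W>" using Bs words(2) by blast
  then have "map (\<lambda>B. approx (s_op B)) Bs = map (\<lambda>B. pmat d (pf B)) Bs" using approx_\<W> by auto
  moreover have "set Bs \<subseteq> Collect bis" using BW \<W> by (rule order_trans)
  ultimately have m: "foldr (*) (map (\<lambda>B. approx (s_op B)) Bs) (1\<^sub>m d) = pmat d (comp Bs)"
    using comp_mat by (simp only:)
  have "suffix Cs Bs \<Longrightarrow> bprod Cs \<in> \<W>" for Cs
    using words(1)[of Cs] Bs set_mono_suffix[of Cs Bs] suffix_length_le[of Cs Bs] by auto
  then have cb: "real (card {i. i < d \<and> pf (bprod Bs) i \<noteq> comp Bs i}) \<le> (real (length Bs) + 1) * (10 * \<epsilon> * real d)"
    using BW by (intro comp_bprod)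
  have bb: "bis (bprod Bs)" using w \<W> by auto
  have "(mat_norm2 (pmat d (pf (bprod Bs)) - pmat d (comp Bs)))\<^sup>2 * real d \<le> 2 * ((real (length Bs) + 1) * (10 * \<epsilon> * real d))"
  proof -
    have "set Bs \<subseteq> Collect bis" using BW \<W> by (rule order_trans)
    from pmat_diff_norm(2)[OF pf_pfun[OF bb] comp_pfun[OF this] d] cb show ?thesis by linarith
  qed
  also have "\<dots> \<le> 2 * ((real n + 1) * (10 * \<epsilon> * real d))"
    using Bs \<epsilon>_nonneg by (intro mult_left_mono mult_right_mono) auto
  also have "\<dots> = (20 * \<epsilon> * (real n + 1)) * real d" by (simp add: algebra_simps)
  also have "\<dots> < \<delta>\<^sup>2 * real d" using \<delta>(2) d by (intro mult_strict_right_mono) auto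
  finally have "(mat_norm2 (pmat d (pf (bprod Bs)) - pmat d (comp Bs)))\<^sup>2 < \<delta>\<^sup>2" using d by simp
  then have "mat_norm2 (pmat d (pf (bprod Bs)) - pmat d (comp Bs)) < \<delta>"
    using \<delta>(1) power_less_imp_less_base[of _ 2 \<delta>] by simp
  then show "mat_norm2 (approx (s_op (bprod Bs)) - foldr (*) (map (\<lambda>B. approx (s_op B)) Bs) (1\<^sub>m d)) < \<delta>"
    unfolding a m .
  show "approx (s_op (bprod Bs)) \<in> partial_perm_mats d"
    unfolding a by (rule pmat_partial_perm[OF pf_pfun[OF bb] pf_pinj[OF w]])
  have "\<bar>real (card {i. i < d \<and> pf (bprod Bs) i = Some i}) / real d - measure M (slice (bprod Bs) \<one>)\<bar> * real d
     = \<bar>(real (card {i. i < d \<and> pf (bprod Bs) i = Some i}) / real d - measure M (slice (bprod Bs) \<one>)) * real d\<bar>"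
    by (simp add: abs_mult)
  also have "(real (card {i. i < d \<and> pf (bprod Bs) i = Some i}) / real d - measure M (slice (bprod Bs) \<one>)) * real d
     = real (card {i. i < d \<and> pf (bprod Bs) i = Some i}) - real d * measure M (slice (bprod Bs) \<one>)"
    using d by (simp add: left_diff_distrib)
  also have "\<bar>real (card {i. i < d \<and> pf (bprod Bs) i = Some i}) - real d * measure M (slice (bprod Bs) \<one>)\<bar> \<le> 3 * \<epsilon> * real d"
    by (rule pf_trace[OF w])
  also have "\<dots> < \<delta> * real d" using \<delta>(3) d by (intro mult_strict_right_mono) auto
  finally have "\<bar>real (card {i. i < d \<and> pf (bprod Bs) i = Some i}) / real d - measure M (slice (bprod Bs) \<one>)\<bar> < \<delta>"
    using d by (simp add: mult_less_cancel_right)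
  then show "cmod (mat_ntr (approx (s_op (bprod Bs))) - complex_of_real (measure M (slice (bprod Bs) \<one>))) < \<delta>"
    unfolding a pmat_trace by (simp only: of_real_diff[symmetric] norm_of_real)
qed

end

context pmp_action begin

text \<open>The bisections to be controlled are all words up to length \<open>n\<close>. The window, the colouring and the
  error are chosen to satisfy the requirements of \<open>model_data\<close> for them.\<close>

lemma model_to_SA:
  assumes \<B>: "finite \<B>" "\<B> \<subseteq> Collect bis" and \<delta>: "\<delta> > 0" and W: "finite W" "W \<subseteq> carrier G" and \<gamma>: "\<gamma> > 0"
  obtains V c \<epsilon> where "(V, c, \<epsilon>) \<in> params" "\<And>d \<sigma>. d > 0 \<Longrightarrow> \<sigma> \<in> models V c \<epsilon> d \<Longrightarrow>
    \<exists>\<phi>\<in>SA \<G> (s_op ` \<B>) n \<delta> d. \<exists>D. real (card {i. i < d \<and> i \<in> D}) \<le> \<gamma> * real d \<and>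
      (\<forall>g\<in>W. \<phi> (s_op (full g)) = pmat d (\<lambda>i. if i \<in> D then None else Some (\<sigma> g i)))"
proof -
  let ?B = "\<B> \<union> binv ` \<B>"
  define \<W> where "\<W> = bprod ` {Bs. set Bs \<subseteq> ?B \<and> length Bs \<le> n} \<union> ?B"
  have B': "finite ?B" "?B \<subseteq> Collect bis" using \<B> bis_binv by auto
  have \<W>: "finite \<W>" "\<W> \<subseteq> Collect bis"
  proof -
    show "finite \<W>" unfolding \<W>_def using finite_lists_length_le[OF B'(1), of n] B'(1)
      by (intro finite_UnI finite_imageI) auto
    have "bis (bprod Bs)" if "set Bs \<subseteq> ?B" for Bs using bis_bprod B'(2) that by (meson order_trans)
    then show "\<W> \<subseteq> Collect bis" unfolding \<W>_def using B'(2) by blast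
  qed
  \<comment> \<open>The first term serves the 2-norm, the second the trace and the third the set \<open>D\<close>.\<close>
  define \<epsilon> where "\<epsilon> = min (\<delta>\<^sup>2 / (40 * (real n + 1))) (min (\<delta> / 6) (\<gamma> / 2))"
  have \<epsilon>: "\<epsilon> > 0" using \<delta> \<gamma> by (simp add: \<epsilon>_def)
  have e1: "20 * \<epsilon> * (real n + 1) < \<delta>\<^sup>2"
  proof -
    have "\<epsilon> \<le> \<delta>\<^sup>2 / (40 * (real n + 1))" by (simp add: \<epsilon>_def)
    then have "\<epsilon> * (40 * (real n + 1)) \<le> \<delta>\<^sup>2" by (simp add: pos_le_divide_eq)
    moreover have "\<delta>\<^sup>2 > 0" using \<delta> by simp
    moreover have "\<epsilon> * (40 * (real n + 1)) = 2 * (20 * \<epsilon> * (real n + 1))" by (simp add: algebra_simps)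
    ultimately show ?thesis by linarith
  qed
  have "\<epsilon> \<le> \<delta> / 6" "\<epsilon> \<le> \<gamma> / 2" unfolding \<epsilon>_def by linarith+
  then have e2: "3 * \<epsilon> < \<delta>" "2 * \<epsilon> \<le> \<gamma>" using \<delta> by linarith+
  obtain W1 where W1: "finite W1" "W1 \<subseteq> carrier G" "\<And>B. B \<in> \<W> \<Longrightarrow> measure M (tail B W1) < \<epsilon>"
    using finite_window[OF \<W> \<epsilon>] by blast
  define W0 where "W0 = W \<union> W1 \<union> {\<one>}"
  have W0: "finite W0" "W0 \<subseteq> carrier G" "\<one> \<in> W0" "W \<subseteq> W0" using W W1 by (auto simp: W0_def)
  note W_W0 = W0(4)
  have W0_tail: "measure M (tail B W0) \<le> \<epsilon>" if "B \<in> \<W>" for B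
  proof -
    have "measure M (tail B W0) \<le> measure M (tail B W1)"
      using that \<W> by (intro M.finite_measure_mono tail_sets) (auto simp: tail_def W0_def)
    then show ?thesis using W1(3)[OF that] by linarith
  qed
  define V where "V = W0 \<union> (\<lambda>g. inv g) ` W0 \<union> (\<lambda>(g, h). g \<otimes> h) ` (W0 \<times> W0) \<union> (\<lambda>(g, h). inv g \<otimes> h) ` (W0 \<times> W0)"
  have V: "finite V" "V \<subseteq> carrier G" using W0 by (auto simp: V_def subset_iff)
  define \<S> where "\<S> = (\<lambda>(C, g). slice C g) ` (\<W> \<times> W0) \<union> (\<lambda>C. tail C W0) ` \<W>"
  have finS: "finite \<S>" unfolding \<S>_def using \<W> W0 by (intro finite_UnI finite_imageI finite_cartesian_product) auto
  have mS: "\<S> \<subseteq> sets M"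
    unfolding \<S>_def using \<W> W0 bisD(3) tail_sets by (auto simp: subset_iff)
  define c where "c x = to_nat_on (Pow \<S>) (ty \<S> x)" for x
  have cP: "countable (Pow \<S>)" using finS by (intro countable_finite) simp
  have tyP: "ty \<S> x \<in> Pow \<S>" for x by (auto simp: ty_def)
  have c_ty: "ty \<S> x = ty \<S> y" if "c x = c y" for x y
    using inj_on_to_nat_on[OF cP] tyP that unfolding c_def by (meson inj_onD)
  have cm: "c \<in> M \<rightarrow>\<^sub>M count_space UNIV"
    unfolding c_def[abs_def] by (rule measurable_compose[OF ty_measurable[OF finS mS]]) simp
  have cf: "finite (c ` space M)"
  proof (rule finite_subset)
    show "c ` space M \<subseteq> to_nat_on (Pow \<S>) ` Pow \<S>" using tyP by (auto simp: c_def)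
  qed (use finS in simp)
  show thesis
  proof (rule that)
    show "(V, c, \<epsilon>) \<in> params" using V cm cf \<epsilon> by (simp add: params_def)
    fix d :: nat and \<sigma> assume d: "d > 0" and "\<sigma> \<in> models V c \<epsilon> d"
    then obtain \<kappa> where m: "model V c \<epsilon> d \<sigma> \<kappa>" by (auto simp: models_def)
    interpret model_data G M \<alpha> V W0 c \<epsilon> d \<sigma> \<kappa> \<W>
    proof
      show "finite W0" "\<one> \<in> W0" "V \<subseteq> carrier G" "c \<in> M \<rightarrow>\<^sub>M count_space UNIV" "finite (c ` space M)"
        "model V c \<epsilon> d \<sigma> \<kappa>" "0 < d" "\<W> \<subseteq> Collect bis" by fact+
      show "W0 \<subseteq> V" unfolding V_def by blast
      show "inv g \<in> V" if "g \<in> W0" for g using that unfolding V_def by blast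
      show "g \<otimes> h \<in> V" if "g \<in> W0" "h \<in> W0" for g h
      proof -
        have "(\<lambda>(g, h). g \<otimes> h) (g, h) \<in> (\<lambda>(g, h). g \<otimes> h) ` (W0 \<times> W0)" using that by (intro imageI SigmaI)
        then show ?thesis unfolding V_def by simp
      qed
      show "inv g \<otimes> h \<in> V" if "g \<in> W0" "h \<in> W0" for g h
      proof -
        have "(\<lambda>(g, h). inv g \<otimes> h) (g, h) \<in> (\<lambda>(g, h). inv g \<otimes> h) ` (W0 \<times> W0)" using that by (intro imageI SigmaI)
        then show ?thesis unfolding V_def by simp
      qed
      show "(g, y) \<in> C" if "C \<in> \<W>" "g \<in> W0" "x \<in> space M" "y \<in> space M" "c x = c y" "(g, x) \<in> C" for C g x y
      proof -
        have "slice C g \<in> \<S>" unfolding \<S>_def using that by blast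
        from ty_eqD[OF c_ty[OF that(5)] this] have "x \<in> slice C g \<longleftrightarrow> y \<in> slice C g" .
        then show ?thesis using that by simp
      qed
      show "y \<in> tail C W0" if "C \<in> \<W>" "x \<in> space M" "y \<in> space M" "c x = c y" "x \<in> tail C W0" for C x y
      proof -
        have "tail C W0 \<in> \<S>" unfolding \<S>_def using that by blast
        from ty_eqD[OF c_ty[OF that(4)] this] show ?thesis using that(5) by simp
      qed
      show "measure M (tail C W0) \<le> \<epsilon>" if "C \<in> \<W>" for C using W0_tail that .
    qed
    have "approx \<in> SA \<G> (s_op ` \<B>) n \<delta> d"
    proof (rule approx_SA[OF \<B>(2) _ _ \<delta> e1 e2(1)])
      show "bprod Bs \<in> \<W>" if "set Bs \<subseteq> ?B" "length Bs \<le> n" for Bs using that unfolding \<W>_def by blast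
      show "?B \<subseteq> \<W>" unfolding \<W>_def by blast
    qed
    moreover have "real (card {i. i < d \<and> i \<in> - Good}) \<le> \<gamma> * real d"
    proof -
      have "real (card {i. i < d \<and> i \<in> - Good}) \<le> 2 * \<epsilon> * real d" using card_not_Good by simp
      also have "\<dots> \<le> \<gamma> * real d" using e2(2) by (intro mult_right_mono) auto
      finally show ?thesis .
    qed
    moreover have "approx (s_op (full g)) = pmat d (\<lambda>i. if i \<in> - Good then None else Some (\<sigma> g i))" if "g \<in> W" for g
    proof -
      have "(\<lambda>i. if i \<in> - Good then None else Some (\<sigma> g i)) = (\<lambda>i. if i \<in> Good then Some (\<sigma> g i) else None)" by auto
      then show ?thesis using approx_rect[of g] that W_W0 by (simp only:) blast
    qed
    ultimately show "\<exists>\<phi>\<in>SA \<G> (s_op ` \<B>) n \<delta> d. \<exists>D. real (card {i. i < d \<and> i \<in> D}) \<le> \<gamma> * real d \<and>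
      (\<forall>g\<in>W. \<phi> (s_op (full g)) = pmat d (\<lambda>i. if i \<in> D then None else Some (\<sigma> g i)))"
      by blast
  qed
qed

text \<open>The approximation built from a model determines the model on \<open>W\<close> up to few points.\<close>

lemma model_card_le:
  assumes \<B>: "finite \<B>" "\<B> \<subseteq> Collect bis" and \<delta>: "\<delta> > 0" and W: "finite W" "W \<subseteq> carrier G" and \<beta>: "\<beta> > 0"
  obtains V c \<epsilon> where "(V, c, \<epsilon>) \<in> params" "\<And>d. d > 0 \<Longrightarrow>
    finite ((\<lambda>\<phi>. restrict \<phi> (s_op ` (\<lambda>g. full g) ` W)) ` SA \<G> (s_op ` \<B>) n \<delta> d) \<Longrightarrow>
    real (card (model_count W V c \<epsilon> d)) \<le>
      real (card ((\<lambda>\<phi>. restrict \<phi> (s_op ` (\<lambda>g. full g) ` W)) ` SA \<G> (s_op ` \<B>) n \<delta> d)) *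
      ((2 ^ card W) ^ d * (real d + 1) powr (\<beta> * real d))"
proof -
  let ?\<gamma> = "\<beta> / (real (card W) + 1)"
  have \<gamma>: "?\<gamma> > 0" using \<beta> by simp
  let ?E = "s_op ` (\<lambda>g. full g) ` W"
  show thesis
  proof (rule model_to_SA[OF \<B> \<delta> W \<gamma>])
  fix V c \<epsilon> assume p: "(V, c, \<epsilon>) \<in> params" and key: "\<And>d \<sigma>. d > 0 \<Longrightarrow> \<sigma> \<in> models V c \<epsilon> d \<Longrightarrow>
    \<exists>\<phi>\<in>SA \<G> (s_op ` \<B>) n \<delta> d. \<exists>D. real (card {i. i < d \<and> i \<in> D}) \<le> ?\<gamma> * real d \<and>
      (\<forall>g\<in>W. \<phi> (s_op (full g)) = pmat d (\<lambda>i. if i \<in> D then None else Some (\<sigma> g i)))"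
  show thesis
  proof (rule that[OF p])
    fix d :: nat assume d: "d > 0" and fin: "finite ((\<lambda>\<phi>. restrict \<phi> ?E) ` SA \<G> (s_op ` \<B>) n \<delta> d)"
    let ?T = "(\<lambda>\<phi>. restrict \<phi> ?E) ` SA \<G> (s_op ` \<B>) n \<delta> d"
    let ?I = "W \<times> {..<d}"
    define m where "m = nat \<lfloor>\<beta> * real d\<rfloor>"
    have mle: "real m \<le> \<beta> * real d" unfolding m_def using \<beta> by simp
    define Rel where "Rel s t \<longleftrightarrow> (\<exists>D. real (card {i. i < d \<and> i \<in> D}) \<le> ?\<gamma> * real d \<and>
      (\<forall>g\<in>W. t (s_op (full g)) = pmat d (\<lambda>i. if i \<in> D then None else Some (s (g, i)))))"
      for s :: "'g \<times> nat \<Rightarrow> nat" and t :: "('g \<times> 'x) l2_op \<Rightarrow> complex mat"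
    have sub: "model_count W V c \<epsilon> d \<subseteq> ?I \<rightarrow>\<^sub>E {..<d}"
      unfolding model_count_def by (intro image_subsetI restr_PiE)
    have "card (model_count W V c \<epsilon> d) \<le> card ?T * (2 ^ card ?I * card {..<d} ^ m)"
    proof (rule hamming_card[where R = Rel])
      show "finite ?I" using W by simp
      show "finite {..<d}" "{..<d} \<noteq> {}" using d by auto
      show "model_count W V c \<epsilon> d \<subseteq> ?I \<rightarrow>\<^sub>E {..<d}" by (rule sub)
      show "finite ?T" by (rule fin)
      show "\<exists>t\<in>?T. Rel s t" if s: "s \<in> model_count W V c \<epsilon> d" for s
      proof -
        obtain \<sigma> where \<sigma>: "\<sigma> \<in> models V c \<epsilon> d" "s = restr W d \<sigma>" using s by (auto simp: model_count_def)
        obtain \<phi> D where \<phi>: "\<phi> \<in> SA \<G> (s_op ` \<B>) n \<delta> d" and D: "real (card {i. i < d \<and> i \<in> D}) \<le> ?\<gamma> * real d"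
          "\<And>g. g \<in> W \<Longrightarrow> \<phi> (s_op (full g)) = pmat d (\<lambda>i. if i \<in> D then None else Some (\<sigma> g i))"
          using key[OF d \<sigma>(1)] by blast
        have "restrict \<phi> ?E (s_op (full g)) = pmat d (\<lambda>i. if i \<in> D then None else Some (s (g, i)))"
          if g: "g \<in> W" for g
        proof -
          have "s_op (full g) \<in> ?E" using g by blast
          then have "restrict \<phi> ?E (s_op (full g)) = pmat d (\<lambda>i. if i \<in> D then None else Some (\<sigma> g i))"
            using D(2)[OF g] by simp
          also have "\<dots> = pmat d (\<lambda>i. if i \<in> D then None else Some (s (g, i)))"
            using g \<sigma>(2) by (intro eq_matI) (auto simp: restr_def)
          finally show ?thesis .
        qed
        then have "Rel s (restrict \<phi> ?E)" unfolding Rel_def using D(1) by blast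
        then show ?thesis using \<phi> by blast
      qed
      fix s s' t assume ss: "s \<in> model_count W V c \<epsilon> d" "s' \<in> model_count W V c \<epsilon> d" and r: "Rel s t" "Rel s' t"
      obtain D where D: "real (card {i. i < d \<and> i \<in> D}) \<le> ?\<gamma> * real d"
        "\<And>g. g \<in> W \<Longrightarrow> t (s_op (full g)) = pmat d (\<lambda>i. if i \<in> D then None else Some (s (g, i)))"
        using r(1) unfolding Rel_def by blast
      obtain D' where D': "\<And>g. g \<in> W \<Longrightarrow> t (s_op (full g)) = pmat d (\<lambda>i. if i \<in> D' then None else Some (s' (g, i)))"
        using r(2) unfolding Rel_def by blast
      have "s (g, i) = s' (g, i)" if gi: "g \<in> W" "i < d" "i \<notin> D" for g i
      proof -
        have pf: "pfun d (\<lambda>i. if i \<in> X then None else Some (r (g, i)))" if "r \<in> model_count W V c \<epsilon> d" for X r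
          using subsetD[OF sub that] gi(1) unfolding pfun_def by (auto simp: PiE_iff split: if_splits)
        have "(if i \<in> D then None else Some (s (g, i))) = (if i \<in> D' then None else Some (s' (g, i)))"
        proof -
          have "pmat d (\<lambda>i. if i \<in> D then None else Some (s (g, i))) = pmat d (\<lambda>i. if i \<in> D' then None else Some (s' (g, i)))"
            using D(2)[OF gi(1)] D'[OF gi(1)] by (rule trans[OF sym])
          then show ?thesis unfolding pmat_eq_iff[OF pf[OF ss(1)] pf[OF ss(2)]] using gi(2) by blast
        qed
        then show ?thesis using gi(3) by (auto split: if_splits)
      qed
      then have "{k \<in> ?I. s k \<noteq> s' k} \<subseteq> W \<times> {i. i < d \<and> i \<in> D}" by auto
      then have "card {k \<in> ?I. s k \<noteq> s' k} \<le> card W * card {i. i < d \<and> i \<in> D}"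
        using W card_mono[of "W \<times> {i. i < d \<and> i \<in> D}"] by (simp add: card_cartesian_product)
      then have "real (card {k \<in> ?I. s k \<noteq> s' k}) \<le> real (card W * card {i. i < d \<and> i \<in> D})" by (rule of_nat_mono)
      also have "\<dots> \<le> real (card W) * (?\<gamma> * real d)" unfolding of_nat_mult using D(1) by (intro mult_left_mono) auto
      also have "\<dots> = (real (card W) / (real (card W) + 1)) * (\<beta> * real d)"
      proof -
        have "N * (\<beta> / X * D) = N / X * (\<beta> * D)" for N X D :: real by simp
        then show ?thesis .
      qed
      also have "\<dots> \<le> 1 * (\<beta> * real d)" using \<beta> by (intro mult_right_mono) (auto simp: divide_simps)
      finally show "card {k \<in> ?I. s k \<noteq> s' k} \<le> m" unfolding m_def by (simp add: le_nat_floor)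
    qed
    then have "real (card (model_count W V c \<epsilon> d)) \<le> real (card ?T * (2 ^ card ?I * card {..<d} ^ m))" by (rule of_nat_mono)
    also have "\<dots> = real (card ?T) * ((2 ^ card W) ^ d * real d ^ m)"
      using W by (simp add: card_cartesian_product power_mult)
    also have "\<dots> \<le> real (card ?T) * ((2 ^ card W) ^ d * (real d + 1) powr (\<beta> * real d))"
    proof (intro mult_left_mono)
      have "real d ^ m \<le> (real d + 1) ^ m" by (intro power_mono) auto
      also have "(real d + 1) ^ m = (real d + 1) powr real m" by (simp add: powr_realpow)
      also have "\<dots> \<le> (real d + 1) powr (\<beta> * real d)" using mle by (intro powr_mono) auto
      finally show "real d ^ m \<le> (real d + 1) powr (\<beta> * real d)" .
    qed auto
    finally show "real (card (model_count W V c \<epsilon> d)) \<le> real (card ?T) * ((2 ^ card W) ^ d * (real d + 1) powr (\<beta> * real d))" .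
  qed
qed
qed

theorem model_dim_le_sofic_dim:
  assumes L: "limit_like L"
  shows "model_dim L \<le> sofic_dim_along L \<G>"
  unfolding model_dim_def
proof (rule SUP_least)
  fix W assume "W \<in> {W. finite W \<and> W \<subseteq> carrier G}"
  then have W: "finite W" "W \<subseteq> carrier G" by auto
  let ?E = "s_op ` (\<lambda>g. full g) ` W"
  let ?X = "INF (V, c, \<epsilon>)\<in>params. L (\<lambda>d. log_rate d (model_count W V c \<epsilon> d))"
  have E: "?E \<in> {E. finite E \<and> E \<subseteq> inv_semigroup \<G>}"
  proof -
    have "bis (full g)" if "g \<in> W" for g using that W(2) by (intro bis_rect) auto
    then show ?thesis using W(1) unfolding inv_semigroup_eq by blast
  qed
  have "?X \<le> (INF F\<in>{F. finite F \<and> F \<subseteq> inv_semigroup \<G>}. INF n\<in>{1..}. INF \<delta>\<in>{0<..}. L (log_card_SA \<G> ?E F n \<delta>))"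
  proof (intro INF_greatest)
    fix F and n :: nat and \<delta> :: real assume F: "F \<in> {F. finite F \<and> F \<subseteq> inv_semigroup \<G>}" and "\<delta> \<in> {0<..}"
    then have \<delta>: "\<delta> > 0" by simp
    obtain \<B> where \<B>: "finite \<B>" "\<B> \<subseteq> Collect bis" "F = s_op ` \<B>"
    proof -
      have "finite F" "F \<subseteq> s_op ` Collect bis" using F unfolding inv_semigroup_eq by simp_all
      from finite_subset_image[OF this] show thesis using that by (elim exE conjE)
    qed
    show "?X \<le> L (log_card_SA \<G> ?E F n \<delta>)"
    proof (rule ereal_le_epsilon2)
      fix e :: real assume e: "e > 0"
      then have e2: "e / 2 > 0" "e / 2 < e" by auto
      show "?X \<le> L (log_card_SA \<G> ?E F n \<delta>) + ereal e"
      proof (rule model_card_le[OF \<B>(1,2) \<delta> W e2(1)])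
      fix V c \<epsilon> assume p: "(V, c, \<epsilon>) \<in> params" and le: "\<And>d. d > 0 \<Longrightarrow>
        finite ((\<lambda>\<phi>. restrict \<phi> ?E) ` SA \<G> (s_op ` \<B>) n \<delta> d) \<Longrightarrow>
        real (card (model_count W V c \<epsilon> d)) \<le> real (card ((\<lambda>\<phi>. restrict \<phi> ?E) ` SA \<G> (s_op ` \<B>) n \<delta> d)) *
          ((2 ^ card W) ^ d * (real d + 1) powr (e / 2 * real d))"
      have K: "(1::real) \<le> 2 ^ card W" by simp
      have "?X \<le> L (\<lambda>d. log_rate d (model_count W V c \<epsilon> d))"
        using INF_lower[OF p, of "\<lambda>(V, c, \<epsilon>). L (\<lambda>d. log_rate d (model_count W V c \<epsilon> d))"] by simp
      also have "\<dots> \<le> L (log_card_SA \<G> ?E F n \<delta>) + ereal e"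
      proof -
        have "\<forall>\<^sub>F d in sequentially. log_rate d (model_count W V c \<epsilon> d) \<le> log_card_SA \<G> ?E F n \<delta> d + ereal e"
          using eventually_log_rate_le[OF K e2(2), where 'b = "('g \<times> 'x) l2_op \<Rightarrow> complex mat" and 'a = "'g \<times> nat \<Rightarrow> nat"] eventually_ge_at_top[of 2]
        proof eventually_elim
          case (elim d)
          let ?T = "(\<lambda>\<phi>. restrict \<phi> ?E) ` SA \<G> F n \<delta> d"
          have "log_rate d (model_count W V c \<epsilon> d) \<le> log_rate d ?T + ereal e"
          proof (cases "finite ?T")
            case True
            then have "real (card (model_count W V c \<epsilon> d)) \<le> real (card ?T) * ((2 ^ card W) ^ d * (real d + 1) powr (e / 2 * real d))"
              using elim(2) le[of d] unfolding \<B>(3) by simp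
            then show ?thesis using elim(1) True finite_model_count[OF W(1)] by blast
          next
            case False
            have "real d * ln (real d) > 0" using elim(2) by simp
            then have "log_rate d ?T = \<infinity>" using False by (simp add: log_rate_def log_card_def)
            then show ?thesis by simp
          qed
          then show ?case by (simp only: log_card_SA_def log_rate_def)
        qed
        then show ?thesis by (rule L[unfolded limit_like_def, rule_format])
      qed
      finally show "?X \<le> L (log_card_SA \<G> ?E F n \<delta>) + ereal e" .
      qed
    qed
  qed
  also have "\<dots> \<le> sofic_dim_along L \<G>"
    unfolding sofic_dim_along_def by (rule SUP_upper[OF E])
  finally show "?X \<le> sofic_dim_along L \<G>" .
qed

end

section \<open>Restriction of models and growth rates of products\<close>

context pmp_action begin

text \<open>Models pull back along an injective homomorphism and coarsen along a map of colours.\<close>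

lemma model_pullback:
  assumes K: "pmp_action K M (\<lambda>h. \<alpha> (f h))" and f: "f \<in> hom K G"
    and inj: "\<And>h. h \<in> carrier K \<Longrightarrow> f h = \<one> \<Longrightarrow> h = \<one>\<^bsub>K\<^esub>"
    and V1: "V1 \<subseteq> carrier K" "f ` V1 \<subseteq> V" and c: "\<And>x. x \<in> space M \<Longrightarrow> c1 x = q (c x)" and \<epsilon>: "\<epsilon> \<le> \<epsilon>1"
    and m: "model V c \<epsilon> d \<sigma> \<kappa>"
  shows "pmp_action.model K M (\<lambda>h. \<alpha> (f h)) V1 c1 \<epsilon>1 d (\<lambda>h. \<sigma> (f h)) (\<lambda>i. q (\<kappa> i))"
proof -
  interpret K: pmp_action K M "\<lambda>h. \<alpha> (f h)" by fact
  have f1: "f \<one>\<^bsub>K\<^esub> = \<one>" using f hom_one[OF f K.is_group is_group] by simp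
  have fm: "f (g \<otimes>\<^bsub>K\<^esub> h) = f g \<otimes> f h" if "g \<in> V1" "h \<in> V1" for g h
    using f V1(1) that by (auto simp: hom_def)
  have good: "K.good_pt (\<lambda>h. \<sigma> (f h)) (\<lambda>i. q (\<kappa> i)) V1 c1 i" if i: "good_pt \<sigma> \<kappa> V c i" for i
    unfolding K.good_pt_def
  proof (intro conjI ballI impI)
    fix g h assume gh: "g \<in> V1" "h \<in> V1" "g \<otimes>\<^bsub>K\<^esub> h \<in> V1"
    then have "f g \<in> V" "f h \<in> V" "f (g \<otimes>\<^bsub>K\<^esub> h) \<in> V" using V1(2) by blast+
    then have "f g \<in> V" "f h \<in> V" "f g \<otimes> f h \<in> V" using fm[OF gh(1,2)] by simp_all
    then show "\<sigma> (f g) (\<sigma> (f h) i) = \<sigma> (f (g \<otimes>\<^bsub>K\<^esub> h)) i"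
      using i fm[OF gh(1,2)] unfolding good_pt_def by simp
  next
    fix g assume g: "g \<in> V1" "\<sigma> (f g) i = i"
    then have "f g \<in> V" using V1(2) by blast
    then have "f g = \<one>" using i g(2) unfolding good_pt_def by blast
    then show "g = \<one>\<^bsub>K\<^esub>" using inj g(1) V1(1) by blast
  next
    obtain x where x: "x \<in> space M" "\<forall>g\<in>V. \<kappa> (\<sigma> g i) = c (\<alpha> g x)" using i unfolding good_pt_def by blast
    have "q (\<kappa> (\<sigma> (f g) i)) = c1 (\<alpha> (f g) x)" if g: "g \<in> V1" for g
    proof -
      have fg: "f g \<in> V" using g V1(2) by blast
      have "\<alpha> (f g) x \<in> space M" using K.act_closed[of g x] g V1(1) x(1) by blast
      then show ?thesis using c bspec[OF x(2) fg] by simp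
    qed
    then show "\<exists>x\<in>space M. \<forall>g\<in>V1. q (\<kappa> (\<sigma> (f g) i)) = c1 (\<alpha> (f g) x)" using x(1) by blast
  qed
  have le: "\<epsilon> * real d \<le> \<epsilon>1 * real d" using \<epsilon> by (intro mult_right_mono) auto
  have "card {i. i < d \<and> \<not> K.good_pt (\<lambda>h. \<sigma> (f h)) (\<lambda>i. q (\<kappa> i)) V1 c1 i} \<le> card {i. i < d \<and> \<not> good_pt \<sigma> \<kappa> V c i}"
    using good by (intro card_mono) auto
  moreover have "real (card {i. i < d \<and> \<not> good_pt \<sigma> \<kappa> V c i}) \<le> \<epsilon> * real d" using m by (simp add: model_def)
  ultimately have 1: "real (card {i. i < d \<and> \<not> K.good_pt (\<lambda>h. \<sigma> (f h)) (\<lambda>i. q (\<kappa> i)) V1 c1 i}) \<le> \<epsilon>1 * real d"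
    using le by linarith
  have 2: "\<bar>real (card {i. i < d \<and> q (\<kappa> i) \<in> Q}) - real d * measure M {x \<in> space M. c1 x \<in> Q}\<bar> \<le> \<epsilon>1 * real d" for Q
  proof -
    have "\<bar>real (card {i. i < d \<and> \<kappa> i \<in> q -` Q}) - real d * measure M {x \<in> space M. c x \<in> q -` Q}\<bar> \<le> \<epsilon> * real d"
      using m unfolding model_def by blast
    moreover have "{x \<in> space M. c x \<in> q -` Q} = {x \<in> space M. c1 x \<in> Q}" using c by auto
    ultimately show ?thesis using le by simp
  qed
  have 3: "q (\<kappa> i) \<in> c1 ` space M" if i: "i < d" for i
  proof -
    obtain x where "x \<in> space M" "\<kappa> i = c x" using m i unfolding model_def by blast
    then show ?thesis using c by (intro image_eqI[of _ _ x]) auto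
  qed
  show ?thesis
    unfolding K.model_def using 1 2 3 m f1 by (auto simp: model_def)
qed

lemma model_dim_bounds:
  assumes "\<And>W. finite W \<Longrightarrow> W \<subseteq> carrier G \<Longrightarrow>
    (INF (V, c, \<epsilon>)\<in>params. L (\<lambda>d. log_rate d (model_count W V c \<epsilon> d))) \<le> b"
  shows "model_dim L \<le> b"
  unfolding model_dim_def using assms by (intro SUP_least) auto

end

lemma log_rate_ge_0:
  assumes "d \<ge> 2" "A \<noteq> {}"
  shows "log_rate d A \<ge> 0"
proof (cases "finite A")
  case True
  then have "real (card A) \<ge> 1" using assms(2) by (simp add: Suc_le_eq card_gt_0_iff)
  then show ?thesis using assms True by (simp add: log_rate_real)
next
  case False
  have "real d * ln (real d) > 0" using assms(1) by simp
  then show ?thesis using False by (simp add: log_rate_def log_card_def)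
qed

text \<open>A nonempty set has a nonnegative rate, so an upper limit of rates is either nonnegative or \<open>-\<infinity>\<close>.\<close>

lemma eventually_empty_if_limsup_neg:
  assumes "limsup (\<lambda>d. log_rate d (A d)) < 0"
  shows "\<forall>\<^sub>F d in sequentially. A d = {}"
proof -
  have "\<forall>\<^sub>F d in sequentially. log_rate d (A d) < 0" using assms by (rule Limsup_lessD)
  then show ?thesis using eventually_ge_at_top[of 2]
  proof eventually_elim
    case (elim d)
    then show ?case using log_rate_ge_0[of d "A d"] by (metis linorder_not_less)
  qed
qed

lemma limsup_eventually_empty:
  assumes "\<forall>\<^sub>F d in sequentially. A d = {}"
  shows "limsup (\<lambda>d. log_rate d (A d)) = -\<infinity>"
proof -
  have "\<forall>\<^sub>F d in sequentially. log_rate d (A d) = -\<infinity>"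
    using assms eventually_ge_at_top[of 2] by eventually_elim (simp add: log_rate_empty)
  then have "limsup (\<lambda>d. log_rate d (A d)) = limsup (\<lambda>d. -\<infinity>)" by (rule Limsup_eq)
  then show ?thesis by (simp add: Limsup_const)
qed

lemma limsup_product:
  assumes A: "\<And>d. finite (A d)" and B: "\<And>d. finite (B d)"
  shows "limsup (\<lambda>d. log_rate d (A d \<times> B d)) \<le> dim_add (limsup (\<lambda>d. log_rate d (A d))) (limsup (\<lambda>d. log_rate d (B d)))"
proof (cases "limsup (\<lambda>d. log_rate d (A d)) = -\<infinity> \<or> limsup (\<lambda>d. log_rate d (B d)) = -\<infinity>")
  case True
  then have "(\<forall>\<^sub>F d in sequentially. A d = {}) \<or> (\<forall>\<^sub>F d in sequentially. B d = {})"
    using eventually_empty_if_limsup_neg[of A] eventually_empty_if_limsup_neg[of B] by fastforce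
  then have "\<forall>\<^sub>F d in sequentially. A d \<times> B d = {}" by (auto elim: eventually_mono)
  then have "limsup (\<lambda>d. log_rate d (A d \<times> B d)) = -\<infinity>" by (rule limsup_eventually_empty)
  then show ?thesis by simp
next
  case False
  have "\<forall>\<^sub>F d in sequentially. log_rate d (A d \<times> B d) \<le> log_rate d (A d) + log_rate d (B d)"
    using eventually_ge_at_top[of 2]
  proof eventually_elim
    case (elim d)
    show ?case
    proof (cases "A d = {} \<or> B d = {}")
      case True
      then show ?thesis using elim by (auto simp: log_rate_empty)
    next
      case False
      then show ?thesis using log_rate_Times[OF elim A B, of d d] by simp
    qed
  qed
  then have "limsup (\<lambda>d. log_rate d (A d \<times> B d)) \<le> limsup (\<lambda>d. log_rate d (A d) + log_rate d (B d))"
    by (rule Limsup_mono)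
  also have "\<dots> \<le> limsup (\<lambda>d. log_rate d (A d)) + limsup (\<lambda>d. log_rate d (B d))"
    by (rule ereal_limsup_add_mono)
  finally show ?thesis using False by (simp add: dim_add_def)
qed

lemma liminf_product:
  assumes A: "\<And>d. finite (A d)" and B: "\<And>d. finite (B d)"
    and lim: "liminf (\<lambda>d. log_rate d (A d)) \<noteq> -\<infinity>" "liminf (\<lambda>d. log_rate d (B d)) \<noteq> -\<infinity>"
  shows "liminf (\<lambda>d. log_rate d (A d)) + liminf (\<lambda>d. log_rate d (B d)) \<le> liminf (\<lambda>d. log_rate d (A d \<times> B d))"
proof -
  have ne: "\<forall>\<^sub>F d in sequentially. C d \<noteq> {}" if "liminf (\<lambda>d. log_rate d (C d)) \<noteq> -\<infinity>" for C :: "nat \<Rightarrow> 'z set"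
  proof -
    have "-\<infinity> < liminf (\<lambda>d. log_rate d (C d))" using that by simp
    then have "\<forall>\<^sub>F d in sequentially. -\<infinity> < log_rate d (C d)" by (rule less_LiminfD)
    then show ?thesis using eventually_ge_at_top[of 2]
      by eventually_elim (auto simp: log_rate_empty)
  qed
  have "liminf (\<lambda>d. log_rate d (A d)) + liminf (\<lambda>d. log_rate d (B d)) \<le> liminf (\<lambda>d. log_rate d (A d) + log_rate d (B d))"
    by (rule ereal_liminf_add_mono) (use lim in auto)
  also have "\<dots> \<le> liminf (\<lambda>d. log_rate d (A d \<times> B d))"
  proof (rule Liminf_mono)
    show "\<forall>\<^sub>F d in sequentially. log_rate d (A d) + log_rate d (B d) \<le> log_rate d (A d \<times> B d)"
      using ne[OF lim(1)] ne[OF lim(2)] eventually_ge_at_top[of 2]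
      by eventually_elim (simp add: log_rate_Times A B)
  qed
  finally show ?thesis .
qed

lemma dim_add_mono: "a \<le> a' \<Longrightarrow> b \<le> b' \<Longrightarrow> dim_add a b \<le> dim_add a' b'"
  by (auto simp: dim_add_def intro: add_mono)

text \<open>The dichotomy in the assumptions excludes families that decrease to \<open>-\<infinity>\<close> through finite values. If
  one infimum is \<open>-\<infinity>\<close> it is attained, and the assumption \<open>le\<close> gives \<open>x = -\<infinity>\<close>.\<close>

lemma le_dim_add_INF:
  fixes f :: "'i \<Rightarrow> ereal" and g :: "'j \<Rightarrow> ereal"
  assumes le: "\<And>i j e::real. i \<in> I \<Longrightarrow> j \<in> J \<Longrightarrow> e > 0 \<Longrightarrow> x \<le> dim_add (f i) (g j) + ereal e"
    and f: "\<And>i. i \<in> I \<Longrightarrow> f i = -\<infinity> \<or> f i \<ge> 0" and g: "\<And>j. j \<in> J \<Longrightarrow> g j = -\<infinity> \<or> g j \<ge> 0"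
    and ne: "I \<noteq> {}" "J \<noteq> {}"
  shows "x \<le> dim_add (INF i\<in>I. f i) (INF j\<in>J. g j)"
proof -
  have le': "x \<le> dim_add (f i) (g j)" if "i \<in> I" "j \<in> J" for i j
  proof (rule ereal_le_epsilon2)
    fix e :: real assume "0 < e"
    then show "x \<le> dim_add (f i) (g j) + ereal e" by (rule le[OF that])
  qed
  show ?thesis
  proof (cases "(INF i\<in>I. f i) = -\<infinity> \<or> (INF j\<in>J. g j) = -\<infinity>")
    case True
    then have "(\<exists>i\<in>I. f i = -\<infinity>) \<or> (\<exists>j\<in>J. g j = -\<infinity>)"
    proof
      assume "(INF i\<in>I. f i) = -\<infinity>"
      then have "(INF i\<in>I. f i) < 0" by simp
      then obtain i where "i \<in> I" "f i < 0" unfolding INF_less_iff by blast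
      then show ?thesis using f[of i] by (auto simp: not_less[symmetric])
    next
      assume "(INF j\<in>J. g j) = -\<infinity>"
      then have "(INF j\<in>J. g j) < 0" by simp
      then obtain i where "i \<in> J" "g i < 0" unfolding INF_less_iff by blast
      then show ?thesis using g[of i] by (auto simp: not_less[symmetric])
    qed
    then have "x = -\<infinity>"
    proof
      assume "\<exists>i\<in>I. f i = -\<infinity>"
      then obtain i j where "i \<in> I" "f i = -\<infinity>" "j \<in> J" using ne by blast
      then show ?thesis using le'[of i j] by (simp add: dim_add_def)
    next
      assume "\<exists>j\<in>J. g j = -\<infinity>"
      then obtain i j where "i \<in> I" "g j = -\<infinity>" "j \<in> J" using ne by blast
      then show ?thesis using le'[of i j] by (simp add: dim_add_def)
    qed
    then show ?thesis by simp
  next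
    case False
    have fi: "f i \<noteq> -\<infinity>" if "i \<in> I" for i using INF_lower[OF that, of f] False by auto
    have gj: "g j \<noteq> -\<infinity>" if "j \<in> J" for j using INF_lower[OF that, of g] False by auto
    have nf: "0 \<le> f i" if "i \<in> I" for i using f fi that by blast
    have ng: "0 \<le> g j" if "j \<in> J" for j using g gj that by blast
    have "x \<le> (INF i\<in>I. f i) + (INF j\<in>J. g j)"
    proof -
      have "x \<le> f i + (INF j\<in>J. g j)" if i: "i \<in> I" for i
      proof -
        have "x \<le> (INF j\<in>J. f i + g j)"
          using le'[OF i] fi[OF i] gj by (intro INF_greatest) (auto simp: dim_add_def)
        also have "\<dots> = f i + (INF j\<in>J. g j)"
          using ne(2) fi[OF i] ng by (intro INF_ereal_add_right) auto
        finally show ?thesis .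
      qed
      then have "x \<le> (INF i\<in>I. f i + (INF j\<in>J. g j))" by (intro INF_greatest)
      also have "\<dots> = (INF i\<in>I. f i) + (INF j\<in>J. g j)"
        using ne(1) False nf ng by (intro INF_ereal_add_left) (auto intro: INF_greatest)
      finally show ?thesis .
    qed
    then show ?thesis using False by (simp add: dim_add_def)
  qed
qed

lemma dim_add_SUP_le:
  fixes f :: "'i \<Rightarrow> ereal" and g :: "'j \<Rightarrow> ereal"
  assumes le: "\<And>i j. i \<in> I \<Longrightarrow> j \<in> J \<Longrightarrow> f i \<noteq> -\<infinity> \<Longrightarrow> g j \<noteq> -\<infinity> \<Longrightarrow> f i + g j \<le> s"
  shows "dim_add (SUP i\<in>I. f i) (SUP j\<in>J. g j) \<le> s"
proof (cases "(SUP i\<in>I. f i) = -\<infinity> \<or> (SUP j\<in>J. g j) = -\<infinity>")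
  case True
  then show ?thesis by (simp add: dim_add_def)
next
  case False
  let ?I = "{i\<in>I. f i \<noteq> -\<infinity>}" and ?J = "{j\<in>J. g j \<noteq> -\<infinity>}"
  have SI: "(SUP i\<in>I. f i) = (SUP i\<in>?I. f i)"
  proof (rule antisym)
    show "(SUP i\<in>I. f i) \<le> (SUP i\<in>?I. f i)"
    proof (rule SUP_least)
      fix i assume "i \<in> I"
      then show "f i \<le> (SUP i\<in>?I. f i)" by (cases "f i = -\<infinity>") (auto intro: SUP_upper)
    qed
  qed (auto intro: SUP_subset_mono)
  have SJ: "(SUP i\<in>J. g i) = (SUP i\<in>?J. g i)"
  proof (rule antisym)
    show "(SUP i\<in>J. g i) \<le> (SUP i\<in>?J. g i)"
    proof (rule SUP_least)
      fix i assume "i \<in> J"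
      then show "g i \<le> (SUP i\<in>?J. g i)" by (cases "g i = -\<infinity>") (auto intro: SUP_upper)
    qed
  qed (auto intro: SUP_subset_mono)
  have I: "?I \<noteq> {}"
  proof
    assume e: "?I = {}"
    have "(SUP i\<in>I. f i) = -\<infinity>" unfolding SI e by (simp add: bot_ereal_def)
    then show False using False by blast
  qed
  have J: "?J \<noteq> {}"
  proof
    assume e: "?J = {}"
    have "(SUP j\<in>J. g j) = -\<infinity>" unfolding SJ e by (simp add: bot_ereal_def)
    then show False using False by blast
  qed
  have "(SUP i\<in>?I. f i) + (SUP j\<in>?J. g j) \<le> s"
  proof -
    have "f i + (SUP j\<in>?J. g j) \<le> s" if i: "i \<in> ?I" for i
    proof -
      have "f i + (SUP j\<in>?J. g j) = (SUP j\<in>?J. f i + g j)"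
        using J i by (subst SUP_ereal_add_right) auto
      also have "\<dots> \<le> s" using le i by (intro SUP_least) auto
      finally show ?thesis .
    qed
    then have "(SUP i\<in>?I. f i + (SUP j\<in>?J. g j)) \<le> s" by (rule SUP_least)
    moreover have "(SUP i\<in>?I. f i) + (SUP j\<in>?J. g j) = (SUP i\<in>?I. f i + (SUP j\<in>?J. g j))"
      using I False SJ by (subst SUP_ereal_add_left) auto
    ultimately show ?thesis by simp
  qed
  then show ?thesis using False SI SJ by (simp add: dim_add_def)
qed

section \<open>Random walks revealing a random permutation\<close>

abbreviation pinv :: "(nat \<Rightarrow> nat) \<Rightarrow> nat \<Rightarrow> nat" where "pinv \<equiv> Hilbert_Choice.inv"

text \<open>Colour-preserving permutations with some values \<open>p\<close> already revealed. Probabilities are expressed as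
  ratios of cardinalities of such sets.\<close>

definition cperms :: "nat \<Rightarrow> (nat \<Rightarrow> nat) \<Rightarrow> (nat \<times> nat) set \<Rightarrow> (nat \<Rightarrow> nat) set" where
  "cperms d \<kappa> p = {f. f permutes {..<d} \<and> (\<forall>i<d. \<kappa> (f i) = \<kappa> i) \<and> (\<forall>(a, b)\<in>p. f a = b)}"

lemma finite_cperms: "finite (cperms d \<kappa> p)"
  by (rule finite_subset[OF _ finite_permutations[of "{..<d}"]]) (auto simp: cperms_def)

text \<open>Conditioning on a uniformly distributed value: \<open>r\<close> values are given up, and on each remaining fibre
  the event has conditional probability at most \<open>\<beta>\<close>.\<close>

lemma reveal_bound:
  fixes \<F> :: "'b \<Rightarrow> 'a set" and \<beta> :: real
  assumes B: "finite B" "B \<noteq> {}" and fin: "\<And>b. b \<in> B \<Longrightarrow> finite (\<F> b)"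
    and disj: "\<And>b b'. b \<in> B \<Longrightarrow> b' \<in> B \<Longrightarrow> b \<noteq> b' \<Longrightarrow> \<F> b \<inter> \<F> b' = {}"
    and eq: "\<And>b. b \<in> B \<Longrightarrow> card (\<F> b) = N" and X: "X \<subseteq> (\<Union>b\<in>B. \<F> b)"
    and Forb: "finite Forb" "card Forb \<le> r"
    and good: "\<And>b. b \<in> B \<Longrightarrow> b \<notin> Forb \<Longrightarrow> real (card (X \<inter> \<F> b)) \<le> \<beta> * real (card (\<F> b))" and \<beta>: "\<beta> \<ge> 0"
  shows "real (card X) \<le> (\<beta> + real r / real (card B)) * real (card (\<Union>b\<in>B. \<F> b))"
proof -
  have tot: "card (\<Union>b\<in>B. \<F> b) = card B * N"
  proof -
    have "card (\<Union>b\<in>B. \<F> b) = (\<Sum>b\<in>B. card (\<F> b))"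
      using B fin disj by (intro card_UN_disjoint) auto
    also have "\<dots> = (\<Sum>b\<in>B. N)" by (intro sum.cong refl eq)
    finally show ?thesis by simp
  qed
  have "X = (\<Union>b\<in>B. X \<inter> \<F> b)" using X by blast
  then have "card X \<le> (\<Sum>b\<in>B. card (X \<inter> \<F> b))"
    using card_UN_le[OF B(1), of "\<lambda>b. X \<inter> \<F> b"] by simp
  then have "real (card X) \<le> real (\<Sum>b\<in>B. card (X \<inter> \<F> b))" by (rule of_nat_mono)
  also have "\<dots> = (\<Sum>b\<in>B. real (card (X \<inter> \<F> b)))" by simp
  also have "\<dots> \<le> (\<Sum>b\<in>B. \<beta> * real N + (if b \<in> Forb then real N else 0))"
  proof (rule sum_mono)
    fix b assume b: "b \<in> B"
    show "real (card (X \<inter> \<F> b)) \<le> \<beta> * real N + (if b \<in> Forb then real N else 0)"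
    proof (cases "b \<in> Forb")
      case True
      have "card (X \<inter> \<F> b) \<le> N" using eq[OF b] fin[OF b] card_mono[of "\<F> b" "X \<inter> \<F> b"] by simp
      then have "real (card (X \<inter> \<F> b)) \<le> real N" by simp
      moreover have "0 \<le> \<beta> * real N" using \<beta> by simp
      ultimately show ?thesis using True by simp
    next
      case False
      then show ?thesis using good[OF b] eq[OF b] by simp
    qed
  qed
  also have "\<dots> = real (card B) * (\<beta> * real N) + real (card (B \<inter> Forb)) * real N"
    using B by (simp add: sum.distrib sum.inter_restrict[symmetric])
  also have "\<dots> \<le> real (card B) * (\<beta> * real N) + real r * real N"
  proof -
    have "card (B \<inter> Forb) \<le> r" using card_mono[OF Forb(1), of "B \<inter> Forb"] Forb(2) by auto
    then show ?thesis by (intro add_left_mono mult_right_mono) auto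
  qed
  also have "\<dots> = (\<beta> + real r / real (card B)) * real (card (\<Union>b\<in>B. \<F> b))"
    using B unfolding tot by (simp add: algebra_simps)
  finally show ?thesis .
qed

lemma cperms_insert: "cperms d \<kappa> (insert (a, b) p) = {f \<in> cperms d \<kappa> p. f a = b}"
  by (auto simp: cperms_def)

lemma cperms_permutes: "f \<in> cperms d \<kappa> p \<Longrightarrow> f permutes {..<d}"
  by (simp add: cperms_def)

lemma cperms_agree: "f \<in> cperms d \<kappa> p \<Longrightarrow> (a, b) \<in> p \<Longrightarrow> f a = b"
  by (auto simp: cperms_def)

text \<open>Composition with a transposition of equally coloured points exchanges two unrevealed values, so these
  are equally likely.\<close>

lemma transpose_cperms_left:
  assumes f: "f \<in> cperms d \<kappa> (insert (a, b) p)" and b: "b < d" "b' < d" "\<kappa> b = \<kappa> b'" "b \<notin> snd ` p" "b' \<notin> snd ` p"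
  shows "Transposition.transpose b b' \<circ> f \<in> cperms d \<kappa> (insert (a, b') p)"
proof -
  have "Transposition.transpose b b' permutes {..<d}" using b by (intro permutes_swap_id) auto
  then have "Transposition.transpose b b' \<circ> f permutes {..<d}" using f by (intro permutes_compose) (auto simp: cperms_def)
  moreover have "\<kappa> (Transposition.transpose b b' y) = \<kappa> y" for y using b by (cases "y = b"; cases "y = b'") auto
  then have "\<forall>i<d. \<kappa> ((Transposition.transpose b b' \<circ> f) i) = \<kappa> i" using f by (simp add: cperms_def)
  moreover have "(Transposition.transpose b b' \<circ> f) x = y" if "(x, y) \<in> insert (a, b') p" for x y
  proof (cases "(x, y) = (a, b')")
    case True
    then show ?thesis using f by (auto simp: cperms_def)
  next
    case False
    then have xy: "(x, y) \<in> p" using that by blast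
    then have "y \<in> snd ` p" by force
    then have "y \<noteq> b" "y \<noteq> b'" using b by blast+
    then show ?thesis using cperms_agree[OF f, of x y] xy by simp
  qed
  ultimately show ?thesis unfolding cperms_def by blast
qed

lemma transpose_cperms_right:
  assumes f: "f \<in> cperms d \<kappa> (insert (a, b) p)" and a: "a < d" "a' < d" "\<kappa> a = \<kappa> a'" "a \<notin> fst ` p" "a' \<notin> fst ` p"
  shows "f \<circ> Transposition.transpose a a' \<in> cperms d \<kappa> (insert (a', b) p)"
proof -
  have t: "Transposition.transpose a a' permutes {..<d}" using a by (intro permutes_swap_id) auto
  then have "f \<circ> Transposition.transpose a a' permutes {..<d}" using f by (intro permutes_compose) (auto simp: cperms_def)
  moreover have "\<kappa> (Transposition.transpose a a' y) = \<kappa> y" for y using a by (cases "y = a"; cases "y = a'") auto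
  then have "\<forall>i<d. \<kappa> ((f \<circ> Transposition.transpose a a') i) = \<kappa> i"
    using f permutes_in_image[OF t] by (simp add: cperms_def)
  moreover have "(f \<circ> Transposition.transpose a a') x = y" if "(x, y) \<in> insert (a', b) p" for x y
  proof (cases "(x, y) = (a', b)")
    case True
    then show ?thesis using f by (auto simp: cperms_def)
  next
    case False
    then have xy: "(x, y) \<in> p" using that by blast
    then have "x \<in> fst ` p" by force
    then have "x \<noteq> a" "x \<noteq> a'" using a by blast+
    then show ?thesis using cperms_agree[OF f, of x y] xy by simp
  qed
  ultimately show ?thesis unfolding cperms_def by blast
qed

lemma reveal_image:
  fixes \<beta> :: real
  assumes a: "a < d" "a \<notin> fst ` p" and B: "B = {b. b < d \<and> \<kappa> b = \<kappa> a \<and> b \<notin> snd ` p}" "B \<noteq> {}"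
    and X: "X \<subseteq> cperms d \<kappa> p" and Forb: "finite Forb" "card Forb \<le> r" and \<beta>: "\<beta> \<ge> 0"
    and good: "\<And>b. b \<in> B \<Longrightarrow> b \<notin> Forb \<Longrightarrow>
      real (card (X \<inter> cperms d \<kappa> (insert (a, b) p))) \<le> \<beta> * real (card (cperms d \<kappa> (insert (a, b) p)))"
  shows "real (card X) \<le> (\<beta> + real r / real (card B)) * real (card (cperms d \<kappa> p))"
proof -
  have U: "cperms d \<kappa> p = (\<Union>b\<in>B. cperms d \<kappa> (insert (a, b) p))"
  proof -
    have "f a \<in> B" if f: "f \<in> cperms d \<kappa> p" for f
    proof -
      have "f a \<notin> snd ` p"
      proof
        assume "f a \<in> snd ` p"
        then obtain x where "(x, f a) \<in> p" by force
        then have "f x = f a" "x \<in> fst ` p" using cperms_agree[OF f] by force+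
        then show False using permutes_inj[OF cperms_permutes[OF f]] a(2) by (metis injD)
      qed
      moreover have "f a < d" using permutes_in_image[OF cperms_permutes[OF f], of a] a(1) by simp
      moreover have "\<kappa> (f a) = \<kappa> a" using f a(1) by (simp add: cperms_def)
      ultimately show ?thesis using B(1) by simp
    qed
    then show ?thesis unfolding cperms_insert by blast
  qed
  have fB: "finite B" using B by simp
  obtain b0 where b0: "b0 \<in> B" using B(2) by blast
  have le: "card (cperms d \<kappa> (insert (a, b) p)) \<le> card (cperms d \<kappa> (insert (a, b') p))" if "b \<in> B" "b' \<in> B" for b b'
  proof (rule card_inj_on_le[OF _ _ finite_cperms])
    show "(\<lambda>f. Transposition.transpose b b' \<circ> f) ` cperms d \<kappa> (insert (a, b) p) \<subseteq> cperms d \<kappa> (insert (a, b') p)"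
      using transpose_cperms_left[of _ d \<kappa> a b p b'] that B(1) by auto
    show "inj_on (\<lambda>f. Transposition.transpose b b' \<circ> f) (cperms d \<kappa> (insert (a, b) p))"
      by (rule inj_onI) (metis fun.map_comp fun.map_id swap_id_idempotent transpose_comp_involutory)
  qed
  have eq: "card (cperms d \<kappa> (insert (a, b) p)) = card (cperms d \<kappa> (insert (a, b0) p))" if "b \<in> B" for b
    using le[OF that b0] le[OF b0 that] by simp
  have disj: "cperms d \<kappa> (insert (a, b) p) \<inter> cperms d \<kappa> (insert (a, b') p) = {}" if "b \<noteq> b'" for b b'
    using that unfolding cperms_insert by auto
  show ?thesis unfolding U
    by (rule reveal_bound[OF fB B(2) finite_cperms disj eq _ Forb good \<beta>]) (use X U in auto)
qed

lemma reveal_preimage: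
  fixes \<beta> :: real
  assumes b: "b < d" "b \<notin> snd ` p" and A: "A = {a. a < d \<and> \<kappa> a = \<kappa> b \<and> a \<notin> fst ` p}" "A \<noteq> {}"
    and X: "X \<subseteq> cperms d \<kappa> p" and Forb: "finite Forb" "card Forb \<le> r" and \<beta>: "\<beta> \<ge> 0"
    and good: "\<And>a. a \<in> A \<Longrightarrow> a \<notin> Forb \<Longrightarrow>
      real (card (X \<inter> cperms d \<kappa> (insert (a, b) p))) \<le> \<beta> * real (card (cperms d \<kappa> (insert (a, b) p)))"
  shows "real (card X) \<le> (\<beta> + real r / real (card A)) * real (card (cperms d \<kappa> p))"
proof -
  have U: "cperms d \<kappa> p = (\<Union>a\<in>A. cperms d \<kappa> (insert (a, b) p))"
  proof -
    have "\<exists>a\<in>A. f a = b" if f: "f \<in> cperms d \<kappa> p" for f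
    proof -
      obtain a where a: "f a = b" using permutes_surj[OF cperms_permutes[OF f]] by (metis surjD)
      have "a < d" using permutes_in_image[OF cperms_permutes[OF f], of a] a b(1) by simp
      moreover have "\<kappa> a = \<kappa> b" using f calculation a by (auto simp: cperms_def)
      moreover have "a \<notin> fst ` p"
      proof
        assume "a \<in> fst ` p"
        then obtain y where y: "(a, y) \<in> p" by force
        then have "y = b" using cperms_agree[OF f y] a by simp
        then show False using y b(2) by force
      qed
      ultimately show ?thesis using A(1) a by blast
    qed
    then show ?thesis unfolding cperms_insert by blast
  qed
  have fA: "finite A" using A by simp
  obtain a0 where a0: "a0 \<in> A" using A(2) by blast
  have le: "card (cperms d \<kappa> (insert (a, b) p)) \<le> card (cperms d \<kappa> (insert (a', b) p))" if "a \<in> A" "a' \<in> A" for a a'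
  proof (rule card_inj_on_le[OF _ _ finite_cperms])
    show "(\<lambda>f. f \<circ> Transposition.transpose a a') ` cperms d \<kappa> (insert (a, b) p) \<subseteq> cperms d \<kappa> (insert (a', b) p)"
      using transpose_cperms_right[of _ d \<kappa> a b p a'] that A(1) by auto
    show "inj_on (\<lambda>f. f \<circ> Transposition.transpose a a') (cperms d \<kappa> (insert (a, b) p))"
      by (rule inj_onI) (metis comp_assoc comp_id transpose_comp_involutory)
  qed
  have eq: "card (cperms d \<kappa> (insert (a, b) p)) = card (cperms d \<kappa> (insert (a0, b) p))" if "a \<in> A" for a
    using le[OF that a0] le[OF a0 that] by simp
  have disj: "cperms d \<kappa> (insert (a, b) p) \<inter> cperms d \<kappa> (insert (a', b) p) = {}" if "a \<noteq> a'" for a a'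
  proof (rule equals0I)
    fix f assume "f \<in> cperms d \<kappa> (insert (a, b) p) \<inter> cperms d \<kappa> (insert (a', b) p)"
    then have "f a = f a'" "f permutes {..<d}" unfolding cperms_insert using cperms_permutes by auto
    then show False using that permutes_inj by (metis injD)
  qed
  show ?thesis unfolding U
    by (rule reveal_bound[OF fA A(2) finite_cperms disj eq _ Forb good \<beta>]) (use X U in auto)
qed

text \<open>The first factor acts by \<open>\<sigma>1\<close> and the second by the conjugate of \<open>\<sigma>2\<close> under the random permutation.
  The maps need only be injective and free of fixed points at tame points, and a walk is only followed
  as long as it meets tame points.\<close>

locale two_factor_walk =
  fixes d :: nat and \<kappa> :: "nat \<Rightarrow> nat"
    and \<sigma>1 :: "'a \<Rightarrow> nat \<Rightarrow> nat" and \<sigma>2 :: "'b \<Rightarrow> nat \<Rightarrow> nat"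
    and tame1 tame2 :: "nat \<Rightarrow> bool" and A1 :: "'a set" and A2 :: "'b set" and m0 K :: nat
  assumes tame1_lt: "tame1 y \<Longrightarrow> y < d" and tame2_lt: "tame2 y \<Longrightarrow> y < d"
    and \<sigma>1_lt: "tame1 y \<Longrightarrow> g \<in> A1 \<Longrightarrow> \<sigma>1 g y < d" and \<sigma>2_lt: "tame2 y \<Longrightarrow> h \<in> A2 \<Longrightarrow> \<sigma>2 h y < d"
    and \<sigma>1_free: "tame1 y \<Longrightarrow> g \<in> A1 \<Longrightarrow> \<sigma>1 g y \<noteq> y" and \<sigma>2_free: "tame2 y \<Longrightarrow> h \<in> A2 \<Longrightarrow> \<sigma>2 h y \<noteq> y"
    and \<sigma>1_inj: "tame1 y \<Longrightarrow> tame1 y' \<Longrightarrow> g \<in> A1 \<Longrightarrow> \<sigma>1 g y = \<sigma>1 g y' \<Longrightarrow> y = y'"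
    and \<sigma>2_inj: "tame2 y \<Longrightarrow> tame2 y' \<Longrightarrow> h \<in> A2 \<Longrightarrow> \<sigma>2 h y = \<sigma>2 h y' \<Longrightarrow> y = y'"
    and large: "\<And>i. i < d \<Longrightarrow> m0 \<le> card {j. j < d \<and> \<kappa> j = \<kappa> i}" and mK: "K < m0"
begin

abbreviation "perms \<equiv> cperms d \<kappa> {}"
abbreviation "letters \<equiv> Inl ` A1 \<union> Inr ` A2"

fun step :: "(nat \<Rightarrow> nat) \<Rightarrow> 'a + 'b \<Rightarrow> nat \<Rightarrow> nat" where
  "step f (Inl g) j = \<sigma>1 g j"
| "step f (Inr h) j = f (\<sigma>2 h (pinv f j))"

fun tame_step :: "(nat \<Rightarrow> nat) \<Rightarrow> 'a + 'b \<Rightarrow> nat \<Rightarrow> bool" where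
  "tame_step f (Inl g) j = tame1 j"
| "tame_step f (Inr h) j = tame2 (pinv f j)"

fun walk :: "(nat \<Rightarrow> nat) \<Rightarrow> ('a + 'b) list \<Rightarrow> nat \<Rightarrow> nat" where
  "walk f [] j = j"
| "walk f (l # ws) j = walk f ws (step f l j)"

fun tame_walk :: "(nat \<Rightarrow> nat) \<Rightarrow> ('a + 'b) list \<Rightarrow> nat \<Rightarrow> bool" where
  "tame_walk f [] j = True"
| "tame_walk f (l # ws) j = (tame_step f l j \<and> tame_walk f ws (step f l j))"

definition alternating :: "('a + 'b) list \<Rightarrow> bool" where
  "alternating ws \<longleftrightarrow> set ws \<subseteq> letters \<and> successively (\<lambda>x y. isl x \<noteq> isl y) ws"

lemma alternating_Cons: "alternating (l # ws) \<Longrightarrow> alternating ws" "alternating (l # l' # ws) \<Longrightarrow> isl l \<noteq> isl l'"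
  by (auto simp: alternating_def successively_Cons)

lemma class_avail:
  assumes "i < d" "finite Z" "card Z \<le> K"
  shows "{j. j < d \<and> \<kappa> j = \<kappa> i \<and> j \<notin> Z} \<noteq> {}"
    "real m0 - real K \<le> real (card {j. j < d \<and> \<kappa> j = \<kappa> i \<and> j \<notin> Z})"
proof -
  have "{j. j < d \<and> \<kappa> j = \<kappa> i \<and> j \<notin> Z} = {j. j < d \<and> \<kappa> j = \<kappa> i} - Z" by auto
  moreover have "card {j. j < d \<and> \<kappa> j = \<kappa> i} - card Z \<le> card ({j. j < d \<and> \<kappa> j = \<kappa> i} - Z)"
    by (rule diff_card_le_card_Diff[OF assms(2)])
  ultimately have le: "m0 - K \<le> card {j. j < d \<and> \<kappa> j = \<kappa> i \<and> j \<notin> Z}"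
    using large[OF assms(1)] assms(3) by simp
  then show "real m0 - real K \<le> real (card {j. j < d \<and> \<kappa> j = \<kappa> i \<and> j \<notin> Z})" by linarith
  show "{j. j < d \<and> \<kappa> j = \<kappa> i \<and> j \<notin> Z} \<noteq> {}" using le mK by (metis card.empty diff_is_0_eq le_zero_eq linorder_not_less)
qed

text \<open>A bound for the probability of an unfavourable outcome in one step with a letter of the second
  factor: \<open>K\<close> preimages and \<open>2 * K + 2\<close> images are unfavourable, out of at least \<open>m0 - K\<close> possible ones.\<close>

definition \<gamma> :: real where "\<gamma> = (3 * real K + 2) / (real m0 - real K)"

lemma \<gamma>_nonneg: "\<gamma> \<ge> 0" using mK by (simp add: \<gamma>_def)

lemma card_vimage_inj:
  assumes "finite Z" "\<And>y y'. P y \<Longrightarrow> P y' \<Longrightarrow> f y = f y' \<Longrightarrow> y = y'"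
  shows "finite {y. P y \<and> f y \<in> Z}" "card {y. P y \<and> f y \<in> Z} \<le> card Z"
proof -
  have i: "inj_on f {y. P y \<and> f y \<in> Z}" by (rule inj_onI) (use assms(2) in blast)
  have s: "f ` {y. P y \<and> f y \<in> Z} \<subseteq> Z" by blast
  show "finite {y. P y \<and> f y \<in> Z}" using i s assms(1) by (rule inj_on_finite)
  show "card {y. P y \<and> f y \<in> Z} \<le> card Z" using i s assms(1) by (rule card_inj_on_le)
qed

text \<open>A walk about to use a letter of the second factor at a vertex \<open>j\<close> about which nothing has
  been revealed. Revealing first the preimage of \<open>j\<close> and then one image, a bounded number of
  outcomes out of linearly many leads back to a visited vertex.\<close>

lemma fresh_walk:
  assumes "alternating ws" "ws \<noteq> []" "\<not> isl (hd ws)" "finite p" "finite R" "snd ` p \<subseteq> R" "j < d" "j \<notin> R"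
    and "card (fst ` p) + 2 * length ws \<le> K" "card R + 2 * length ws \<le> K"
  shows "real (card {f \<in> cperms d \<kappa> p. tame_walk f ws j \<and> walk f ws j \<in> insert j R}) \<le> real (length ws) * \<gamma> * real (card (cperms d \<kappa> p))"
  using assms
proof (induction "length ws" arbitrary: ws p R j rule: less_induct)
  case (less ws p R j)
  obtain h ws1 where ws: "ws = Inr h # ws1"
    using less.prems(2,3) by (cases ws; cases "hd ws") auto
  have h: "h \<in> A2" using less.prems(1) by (auto simp: alternating_def ws)
  have avail: "real m0 - real K > 0" using mK by simp
  let ?X = "{f \<in> cperms d \<kappa> p. tame_walk f ws j \<and> walk f ws j \<in> insert j R}"
  let ?A = "{a. a < d \<and> \<kappa> a = \<kappa> j \<and> a \<notin> fst ` p}"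
  \<comment> \<open>The preimage \<open>a\<close> of \<open>j\<close> must not be moved by \<open>h\<close> to a point at which \<open>f\<close> is known.\<close>
  let ?F1 = "{a. tame2 a \<and> \<sigma>2 h a \<in> fst ` p}"
  have K1: "card (fst ` p) \<le> K" "card R \<le> K" using less.prems(9,10) by linarith+
  have fF: "finite (fst ` p)" using less.prems(4) by simp
  have F1: "finite ?F1" "card ?F1 \<le> K"
    using card_vimage_inj[of "fst ` p" tame2 "\<sigma>2 h"] fF \<sigma>2_inj[OF _ _ h] K1(1) by (blast, meson order_trans)
  have jp: "j \<notin> snd ` p" using less.prems(6,8) by blast
  let ?b = "(2 * real K + 2) / (real m0 - real K) + (real (length ws) - 1) * \<gamma>"
  have lw: "real (length ws) - 1 \<ge> 0" by (simp add: ws)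
  have b0: "?b \<ge> 0" using avail lw \<gamma>_nonneg by (intro add_nonneg_nonneg mult_nonneg_nonneg divide_nonneg_nonneg) auto
  have "real (card ?X) \<le> (?b + real K / real (card ?A)) * real (card (cperms d \<kappa> p))"
  proof (rule reveal_preimage[OF less.prems(7) jp refl class_avail(1)[OF less.prems(7) fF K1(1)] _ F1 b0])
    show "?X \<subseteq> cperms d \<kappa> p" by blast
    fix a assume a: "a \<in> ?A" "a \<notin> ?F1"
    let ?p1 = "insert (a, j) p"
    show "real (card (?X \<inter> cperms d \<kappa> ?p1)) \<le> ?b * real (card (cperms d \<kappa> ?p1))"
    proof (cases "tame2 a")
      case False
      have "?X \<inter> cperms d \<kappa> ?p1 = {}"
      proof (rule equals0I)
        fix f assume f: "f \<in> ?X \<inter> cperms d \<kappa> ?p1"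
        then have "pinv f j = a" using cperms_agree[of f d \<kappa> ?p1 a j] cperms_permutes[of f d \<kappa> ?p1] permutes_inverses(2)[of f "{..<d}" a] by auto
        then show False using f False by (simp add: ws)
      qed
      then show ?thesis using b0 by simp
    next
      case ta: True
      let ?a = "\<sigma>2 h a"
      have a': "?a < d" "?a \<notin> fst ` ?p1" using \<sigma>2_lt[OF ta h] \<sigma>2_free[OF ta h] a ta by auto
      have fF2: "finite (snd ` ?p1)" using less.prems(4) by simp
      have K2: "card (snd ` ?p1) \<le> K"
      proof -
        have "card (snd ` ?p1) \<le> card (insert j R)" using less.prems(5,6) by (intro card_mono) auto
        also have "\<dots> \<le> card R + 1" using less.prems(5) by (simp add: card_insert_if)
        finally show ?thesis using less.prems(10) ws by simp
      qed
      let ?B = "{b. b < d \<and> \<kappa> b = \<kappa> ?a \<and> b \<notin> snd ` ?p1}"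
      \<comment> \<open>The image \<open>b\<close> must not have been visited, and the next letter, if there is one, must not lead from \<open>b\<close> back to a visited point.\<close>
      define F3 where "F3 = (case ws1 of [] \<Rightarrow> {} | l # _ \<Rightarrow> (case l of Inl g \<Rightarrow> {b. tame1 b \<and> \<sigma>1 g b \<in> insert j R} | Inr _ \<Rightarrow> {}))"
      define F2 where "F2 = insert j R \<union> F3"
      have R1: "finite (insert j R)" "card (insert j R) \<le> K + 1"
        using less.prems(5) K1(2) by (auto simp: card_insert_if)
      have F2: "finite F2" "card F2 \<le> 2 * K + 2"
      proof -
        have "finite F3 \<and>
          card F3 \<le> K + 1"
        proof (cases "\<exists>g ws2. ws1 = Inl g # ws2")
          case True
          then obtain g ws2 where w: "ws1 = Inl g # ws2" by blast
          have g: "g \<in> A1" using less.prems(1) by (auto simp: alternating_def ws w)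
          have "finite {b. tame1 b \<and> \<sigma>1 g b \<in> insert j R}" "card {b. tame1 b \<and> \<sigma>1 g b \<in> insert j R} \<le> card (insert j R)"
            using card_vimage_inj[of "insert j R" tame1 "\<sigma>1 g"] R1(1) \<sigma>1_inj[OF _ _ g] by blast+
          then show ?thesis using R1(2) by (simp add: F3_def w)
        next
          case False
          then show ?thesis by (auto simp: F3_def split: list.split sum.split)
        qed
        note Y = this
        show "finite F2" unfolding F2_def using R1(1) Y by blast
        have "card F2 \<le> card (insert j R) + card F3"
          unfolding F2_def by (rule card_Un_le)
        then show "card F2 \<le> 2 * K + 2" using R1(2) Y by linarith
      qed
      let ?c = "(real (length ws) - 1) * \<gamma>"
      have c0: "?c \<ge> 0" using lw \<gamma>_nonneg by simp
      have "real (card (?X \<inter> cperms d \<kappa> ?p1)) \<le> (?c + real (2 * K + 2) / real (card ?B)) * real (card (cperms d \<kappa> ?p1))"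
      proof (rule reveal_image[OF a' refl class_avail(1)[OF a'(1) fF2 K2] _ F2 c0])
        show "?X \<inter> cperms d \<kappa> ?p1 \<subseteq> cperms d \<kappa> ?p1" by blast
        fix b assume b: "b \<in> ?B" "b \<notin> F2"
        let ?p2 = "insert (?a, b) ?p1"
        let ?Y = "?X \<inter> cperms d \<kappa> ?p1 \<inter> cperms d \<kappa> ?p2"
        have bR: "b \<notin> insert j R" using b(2) by (auto simp: F2_def)
        have step: "step f (Inr h) j = b" if f: "f \<in> cperms d \<kappa> ?p2" for f
        proof -
          have "f a = j" "f ?a = b" using cperms_agree[OF f] by auto
          then have "pinv f j = a" using permutes_inverses(2)[OF cperms_permutes[OF f], of a] by simp
          then show ?thesis using \<open>f ?a = b\<close> by simp
        qed
        have Y: "tame_walk f ws1 b \<and> walk f ws1 b \<in> insert j R" if "f \<in> ?Y" for f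
          using that step[of f] by (auto simp: ws)
        show "real (card ?Y) \<le> ?c * real (card (cperms d \<kappa> ?p2))"
        proof (cases ws1)
          case Nil
          then have "?Y = {}" using Y bR by auto
          then show ?thesis using c0 by simp
        next
          case (Cons l ws2)
          have "isl l" using alternating_Cons(2) less.prems(1) unfolding ws Cons by fastforce
          then obtain g where l: "l = Inl g" by (cases l) auto
          have g: "g \<in> A1" using less.prems(1) by (auto simp: alternating_def ws Cons l)
          let ?j = "\<sigma>1 g b"
          show ?thesis
          proof (cases "tame1 b")
            case False
            then have "?Y = {}" using Y by (auto simp: Cons l)
            then show ?thesis using c0 by simp
          next
            case tb: True
            have jR: "?j \<notin> insert b (insert j R)"
              using b(2) tb \<sigma>1_free[OF tb g] by (auto simp: F2_def F3_def Cons l)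
            show ?thesis
            proof (cases "ws2 = []")
              case True
              then have "?Y = {}" using Y jR by (auto simp: Cons l)
              then show ?thesis using c0 by simp
            next
              case False
              let ?R = "insert b (insert j R)"
              let ?E = "{f \<in> cperms d \<kappa> ?p2. tame_walk f ws2 ?j \<and> walk f ws2 ?j \<in> insert ?j ?R}"
              have len: "length ws = length ws2 + 2" by (simp add: ws Cons)
              have "real (card ?E)
                 \<le> real (length ws2) * \<gamma> * real (card (cperms d \<kappa> ?p2))"
              proof (rule less.hyps)
                show "length ws2 < length ws" by (simp add: len)
                show "alternating ws2" using less.prems(1) alternating_Cons(1) unfolding ws Cons by blast
                show "ws2 \<noteq> []" by fact
                have "isl l \<noteq> isl (hd ws2)" using alternating_Cons(2)[of l "hd ws2" "tl ws2"] alternating_Cons(1)[of "Inr h"] less.prems(1) False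
                  unfolding ws Cons by simp
                then show "\<not> isl (hd ws2)" by (simp add: l)
                show "finite ?p2" "finite ?R" using less.prems by simp_all
                show "snd ` ?p2 \<subseteq> ?R" using less.prems(6) by auto
                show "?j < d" using \<sigma>1_lt[OF tb g] .
                show "?j \<notin> ?R" by (rule jR)
                have "card (fst ` ?p2) \<le> card (fst ` p) + 2"
                  using fF by (simp add: card_insert_if)
                then show "card (fst ` ?p2) + 2 * length ws2 \<le> K" using less.prems(9) len by linarith
                have "card ?R \<le> card R + 2" using less.prems(5) by (simp add: card_insert_if)
                then show "card ?R + 2 * length ws2 \<le> K" using less.prems(10) len by linarith
              qed
              moreover have "?Y \<subseteq> ?E"
                using Y by (auto simp: Cons l)
              then have "card ?Y \<le> card ?E"
                using finite_cperms[of d \<kappa> ?p2] by (intro card_mono) auto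
              ultimately have "real (card ?Y) \<le> real (length ws2) * \<gamma> * real (card (cperms d \<kappa> ?p2))" by linarith
              also have "\<dots> \<le> ?c * real (card (cperms d \<kappa> ?p2))"
                using \<gamma>_nonneg by (intro mult_right_mono) (auto simp: len)
              finally show ?thesis .
            qed
          qed
        qed
      qed
      also have "\<dots> \<le> ?b * real (card (cperms d \<kappa> ?p1))"
      proof (rule mult_right_mono)
        have "real (2 * K + 2) / real (card ?B) \<le> (2 * real K + 2) / (real m0 - real K)"
          using class_avail(2)[OF a'(1) fF2 K2] avail by (intro frac_le) auto
        then show "?c + real (2 * K + 2) / real (card ?B) \<le> ?b" by simp
      qed simp
      finally show ?thesis .
    qed
  qed
  also have "\<dots> \<le> (real (length ws) * \<gamma>) * real (card (cperms d \<kappa> p))"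
  proof (rule mult_right_mono)
    have "real K / real (card ?A) \<le> real K / (real m0 - real K)"
      using class_avail(2)[OF less.prems(7) fF K1(1)] avail by (intro frac_le) auto
    moreover have "\<gamma> = (2 * real K + 2) / (real m0 - real K) + real K / (real m0 - real K)"
      by (simp add: \<gamma>_def add_divide_distrib[symmetric])
    moreover have "(real (length ws) - 1) * \<gamma> = real (length ws) * \<gamma> - \<gamma>" by (simp only: left_diff_distrib mult_1)
    ultimately show "?b + real K / real (card ?A) \<le> real (length ws) * \<gamma>"
      by linarith
  qed simp
  finally show ?case .
qed

text \<open>A first letter of the first factor moves the start to a different point, at which nothing has been
  revealed; from then on \<open>fresh_walk\<close> applies.\<close>

lemma returning_walk:
  assumes ws: "alternating ws" "ws \<noteq> []" and i: "i < d" and K: "2 * length ws + 1 \<le> K"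
  shows "real (card {f \<in> perms. tame_walk f ws i \<and> walk f ws i = i}) \<le> real (length ws) * \<gamma> * real (card perms)"
proof -
  let ?D = "{f \<in> perms. tame_walk f ws i \<and> walk f ws i = i}"
  have nn: "0 \<le> real n * \<gamma> * real (card perms)" for n
    using \<gamma>_nonneg by (intro mult_nonneg_nonneg) auto
  obtain l ws1 where w: "ws = l # ws1" using ws(2) by (cases ws) auto
  show ?thesis
  proof (cases l)
    case (Inr h)
    have "real (card {f \<in> perms. tame_walk f ws i \<and> walk f ws i \<in> insert i {}}) \<le> real (length ws) * \<gamma> * real (card perms)"
      by (rule fresh_walk) (use ws i K in \<open>auto simp: w Inr\<close>)
    then show ?thesis by simp
  next
    case (Inl g)
    have g: "g \<in> A1" using ws(1) by (auto simp: alternating_def w Inl)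
    let ?j = "\<sigma>1 g i"
    let ?E = "{f \<in> perms. tame_walk f ws1 ?j \<and> walk f ws1 ?j \<in> insert ?j {i}}"
    show ?thesis
    proof (cases "tame1 i \<and> ws1 \<noteq> []")
      case False
      have "?D = {}"
        using False \<sigma>1_free[OF _ g] by (auto simp: w Inl)
      then show ?thesis using nn[of "length ws"] by (simp only: card.empty of_nat_0)
    next
      case True
      have "real (card ?E) \<le> real (length ws1) * \<gamma> * real (card perms)"
      proof (rule fresh_walk)
        show "alternating ws1" using ws(1) alternating_Cons(1) unfolding w by blast
        show "ws1 \<noteq> []" using True by blast
        show "\<not> isl (hd ws1)" using alternating_Cons(2)[of l "hd ws1" "tl ws1"] ws(1) True unfolding w Inl by simp
        show "?j < d" "?j \<notin> {i}" using True \<sigma>1_lt[OF _ g] \<sigma>1_free[OF _ g] by auto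
      qed (use K in \<open>auto simp: w\<close>)
      moreover have "card ?D \<le> card ?E"
        using finite_cperms[of d \<kappa> "{}"] by (intro card_mono) (auto simp: w Inl)
      ultimately have "real (card ?D) \<le> real (length ws1) * \<gamma> * real (card perms)"
        by linarith
      also have "\<dots> \<le> real (length ws) * \<gamma> * real (card perms)"
        using \<gamma>_nonneg by (intro mult_right_mono) (auto simp: w)
      finally show ?thesis .
    qed
  qed
qed

end

section \<open>The upper bound for free products\<close>

lemma fp_cons_eq_Cons: "fp_reduced G H (l # w) \<Longrightarrow> fp_cons G H l w = l # w"
proof -
  assume r: "fp_reduced G H (l # w)"
  show ?thesis
  proof (cases w)
    case (Cons k v)
    then have "isl l \<noteq> isl k" using r by (simp add: fp_reduced_Cons)
    then show ?thesis using Cons by (cases l; cases k) auto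
  qed simp
qed

lemma fp_reduced_suffix: "fp_reduced G H w \<Longrightarrow> suffix u w \<Longrightarrow> fp_reduced G H u"
proof -
  assume r: "fp_reduced G H w" and s: "suffix u w"
  obtain v where "w = v @ u" using s by (auto simp: suffix_def)
  moreover have "fp_reduced G H (v @ u) \<Longrightarrow> fp_reduced G H u"
    by (induction v) (auto simp: fp_reduced_Cons)
  ultimately show ?thesis using r by simp
qed

lemma finite_suffix_closure: "finite Z \<Longrightarrow> finite {u. \<exists>z\<in>Z. suffix u z}"
proof -
  assume "finite Z"
  moreover have "{u. \<exists>z\<in>Z. suffix u z} = (\<Union>z\<in>Z. {u. suffix u z})" by blast
  moreover have "finite {u. suffix u z}" for z :: "'a list"
  proof -
    have "{u. suffix u z} = set (suffixes z)" by (simp add: set_suffixes_eq)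
    then show ?thesis by simp
  qed
  ultimately show ?thesis by simp
qed

lemma finite_letters: "finite Z \<Longrightarrow> finite {g. \<exists>z\<in>Z. Inl g \<in> set z}" "finite Z \<Longrightarrow> finite {h. \<exists>z\<in>Z. Inr h \<in> set z}"
proof -
  assume Z: "finite Z"
  have f: "finite (\<Union>z\<in>Z. set z)" using Z by simp
  have "{g. \<exists>z\<in>Z. Inl g \<in> set z} = Inl -` (\<Union>z\<in>Z. set z)" by auto
  then show "finite {g. \<exists>z\<in>Z. Inl g \<in> set z}" using finite_vimageI[OF f, of Inl] by simp
next
  assume Z: "finite Z"
  have f: "finite (\<Union>z\<in>Z. set z)" using Z by simp
  have "{g. \<exists>z\<in>Z. Inr g \<in> set z} = Inr -` (\<Union>z\<in>Z. set z)" by auto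
  then show "finite {g. \<exists>z\<in>Z. Inr g \<in> set z}" using finite_vimageI[OF f, of Inr] by simp
qed

lemma countable_free_product:
  assumes "countable (carrier G)" "countable (carrier H)"
  shows "countable (carrier (free_product G H))"
proof (rule countable_subset)
  show "carrier (free_product G H) \<subseteq> lists (Inl ` carrier G \<union> Inr ` carrier H)"
  proof
    fix w assume "w \<in> carrier (free_product G H)"
    then have "list_all (fp_letter G H) w" by (simp add: free_product_def fp_reduced_def)
    then have "l \<in> Inl ` carrier G \<union> Inr ` carrier H" if "l \<in> set w" for l
      using that by (cases l) (auto simp: list_all_iff)
    then show "w \<in> lists (Inl ` carrier G \<union> Inr ` carrier H)" by blast
  qed
  show "countable (lists (Inl ` carrier G \<union> Inr ` carrier H))" using assms by (intro countable_lists) simp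
qed

locale free_product_action =
  fixes G1 :: "('a, 'm) monoid_scheme" and G2 :: "('b, 'n) monoid_scheme"
    and M :: "'x measure" and \<alpha> :: "('a + 'b) list \<Rightarrow> 'x \<Rightarrow> 'x"
  assumes grp1: "group G1" and cnt1: "countable (carrier G1)"
    and grp2: "group G2" and cnt2: "countable (carrier G2)"
    and prb: "prob_space M" and act: "mp_action (free_product G1 G2) M \<alpha>"
begin

sublocale F: pmp_action "free_product G1 G2" M \<alpha>
  by (rule pmp_action.intro[OF group_free_product[OF grp1 grp2] countable_free_product[OF cnt1 cnt2] prb act])

sublocale P1: pmp_action G1 M "\<lambda>g. \<alpha> (fp_inl G1 g)"
  by (rule pmp_action.intro[OF grp1 cnt1 prb mp_action_compose_hom[OF grp1 fp_inl_hom[OF grp1] act]])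

sublocale P2: pmp_action G2 M "\<lambda>h. \<alpha> (fp_inr G2 h)"
  by (rule pmp_action.intro[OF grp2 cnt2 prb mp_action_compose_hom[OF grp2 fp_inr_hom[OF grp2] act]])

lemma carrier_fp: "carrier (free_product G1 G2) = {w. fp_reduced G1 G2 w}"
  by (simp add: free_product_def)

lemma one_fp: "\<one>\<^bsub>free_product G1 G2\<^esub> = []"
  by (simp add: free_product_def)

lemma mult_fp: "u \<otimes>\<^bsub>free_product G1 G2\<^esub> v = foldr (fp_cons G1 G2) u v"
  by (simp add: free_product_def)

lemma letter_inl: "fp_reduced G1 G2 w \<Longrightarrow> Inl g \<in> set w \<Longrightarrow> g \<in> carrier G1 \<and> g \<noteq> \<one>\<^bsub>G1\<^esub> \<and> fp_inl G1 g = ([Inl g] :: ('a + 'b) list)"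
  by (auto simp: fp_reduced_def list_all_iff fp_inl_def)

lemma letter_inr: "fp_reduced G1 G2 w \<Longrightarrow> Inr g \<in> set w \<Longrightarrow> g \<in> carrier G2 \<and> g \<noteq> \<one>\<^bsub>G2\<^esub> \<and> fp_inr G2 g = ([Inr g] :: ('a + 'b) list)"
  by (auto simp: fp_reduced_def list_all_iff fp_inr_def)

definition ev :: "('a \<Rightarrow> nat \<Rightarrow> nat) \<Rightarrow> ('b \<Rightarrow> nat \<Rightarrow> nat) \<Rightarrow> ('a + 'b) list \<Rightarrow> nat \<Rightarrow> nat" where
  "ev s1 s2 w = foldr (\<lambda>l. case l of Inl g \<Rightarrow> s1 g | Inr h \<Rightarrow> s2 h) w"

lemma ev_simps [simp]: "ev s1 s2 [] i = i" "ev s1 s2 (Inl g # w) i = s1 g (ev s1 s2 w i)"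
  "ev s1 s2 (Inr h # w) i = s2 h (ev s1 s2 w i)"
  by (simp_all add: ev_def)

text \<open>In the window each suffix of a reduced word is the product of its first letter and the rest, so
  multiplicativity at \<open>i\<close> can be used letter by letter.\<close>

lemma good_pt_ev:
  assumes V: "\<And>u. suffix u w \<Longrightarrow> u \<in> V" "\<And>l. l \<in> set w \<Longrightarrow> [l] \<in> V" and w: "fp_reduced G1 G2 w"
    and g: "F.good_pt \<sigma> \<kappa> V c i" and one: "\<sigma> [] i = i"
  shows "suffix u w \<Longrightarrow> \<sigma> u i = ev (\<lambda>g. \<sigma> (fp_inl G1 g)) (\<lambda>h. \<sigma> (fp_inr G2 h)) u i"
proof (induction u)
  case Nil
  then show ?case using one by simp
next
  case (Cons l u)
  have su: "suffix u w" using suffix_ConsD[OF Cons.prems] .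
  have lw: "l \<in> set w" using Cons.prems set_mono_suffix by fastforce
  have red: "fp_reduced G1 G2 (l # u)" using fp_reduced_suffix[OF w Cons.prems] .
  have m: "[l] \<otimes>\<^bsub>free_product G1 G2\<^esub> u = l # u" by (simp add: mult_fp fp_cons_eq_Cons[OF red])
  have "\<sigma> [l] (\<sigma> u i) = \<sigma> ([l] \<otimes>\<^bsub>free_product G1 G2\<^esub> u) i"
    using g V(1)[OF su] V(2)[OF lw] V(1)[OF Cons.prems] m unfolding F.good_pt_def by metis
  then have "\<sigma> (l # u) i = \<sigma> [l] (\<sigma> u i)" unfolding m by simp
  also have "\<dots> = \<sigma> [l] (ev (\<lambda>g. \<sigma> (fp_inl G1 g)) (\<lambda>h. \<sigma> (fp_inr G2 h)) u i)" using Cons.IH[OF su] by simp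
  also have "\<dots> = ev (\<lambda>g. \<sigma> (fp_inl G1 g)) (\<lambda>h. \<sigma> (fp_inr G2 h)) (l # u) i"
  proof (cases l)
    case (Inl g)
    then show ?thesis using letter_inl[OF w, of g] lw by simp
  next
    case (Inr h)
    then show ?thesis using letter_inr[OF w, of h] lw by simp
  qed
  finally show ?case .
qed

text \<open>The models of the factors obtained by restriction determine the action of the words in \<open>W\<close> at all
  good points, so they determine the model up to a small Hamming distance.\<close>

lemma model_count_free_product_le:
  assumes W: "finite W" "W \<subseteq> carrier (free_product G1 G2)"
    and p1: "(V1, c1, e1) \<in> P1.params" and p2: "(V2, c2, e2) \<in> P2.params" and \<beta>: "\<beta> > 0"
  defines "L1 \<equiv> {g. \<exists>w\<in>W. Inl g \<in> set w}" and "L2 \<equiv> {h. \<exists>w\<in>W. Inr h \<in> set w}"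
  shows "\<exists>V c \<epsilon>. (V, c, \<epsilon>) \<in> F.params \<and> (\<forall>d>0. real (card (F.model_count W V c \<epsilon> d)) \<le>
    real (card (P1.model_count L1 V1 c1 e1 d \<times> P2.model_count L2 V2 c2 e2 d)) * ((2 ^ card W) ^ d * (real d + 1) powr (\<beta> * real d)))"
proof -
  let ?i1 = "fp_inl G1" and ?i2 = "fp_inr G2"
  have P1: "finite V1" "V1 \<subseteq> carrier G1" "c1 \<in> M \<rightarrow>\<^sub>M count_space UNIV" "finite (c1 ` space M)" "e1 > 0"
    using p1 by (auto simp: P1.params_def)
  have P2: "finite V2" "V2 \<subseteq> carrier G2" "c2 \<in> M \<rightarrow>\<^sub>M count_space UNIV" "finite (c2 ` space M)" "e2 > 0"
    using p2 by (auto simp: P2.params_def)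
  have red: "fp_reduced G1 G2 w" if "w \<in> W" for w using that W(2) by (auto simp: carrier_fp)
  define S where "S = {u. \<exists>w\<in>W. suffix u w}"
  define V where "V = ?i1 ` V1 \<union> ?i2 ` V2 \<union> S \<union> (\<lambda>l. [l]) ` (\<Union>w\<in>W. set w)"
  have finS: "finite S" unfolding S_def by (rule finite_suffix_closure[OF W(1)])
  have V: "finite V" unfolding V_def using P1(1) P2(1) finS W(1) by simp
  have Vc: "V \<subseteq> carrier (free_product G1 G2)"
  proof -
    have "?i1 ` V1 \<subseteq> carrier (free_product G1 G2)" "?i2 ` V2 \<subseteq> carrier (free_product G1 G2)"
      using P1(2) P2(2) hom_in_carrier[OF fp_inl_hom[OF grp1]] hom_in_carrier[OF fp_inr_hom[OF grp2]] by blast+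
    moreover have "S \<subseteq> carrier (free_product G1 G2)" unfolding S_def carrier_fp using fp_reduced_suffix red by blast
    moreover have "fp_reduced G1 G2 [l]" if "l \<in> set w" "w \<in> W" for l w
      using red[OF that(2)] that(1) by (auto simp: fp_reduced_def list_all_iff)
    ultimately show ?thesis unfolding V_def carrier_fp by blast
  qed
  \<comment> \<open>One colouring that refines both given ones.\<close>
  define c where "c x = prod_encode (c1 x, c2 x)" for x
  have cm: "c \<in> M \<rightarrow>\<^sub>M count_space UNIV"
    unfolding measurable_colour_iff
  proof
    fix a
    have "{x \<in> space M. c x = a} = {x \<in> space M. c1 x = fst (prod_decode a)} \<inter> {x \<in> space M. c2 x = snd (prod_decode a)}"
      unfolding c_def by auto
    also have "\<dots> \<in> sets M" using P1(3) P2(3) unfolding measurable_colour_iff by (intro sets.Int) blast+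
    finally show "{x \<in> space M. c x = a} \<in> sets M" .
  qed
  have cf: "finite (c ` space M)"
  proof (rule finite_subset)
    show "c ` space M \<subseteq> prod_encode ` (c1 ` space M \<times> c2 ` space M)" unfolding c_def by blast
  qed (use P1(4) P2(4) in simp)
  define \<epsilon> where "\<epsilon> = min e1 (min e2 (\<beta> / (2 * (real (card W) + 1))))"
  have \<epsilon>: "\<epsilon> > 0" "\<epsilon> \<le> e1" "\<epsilon> \<le> e2" "\<epsilon> \<le> \<beta> / (2 * (real (card W) + 1))" using P1(5) P2(5) \<beta> by (auto simp: \<epsilon>_def)
  have fL: "finite L1" "finite L2" unfolding L1_def L2_def using finite_letters W(1) by blast+
  have "real (card (F.model_count W V c \<epsilon> d)) \<le>
    real (card (P1.model_count L1 V1 c1 e1 d \<times> P2.model_count L2 V2 c2 e2 d)) * ((2 ^ card W) ^ d * (real d + 1) powr (\<beta> * real d))"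
    if d: "d > 0" for d
  proof -
    let ?I = "W \<times> {..<d}" and ?T = "P1.model_count L1 V1 c1 e1 d \<times> P2.model_count L2 V2 c2 e2 d"
    define m where "m = nat \<lfloor>\<beta> * real d\<rfloor>"
    have mle: "real m \<le> \<beta> * real d" unfolding m_def using \<beta> by simp
    define Rel where "Rel s t \<longleftrightarrow> (\<exists>D. D \<subseteq> {..<d} \<and> real (card D) \<le> \<epsilon> * real d \<and>
       (\<forall>w\<in>W. \<forall>i<d. i \<notin> D \<longrightarrow> s (w, i) = ev (\<lambda>g j. fst t (g, j)) (\<lambda>h j. snd t (h, j)) w i))"
      for s :: "('a + 'b) list \<times> nat \<Rightarrow> nat" and t :: "('a \<times> nat \<Rightarrow> nat) \<times> ('b \<times> nat \<Rightarrow> nat)"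
    have sub: "F.model_count W V c \<epsilon> d \<subseteq> ?I \<rightarrow>\<^sub>E {..<d}"
      unfolding F.model_count_def by (intro image_subsetI F.restr_PiE)
    have "card (F.model_count W V c \<epsilon> d) \<le> card ?T * (2 ^ card ?I * card {..<d} ^ m)"
    proof (rule hamming_card[where R = Rel])
      show "finite ?I" using W by simp
      show "finite {..<d}" "{..<d} \<noteq> {}" using d by auto
      show "F.model_count W V c \<epsilon> d \<subseteq> ?I \<rightarrow>\<^sub>E {..<d}" by (rule sub)
      show "finite ?T" using P1.finite_model_count[OF fL(1)] P2.finite_model_count[OF fL(2)] by (rule finite_cartesian_product)
      show "\<exists>t\<in>?T. Rel s t" if s: "s \<in> F.model_count W V c \<epsilon> d" for s
      proof -
        obtain \<sigma> \<kappa> where \<sigma>: "F.model V c \<epsilon> d \<sigma> \<kappa>" "s = F.restr W d \<sigma>"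
          using s unfolding F.model_count_def F.models_def by blast
        have "P1.model V1 c1 e1 d (\<lambda>g. \<sigma> (?i1 g)) (\<lambda>i. fst (prod_decode (\<kappa> i)))"
          by (rule F.model_pullback[OF P1.pmp_action_axioms fp_inl_hom[OF grp1] _ P1(2) _ _ \<epsilon>(2) \<sigma>(1)])
             (auto simp: one_fp fp_inl_def V_def c_def split: if_splits)
        then have t1: "P1.restr L1 d (\<lambda>g. \<sigma> (?i1 g)) \<in> P1.model_count L1 V1 c1 e1 d"
          unfolding P1.model_count_def P1.models_def by blast
        have "P2.model V2 c2 e2 d (\<lambda>g. \<sigma> (?i2 g)) (\<lambda>i. snd (prod_decode (\<kappa> i)))"
          by (rule F.model_pullback[OF P2.pmp_action_axioms fp_inr_hom[OF grp2] _ P2(2) _ _ \<epsilon>(3) \<sigma>(1)])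
             (auto simp: one_fp fp_inr_def V_def c_def split: if_splits)
        then have t2: "P2.restr L2 d (\<lambda>g. \<sigma> (?i2 g)) \<in> P2.model_count L2 V2 c2 e2 d"
          unfolding P2.model_count_def P2.models_def by blast
        let ?t = "(P1.restr L1 d (\<lambda>g. \<sigma> (?i1 g)), P2.restr L2 d (\<lambda>g. \<sigma> (?i2 g)))"
        let ?D = "{i. i < d \<and> \<not> F.good_pt \<sigma> \<kappa> V c i}"
        have lt: "\<sigma> w i < d" if "i < d" for w i using \<sigma>(1) that unfolding F.model_def by blast
        have one: "\<sigma> [] i = i" if "i < d" for i using \<sigma>(1) that unfolding F.model_def one_fp by blast
        have "s (w, i) = ev (\<lambda>g j. fst ?t (g, j)) (\<lambda>h j. snd ?t (h, j)) w i"
          if w: "w \<in> W" and i: "i < d" "i \<notin> ?D" for w i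
        proof -
          have g: "F.good_pt \<sigma> \<kappa> V c i" using i by blast
          have "\<sigma> w i = ev (\<lambda>g. \<sigma> (?i1 g)) (\<lambda>h. \<sigma> (?i2 h)) w i"
          proof (rule good_pt_ev[OF _ _ red[OF w] g one[OF i(1)]])
            show "u \<in> V" if "suffix u w" for u using that w unfolding V_def S_def by blast
            show "[l] \<in> V" if "l \<in> set w" for l using that w unfolding V_def by blast
          qed simp
          also have "\<dots> = ev (\<lambda>g j. fst ?t (g, j)) (\<lambda>h j. snd ?t (h, j)) w i"
          proof -
            have "set u \<subseteq> set w \<Longrightarrow> ev (\<lambda>g. \<sigma> (?i1 g)) (\<lambda>h. \<sigma> (?i2 h)) u i = ev (\<lambda>g j. fst ?t (g, j)) (\<lambda>h j. snd ?t (h, j)) u i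
              \<and> ev (\<lambda>g. \<sigma> (?i1 g)) (\<lambda>h. \<sigma> (?i2 h)) u i < d" for u
            proof (induction u)
              case Nil
              then show ?case using i by simp
            next
              case (Cons l u)
              then have IH: "ev (\<lambda>g. \<sigma> (?i1 g)) (\<lambda>h. \<sigma> (?i2 h)) u i = ev (\<lambda>g j. fst ?t (g, j)) (\<lambda>h j. snd ?t (h, j)) u i"
                "ev (\<lambda>g. \<sigma> (?i1 g)) (\<lambda>h. \<sigma> (?i2 h)) u i < d" by auto
              show ?case
              proof (cases l)
                case (Inl g)
                then have "g \<in> L1" using Cons.prems w unfolding L1_def by auto
                then show ?thesis using IH lt[OF IH(2), of "?i1 g"] Inl by (simp add: P1.restr_def)
              next
                case (Inr g)
                then have "g \<in> L2" using Cons.prems w unfolding L2_def by auto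
                then show ?thesis using IH lt[OF IH(2), of "?i2 g"] Inr by (simp add: P2.restr_def)
              qed
            qed
            from this[of w] show ?thesis by blast
          qed
          finally show ?thesis using \<sigma>(2) w i by (simp add: F.restr_def)
        qed
        moreover have "real (card ?D) \<le> \<epsilon> * real d" using \<sigma>(1) unfolding F.model_def by blast
        moreover have "?D \<subseteq> {..<d}" by auto
        ultimately have "Rel s ?t" unfolding Rel_def by blast
        then show ?thesis using t1 t2 by blast
      qed
      fix s s' t assume r: "Rel s t" "Rel s' t"
      obtain D where D: "D \<subseteq> {..<d}" "real (card D) \<le> \<epsilon> * real d"
        "\<forall>w\<in>W. \<forall>i<d. i \<notin> D \<longrightarrow> s (w, i) = ev (\<lambda>g j. fst t (g, j)) (\<lambda>h j. snd t (h, j)) w i"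
        using r(1) unfolding Rel_def by blast
      obtain D' where D': "D' \<subseteq> {..<d}" "real (card D') \<le> \<epsilon> * real d"
        "\<forall>w\<in>W. \<forall>i<d. i \<notin> D' \<longrightarrow> s' (w, i) = ev (\<lambda>g j. fst t (g, j)) (\<lambda>h j. snd t (h, j)) w i"
        using r(2) unfolding Rel_def by blast
      have finD: "finite (D \<union> D')" using D(1) D'(1) finite_subset[of _ "{..<d}"] by blast
      have "{k \<in> ?I. s k \<noteq> s' k} \<subseteq> W \<times> (D \<union> D')"
      proof
        fix k assume k: "k \<in> {k \<in> ?I. s k \<noteq> s' k}"
        obtain w i where wi: "k = (w, i)" by (cases k)
        then have "w \<in> W" "i < d" "s (w, i) \<noteq> s' (w, i)" using k by auto
        then have "i \<in> D \<or> i \<in> D'" using D(3) D'(3) by fastforce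
        then show "k \<in> W \<times> (D \<union> D')" using wi \<open>w \<in> W\<close> by simp
      qed
      then have "card {k \<in> ?I. s k \<noteq> s' k} \<le> card (W \<times> (D \<union> D'))"
        using W(1) finD by (intro card_mono finite_cartesian_product)
      also have "\<dots> \<le> card W * (card D + card D')" by (simp add: card_cartesian_product card_Un_le)
      finally have "real (card {k \<in> ?I. s k \<noteq> s' k}) \<le> real (card W * (card D + card D'))" by (rule of_nat_mono)
      also have "\<dots> = real (card W) * (real (card D) + real (card D'))" by simp
      also have "\<dots> \<le> real (card W) * (\<epsilon> * real d + \<epsilon> * real d)" using D(2) D'(2) by (intro mult_left_mono add_mono) auto
      also have "\<dots> \<le> real (card W) * (\<beta> / (2 * (real (card W) + 1)) * real d + \<beta> / (2 * (real (card W) + 1)) * real d)"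
        using \<epsilon>(4) by (intro mult_left_mono add_mono mult_right_mono) auto
      also have "\<dots> = (real (card W) / (real (card W) + 1)) * (\<beta> * real d)"
      proof -
        have "N * (\<beta> / (2 * X) * E + \<beta> / (2 * X) * E) = N / X * (\<beta> * E)" for N X E :: real by simp
        then show ?thesis .
      qed
      also have "\<dots> \<le> 1 * (\<beta> * real d)" using \<beta> by (intro mult_right_mono) (auto simp: divide_simps)
      finally show "card {k \<in> ?I. s k \<noteq> s' k} \<le> m" unfolding m_def by (simp add: le_nat_floor)
    qed
    then have "real (card (F.model_count W V c \<epsilon> d)) \<le> real (card ?T * (2 ^ card ?I * card {..<d} ^ m))" by (rule of_nat_mono)
    also have "\<dots> = real (card ?T) * ((2 ^ card W) ^ d * real d ^ m)"
      using W by (simp add: card_cartesian_product power_mult)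
    also have "\<dots> \<le> real (card ?T) * ((2 ^ card W) ^ d * (real d + 1) powr (\<beta> * real d))"
    proof (intro mult_left_mono)
      have "real d ^ m \<le> (real d + 1) ^ m" by (intro power_mono) auto
      also have "(real d + 1) ^ m = (real d + 1) powr real m" by (simp add: powr_realpow)
      also have "\<dots> \<le> (real d + 1) powr (\<beta> * real d)" using mle by (intro powr_mono) auto
      finally show "real d ^ m \<le> (real d + 1) powr (\<beta> * real d)" .
    qed auto
    finally show ?thesis .
  qed
  moreover have "(V, c, \<epsilon>) \<in> F.params" using V Vc cm cf \<epsilon>(1) by (simp add: F.params_def)
  ultimately show ?thesis by blast
qed

theorem model_dim_free_product_le:
  "F.model_dim limsup \<le> dim_add (P1.model_dim limsup) (P2.model_dim limsup)"
proof (rule F.model_dim_bounds)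
  fix W assume W: "finite W" "W \<subseteq> carrier (free_product G1 G2)"
  let ?L1 = "{g. \<exists>w\<in>W. Inl g \<in> set w}" and ?L2 = "{h. \<exists>w\<in>W. Inr h \<in> set w}"
  let ?X = "INF (V, c, \<epsilon>)\<in>F.params. limsup (\<lambda>d. log_rate d (F.model_count W V c \<epsilon> d))"
  let ?f = "\<lambda>(V, c, \<epsilon>). limsup (\<lambda>d. log_rate d (P1.model_count ?L1 V c \<epsilon> d))"
  let ?g = "\<lambda>(V, c, \<epsilon>). limsup (\<lambda>d. log_rate d (P2.model_count ?L2 V c \<epsilon> d))"
  have L: "finite ?L1" "finite ?L2" using finite_letters[OF W(1)] by blast+
  have Lc: "?L1 \<subseteq> carrier G1" "?L2 \<subseteq> carrier G2"
    using W(2) letter_inl letter_inr unfolding carrier_fp by blast+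
  have dich: "limsup (\<lambda>d. log_rate d (A d)) = -\<infinity> \<or> 0 \<le> limsup (\<lambda>d. log_rate d (A d))" for A :: "nat \<Rightarrow> 'z set"
    using limsup_eventually_empty[OF eventually_empty_if_limsup_neg[of A]] not_le by blast
  have "?X \<le> dim_add (INF p\<in>P1.params. ?f p) (INF p\<in>P2.params. ?g p)"
  proof (rule le_dim_add_INF)
    fix p1 p2 and e :: real assume p: "p1 \<in> P1.params" "p2 \<in> P2.params" and e: "e > 0"
    obtain V1 c1 e1 V2 c2 e2 where pp: "p1 = (V1, c1, e1)" "p2 = (V2, c2, e2)" by (cases p1, cases p2)
    let ?A = "P1.model_count ?L1 V1 c1 e1" and ?B = "P2.model_count ?L2 V2 c2 e2"
    obtain V c \<epsilon> where q: "(V, c, \<epsilon>) \<in> F.params" and le: "\<And>d. d > 0 \<Longrightarrow> real (card (F.model_count W V c \<epsilon> d)) \<le>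
      real (card (?A d \<times> ?B d)) * ((2 ^ card W) ^ d * (real d + 1) powr (e / 2 * real d))"
      using model_count_free_product_le[OF W p(1)[unfolded pp] p(2)[unfolded pp] half_gt_zero[OF e]] by blast
    have fA: "finite (?A d)" and fB: "finite (?B d)" for d
      using P1.finite_model_count[OF L(1)] P2.finite_model_count[OF L(2)] by blast+
    have K: "(1::real) \<le> 2 ^ card W" "e / 2 < e" using e by auto
    have "?X \<le> limsup (\<lambda>d. log_rate d (F.model_count W V c \<epsilon> d))"
      using INF_lower[OF q, of "\<lambda>(V, c, \<epsilon>). limsup (\<lambda>d. log_rate d (F.model_count W V c \<epsilon> d))"] by simp
    also have "\<dots> \<le> limsup (\<lambda>d. log_rate d (?A d \<times> ?B d)) + ereal e"
    proof (rule limit_like_limsup[unfolded limit_like_def, rule_format])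
      show "\<forall>\<^sub>F d in sequentially. log_rate d (F.model_count W V c \<epsilon> d) \<le> log_rate d (?A d \<times> ?B d) + ereal e"
        using eventually_log_rate_le[OF K, where 'a = "('a + 'b) list \<times> nat \<Rightarrow> nat" and 'b = "('a \<times> nat \<Rightarrow> nat) \<times> ('b \<times> nat \<Rightarrow> nat)"]
          eventually_gt_at_top[of 0]
      proof eventually_elim
        case (elim d)
        show ?case by (rule elim(1)[rule_format, OF _ _ le[OF elim(2)]]) (rule F.finite_model_count[OF W(1)] finite_cartesian_product[OF fA fB])+
      qed
    qed
    also have "\<dots> \<le> dim_add (?f p1) (?g p2) + ereal e"
      using limsup_product[of ?A ?B, OF fA fB] unfolding pp by (simp add: add_right_mono)
    finally show "?X \<le> dim_add (?f p1) (?g p2) + ereal e" .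
  next
    fix p assume "p \<in> P1.params"
    obtain V c \<epsilon> where "p = (V, c, \<epsilon>)" by (cases p)
    then show "?f p = -\<infinity> \<or> 0 \<le> ?f p" using dich by simp
  next
    fix p assume "p \<in> P2.params"
    obtain V c \<epsilon> where "p = (V, c, \<epsilon>)" by (cases p)
    then show "?g p = -\<infinity> \<or> 0 \<le> ?g p" using dich by simp
  next
    have "finite ((\<lambda>_. 0 :: nat) ` space M)" by (rule finite_subset[of _ "{0}"]) auto
    then have "({}, \<lambda>_. 0, 1) \<in> P1.params" "({}, \<lambda>_. 0, 1) \<in> P2.params"
      by (simp_all add: P1.params_def P2.params_def)
    then show "P1.params \<noteq> {}" "P2.params \<noteq> {}" by blast+
  qed
  also have "\<dots> \<le> dim_add (P1.model_dim limsup) (P2.model_dim limsup)"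
    unfolding P1.model_dim_def P2.model_dim_def
    by (intro dim_add_mono SUP_upper) (use L Lc in blast)+
  finally show "?X \<le> dim_add (P1.model_dim limsup) (P2.model_dim limsup)" .
qed

end

section \<open>Joining two models by a random permutation\<close>

context pmp_action
begin

text \<open>The products and inverses needed to compute with the letters \<open>A\<close> at a good point.\<close>

definition window :: "'g set \<Rightarrow> 'g set \<Rightarrow> bool" where
  "window A V \<longleftrightarrow> A \<subseteq> carrier G \<and> \<one> \<notin> A \<and> finite V \<and> \<one> \<in> V \<and> A \<subseteq> V \<and> (\<forall>g\<in>A. inv g \<in> V) \<and>
     (\<forall>g\<in>A. \<forall>h\<in>A. g \<otimes> h \<in> V)"

text \<open>The model comes with its own colouring \<open>\<kappa>'\<close>; at a tame point it agrees with the common colouring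
  \<open>\<kappa>\<close> before and after each letter.\<close>

definition tame :: "('g \<Rightarrow> nat \<Rightarrow> nat) \<Rightarrow> (nat \<Rightarrow> nat) \<Rightarrow> (nat \<Rightarrow> nat) \<Rightarrow> 'g set \<Rightarrow> 'g set \<Rightarrow> ('x \<Rightarrow> nat) \<Rightarrow> nat \<Rightarrow> nat \<Rightarrow> bool" where
  "tame \<sigma> \<kappa>' \<kappa> V A c d y \<longleftrightarrow> y < d \<and> good_pt \<sigma> \<kappa>' V c y \<and> \<kappa>' y = \<kappa> y \<and> (\<forall>g\<in>A. \<kappa>' (\<sigma> g y) = \<kappa> (\<sigma> g y))"

lemma tameD:
  assumes "tame \<sigma> \<kappa>' \<kappa> V A c d y"
  shows "y < d" "good_pt \<sigma> \<kappa>' V c y" "\<kappa>' y = \<kappa> y" "\<And>g. g \<in> A \<Longrightarrow> \<kappa>' (\<sigma> g y) = \<kappa> (\<sigma> g y)"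
  using assms unfolding tame_def by blast+

lemma windowD:
  assumes "window A V"
  shows "A \<subseteq> carrier G" "\<one> \<notin> A" "finite V" "\<one> \<in> V" "A \<subseteq> V" "\<And>g. g \<in> A \<Longrightarrow> inv g \<in> V"
    "\<And>g h. g \<in> A \<Longrightarrow> h \<in> A \<Longrightarrow> g \<otimes> h \<in> V"
  using assms unfolding window_def by blast+

lemma good_pt_mult: "good_pt \<sigma> \<kappa> V c y \<Longrightarrow> g \<in> V \<Longrightarrow> h \<in> V \<Longrightarrow> g \<otimes> h \<in> V \<Longrightarrow> \<sigma> g (\<sigma> h y) = \<sigma> (g \<otimes> h) y"
  unfolding good_pt_def by blast

lemma tame_mult:
  assumes "window A V" "tame \<sigma> \<kappa>' \<kappa> V A c d y" "g \<in> A" "h \<in> A"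
  shows "\<sigma> g (\<sigma> h y) = \<sigma> (g \<otimes> h) y"
  by (rule good_pt_mult[OF tameD(2)[OF assms(2)]]) (use windowD(5,7)[OF assms(1)] assms(3,4) in blast)+

lemma tame_free:
  assumes "window A V" "tame \<sigma> \<kappa>' \<kappa> V A c d y" "g \<in> A"
  shows "\<sigma> g y \<noteq> y"
proof
  assume "\<sigma> g y = y"
  moreover have "g \<in> V" using windowD(5)[OF assms(1)] assms(3) by blast
  ultimately have "g = \<one>" using tameD(2)[OF assms(2)] unfolding good_pt_def by blast
  then show False using windowD(2)[OF assms(1)] assms(3) by blast
qed

lemma good_pt_inj:
  assumes A: "window A V" and one: "\<forall>i<d. \<sigma> \<one> i = i" and y: "good_pt \<sigma> \<kappa> V c y" "y < d"
    and y': "good_pt \<sigma> \<kappa> V c y'" "y' < d" and g: "g \<in> A" and eq: "\<sigma> g y = \<sigma> g y'"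
  shows "y = y'"
proof -
  have gV: "g \<in> V" "inv g \<in> V" "\<one> \<in> V" and gc: "g \<in> carrier G" using windowD[OF A] g by blast+
  have m: "inv g \<otimes> g = \<one>" using gc by simp
  have *: "\<sigma> (inv g) (\<sigma> g z) = z" if z: "good_pt \<sigma> \<kappa> V c z" "z < d" for z
    using good_pt_mult[OF z(1) gV(2,1)] m gV(3) one z(2) by simp
  have "y = \<sigma> (inv g) (\<sigma> g y)" by (rule *[OF y, symmetric])
  also have "\<dots> = \<sigma> (inv g) (\<sigma> g y')" by (simp only: eq)
  also have "\<dots> = y'" by (rule *[OF y'])
  finally show ?thesis .
qed

text \<open>This is the colour bookkeeping of one step of a walk: a point of the model is matched with a
  point of the space that has the same colour before and after the step.\<close>

lemma tame_colour:
  assumes A: "window A V" and one: "\<forall>i<d. \<sigma> \<one> i = i" and y: "tame \<sigma> \<kappa>' \<kappa> V A c d y" and g: "g \<in> A"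
  shows "\<exists>x\<in>space M. c x = \<kappa> y \<and> c (\<alpha> g x) = \<kappa> (\<sigma> g y)"
proof -
  obtain x where x: "x \<in> space M" "\<forall>g\<in>V. \<kappa>' (\<sigma> g y) = c (\<alpha> g x)"
    using tameD(2)[OF y] unfolding good_pt_def by blast
  have gV: "g \<in> V" "\<one> \<in> V" using windowD[OF A] g by blast+
  have yd: "\<sigma> \<one> y = y" using one tameD(1)[OF y] by blast
  have "c x = \<kappa> y" using x(2)[rule_format, OF gV(2)] x(1) yd tameD(3)[OF y] by simp
  moreover have "c (\<alpha> g x) = \<kappa> (\<sigma> g y)" using x(2)[rule_format, OF gV(1)] tameD(4)[OF y g] by simp
  ultimately show ?thesis using x(1) by blast
qed

text \<open>Letters act injectively on good points, so each letter leads few points into the set where the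
  colourings differ.\<close>

lemma card_untame:
  assumes A: "window A V" and m: "model V c e d \<sigma> \<kappa>'" and e: "e \<le> \<nu>"
    and \<kappa>: "real (card {i. i < d \<and> \<kappa>' i \<noteq> \<kappa> i}) \<le> \<nu> * real d"
  shows "real (card {i. i < d \<and> \<not> tame \<sigma> \<kappa>' \<kappa> V A c d i}) \<le> (2 + real (card A)) * \<nu> * real d"
proof -
  let ?B = "{i. i < d \<and> \<not> good_pt \<sigma> \<kappa>' V c i}" and ?D = "{i. i < d \<and> \<kappa>' i \<noteq> \<kappa> i}"
  let ?S = "\<lambda>g. {i. i < d \<and> good_pt \<sigma> \<kappa>' V c i \<and> \<kappa>' (\<sigma> g i) \<noteq> \<kappa> (\<sigma> g i)}"
  have fA: "finite A" using windowD(3,5)[OF A] finite_subset by blast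
  have one: "\<forall>i<d. \<sigma> \<one> i = i" and lt: "\<And>g i. i < d \<Longrightarrow> \<sigma> g i < d"
    and B: "real (card ?B) \<le> e * real d" using m unfolding model_def by blast+
  have fin: "finite ?B" "finite ?D" "\<And>g. finite (?S g)" by simp_all
  have S: "card (?S g) \<le> card ?D" if g: "g \<in> A" for g
  proof (rule card_inj_on_le)
    show "inj_on (\<sigma> g) (?S g)"
    proof (rule inj_onI)
      fix y y' assume y: "y \<in> ?S g" "y' \<in> ?S g" and eq: "\<sigma> g y = \<sigma> g y'"
      have p: "good_pt \<sigma> \<kappa>' V c y" "y < d" "good_pt \<sigma> \<kappa>' V c y'" "y' < d" using y by blast+
      show "y = y'" by (rule good_pt_inj[OF A one p g eq])
    qed
    show "\<sigma> g ` ?S g \<subseteq> ?D" using lt by blast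
  qed (rule fin)
  have sub: "{i. i < d \<and> \<not> tame \<sigma> \<kappa>' \<kappa> V A c d i} \<subseteq> ?B \<union> ?D \<union> (\<Union>g\<in>A. ?S g)"
    unfolding tame_def by blast
  have "card {i. i < d \<and> \<not> tame \<sigma> \<kappa>' \<kappa> V A c d i} \<le> card (?B \<union> ?D \<union> (\<Union>g\<in>A. ?S g))"
    by (intro card_mono sub finite_UnI fin finite_UN_I fA)
  also have "\<dots> \<le> card (?B \<union> ?D) + card (\<Union>g\<in>A. ?S g)" by (rule card_Un_le)
  also have "\<dots> \<le> (card ?B + card ?D) + (\<Sum>g\<in>A. card (?S g))"
    by (intro add_mono card_Un_le card_UN_le fA)
  also have "\<dots> \<le> (card ?B + card ?D) + card A * card ?D"
    using sum_bounded_above[of A "\<lambda>g. card (?S g)" "card ?D"] S by (intro add_left_mono) simp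
  finally have "real (card {i. i < d \<and> \<not> tame \<sigma> \<kappa>' \<kappa> V A c d i}) \<le> real ((card ?B + card ?D) + card A * card ?D)"
    by (rule of_nat_mono)
  also have "\<dots> = real (card ?B) + real (card ?D) + real (card A) * real (card ?D)" by simp
  also have "\<dots> \<le> \<nu> * real d + \<nu> * real d + real (card A) * (\<nu> * real d)"
  proof (intro add_mono mult_left_mono \<kappa>)
    show "real (card ?B) \<le> \<nu> * real d" by (rule order_trans[OF B mult_right_mono[OF e]]) simp
  qed simp
  also have "\<dots> = (2 + real (card A)) * \<nu> * real d" by (simp add: algebra_simps)
  finally show ?thesis .
qed

end

text \<open>\<open>Z\<close> contains all words met while multiplying two words of the window \<open>V\<close> letter by letter, and
  \<open>A1\<close>, \<open>A2\<close> contain their letters. The colouring \<open>ct\<close> used for the factors refines \<open>c\<close> and determines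
  its values along prefixes of words in \<open>V\<close>; \<open>q\<close> recovers \<open>c\<close>. All colour classes of \<open>\<kappa>\<close> are large,
  and the last group of inequalities makes the exceptional sets small.\<close>

locale random_join = free_product_action G1 G2 M \<alpha>
  for G1 :: "('a, 'm) monoid_scheme" and G2 :: "('b, 'n) monoid_scheme"
    and M :: "'x measure" and \<alpha> :: "('a + 'b) list \<Rightarrow> 'x \<Rightarrow> 'x" +
  fixes V Z :: "('a + 'b) list set" and c ct :: "'x \<Rightarrow> nat" and q :: "nat \<Rightarrow> nat"
    and V1 A1 :: "'a set" and V2 A2 :: "'b set" and e \<nu> \<epsilon> :: real and d m0 N :: nat
    and \<sigma>1 :: "'a \<Rightarrow> nat \<Rightarrow> nat" and \<sigma>2 :: "'b \<Rightarrow> nat \<Rightarrow> nat" and \<kappa> \<kappa>1 \<kappa>2 :: "nat \<Rightarrow> nat"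
  assumes V: "finite V" "V \<subseteq> Z"
    and Z: "finite Z" "Z \<subseteq> carrier (free_product G1 G2)" "\<And>u z. z \<in> Z \<Longrightarrow> suffix u z \<Longrightarrow> u \<in> Z"
    and ZV: "\<And>u w v. w \<in> V \<Longrightarrow> v \<in> V \<Longrightarrow> suffix u w \<Longrightarrow> foldr (fp_cons G1 G2) u v \<in> Z"
    and len: "\<And>z. z \<in> Z \<Longrightarrow> length z \<le> N"
    and A: "\<And>z g. z \<in> Z \<Longrightarrow> Inl g \<in> set z \<Longrightarrow> g \<in> A1" "\<And>z h. z \<in> Z \<Longrightarrow> Inr h \<in> set z \<Longrightarrow> h \<in> A2"
    and win: "P1.window A1 V1" "P2.window A2 V2"
    and q: "\<And>x. x \<in> space M \<Longrightarrow> c x = q (ct x)"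
    and refine: "\<And>x y u w. x \<in> space M \<Longrightarrow> y \<in> space M \<Longrightarrow> ct x = ct y \<Longrightarrow> w \<in> V \<Longrightarrow> prefix u w \<Longrightarrow> c (\<alpha> u x) = c (\<alpha> u y)"
    and mod1: "P1.model V1 ct e d \<sigma>1 \<kappa>1" and mod2: "P2.model V2 ct e d \<sigma>2 \<kappa>2"
    and \<kappa>: "\<And>i. i < d \<Longrightarrow> \<kappa> i \<in> ct ` space M"
    and near: "real (card {i. i < d \<and> \<kappa>1 i \<noteq> \<kappa> i}) \<le> \<nu> * real d" "real (card {i. i < d \<and> \<kappa>2 i \<noteq> \<kappa> i}) \<le> \<nu> * real d"
    and big: "\<And>i. i < d \<Longrightarrow> m0 \<le> card {j. j < d \<and> \<kappa> j = \<kappa> i}" and mN: "2 * N + 1 < m0"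
    and small: "e \<le> \<nu>" "real (card Z) * (2 + real (card A1) + real (card A2)) * \<nu> \<le> \<epsilon> / 2" "2 * \<nu> \<le> \<epsilon>"
      "4 * real (card V) * real N * ((3 * real (2 * N + 1) + 2) / (real m0 - real (2 * N + 1))) \<le> \<epsilon>"
    and \<epsilon>: "\<epsilon> > 0"
begin

abbreviation "tame1 \<equiv> P1.tame \<sigma>1 \<kappa>1 \<kappa> V1 A1 ct d"
abbreviation "tame2 \<equiv> P2.tame \<sigma>2 \<kappa>2 \<kappa> V2 A2 ct d"

lemma mod1D: "\<And>g i. i < d \<Longrightarrow> \<sigma>1 g i < d" "\<forall>i<d. \<sigma>1 \<one>\<^bsub>G1\<^esub> i = i" using mod1 unfolding P1.model_def by blast+
lemma mod2D: "\<And>h i. i < d \<Longrightarrow> \<sigma>2 h i < d" "\<forall>i<d. \<sigma>2 \<one>\<^bsub>G2\<^esub> i = i" using mod2 unfolding P2.model_def by blast+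

sublocale two_factor_walk d \<kappa> \<sigma>1 \<sigma>2 tame1 tame2 A1 A2 m0 "2 * N + 1"
proof (rule two_factor_walk.intro)
  show "\<And>y. tame1 y \<Longrightarrow> y < d" by (rule P1.tameD(1))
  show "\<And>y. tame2 y \<Longrightarrow> y < d" by (rule P2.tameD(1))
  show "\<And>y g. tame1 y \<Longrightarrow> g \<in> A1 \<Longrightarrow> \<sigma>1 g y < d" by (rule mod1D(1)[OF P1.tameD(1)])
  show "\<And>y g. tame2 y \<Longrightarrow> g \<in> A2 \<Longrightarrow> \<sigma>2 g y < d" by (rule mod2D(1)[OF P2.tameD(1)])
  show "\<And>y g. tame1 y \<Longrightarrow> g \<in> A1 \<Longrightarrow> \<sigma>1 g y \<noteq> y" by (rule P1.tame_free[OF win(1)])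
  show "\<And>y g. tame2 y \<Longrightarrow> g \<in> A2 \<Longrightarrow> \<sigma>2 g y \<noteq> y" by (rule P2.tame_free[OF win(2)])
  show "\<And>y y' g. tame1 y \<Longrightarrow> tame1 y' \<Longrightarrow> g \<in> A1 \<Longrightarrow> \<sigma>1 g y = \<sigma>1 g y' \<Longrightarrow> y = y'"
    by (rule P1.good_pt_inj[OF win(1), where \<sigma> = \<sigma>1 and d = d]) (rule mod1D(2) | rule P1.tameD(1,2) | assumption)+
  show "\<And>y y' g. tame2 y \<Longrightarrow> tame2 y' \<Longrightarrow> g \<in> A2 \<Longrightarrow> \<sigma>2 g y = \<sigma>2 g y' \<Longrightarrow> y = y'"
    by (rule P2.good_pt_inj[OF win(2), where \<sigma> = \<sigma>2 and d = d]) (rule mod2D(2) | rule P2.tameD(1,2) | assumption)+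
qed (use big mN in blast)+

text \<open>A word acts from its last letter to its first, whereas walks read their letters in order of
  application.\<close>

definition act :: "(nat \<Rightarrow> nat) \<Rightarrow> ('a + 'b) list \<Rightarrow> nat \<Rightarrow> nat" where
  "act f w i = walk f (rev w) i"

definition alltame :: "(nat \<Rightarrow> nat) \<Rightarrow> ('a + 'b) list \<Rightarrow> nat \<Rightarrow> bool" where
  "alltame f w i \<longleftrightarrow> tame_walk f (rev w) i"

lemma walk_append: "walk f (xs @ ys) j = walk f ys (walk f xs j)"
  by (induction xs arbitrary: j) auto

lemma tame_walk_append: "tame_walk f (xs @ ys) j \<longleftrightarrow> tame_walk f xs j \<and> tame_walk f ys (walk f xs j)"
  by (induction xs arbitrary: j) auto

lemma act_simps [simp]: "act f [] i = i" "act f (l # w) i = step f l (act f w i)"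
  by (simp_all add: act_def walk_append)

lemma alltame_simps [simp]: "alltame f [] i" "alltame f (l # w) i \<longleftrightarrow> alltame f w i \<and> tame_step f l (act f w i)"
  by (simp_all add: act_def alltame_def tame_walk_append)

lemma act_eq_ev: "act f w i = ev \<sigma>1 (\<lambda>h j. f (\<sigma>2 h (pinv f j))) w i"
proof (induction w)
  case (Cons l w)
  then show ?case by (cases l) simp_all
qed simp

lemma perm:
  assumes "f \<in> perms"
  shows "\<And>i. i < d \<Longrightarrow> f i < d" "\<And>i. i < d \<Longrightarrow> pinv f i < d" "\<And>i. pinv f (f i) = i"
    "\<And>i. f (pinv f i) = i" "\<And>i. i < d \<Longrightarrow> \<kappa> (f i) = \<kappa> i"
proof -
  have p: "f permutes {..<d}" using cperms_permutes[OF assms] .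
  show "f i < d" if "i < d" for i using permutes_in_image[OF p, of i] that by simp
  show "pinv f i < d" if "i < d" for i using permutes_in_image[OF permutes_inv[OF p], of i] that by simp
  show "pinv f (f i) = i" "f (pinv f i) = i" for i using permutes_inverses[OF p] by simp_all
  show "\<kappa> (f i) = \<kappa> i" if "i < d" for i using assms that by (simp add: cperms_def)
qed

lemma step_lt:
  assumes f: "f \<in> perms" and j: "j < d"
  shows "step f l j < d"
proof (cases l)
  case (Inl g) then show ?thesis using mod1D(1)[OF j] by simp
next
  case (Inr h) then show ?thesis using perm(1)[OF f mod2D(1)[OF perm(2)[OF f j]]] by simp
qed

lemma act_lt: "f \<in> perms \<Longrightarrow> i < d \<Longrightarrow> act f w i < d"
  by (induction w) (simp_all add: step_lt)

text \<open>If the letters come from the same factor they are multiplied inside the free product, and the model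
  of that factor multiplies them correctly at a tame point.\<close>

lemma act_fp_cons:
  assumes f: "f \<in> perms" and i: "i < d" and z: "alltame f z i" "\<And>k. k \<in> set z \<Longrightarrow> k \<in> letters"
    and l: "l \<in> letters"
  shows "act f (fp_cons G1 G2 l z) i = step f l (act f z i)"
proof (cases z)
  case Nil
  then show ?thesis by simp
next
  case (Cons k w)
  let ?y = "act f w i"
  have y: "?y < d" by (rule act_lt[OF f i])
  have k: "k \<in> letters" and t: "tame_step f k ?y" using z Cons by auto
  show ?thesis
  proof (cases l)
    case l1: (Inl g)
    show ?thesis
    proof (cases k)
      case (Inl g')
      have g: "g \<in> A1" "g' \<in> A1" using l k l1 Inl by auto
      have "\<sigma>1 g (\<sigma>1 g' ?y) = \<sigma>1 (g \<otimes>\<^bsub>G1\<^esub> g') ?y"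
        by (rule P1.tame_mult[OF win(1) _ g, where y = ?y]) (use t Inl in simp)
      then show ?thesis using Cons l1 Inl mod1D(2) y by simp
    next
      case (Inr h) then show ?thesis using Cons l1 by simp
    qed
  next
    case l2: (Inr h)
    show ?thesis
    proof (cases k)
      case (Inl g) then show ?thesis using Cons l2 by simp
    next
      case (Inr h')
      let ?y' = "pinv f ?y"
      have h: "h \<in> A2" "h' \<in> A2" using l k l2 Inr by auto
      have "\<sigma>2 h (\<sigma>2 h' ?y') = \<sigma>2 (h \<otimes>\<^bsub>G2\<^esub> h') ?y'"
        by (rule P2.tame_mult[OF win(2) _ h, where y = ?y']) (use t Inr in simp)
      then show ?thesis using Cons l2 Inr mod2D(2) perm(2)[OF f y] by (simp add: perm(3,4)[OF f])
    qed
  qed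
qed

lemma letter: "z \<in> Z \<Longrightarrow> k \<in> set z \<Longrightarrow> k \<in> letters"
  using A by (cases k) auto

lemma act_mult:
  assumes f: "f \<in> perms" and i: "i < d" and t: "\<And>z. z \<in> Z \<Longrightarrow> alltame f z i" and w: "w \<in> V" and v: "v \<in> V"
  shows "suffix u w \<Longrightarrow> act f u (act f v i) = act f (foldr (fp_cons G1 G2) u v) i"
proof (induction u)
  case (Cons l u)
  have su: "suffix u w" using suffix_ConsD[OF Cons.prems] .
  let ?z = "foldr (fp_cons G1 G2) u v"
  have z: "?z \<in> Z" by (rule ZV[OF w v su])
  have "l \<in> set w" using set_mono_suffix[OF Cons.prems] by simp
  then have l: "l \<in> letters" using letter V(2) w by blast
  have "act f (fp_cons G1 G2 l ?z) i = step f l (act f ?z i)"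
    by (rule act_fp_cons[OF f i t[OF z] letter[OF z] l])
  then show ?case using Cons.IH[OF su] by simp
qed simp

lemma step_colour:
  assumes f: "f \<in> perms" and j: "j < d" and t: "tame_step f l j" and l: "l \<in> letters"
  shows "\<exists>x\<in>space M. ct x = \<kappa> j \<and> ct (\<alpha> [l] x) = \<kappa> (step f l j)"
proof (cases l)
  case (Inl g)
  have g: "g \<in> A1" using l Inl by auto
  have t': "tame1 j" using t Inl by simp
  have "fp_inl G1 g = [l]" using g P1.windowD(2)[OF win(1)] Inl by (auto simp: fp_inl_def)
  then show ?thesis using P1.tame_colour[OF win(1) mod1D(2) t' g] Inl by simp
next
  case (Inr h)
  let ?j = "pinv f j"
  have h: "h \<in> A2" using l Inr by auto
  then have r: "fp_inr G2 h = [l]" using P2.windowD(2)[OF win(2)] Inr by (auto simp: fp_inr_def)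
  have j': "?j < d" by (rule perm(2)[OF f j])
  have t': "tame2 ?j" using t Inr by simp
  obtain x where x: "x \<in> space M" "ct x = \<kappa> ?j" "ct (\<alpha> (fp_inr G2 h) x) = \<kappa> (\<sigma>2 h ?j)"
    using P2.tame_colour[OF win(2) mod2D(2) t' h] by blast
  have "\<kappa> ?j = \<kappa> j" using perm(5)[OF f j'] by (simp add: perm(4)[OF f])
  moreover have "\<kappa> (\<sigma>2 h ?j) = \<kappa> (step f l j)" using perm(5)[OF f mod2D(1)[OF j', of h]] Inr by simp
  ultimately show ?thesis using x r by (intro bexI[of _ x]) simp_all
qed

text \<open>Induction along the word, applied letter by letter. Each letter is traced by a point of the space with
  the right colour; passing from one such point to the next is harmless as \<open>ct\<close> determines the final
  colour \<open>c\<close> after the remaining prefix \<open>u\<close>.\<close>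

lemma act_colour:
  assumes f: "f \<in> perms" and i: "i < d" and w: "w \<in> V" and t: "alltame f w i"
    and x0: "x0 \<in> space M" "ct x0 = \<kappa> i"
  shows "w = u @ v \<Longrightarrow> \<exists>y\<in>space M. ct y = \<kappa> (act f v i) \<and> c (\<alpha> w x0) = c (\<alpha> u y)"
proof (induction v arbitrary: u)
  case Nil
  then show ?case using x0 by auto
next
  case (Cons l v)
  have wr: "fp_reduced G1 G2 w" using Z(2) V(2) w carrier_fp by blast
  have w': "w = (u @ [l]) @ v" using Cons.prems by simp
  obtain y where y: "y \<in> space M" "ct y = \<kappa> (act f v i)" "c (\<alpha> w x0) = c (\<alpha> (u @ [l]) y)"
    using Cons.IH[OF w'] by blast
  have tw: "alltame f s i \<Longrightarrow> suffix (l # v) s \<Longrightarrow> tame_step f l (act f v i)" for s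
    by (induction s) (auto simp: suffix_Cons)
  have tl: "tame_step f l (act f v i)" by (rule tw[OF t]) (use Cons.prems in \<open>auto simp: suffix_def\<close>)
  have lA: "l \<in> letters" using letter[of w] V(2) w Cons.prems by auto
  obtain x where x: "x \<in> space M" "ct x = \<kappa> (act f v i)" "ct (\<alpha> [l] x) = \<kappa> (step f l (act f v i))"
    using step_colour[OF f act_lt[OF f i] tl lA] by blast
  have eq: "ct y = ct x" using x(2) y(2) by simp
  have pre: "prefix (u @ [l]) w" using w' by simp
  have "c (\<alpha> (u @ [l]) y) = c (\<alpha> (u @ [l]) x)" by (rule refine[OF y(1) x(1) eq w pre])
  also have "\<alpha> (u @ [l]) x = \<alpha> u (\<alpha> [l] x)"
  proof -
    have red: "fp_reduced G1 G2 (u @ [l])" "fp_reduced G1 G2 u" "fp_reduced G1 G2 [l]"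
      using wr Cons.prems by (auto simp: fp_reduced_def successively_append_iff)
    have "foldr (fp_cons G1 G2) u [l] = u @ [l]" using red(1)
    proof (induction u)
      case (Cons k u)
      have r: "fp_reduced G1 G2 (k # (u @ [l]))" using Cons.prems by simp
      then have "fp_reduced G1 G2 (u @ [l])" by (simp add: fp_reduced_Cons)
      then show ?case using Cons.IH fp_cons_eq_Cons[OF r] by simp
    qed simp
    then have "u @ [l] = u \<otimes>\<^bsub>free_product G1 G2\<^esub> [l]" by (simp add: mult_fp)
    then show ?thesis using F.act_mult[of u "[l]" x] red x(1) carrier_fp by simp
  qed
  finally have "c (\<alpha> w x0) = c (\<alpha> u (\<alpha> [l] x))" using y(3) by simp
  moreover have "\<alpha> [l] x \<in> space M"
  proof (rule F.act_closed[OF _ x(1)])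
    show "[l] \<in> carrier (free_product G1 G2)" using wr Cons.prems by (auto simp: carrier_fp fp_reduced_def)
  qed
  ultimately show ?case using x(3) by (intro bexI[of _ "\<alpha> [l] x"]) simp_all
qed

lemma good_join:
  assumes f: "f \<in> perms" and i: "i < d" and t: "\<And>z. z \<in> Z \<Longrightarrow> alltame f z i"
    and free: "\<And>w. w \<in> V \<Longrightarrow> w \<noteq> [] \<Longrightarrow> act f w i \<noteq> i"
  shows "F.good_pt (act f) (\<lambda>j. q (\<kappa> j)) V c i"
  unfolding F.good_pt_def
proof (intro conjI ballI impI)
  fix g h assume g: "g \<in> V" "h \<in> V"
  show "act f g (act f h i) = act f (g \<otimes>\<^bsub>free_product G1 G2\<^esub> h) i"
    unfolding mult_fp by (rule act_mult[OF f i t g]) simp_all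
next
  fix g assume g: "g \<in> V" "act f g i = i"
  show "g = \<one>\<^bsub>free_product G1 G2\<^esub>" using free[OF g(1)] g(2) unfolding one_fp by blast
next
  obtain x0 where x0: "x0 \<in> space M" "ct x0 = \<kappa> i" using \<kappa>[OF i] by (metis imageE)
  have "q (\<kappa> (act f w i)) = c (\<alpha> w x0)" if w: "w \<in> V" for w
  proof -
    have wZ: "w \<in> Z" using w V(2) by blast
    obtain y where y: "y \<in> space M" "ct y = \<kappa> (act f w i)" "c (\<alpha> w x0) = c (\<alpha> [] y)"
      using act_colour[OF f i w t[OF wZ] x0, of "[]" w] by auto
    have "\<alpha> [] y = y" using F.act_one[OF y(1)] by (simp add: one_fp)
    then show ?thesis using q[OF y(1)] y(2,3) by simp
  qed
  then show "\<exists>x\<in>space M. \<forall>g\<in>V. q (\<kappa> (act f g i)) = c (\<alpha> g x)" using x0(1) by blast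
qed

lemma step_inj: "f \<in> perms \<Longrightarrow> tame_step f l j \<Longrightarrow> tame_step f l j' \<Longrightarrow> l \<in> letters \<Longrightarrow> step f l j = step f l j' \<Longrightarrow> j = j'"
proof -
  assume f: "f \<in> perms" and t: "tame_step f l j" "tame_step f l j'" and l: "l \<in> letters" and eq: "step f l j = step f l j'"
  show ?thesis
  proof (cases l)
    case (Inl g)
    then show ?thesis using \<sigma>1_inj[of j j' g] t l eq by auto
  next
    case (Inr h)
    have "\<sigma>2 h (pinv f j) = \<sigma>2 h (pinv f j')"
      using arg_cong[OF eq, of "pinv f"] Inr by (simp add: perm(3)[OF f])
    then have "pinv f j = pinv f j'"
      using \<sigma>2_inj[of "pinv f j" "pinv f j'" h] t l Inr by auto
    then have "f (pinv f j) = f (pinv f j')" by simp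
    then show ?thesis by (simp only: perm(4)[OF f])
  qed
qed

lemma act_inj:
  assumes f: "f \<in> perms"
  shows "alltame f z i \<Longrightarrow> alltame f z i' \<Longrightarrow> set z \<subseteq> letters \<Longrightarrow> act f z i = act f z i' \<Longrightarrow> i = i'"
proof (induction z)
  case (Cons l z)
  have p: "tame_step f l (act f z i)" "tame_step f l (act f z i')" "l \<in> letters"
    "step f l (act f z i) = step f l (act f z i')" using Cons.prems by simp_all
  show ?case by (rule Cons.IH) (use Cons.prems step_inj[OF f p] in simp_all)
qed simp

text \<open>The walk up to the first untame step is injective in its starting point.\<close>

lemma card_first_untame:
  assumes f: "f \<in> perms" and z: "l # z \<in> Z"
  shows "real (card {i. i < d \<and> alltame f z i \<and> \<not> tame_step f l (act f z i)}) \<le> (2 + real (card A1) + real (card A2)) * \<nu> * real d"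
proof -
  let ?S = "{i. i < d \<and> alltame f z i \<and> \<not> tame_step f l (act f z i)}"
  have \<nu>: "\<nu> * real d \<ge> 0" using near(1) of_nat_0_le_iff order_trans by blast
  have zZ: "set z \<subseteq> letters" using letter[OF z] by auto
  have inj: "inj_on (act f z) ?S"
  proof (rule inj_onI)
    fix i i' assume "i \<in> ?S" "i' \<in> ?S" and eq: "act f z i = act f z i'"
    then have "alltame f z i" "alltame f z i'" by blast+
    then show "i = i'" using act_inj[OF f _ _ zZ eq] by blast
  qed
  show ?thesis
  proof (cases l)
    case (Inl g)
    have "card ?S \<le> card {i. i < d \<and> \<not> tame1 i}"
    proof (rule card_inj_on_le[OF inj])
      show "act f z ` ?S \<subseteq> {i. i < d \<and> \<not> tame1 i}" using act_lt[OF f] Inl by auto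
    qed simp
    then have "real (card ?S) \<le> real (card {i. i < d \<and> \<not> tame1 i})" by (rule of_nat_mono)
    also have "\<dots> \<le> (2 + real (card A1)) * \<nu> * real d" by (rule P1.card_untame[OF win(1) mod1 small(1) near(1)])
    also have "\<dots> \<le> (2 + real (card A1) + real (card A2)) * (\<nu> * real d)"
      unfolding mult.assoc using \<nu> by (intro mult_right_mono) auto
    finally show ?thesis by (simp only: mult.assoc)
  next
    case (Inr h)
    have "card ?S \<le> card {i. i < d \<and> \<not> tame2 i}"
    proof (rule card_inj_on_le)
      show "inj_on (\<lambda>i. pinv f (act f z i)) ?S"
      proof (rule inj_onI)
        fix i i' assume s: "i \<in> ?S" "i' \<in> ?S" and eq: "pinv f (act f z i) = pinv f (act f z i')"
        have "act f z i = act f z i'" using arg_cong[OF eq, of f] by (simp only: perm(4)[OF f])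
        then show "i = i'" using inj_onD[OF inj _ s] by blast
      qed
      show "(\<lambda>i. pinv f (act f z i)) ` ?S \<subseteq> {i. i < d \<and> \<not> tame2 i}"
        using perm(2)[OF f act_lt[OF f]] Inr by auto
    qed simp
    then have "real (card ?S) \<le> real (card {i. i < d \<and> \<not> tame2 i})" by (rule of_nat_mono)
    also have "\<dots> \<le> (2 + real (card A2)) * \<nu> * real d" by (rule P2.card_untame[OF win(2) mod2 small(1) near(2)])
    also have "\<dots> \<le> (2 + real (card A1) + real (card A2)) * (\<nu> * real d)"
      unfolding mult.assoc using \<nu> by (intro mult_right_mono) auto
    finally show ?thesis by (simp only: mult.assoc)
  qed
qed

lemma card_not_alltame:
  assumes f: "f \<in> perms"
  shows "real (card {i. i < d \<and> (\<exists>z\<in>Z. \<not> alltame f z i)}) \<le> \<epsilon> / 2 * real d"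
proof -
  let ?U = "{i. i < d \<and> (\<exists>z\<in>Z. \<not> alltame f z i)}"
  let ?S = "\<lambda>y. {i. i < d \<and> y \<noteq> [] \<and> alltame f (tl y) i \<and> \<not> tame_step f (hd y) (act f (tl y) i)}"
  let ?b = "(2 + real (card A1) + real (card A2)) * \<nu> * real d"
  have \<nu>: "\<nu> * real d \<ge> 0" using near(1) of_nat_0_le_iff order_trans by blast
  have "\<exists>y\<in>Z. i \<in> ?S y" if "z \<in> Z" "\<not> alltame f z i" "i < d" for z i
    using that
  proof (induction z)
    case (Cons l z)
    show ?case
    proof (cases "alltame f z i")
      case True
      then show ?thesis using Cons.prems by (intro bexI[of _ "l # z"]) simp_all
    next
      case False
      have "z \<in> Z" using Z(3)[OF Cons.prems(1)] by (simp add: suffix_ConsI)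
      then show ?thesis using Cons.IH[OF _ False Cons.prems(3)] by blast
    qed
  qed simp
  then have "?U \<subseteq> (\<Union>y\<in>Z. ?S y)" by blast
  then have "card ?U \<le> card (\<Union>y\<in>Z. ?S y)" by (intro card_mono finite_UN_I Z(1)) simp_all
  also have "\<dots> \<le> (\<Sum>y\<in>Z. card (?S y))" by (rule card_UN_le[OF Z(1)])
  finally have "real (card ?U) \<le> real (\<Sum>y\<in>Z. card (?S y))" by (rule of_nat_mono)
  also have "\<dots> = (\<Sum>y\<in>Z. real (card (?S y)))" by simp
  also have "\<dots> \<le> (\<Sum>y\<in>Z. ?b)"
  proof (rule sum_mono)
    fix y assume y: "y \<in> Z"
    show "real (card (?S y)) \<le> ?b"
    proof (cases y)
      case Nil
      then show ?thesis using \<nu> by (simp add: mult.assoc)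
    next
      case (Cons l z)
      then show ?thesis using card_first_untame[OF f, of l z] y by simp
    qed
  qed
  also have "\<dots> = real (card Z) * (2 + real (card A1) + real (card A2)) * \<nu> * real d" by simp
  also have "\<dots> \<le> \<epsilon> / 2 * real d" by (intro mult_right_mono small(2)) simp
  finally show ?thesis .
qed

definition ret :: "(nat \<Rightarrow> nat) \<Rightarrow> nat set" where
  "ret f = {i. i < d \<and> (\<exists>w\<in>V. w \<noteq> [] \<and> alltame f w i \<and> act f w i = i)}"

text \<open>Outside the starts of untame or returning walks all points are good. The colour statistics are
  inherited from the first model.\<close>

lemma model_join:
  assumes f: "f \<in> perms" and r: "real (card (ret f)) \<le> \<epsilon> / 2 * real d"
  shows "F.model V c \<epsilon> d (act f) (\<lambda>j. q (\<kappa> j))"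
  unfolding F.model_def
proof (intro conjI allI impI)
  let ?B = "{i. i < d \<and> \<not> F.good_pt (act f) (\<lambda>j. q (\<kappa> j)) V c i}"
  let ?U = "{i. i < d \<and> (\<exists>z\<in>Z. \<not> alltame f z i)}"
  show "act f g i < d" if "i < d" for g i by (rule act_lt[OF f that])
  show "act f \<one>\<^bsub>free_product G1 G2\<^esub> i = i" for i by (simp add: one_fp)
  show "q (\<kappa> i) \<in> c ` space M" if i: "i < d" for i
  proof -
    obtain x where "x \<in> space M" "\<kappa> i = ct x" using \<kappa>[OF i] by (metis imageE)
    then show ?thesis using q[of x] by (intro image_eqI[of _ _ x]) simp_all
  qed
  have "i \<in> ?U \<union> ret f"
    if i: "i < d" "\<not> F.good_pt (act f) (\<lambda>j. q (\<kappa> j)) V c i" for i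
  proof (rule ccontr)
    assume n: "\<not> ?thesis"
    have t: "alltame f z i" if "z \<in> Z" for z using n that i(1) by blast
    have "act f w i \<noteq> i" if "w \<in> V" "w \<noteq> []" for w
      using n that i(1) t[of w] V(2) unfolding ret_def by blast
    then show False using good_join[OF f i(1) t] i(2) by blast
  qed
  then have sub: "?B \<subseteq> ?U \<union> ret f"
    by blast
  have "card ?B \<le> card (?U \<union> ret f)"
    by (intro card_mono sub) (simp add: ret_def)
  also have "\<dots> \<le> card ?U + card (ret f)" by (rule card_Un_le)
  finally have "real (card ?B) \<le>
    real (card ?U + card (ret f))" by (rule of_nat_mono)
  also have "\<dots> = real (card ?U) + real (card (ret f))" by simp
  also have "\<dots> \<le> \<epsilon> / 2 * real d + \<epsilon> / 2 * real d" by (rule add_mono[OF card_not_alltame[OF f] r])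
  finally show "real (card ?B) \<le> \<epsilon> * real d" by simp
  fix Q
  let ?Q = "{t. q t \<in> Q}" and ?D = "{i. i < d \<and> \<kappa>1 i \<noteq> \<kappa> i}"
  have "\<bar>real (card {i. i < d \<and> \<kappa>1 i \<in> ?Q}) - real d * measure M {x \<in> space M. ct x \<in> ?Q}\<bar> \<le> e * real d"
    using mod1 unfolding P1.model_def by blast
  also have "{x \<in> space M. ct x \<in> ?Q} = {x \<in> space M. c x \<in> Q}" using q by auto
  finally have 1: "\<bar>real (card {i. i < d \<and> \<kappa>1 i \<in> ?Q}) - real d * measure M {x \<in> space M. c x \<in> Q}\<bar> \<le> e * real d" .
  have near': "card X \<le> card Y + card ?D" if "X \<subseteq> Y \<union> ?D" "finite Y" for X Y
  proof -
    have "card X \<le> card (Y \<union> ?D)" by (rule card_mono) (use that in simp_all)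
    then show ?thesis using card_Un_le[of Y ?D] by linarith
  qed
  have 2: "card {i. i < d \<and> \<kappa>1 i \<in> ?Q} \<le> card {i. i < d \<and> q (\<kappa> i) \<in> Q} + card ?D" by (rule near') auto
  have 3: "card {i. i < d \<and> q (\<kappa> i) \<in> Q} \<le> card {i. i < d \<and> \<kappa>1 i \<in> ?Q} + card ?D" by (rule near') auto
  have 4: "e * real d + \<nu> * real d \<le> \<epsilon> * real d"
  proof -
    have "e + \<nu> \<le> \<epsilon>" using small(1,3) by simp
    then have "(e + \<nu>) * real d \<le> \<epsilon> * real d" by (rule mult_right_mono) simp
    then show ?thesis by (simp add: algebra_simps)
  qed
  show "\<bar>real (card {i. i < d \<and> q (\<kappa> i) \<in> Q}) - real d * measure M {x \<in> space M. c x \<in> Q}\<bar> \<le> \<epsilon> * real d"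
    using 1 of_nat_mono[OF 2, where 'a = real] of_nat_mono[OF 3, where 'a = real] near(1) 4 unfolding of_nat_add by linarith
qed

lemma card_ret_le: "(\<Sum>f\<in>perms. real (card (ret f))) \<le> \<epsilon> / 4 * real d * real (card perms)"
proof -
  let ?p = "\<lambda>f w i. alltame f w i \<and> act f w i = i"
  let ?C = "perms" and ?V = "V - {[]}"
  have fV: "finite ?V" using V(1) by simp
  have ok: "alternating (rev w)" if w: "w \<in> V" for w
  proof -
    have wZ: "w \<in> Z" using w V(2) by blast
    have r: "fp_reduced G1 G2 w" using wZ Z(2) carrier_fp by blast
    have "successively (\<lambda>x y. isl x \<noteq> isl y) (rev w)"
      using r by (auto simp: fp_reduced_def successively_rev elim: successively_mono)
    moreover have "set (rev w) \<subseteq> letters" using letter[OF wZ] by auto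
    ultimately show ?thesis unfolding alternating_def by blast
  qed
  have "real (card (ret f)) \<le> (\<Sum>w\<in>?V. \<Sum>i<d. if ?p f w i then 1 else 0)" for f
  proof -
    have "ret f = (\<Union>w\<in>?V. {i. i < d \<and> ?p f w i})" unfolding ret_def by blast
    then have "card (ret f) \<le> (\<Sum>w\<in>?V. card {i. i < d \<and> ?p f w i})" using card_UN_le[OF fV] by simp
    also have "\<dots> = (\<Sum>w\<in>?V. \<Sum>i<d. if ?p f w i then 1 else 0)"
    proof (rule sum.cong[OF refl])
      fix w
      have "{i. i < d \<and> ?p f w i} = {i\<in>{..<d}. ?p f w i}" by auto
      then show "card {i. i < d \<and> ?p f w i} = (\<Sum>i<d. if ?p f w i then 1 else 0)"
        by (simp add: sum.If_cases Int_def)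
    qed
    finally have "real (card (ret f)) \<le> real (\<Sum>w\<in>?V. \<Sum>i<d. if ?p f w i then 1 else 0)" by (rule of_nat_mono)
    then show ?thesis by (simp add: of_nat_sum if_distrib cong: if_cong)
  qed
  then have "(\<Sum>f\<in>?C. real (card (ret f))) \<le> (\<Sum>f\<in>?C. \<Sum>w\<in>?V. \<Sum>i<d. if ?p f w i then 1 else 0)"
    by (rule sum_mono)
  also have "\<dots> = (\<Sum>w\<in>?V. \<Sum>f\<in>?C. \<Sum>i<d. if ?p f w i then 1 else 0)" by (rule sum.swap)
  also have "\<dots> = (\<Sum>w\<in>?V. \<Sum>i<d. \<Sum>f\<in>?C. if ?p f w i then 1 else 0)"
    by (intro sum.cong refl sum.swap)
  also have "\<dots> = (\<Sum>w\<in>?V. \<Sum>i<d. real (card {f \<in> ?C. ?p f w i}))"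
    by (intro sum.cong refl) (simp add: sum.If_cases finite_cperms Int_def)
  also have "\<dots> \<le> (\<Sum>w\<in>?V. \<Sum>i<d. real N * \<gamma> * real (card ?C))"
  proof (intro sum_mono)
    fix w i assume w: "w \<in> ?V" and i: "i \<in> {..<d}"
    have l: "length w \<le> N" using len[of w] V(2) w by blast
    have "real (card {f \<in> ?C. tame_walk f (rev w) i \<and> walk f (rev w) i = i}) \<le> real (length (rev w)) * \<gamma> * real (card ?C)"
      by (rule returning_walk) (use w i l ok[of w] in auto)
    also have "\<dots> \<le> real N * \<gamma> * real (card ?C)" using l \<gamma>_nonneg by (intro mult_right_mono) auto
    finally show "real (card {f \<in> ?C. ?p f w i}) \<le> real N * \<gamma> * real (card ?C)"
      unfolding alltame_def act_def .
  qed
  also have "\<dots> = real (card ?V) * real N * \<gamma> * real d * real (card ?C)" by simp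
  also have "\<dots> \<le> real (card V) * real N * \<gamma> * real d * real (card ?C)"
    using \<gamma>_nonneg card_mono[OF V(1), of ?V] by (intro mult_right_mono) auto
  also have "\<dots> \<le> \<epsilon> / 4 * real d * real (card ?C)"
  proof (intro mult_right_mono)
    have "4 * real (card V) * real N * \<gamma> \<le> \<epsilon>" using small(4) unfolding \<gamma>_def .
    then show "real (card V) * real N * \<gamma> \<le> \<epsilon> / 4" by linarith
  qed simp_all
  finally show ?thesis .
qed

text \<open>Markov's inequality, applied to the number of points with a returning walk.\<close>

theorem half_of_the_joins_are_models:
  assumes d: "d > 0"
  shows "card perms \<le> 2 * card {f \<in> perms. F.model V c \<epsilon> d (act f) (\<lambda>j. q (\<kappa> j))}"
proof -
  let ?C = "perms"
  let ?B = "{f \<in> ?C. \<not> real (card (ret f)) \<le> \<epsilon> / 2 * real d}" and ?G = "{f \<in> ?C. F.model V c \<epsilon> d (act f) (\<lambda>j. q (\<kappa> j))}"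
  have fin: "finite ?C" by (rule finite_cperms)
  have pos: "\<epsilon> / 4 * real d > 0" using \<epsilon> d by simp
  have "real (card ?B) * (\<epsilon> / 2 * real d) = (\<Sum>f\<in>?B. \<epsilon> / 2 * real d)" by simp
  also have "\<dots> \<le> (\<Sum>f\<in>?B. real (card (ret f)))" by (intro sum_mono) auto
  also have "\<dots> \<le> (\<Sum>f\<in>?C. real (card (ret f)))" using fin by (intro sum_mono2) auto
  also have "\<dots> \<le> \<epsilon> / 4 * real d * real (card ?C)" by (rule card_ret_le)
  finally have "(\<epsilon> / 4 * real d) * (2 * real (card ?B)) \<le> (\<epsilon> / 4 * real d) * real (card ?C)" by simp
  then have "2 * real (card ?B) \<le> real (card ?C)" using pos by (simp only: mult_le_cancel_left_pos)
  then have B: "2 * card ?B \<le> card ?C" by linarith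
  have "?C \<subseteq> ?B \<union> ?G" using model_join by blast
  then have "card ?C \<le> card (?B \<union> ?G)" using fin by (intro card_mono) simp_all
  then have "card ?C \<le> card ?B + card ?G" using card_Un_le[of ?B ?G] by linarith
  then show ?thesis using B by linarith
qed

end

section \<open>Matching the colourings of two models\<close>

lemma card_permute:
  assumes U: "U permutes {..<d}"
  shows "card {i. i < d \<and> P (U i)} = card {i. i < (d::nat) \<and> P i}"
proof (rule bij_betw_same_card[of U])
  have lt: "U i < d \<longleftrightarrow> i < d" for i using permutes_in_image[OF U, of i] by simp
  have "U ` {i. i < d \<and> P (U i)} = {i. i < d \<and> P i}"
  proof (intro equalityI subsetI)
    fix y assume y: "y \<in> {i. i < d \<and> P i}"
    have e: "U (pinv U y) = y" by (rule permutes_inverses(1)[OF U])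
    have "pinv U y < d" using lt[of "pinv U y"] e y by simp
    then show "y \<in> U ` {i. i < d \<and> P (U i)}" using e y by (intro image_eqI[of _ _ "pinv U y"]) simp_all
  qed (use lt in auto)
  then show "bij_betw U {i. i < d \<and> P (U i)} {i. i < d \<and> P i}"
    using permutes_inj_on[OF U] by (simp add: bij_betw_def)
qed

text \<open>Take a permutation with the maximal number of agreements. If some point of colour \<open>v\<close> is matched
  wrongly, then all points that receive the colour \<open>v\<close> have it, as otherwise a transposition would
  produce one more agreement. So the wrong matches of colour \<open>v\<close> are counted by the difference of the
  class sizes.\<close>

lemma match_colourings:
  fixes \<kappa>1 \<kappa>2 :: "nat \<Rightarrow> nat" and D :: real
  assumes S: "finite S" "\<And>i. i < d \<Longrightarrow> \<kappa>2 i \<in> S" and D0: "D \<ge> 0"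
    and D: "\<And>v. v \<in> S \<Longrightarrow> real (card {i. i < d \<and> \<kappa>2 i = v}) - real (card {i. i < d \<and> \<kappa>1 i = v}) \<le> D"
  shows "\<exists>U. U permutes {..<d} \<and> real (card {i. i < d \<and> \<kappa>1 (U i) \<noteq> \<kappa>2 i}) \<le> real (card S) * D"
proof -
  let ?A = "\<lambda>U. {i. i < d \<and> \<kappa>1 (U i) = \<kappa>2 i}"
  have cA: "card (?A U) < Suc d" for U 
  proof -
    have "?A U \<subseteq> {..<d}" by blast
    then have "card (?A U) \<le> card {..<d}" by (intro card_mono) simp_all
    then show ?thesis by simp
  qed
  obtain U where U: "U permutes {..<d}" and max: "\<And>U'. U' permutes {..<d} \<Longrightarrow> card (?A U') \<le> card (?A U)"
    using ex_has_greatest_nat[of "\<lambda>U. U permutes {..<d}" id "\<lambda>U. card (?A U)" "Suc d"] permutes_id[of "{..<d}"] cA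
    by (meson less_imp_le)
  let ?W = "\<lambda>v. {i. i < d \<and> \<kappa>2 i = v \<and> \<kappa>1 (U i) \<noteq> v}"
  have bad: "real (card (?W v)) \<le> D" if v: "v \<in> S" for v
  proof (cases "\<exists>i<d. \<kappa>2 i = v \<and> \<kappa>1 (U i) \<noteq> v")
    case True
    then obtain i where i: "i < d" "\<kappa>2 i = v" "\<kappa>1 (U i) \<noteq> v" by blast
    have agree: "\<kappa>2 j = v" if j: "j < d" "\<kappa>1 (U j) = v" for j
    proof (rule ccontr)
      assume n: "\<kappa>2 j \<noteq> v"
      let ?U = "U \<circ> Transposition.transpose i j"
      have p: "?U permutes {..<d}" using i j by (intro permutes_compose[OF permutes_swap_id U]) simp_all
      have "?A U \<subset> ?A ?U"
      proof (rule psubsetI)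
        show "?A U \<subseteq> ?A ?U"
        proof
          fix k assume k: "k \<in> ?A U"
          then have "k \<noteq> i" "k \<noteq> j" using i j n by auto
          then show "k \<in> ?A ?U" using k by simp
        qed
        have "i \<in> ?A ?U" "i \<notin> ?A U" using i j by auto
        then show "?A U \<noteq> ?A ?U" by blast
      qed
      then have "card (?A U) < card (?A ?U)" by (intro psubset_card_mono) simp_all
      then show False using max[OF p] by simp
    qed
    have "{i. i < d \<and> \<kappa>2 i = v} = (?W v) \<union> {i. i < d \<and> \<kappa>1 (U i) = v}"
      using agree by blast
    then have "card {i. i < d \<and> \<kappa>2 i = v} = card (?W v) + card {i. i < d \<and> \<kappa>1 (U i) = v}"
      by (simp only:) (rule card_Un_disjoint, auto)
    moreover have "card {i. i < d \<and> \<kappa>1 (U i) = v} = card {i. i < d \<and> \<kappa>1 i = v}" by (rule card_permute[OF U])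
    ultimately show ?thesis using D[OF v] by linarith
  next
    case False
    then have "(?W v) = {}" by blast
    then show ?thesis using D0 by (simp only: card.empty of_nat_0)
  qed
  have "{i. i < d \<and> \<kappa>1 (U i) \<noteq> \<kappa>2 i} \<subseteq> (\<Union>v\<in>S. (?W v))" using S(2) by auto
  then have "card {i. i < d \<and> \<kappa>1 (U i) \<noteq> \<kappa>2 i} \<le> card (\<Union>v\<in>S. (?W v))"
    using S(1) by (intro card_mono finite_UN_I) simp_all
  also have "\<dots> \<le> (\<Sum>v\<in>S. card (?W v))" by (rule card_UN_le[OF S(1)])
  finally have "real (card {i. i < d \<and> \<kappa>1 (U i) \<noteq> \<kappa>2 i}) \<le> real (\<Sum>v\<in>S. card (?W v))"
    by (rule of_nat_mono)
  also have "\<dots> \<le> (\<Sum>v\<in>S. D)" unfolding of_nat_sum by (intro sum_mono bad)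
  finally show ?thesis using U by auto
qed

text \<open>Double counting of the good pairs.\<close>

lemma exists_good_for_half:
  assumes fin: "finite R" "finite C" "C \<noteq> {}" and half: "\<And>r. r \<in> R \<Longrightarrow> card C \<le> 2 * card {f \<in> C. P f r}"
  shows "\<exists>f\<in>C. card R \<le> 2 * card {r \<in> R. P f r}"
proof (rule ccontr)
  assume "\<not> ?thesis"
  then have "\<And>f. f \<in> C \<Longrightarrow> 2 * card {r \<in> R. P f r} < card R" by auto
  then have "(\<Sum>f\<in>C. 2 * card {r \<in> R. P f r}) < (\<Sum>f\<in>C. card R)" using fin by (intro sum_strict_mono) auto
  moreover have "(\<Sum>f\<in>C. card {r \<in> R. P f r}) = (\<Sum>r\<in>R. card {f \<in> C. P f r})"
    by (rule sum_multicount_gen) (use fin in auto)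
  moreover have "(\<Sum>r\<in>R. card C) \<le> (\<Sum>r\<in>R. 2 * card {f \<in> C. P f r})" by (rule sum_mono[OF half])
  ultimately show False by (simp add: sum_distrib_left[symmetric] mult.commute)
qed

context pmp_action
begin

lemma model_conj:
  assumes U: "U permutes {..<d}" and m: "model V c \<epsilon> d \<sigma> \<kappa>"
  shows "model V c \<epsilon> d (\<lambda>g i. U (\<sigma> g (pinv U i))) (\<lambda>i. \<kappa> (pinv U i))"
    (is "model V c \<epsilon> d ?\<sigma> ?\<kappa>")
proof -
  have lt: "U i < d" "pinv U i < d" if "i < d" for i
    using permutes_in_image[OF U, of i] permutes_in_image[OF permutes_inv[OF U], of i] that by simp_all
  have iU: "pinv U (U i) = i" "U (pinv U i) = i" for i using permutes_inverses[OF U] by simp_all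
  have Ueq: "U x = U y \<longleftrightarrow> x = y" for x y by (rule inj_eq[OF permutes_inj[OF U]])
  have g: "good_pt ?\<sigma> ?\<kappa> V c (U j) \<longleftrightarrow> good_pt \<sigma> \<kappa> V c j" for j
    unfolding good_pt_def by (simp only: iU Ueq)
  have "card {i. i < d \<and> \<not> good_pt ?\<sigma> ?\<kappa> V c i} = card {i. i < d \<and> \<not> good_pt ?\<sigma> ?\<kappa> V c (U i)}"
    by (rule card_permute[OF U, symmetric])
  also have "\<dots> = card {i. i < d \<and> \<not> good_pt \<sigma> \<kappa> V c i}" by (simp only: g)
  finally have 1: "card {i. i < d \<and> \<not> good_pt ?\<sigma> ?\<kappa> V c i} = card {i. i < d \<and> \<not> good_pt \<sigma> \<kappa> V c i}" .
  have 2: "card {i. i < d \<and> ?\<kappa> i \<in> Q} = card {i. i < d \<and> \<kappa> i \<in> Q}" for Q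
    using card_permute[OF U, of "\<lambda>i. ?\<kappa> i \<in> Q"] by (simp only: iU)
  show ?thesis
    unfolding model_def 1 2
  proof (intro conjI allI impI)
    show "U (\<sigma> g (pinv U i)) < d" if "i < d" for g i
      using m lt that unfolding model_def by blast
    show "U (\<sigma> \<one> (pinv U i)) = i" if "i < d" for i
      using m lt(2)[OF that] iU(2)[of i] unfolding model_def by simp
    show "?\<kappa> i \<in> c ` space M" if "i < d" for i using m lt(2)[OF that] unfolding model_def by blast
  qed (use m in \<open>unfold model_def, blast+\<close>)
qed

lemma model_cong_colour:
  assumes m: "model V c \<epsilon> d \<sigma> \<kappa>" and eq: "\<And>i. i < d \<Longrightarrow> \<kappa>' i = \<kappa> i"
  shows "model V c \<epsilon> d \<sigma> \<kappa>'"
proof -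
  have lt: "\<sigma> g i < d" if "i < d" for g i using m that unfolding model_def by blast
  have g: "good_pt \<sigma> \<kappa>' V c i \<longleftrightarrow> good_pt \<sigma> \<kappa> V c i" if "i < d" for i
    unfolding good_pt_def by (simp only: eq[OF lt[OF that]])
  have 1: "{i. i < d \<and> \<not> good_pt \<sigma> \<kappa>' V c i} = {i. i < d \<and> \<not> good_pt \<sigma> \<kappa> V c i}" using g by blast
  have 2: "{i. i < d \<and> \<kappa>' i \<in> Q} = {i. i < d \<and> \<kappa> i \<in> Q}" for Q using eq by auto
  show ?thesis
    unfolding model_def 1 2
  proof (intro conjI allI impI)
    show "\<kappa>' i \<in> c ` space M" if "i < d" for i using m eq[OF that] that unfolding model_def by simp
  qed (use m in \<open>unfold model_def, blast+\<close>)
qed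

definition coloured_count :: "'g set \<Rightarrow> 'g set \<Rightarrow> ('x \<Rightarrow> nat) \<Rightarrow> real \<Rightarrow> nat \<Rightarrow> (nat \<Rightarrow> nat) \<Rightarrow> ('g \<times> nat \<Rightarrow> nat) set" where
  "coloured_count W V c \<epsilon> d \<kappa> = restr W d ` {\<sigma>. model V c \<epsilon> d \<sigma> \<kappa>}"

lemma coloured_count_subset: "coloured_count W V c \<epsilon> d \<kappa> \<subseteq> model_count W V c \<epsilon> d"
  unfolding coloured_count_def model_count_def models_def by blast

lemma finite_coloured_count: "finite W \<Longrightarrow> finite (coloured_count W V c \<epsilon> d \<kappa>)"
  using finite_subset[OF coloured_count_subset finite_model_count] .

lemma card_coloured_count_conj:
  assumes U: "U permutes {..<d}" and W: "finite W"
  shows "card (coloured_count W V c \<epsilon> d \<kappa>) \<le> card (coloured_count W V c \<epsilon> d (\<lambda>i. \<kappa> (pinv U i)))"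
proof (rule card_inj_on_le)
  let ?F = "\<lambda>r. restrict (\<lambda>(g, i). U (r (g, pinv U i))) (W \<times> {..<d})"
  have lt: "U i < d" "pinv U i < d" if "i < d" for i
    using permutes_in_image[OF U, of i] permutes_in_image[OF permutes_inv[OF U], of i] that by simp_all
  have iU: "pinv U (U i) = i" for i using permutes_inverses[OF U] by simp
  show "inj_on ?F (coloured_count W V c \<epsilon> d \<kappa>)"
  proof (rule inj_onI)
    fix r r' assume r: "r \<in> coloured_count W V c \<epsilon> d \<kappa>" "r' \<in> coloured_count W V c \<epsilon> d \<kappa>" and eq: "?F r = ?F r'"
    have ext: "r \<in> extensional (W \<times> {..<d})" "r' \<in> extensional (W \<times> {..<d})"
      using r unfolding coloured_count_def restr_def by auto
    have "r (g, i) = r' (g, i)" if "g \<in> W" "i < d" for g i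
    proof -
      have "U (r (g, i)) = U (r' (g, i))"
        using fun_cong[OF eq, of "(g, U i)"] that lt(1)[OF that(2)] by (simp add: iU)
      then show ?thesis by (simp only: inj_eq[OF permutes_inj[OF U]])
    qed
    then show "r = r'" using ext by (intro extensionalityI[of _ "W \<times> {..<d}"]) auto
  qed
  show "?F ` coloured_count W V c \<epsilon> d \<kappa> \<subseteq> coloured_count W V c \<epsilon> d (\<lambda>i. \<kappa> (pinv U i))"
  proof (rule image_subsetI)
    fix r assume "r \<in> coloured_count W V c \<epsilon> d \<kappa>"
    then obtain \<sigma> where \<sigma>: "model V c \<epsilon> d \<sigma> \<kappa>" "r = restr W d \<sigma>" unfolding coloured_count_def by blast
    have "?F r = restr W d (\<lambda>g i. U (\<sigma> g (pinv U i)))"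
      unfolding \<sigma>(2) restr_def using lt(2) by (intro restrict_ext) auto
    then show "?F r \<in> coloured_count W V c \<epsilon> d (\<lambda>i. \<kappa> (pinv U i))"
      unfolding coloured_count_def using model_conj[OF U \<sigma>(1)] by blast
  qed
  show "finite (coloured_count W V c \<epsilon> d (\<lambda>i. \<kappa> (pinv U i)))" by (rule finite_coloured_count[OF W])
qed

lemma model_count_coloured:
  "model_count W V c \<epsilon> d \<subseteq> (\<Union>\<kappa>\<in>{..<d} \<rightarrow>\<^sub>E c ` space M. coloured_count W V c \<epsilon> d \<kappa>)"
proof
  fix r assume "r \<in> model_count W V c \<epsilon> d"
  then obtain \<sigma> \<kappa> where m: "model V c \<epsilon> d \<sigma> \<kappa>" and r: "r = restr W d \<sigma>"
    unfolding model_count_def models_def by blast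
  let ?\<kappa> = "restrict \<kappa> {..<d}"
  have "model V c \<epsilon> d \<sigma> ?\<kappa>" by (rule model_cong_colour[OF m]) simp
  then have "r \<in> coloured_count W V c \<epsilon> d ?\<kappa>" unfolding coloured_count_def r by blast
  moreover have "?\<kappa> \<in> {..<d} \<rightarrow>\<^sub>E c ` space M" using m unfolding model_def by auto
  ultimately show "r \<in> (\<Union>\<kappa>\<in>{..<d} \<rightarrow>\<^sub>E c ` space M. coloured_count W V c \<epsilon> d \<kappa>)" by blast
qed

lemma window_exists:
  assumes "finite A" "A \<subseteq> carrier G" "\<one> \<notin> A"
  shows "\<exists>V\<subseteq>carrier G. window A V"
proof -
  let ?V = "insert \<one> (A \<union> (\<lambda>g. inv g) ` A \<union> (\<lambda>(g, h). g \<otimes> h) ` (A \<times> A))"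
  have "?V \<subseteq> carrier G" using assms(2) by auto
  moreover have "window A ?V" unfolding window_def using assms by auto
  ultimately show ?thesis by blast
qed

text \<open>The colour of \<open>x\<close> encodes the list of all values that have to be determined by it.\<close>

lemma refine_colour:
  assumes U: "finite U" "U \<subseteq> carrier G" "\<one> \<in> U" and c: "c \<in> M \<rightarrow>\<^sub>M count_space UNIV" and cf: "finite (c ` space M)"
  obtains ct :: "'x \<Rightarrow> nat" and q where "ct \<in> M \<rightarrow>\<^sub>M count_space UNIV" "finite (ct ` space M)"
    "\<And>x. x \<in> space M \<Longrightarrow> (c x :: nat) = q (ct x)"
    "\<And>x y u. x \<in> space M \<Longrightarrow> y \<in> space M \<Longrightarrow> ct x = ct y \<Longrightarrow> u \<in> U \<Longrightarrow> c (\<alpha> u x) = c (\<alpha> u y)"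
proof -
  obtain us where us: "set us = U" using finite_list[OF U(1)] by blast
  define ct where "ct x = list_encode (map (\<lambda>u. c (\<alpha> u x)) us)" for x
  define q where "q t = c (SOME x. x \<in> space M \<and> ct x = t)" for t
  have ref: "c (\<alpha> u x) = c (\<alpha> u y)" if "ct x = ct y" "u \<in> U" for x y u
  proof -
    have "map (\<lambda>u. c (\<alpha> u x)) us = map (\<lambda>u. c (\<alpha> u y)) us" using that(1) unfolding ct_def by (simp only: list_encode_eq)
    then show ?thesis using that(2) us by simp
  qed
  have "set vs \<subseteq> carrier G \<Longrightarrow> {x \<in> space M. map (\<lambda>u. c (\<alpha> u x)) vs = ys} \<in> sets M" for vs ys
  proof (induction vs arbitrary: ys)
    case Nil
    show ?case by (cases "ys = []") simp_all
  next
    case (Cons u vs)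
    show ?case
    proof (cases ys)
      case (Cons y ys')
      have u: "u \<in> carrier G" "set vs \<subseteq> carrier G" using Cons.prems by simp_all
      have "(\<lambda>x. c (\<alpha> u x)) \<in> M \<rightarrow>\<^sub>M count_space UNIV" by (rule measurable_compose[OF act_measurable[OF u(1)] c])
      then have "(\<lambda>x. c (\<alpha> u x)) -` {y} \<inter> space M \<in> sets M" by (rule measurable_sets) simp
      then have "((\<lambda>x. c (\<alpha> u x)) -` {y} \<inter> space M) \<inter> {x \<in> space M. map (\<lambda>u. c (\<alpha> u x)) vs = ys'} \<in> sets M"
        by (rule sets.Int[OF _ Cons.IH[OF u(2)]])
      also have "((\<lambda>x. c (\<alpha> u x)) -` {y} \<inter> space M) \<inter> {x \<in> space M. map (\<lambda>u. c (\<alpha> u x)) vs = ys'} =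
        {x \<in> space M. map (\<lambda>u. c (\<alpha> u x)) (u # vs) = ys}" using Cons by auto
      finally show ?thesis .
    qed simp
  qed
  then have lev: "{x \<in> space M. map (\<lambda>u. c (\<alpha> u x)) us = ys} \<in> sets M" for ys using U(2) us by blast
  show thesis
  proof (rule that)
    show "ct \<in> M \<rightarrow>\<^sub>M count_space UNIV"
      unfolding measurable_colour_iff
    proof
      fix a
      have "ct x = a \<longleftrightarrow> map (\<lambda>u. c (\<alpha> u x)) us = list_decode a" for x
        unfolding ct_def using list_encode_inverse list_decode_inverse by metis
      then show "{x \<in> space M. ct x = a} \<in> sets M" using lev by simp
    qed
    have sub: "ct ` space M \<subseteq> list_encode ` {xs. set xs \<subseteq> c ` space M \<and> length xs = length us}"
    proof (rule image_subsetI)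
      fix x assume x: "x \<in> space M"
      have "c (\<alpha> u x) \<in> c ` space M" if "u \<in> set us" for u
      proof -
        have "u \<in> carrier G" using that us U(2) by blast
        then show ?thesis using act_closed[OF _ x] by blast
      qed
      then show "ct x \<in> list_encode ` {xs. set xs \<subseteq> c ` space M \<and> length xs = length us}"
        unfolding ct_def by (intro imageI) auto
    qed
    show "finite (ct ` space M)" by (rule finite_subset[OF sub finite_imageI[OF finite_lists_length_eq[OF cf]]])
    show "c x = q (ct x)" if x: "x \<in> space M" for x
    proof -
      define y where "y = (SOME y. y \<in> space M \<and> ct y = ct x)"
      have y: "y \<in> space M \<and> ct y = ct x" unfolding y_def by (rule someI[of _ x]) (simp add: x)
      have "c (\<alpha> \<one> y) = c (\<alpha> \<one> x)" using ref[of y x \<one>] y U(3) by blast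
      then show ?thesis unfolding q_def y_def[symmetric] using y x by simp
    qed
    show "c (\<alpha> u x) = c (\<alpha> u y)" if "ct x = ct y" "u \<in> U" for x y u by (rule ref[OF that])
  qed
qed

end

section \<open>The lower bound for free products\<close>

context free_product_action
begin

text \<open>One permutation \<open>f\<close> is good for half of all pairs. Given \<open>f\<close>, the joined model determines both models,
  as the letters of the factors act by \<open>\<sigma>1\<close> and by the conjugate of \<open>\<sigma>2\<close>.\<close>

lemma joined_models_count:
  assumes d: "d > 0" and W: "finite W1" "finite W2"
    and J: "\<And>\<sigma>1 \<sigma>2. P1.model V1 ct e d \<sigma>1 \<kappa>1 \<Longrightarrow> P2.model V2 ct e d \<sigma>2 \<kappa>2 \<Longrightarrow>
      random_join G1 G2 M \<alpha> V Z c ct q V1 A1 V2 A2 e \<nu> \<epsilon> d m0 N \<sigma>1 \<sigma>2 \<kappa> \<kappa>1 \<kappa>2"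
  shows "card (P1.coloured_count W1 V1 ct e d \<kappa>1 \<times> P2.coloured_count W2 V2 ct e d \<kappa>2) \<le>
    2 * card (F.model_count (fp_inl G1 ` W1 \<union> fp_inr G2 ` W2) V c \<epsilon> d)"
proof -
  let ?R = "P1.coloured_count W1 V1 ct e d \<kappa>1 \<times> P2.coloured_count W2 V2 ct e d \<kappa>2" and ?C = "cperms d \<kappa> {}"
  let ?W = "fp_inl G1 ` W1 \<union> fp_inr G2 ` W2"
  define s1 where "s1 r = (SOME \<sigma>. P1.model V1 ct e d \<sigma> \<kappa>1 \<and> r = P1.restr W1 d \<sigma>)" for r
  define s2 where "s2 r = (SOME \<sigma>. P2.model V2 ct e d \<sigma> \<kappa>2 \<and> r = P2.restr W2 d \<sigma>)" for r
  define jn where "jn f r = ev (s1 (fst r)) (\<lambda>h j. f (s2 (snd r) h (pinv f j)))" for f r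
  have s1: "P1.model V1 ct e d (s1 r) \<kappa>1 \<and> r = P1.restr W1 d (s1 r)" if "r \<in> P1.coloured_count W1 V1 ct e d \<kappa>1" for r
  proof -
    have "\<exists>\<sigma>. P1.model V1 ct e d \<sigma> \<kappa>1 \<and> r = P1.restr W1 d \<sigma>" using that unfolding P1.coloured_count_def by blast
    then show ?thesis unfolding s1_def by (rule someI_ex)
  qed
  have s2: "P2.model V2 ct e d (s2 r) \<kappa>2 \<and> r = P2.restr W2 d (s2 r)" if "r \<in> P2.coloured_count W2 V2 ct e d \<kappa>2" for r
  proof -
    have "\<exists>\<sigma>. P2.model V2 ct e d \<sigma> \<kappa>2 \<and> r = P2.restr W2 d \<sigma>" using that unfolding P2.coloured_count_def by blast
    then show ?thesis unfolding s2_def by (rule someI_ex)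
  qed
  have fR: "finite ?R" using P1.finite_coloured_count[OF W(1)] P2.finite_coloured_count[OF W(2)] by (rule finite_cartesian_product)
  have fC: "finite ?C" "?C \<noteq> {}"
  proof -
    have "id \<in> ?C" by (simp add: cperms_def permutes_id)
    then show "?C \<noteq> {}" by blast
  qed (rule finite_cperms)
  have "\<exists>f\<in>?C. card ?R \<le> 2 * card {r \<in> ?R. F.model V c \<epsilon> d (jn f r) (\<lambda>j. q (\<kappa> j))}"
  proof (rule exists_good_for_half[OF fR fC])
    fix r assume r: "r \<in> ?R"
    have m: "P1.model V1 ct e d (s1 (fst r)) \<kappa>1" "P2.model V2 ct e d (s2 (snd r)) \<kappa>2"
      using s1[of "fst r"] s2[of "snd r"] r by auto
    interpret J: random_join G1 G2 M \<alpha> V Z c ct q V1 A1 V2 A2 e \<nu> \<epsilon> d m0 N "s1 (fst r)" "s2 (snd r)" \<kappa> \<kappa>1 \<kappa>2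
      by (rule J[OF m])
    have "J.act f = jn f r" for f unfolding jn_def by (intro ext J.act_eq_ev)
    then show "card ?C \<le> 2 * card {f \<in> ?C. F.model V c \<epsilon> d (jn f r) (\<lambda>j. q (\<kappa> j))}"
      using J.half_of_the_joins_are_models[OF d] by simp
  qed
  then obtain f where f: "f \<in> ?C" and half: "card ?R \<le> 2 * card {r \<in> ?R. F.model V c \<epsilon> d (jn f r) (\<lambda>j. q (\<kappa> j))}" by blast
  have p: "f permutes {..<d}" by (rule cperms_permutes[OF f])
  have fi: "f i < d" if "i < d" for i using permutes_in_image[OF p, of i] that by simp
  have fW: "finite ?W" using W by simp
  let ?Rf = "{r \<in> ?R. F.model V c \<epsilon> d (jn f r) (\<lambda>j. q (\<kappa> j))}"
  have "card ?Rf \<le> card (F.model_count ?W V c \<epsilon> d)"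
  proof (rule card_inj_on_le)
    show "(\<lambda>r. F.restr ?W d (jn f r)) ` ?Rf \<subseteq> F.model_count ?W V c \<epsilon> d"
      unfolding F.model_count_def F.models_def by blast
    show "finite (F.model_count ?W V c \<epsilon> d)" by (rule F.finite_model_count[OF fW])
    show "inj_on (\<lambda>r. F.restr ?W d (jn f r)) ?Rf"
    proof (rule inj_onI)
      fix r r' assume r: "r \<in> ?Rf" "r' \<in> ?Rf" and eq: "F.restr ?W d (jn f r) = F.restr ?W d (jn f r')"
      have R: "r \<in> ?R" "r' \<in> ?R" using r by blast+
      have e: "jn f r w i = jn f r' w i" if "w \<in> ?W" "i < d" for w i
        using fun_cong[OF eq, of "(w, i)"] that by (simp add: F.restr_def)
      have j1: "jn f t (fp_inl G1 g) i = s1 (fst t) g i" if "t \<in> ?R" "i < d" for t g i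
      proof -
        have "P1.model V1 ct e d (s1 (fst t)) \<kappa>1" using s1[of "fst t"] that(1) by auto
        then have "s1 (fst t) \<one>\<^bsub>G1\<^esub> i = i" using that(2) unfolding P1.model_def by blast
        then show ?thesis by (simp add: jn_def fp_inl_def)
      qed
      have j2: "jn f t (fp_inr G2 h) (f i) = f (s2 (snd t) h i)" if "t \<in> ?R" "i < d" for t h i
      proof -
        have "P2.model V2 ct e d (s2 (snd t)) \<kappa>2" using s2[of "snd t"] that(1) by auto
        then have "s2 (snd t) \<one>\<^bsub>G2\<^esub> i = i" using that(2) unfolding P2.model_def by blast
        then show ?thesis by (simp add: jn_def fp_inr_def permutes_inverses(2)[OF p])
      qed
      have "s1 (fst r) g i = s1 (fst r') g i" if "g \<in> W1" "i < d" for g i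
        using e[of "fp_inl G1 g" i] j1[OF R(1) that(2)] j1[OF R(2) that(2)] that by simp
      then have "P1.restr W1 d (s1 (fst r)) = P1.restr W1 d (s1 (fst r'))"
        unfolding P1.restr_def by (intro restrict_ext) auto
      then have 1: "fst r = fst r'" using s1[of "fst r"] s1[of "fst r'"] R by auto
      have "s2 (snd r) h i = s2 (snd r') h i" if h: "h \<in> W2" "i < d" for h i
      proof -
        have "f (s2 (snd r) h i) = f (s2 (snd r') h i)"
          using e[of "fp_inr G2 h" "f i"] j2[OF R(1) h(2)] j2[OF R(2) h(2)] h fi[OF h(2)] by simp
        then show ?thesis by (simp only: inj_eq[OF permutes_inj[OF p]])
      qed
      then have "P2.restr W2 d (s2 (snd r)) = P2.restr W2 d (s2 (snd r'))"
        unfolding P2.restr_def by (intro restrict_ext) auto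
      then have 2: "snd r = snd r'" using s2[of "snd r"] s2[of "snd r'"] R by auto
      show "r = r'" using 1 2 by (rule prod_eqI)
    qed
  qed
  then show ?thesis using half by linarith
qed

end

lemma fp_reduced_prefix: "fp_reduced G H w \<Longrightarrow> prefix u w \<Longrightarrow> fp_reduced G H u"
  by (auto simp: prefix_def fp_reduced_def successively_append_iff)

lemma finite_prefix_closure: "finite Z \<Longrightarrow> finite {u. \<exists>z\<in>Z. prefix u z}"
proof -
  assume Z: "finite Z"
  have "{u. \<exists>z\<in>Z. prefix u z} = (\<Union>z\<in>Z. set (prefixes z))" by (auto simp: set_prefixes_eq)
  then show ?thesis using Z by simp
qed

context pmp_action
begin

lemma charged_colour:
  assumes c: "c \<in> M \<rightarrow>\<^sub>M count_space UNIV" "finite (c ` space M)"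
  obtains v :: nat where "v \<in> c ` space M" "measure M {x \<in> space M. c x = v} > 0"
proof -
  have "\<exists>v\<in>c ` space M. measure M {x \<in> space M. c x = v} \<noteq> 0"
  proof (rule ccontr)
    assume n: "\<not> ?thesis"
    have "{x \<in> space M. c x \<in> {v. measure M {x \<in> space M. c x = v} = 0}} = space M" using n by blast
    then show False using null_colour_set[OF c] M.prob_space by simp
  qed
  then show thesis using that measure_nonneg zero_less_measure_iff by blast
qed

end

context free_product_action
begin

text \<open>Sum of \<open>joined_models_count\<close> over all pairs of colourings. For a given pair the second model is
  first conjugated to make the colourings match, and then colours of measure 0 are replaced by one of
  positive measure to make all colour classes large. The constant \<open>K\<close> accounts for the number of
  colourings.\<close>

lemma model_count_factors_le:
  assumes W: "finite W1" "finite W2" and p: "(V, c, \<epsilon>) \<in> F.params"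
  shows "\<exists>V1 V2 ct e K d0. (V1, ct, e) \<in> P1.params \<and> (V2, ct, e) \<in> P2.params \<and> K \<ge> 1 \<and>
    (\<forall>d\<ge>d0. real (card (P1.model_count W1 V1 ct e d \<times> P2.model_count W2 V2 ct e d)) \<le>
      real (card (F.model_count (fp_inl G1 ` W1 \<union> fp_inr G2 ` W2) V c \<epsilon> d)) * K ^ d)"
proof -
  let ?W = "fp_inl G1 ` W1 \<union> fp_inr G2 ` W2"
  let ?N = "\<lambda>d. card (F.model_count ?W V c \<epsilon> d)"
  have V: "finite V" "V \<subseteq> carrier (free_product G1 G2)" "c \<in> M \<rightarrow>\<^sub>M count_space UNIV" "finite (c ` space M)" "\<epsilon> > 0"
    using p by (auto simp: F.params_def)
  have redV: "fp_reduced G1 G2 w" if "w \<in> V" for w using that V(2) carrier_fp by blast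

  define S0 where "S0 = {u. \<exists>w\<in>V. suffix u w}"
  define Z0 where "Z0 = (\<lambda>(u, v). foldr (fp_cons G1 G2) u v) ` (S0 \<times> V) \<union> V"
  define Z where "Z = {u. \<exists>z\<in>Z0. suffix u z}"
  define N where "N = (\<Sum>z\<in>Z. length z)"
  have fZ0: "finite Z0" unfolding Z0_def S0_def using finite_suffix_closure[OF V(1)] V(1) by simp
  have fZ: "finite Z" unfolding Z_def by (rule finite_suffix_closure[OF fZ0])
  have redS0: "fp_reduced G1 G2 u" if "u \<in> S0" for u using that fp_reduced_suffix redV unfolding S0_def by blast
  have redZ0: "fp_reduced G1 G2 z" if "z \<in> Z0" for z
    using that redV fp_mult_reduced[OF grp1 grp2 redS0 redV] unfolding Z0_def by auto
  have redZ: "fp_reduced G1 G2 z" if "z \<in> Z" for z using that fp_reduced_suffix redZ0 unfolding Z_def by blast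
  have VZ0: "V \<subseteq> Z0" unfolding Z0_def by blast
  have Z0Z: "Z0 \<subseteq> Z" unfolding Z_def by blast
  have sufZ: "u \<in> Z" if "z \<in> Z" "suffix u z" for u z
    using that suffix_order.trans unfolding Z_def by blast
  have prodZ: "foldr (fp_cons G1 G2) u v \<in> Z" if "w \<in> V" "v \<in> V" "suffix u w" for u v w
  proof -
    have "(u, v) \<in> S0 \<times> V" unfolding S0_def using that by blast
    then have "foldr (fp_cons G1 G2) u v \<in> Z0" unfolding Z0_def by force
    then show ?thesis using Z0Z by blast
  qed
  have lenZ: "length z \<le> N" if "z \<in> Z" for z unfolding N_def by (rule member_le_sum[OF that _ fZ]) simp

  define A1 where "A1 = {g. \<exists>z\<in>Z. Inl g \<in> set z}"
  define A2 where "A2 = {h. \<exists>z\<in>Z. Inr h \<in> set z}"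
  have fA: "finite A1" "finite A2" unfolding A1_def A2_def using finite_letters fZ by blast+
  have A1: "A1 \<subseteq> carrier G1" "\<one>\<^bsub>G1\<^esub> \<notin> A1" unfolding A1_def using letter_inl redZ by blast+
  have A2: "A2 \<subseteq> carrier G2" "\<one>\<^bsub>G2\<^esub> \<notin> A2" unfolding A2_def using letter_inr redZ by blast+
  obtain V1 where V1: "V1 \<subseteq> carrier G1" "P1.window A1 V1" using P1.window_exists[OF fA(1) A1] by blast
  obtain V2 where V2: "V2 \<subseteq> carrier G2" "P2.window A2 V2" using P2.window_exists[OF fA(2) A2] by blast

  define U0 where "U0 = insert [] {u. \<exists>w\<in>V. prefix u w}"
  have U0: "finite U0" "U0 \<subseteq> carrier (free_product G1 G2)" "\<one>\<^bsub>free_product G1 G2\<^esub> \<in> U0"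
  proof -
    show "finite U0" unfolding U0_def using finite_prefix_closure[OF V(1)] by simp
    have "fp_reduced G1 G2 u" if u: "u \<in> U0" for u
    proof (cases "u = []")
      case False
      then obtain w where "w \<in> V" "prefix u w" using u unfolding U0_def by blast
      then show ?thesis using fp_reduced_prefix[OF redV] by blast
    qed simp
    then show "U0 \<subseteq> carrier (free_product G1 G2)" unfolding carrier_fp by blast
    show "\<one>\<^bsub>free_product G1 G2\<^esub> \<in> U0" unfolding U0_def one_fp by blast
  qed
  show ?thesis
  proof (rule F.refine_colour[OF U0 V(3,4)])
    fix ct :: "'x \<Rightarrow> nat" and q :: "nat \<Rightarrow> nat" assume ct: "ct \<in> M \<rightarrow>\<^sub>M count_space UNIV" "finite (ct ` space M)"
      and q: "\<And>x. x \<in> space M \<Longrightarrow> c x = q (ct x)"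
      and ref: "\<And>x y u. x \<in> space M \<Longrightarrow> y \<in> space M \<Longrightarrow> ct x = ct y \<Longrightarrow> u \<in> U0 \<Longrightarrow> c (\<alpha> u x) = c (\<alpha> u y)"
    let ?S = "ct ` space M" and ?m = "\<lambda>v. measure M {x \<in> space M. ct x = v}"
    obtain v0 where v0: "v0 \<in> ?S" "?m v0 > 0" by (rule F.charged_colour[OF ct])
    \<comment> \<open>The least positive measure of a colour; a class of \<open>\<kappa>\<close> has at least \<open>p0 / 2 * d\<close> members.\<close>
    define p0 where "p0 = Min (?m ` {v \<in> ?S. ?m v > 0})"
    have fm: "finite (?m ` {v \<in> ?S. ?m v > 0})" using ct(2) by simp
    have p0: "p0 > 0"
    proof -
      have "?m ` {v \<in> ?S. ?m v > 0} \<noteq> {}" using v0 by blast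
      then have "p0 \<in> ?m ` {v \<in> ?S. ?m v > 0}" unfolding p0_def by (rule Min_in[OF fm])
      then show ?thesis by blast
    qed
    have p0_le: "p0 \<le> ?m v" if "v \<in> ?S" "?m v > 0" for v
      unfolding p0_def by (rule Min_le[OF fm]) (use that in blast)
    define k where "k = card ?S"
    have k: "k \<ge> 1" unfolding k_def using v0(1) ct(2) card_gt_0_iff[of ?S] by (metis One_nat_def Suc_leI empty_iff)
    define B where "B = real (card Z) * (2 + real (card A1) + real (card A2))"
    have B: "B \<ge> 0" unfolding B_def by simp
    \<comment> \<open>Bound for the proportion of points at which colourings differ.\<close>
    define \<nu> where "\<nu> = min (\<epsilon> / 2) (\<epsilon> / (2 * (B + 1)))"
    have \<nu>: "\<nu> > 0" "2 * \<nu> \<le> \<epsilon>" "B * \<nu> \<le> \<epsilon> / 2"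
    proof -
      show "\<nu> > 0" using V(5) B by (simp add: \<nu>_def)
      have "\<nu> \<le> \<epsilon> / 2" unfolding \<nu>_def by (rule min.cobounded1)
      then show "2 * \<nu> \<le> \<epsilon>" by simp
      have "B * \<nu> \<le> B * (\<epsilon> / (2 * (B + 1)))" by (rule mult_left_mono[OF _ B]) (simp add: \<nu>_def)
      also have "\<dots> = (B / (B + 1)) * (\<epsilon> / 2)" by simp
      also have "\<dots> \<le> 1 * (\<epsilon> / 2)" using B V(5) by (intro mult_right_mono) auto
      finally show "B * \<nu> \<le> \<epsilon> / 2" by simp
    qed
    \<comment> \<open>Matching costs \<open>2 * e\<close> for each of the \<open>k\<close> colours, and removing null colours another \<open>e\<close>.\<close>
    define e where "e = min (p0 / 2) (\<nu> / (2 * real k + 1))"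
    have e: "e > 0" "e \<le> p0 / 2" "(2 * real k + 1) * e \<le> \<nu>" "e \<le> \<nu>"
    proof -
      show "e > 0" using p0 \<nu>(1) by (simp add: e_def)
      show "e \<le> p0 / 2" unfolding e_def by (rule min.cobounded1)
      have "e \<le> \<nu> / (2 * real k + 1)" by (simp add: e_def)
      then show 1: "(2 * real k + 1) * e \<le> \<nu>" by (simp add: pos_le_divide_eq mult.commute)
      have "1 * e \<le> (2 * real k + 1) * e" using \<open>e > 0\<close> by (intro mult_right_mono) auto
      then show "e \<le> \<nu>" using 1 by simp
    qed
    define L where "L = 2 * N + 1"
    \<comment> \<open>Class sizes of at least \<open>L + 1 + T\<close> make the probability of a return small enough.\<close>
    define T where "T = 4 * real (card V) * real N * (3 * real L + 2) / \<epsilon>"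
    have T: "T \<ge> 0" using V(5) by (simp add: T_def)
    define d0 where "d0 = Suc (nat \<lceil>2 * (real L + 2 + T) / p0\<rceil>)"
    have P1p: "(V1, ct, e) \<in> P1.params" using V1 ct e(1) P1.windowD(3)[OF V1(2)] by (simp add: P1.params_def)
    have P2p: "(V2, ct, e) \<in> P2.params" using V2 ct e(1) P2.windowD(3)[OF V2(2)] by (simp add: P2.params_def)
    let ?M = "\<lambda>d. P1.model_count W1 V1 ct e d \<times> P2.model_count W2 V2 ct e d"
    let ?R1 = "\<lambda>d \<kappa>1. P1.coloured_count W1 V1 ct e d \<kappa>1"
    let ?R2 = "\<lambda>d \<kappa>2. P2.coloured_count W2 V2 ct e d \<kappa>2"
    have main: "card (?R1 d \<kappa>1 \<times> ?R2 d \<kappa>2) \<le> 2 * ?N d"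
      if d: "d \<ge> d0" for d \<kappa>1 \<kappa>2
    proof (cases "?R1 d \<kappa>1 = {} \<or> ?R2 d \<kappa>2 = {}")
      case True
      then have "?R1 d \<kappa>1 \<times> ?R2 d \<kappa>2 = {}" by blast
      then show ?thesis by (simp only: card.empty)
    next
      case False
      have d1: "d > 0" using d unfolding d0_def by simp
      obtain \<sigma>1' where m1: "P1.model V1 ct e d \<sigma>1' \<kappa>1" using False unfolding P1.coloured_count_def by blast
      obtain \<sigma>2' where m2: "P2.model V2 ct e d \<sigma>2' \<kappa>2" using False unfolding P2.coloured_count_def by blast
      have st1: "\<bar>real (card {i. i < d \<and> \<kappa>1 i \<in> Q}) - real d * measure M {x \<in> space M. ct x \<in> Q}\<bar> \<le> e * real d" for Q
        using m1 unfolding P1.model_def by blast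
      have st2: "\<bar>real (card {i. i < d \<and> \<kappa>2 i \<in> Q}) - real d * measure M {x \<in> space M. ct x \<in> Q}\<bar> \<le> e * real d" for Q
        using m2 unfolding P2.model_def by blast
      have S1: "\<kappa>1 i \<in> ?S" if "i < d" for i using m1 that unfolding P1.model_def by blast
      have S2: "\<kappa>2 i \<in> ?S" if "i < d" for i using m2 that unfolding P2.model_def by blast
      have df: "real (card {i. i < d \<and> \<kappa>2 i = v}) - real (card {i. i < d \<and> \<kappa>1 i = v}) \<le> 2 * e * real d" for v
        using st1[of "{v}"] st2[of "{v}"] unfolding singleton_iff by linarith
      have e0: "2 * e * real d \<ge> 0" using e(1) by simp
      obtain U where U: "U permutes {..<d}" and ag: "real (card {i. i < d \<and> \<kappa>1 (U i) \<noteq> \<kappa>2 i}) \<le> real (card ?S) * (2 * e * real d)"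
        using match_colourings[where d = d and ?\<kappa>2.0 = \<kappa>2, OF ct(2) S2 e0 df] by blast
      let ?\<kappa>2 = "\<lambda>i. \<kappa>2 (pinv U i)"
      define \<kappa> where "\<kappa> i = (if ?m (\<kappa>1 i) = 0 then v0 else \<kappa>1 i)" for i
      let ?N1 = "{i. i < d \<and> \<kappa>1 i \<in> {v. ?m v = 0}}"
      let ?D1 = "{i. i < d \<and> \<kappa>1 i \<noteq> \<kappa> i}"
      let ?D2 = "{i. i < d \<and> ?\<kappa>2 i \<noteq> \<kappa>1 i}"
      let ?D = "{i. i < d \<and> ?\<kappa>2 i \<noteq> \<kappa> i}"
      let ?C1 = "\<lambda>i. {j. j < d \<and> \<kappa>1 j = \<kappa> i}"
      let ?C = "\<lambda>i. {j. j < d \<and> \<kappa> j = \<kappa> i}"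
      have ag': "real (card ?D2) \<le> real k * (2 * e * real d)"
      proof -
        have "card ?D2 = card {i. i < d \<and> ?\<kappa>2 (U i) \<noteq> \<kappa>1 (U i)}"
          by (rule card_permute[OF U, symmetric])
        also have "{i. i < d \<and> ?\<kappa>2 (U i) \<noteq> \<kappa>1 (U i)} = {i. i < d \<and> \<kappa>1 (U i) \<noteq> \<kappa>2 i}"
          by (simp only: permutes_inverses(2)[OF U]) (simp only: eq_commute)
        finally show ?thesis using ag unfolding k_def by simp
      qed
      have null: "real (card ?D1) \<le> e * real d"
      proof -
        have "?D1 \<subseteq> ?N1" unfolding \<kappa>_def by auto
        then have "card ?D1 \<le> card ?N1" by (intro card_mono) simp_all
        then have "real (card ?D1) \<le> real (card ?N1)" by (rule of_nat_mono)
        also have "\<dots> \<le> e * real d" using st1[of "{v. ?m v = 0}"] F.null_colour_set[OF ct] by simp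
        finally show ?thesis .
      qed
      have near1: "real (card ?D1) \<le> \<nu> * real d"
        by (rule order_trans[OF null mult_right_mono[OF e(4)]]) simp
      have near2: "real (card ?D) \<le> \<nu> * real d"
      proof -
        have "card ?D \<le> card (?D2 \<union> ?D1)"
          by (intro card_mono) auto
        also have "\<dots> \<le> card ?D2 + card ?D1" by (rule card_Un_le)
        finally have "real (card ?D) \<le> real (card ?D2 + card ?D1)"
          by (rule of_nat_mono)
        also have "\<dots> \<le> real k * (2 * e * real d) + e * real d" unfolding of_nat_add by (rule add_mono[OF ag' null])
        also have "\<dots> = ((2 * real k + 1) * e) * real d" by (simp add: algebra_simps)
        also have "\<dots> \<le> \<nu> * real d" by (rule mult_right_mono[OF e(3)]) simp
        finally show ?thesis .
      qed
      define m0 where "m0 = nat \<lfloor>p0 / 2 * real d\<rfloor>"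
      have m0: "real m0 \<le> p0 / 2 * real d" "real m0 \<ge> real L + 1 + T"
      proof -
        have nn: "p0 / 2 * real d \<ge> 0" using p0 by simp
        show "real m0 \<le> p0 / 2 * real d" unfolding m0_def by (rule of_nat_floor[OF nn])
        have "2 * (real L + 2 + T) / p0 \<le> real d0" unfolding d0_def by linarith
        also have "\<dots> \<le> real d" using d by simp
        finally have "real L + 2 + T \<le> p0 / 2 * real d" using p0 by (simp add: pos_divide_le_eq mult.commute)
        then show "real m0 \<ge> real L + 1 + T" unfolding m0_def using nn by linarith
      qed
      have \<kappa>S: "\<kappa> i \<in> ?S" "?m (\<kappa> i) > 0" if i: "i < d" for i
      proof -
        show "\<kappa> i \<in> ?S" using S1[OF i] v0(1) unfolding \<kappa>_def by simp
        show "?m (\<kappa> i) > 0" using v0(2) measure_nonneg[of M "{x \<in> space M. ct x = \<kappa>1 i}"] unfolding \<kappa>_def by (auto simp: zero_less_measure_iff)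
      qed
      have big: "m0 \<le> card (?C i)" if i: "i < d" for i
      proof -
        have "(?C1 i) \<subseteq> (?C i)" using \<kappa>S(2)[OF i] by (auto simp: \<kappa>_def)
        then have "card (?C1 i) \<le> card (?C i)" by (intro card_mono) simp_all
        moreover have "real (card (?C1 i)) \<ge> real d * ?m (\<kappa> i) - e * real d"
          using st1[of "{\<kappa> i}"] unfolding singleton_iff by linarith
        moreover have "real d * ?m (\<kappa> i) \<ge> real d * p0" by (rule mult_left_mono[OF p0_le[OF \<kappa>S[OF i]]]) simp
        moreover have "e * real d \<le> p0 / 2 * real d" by (rule mult_right_mono[OF e(2)]) simp
        moreover have "real d * p0 = p0 / 2 * real d + p0 / 2 * real d" by simp
        ultimately have "real m0 \<le> real (card (?C i))" using m0(1) by linarith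
        then show ?thesis by simp
      qed
      have Lm: "L < m0" using m0(2) T by linarith
      have \<gamma>: "4 * real (card V) * real N * ((3 * real L + 2) / (real m0 - real L)) \<le> \<epsilon>"
      proof -
        have pos: "real m0 - real L > 0" using Lm by simp
        have "4 * real (card V) * real N * (3 * real L + 2) = T * \<epsilon>" using V(5) by (simp add: T_def)
        also have "\<dots> \<le> \<epsilon> * (real m0 - real L)" using m0(2) V(5) by (simp add: mult.commute)
        finally show ?thesis using pos by (simp add: pos_divide_le_eq)
      qed
      have J: "random_join G1 G2 M \<alpha> V Z c ct q V1 A1 V2 A2 e \<nu> \<epsilon> d m0 N \<sigma>1 \<sigma>2 \<kappa> \<kappa>1 ?\<kappa>2"
        if m: "P1.model V1 ct e d \<sigma>1 \<kappa>1" "P2.model V2 ct e d \<sigma>2 ?\<kappa>2" for \<sigma>1 \<sigma>2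
      proof (rule random_join.intro[OF free_product_action_axioms random_join_axioms.intro])
        show "finite V" "V \<subseteq> Z" using V(1) VZ0 Z0Z by blast+
        show "finite Z" by (rule fZ)
        show "Z \<subseteq> carrier (free_product G1 G2)" using redZ unfolding carrier_fp by blast
        show "\<And>u z. z \<in> Z \<Longrightarrow> suffix u z \<Longrightarrow> u \<in> Z" by (rule sufZ)
        show "\<And>u w v. w \<in> V \<Longrightarrow> v \<in> V \<Longrightarrow> suffix u w \<Longrightarrow> foldr (fp_cons G1 G2) u v \<in> Z" by (rule prodZ)
        show "\<And>z. z \<in> Z \<Longrightarrow> length z \<le> N" by (rule lenZ)
        show "\<And>z g. z \<in> Z \<Longrightarrow> Inl g \<in> set z \<Longrightarrow> g \<in> A1" unfolding A1_def by blast
        show "\<And>z h. z \<in> Z \<Longrightarrow> Inr h \<in> set z \<Longrightarrow> h \<in> A2" unfolding A2_def by blast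
        show "P1.window A1 V1" by (rule V1(2))
        show "P2.window A2 V2" by (rule V2(2))
        show "\<And>x. x \<in> space M \<Longrightarrow> c x = q (ct x)" by (rule q)
        show "c (\<alpha> u x) = c (\<alpha> u y)" if "x \<in> space M" "y \<in> space M" "ct x = ct y" "w \<in> V" "prefix u w" for x y u w
        proof (rule ref[OF that(1-3)])
          show "u \<in> U0" unfolding U0_def using that(4,5) by blast
        qed
        show "P1.model V1 ct e d \<sigma>1 \<kappa>1" "P2.model V2 ct e d \<sigma>2 ?\<kappa>2" by (rule m)+
        show "\<And>i. i < d \<Longrightarrow> \<kappa> i \<in> ct ` space M" by (rule \<kappa>S(1))
        show "real (card ?D1) \<le> \<nu> * real d" by (rule near1)
        show "real (card ?D) \<le> \<nu> * real d" by (rule near2)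
        show "\<And>i. i < d \<Longrightarrow> m0 \<le> card (?C i)" by (rule big)
        show "2 * N + 1 < m0" using Lm unfolding L_def .
        show "e \<le> \<nu>" by (rule e(4))
        show "real (card Z) * (2 + real (card A1) + real (card A2)) * \<nu> \<le> \<epsilon> / 2" using \<nu>(3) unfolding B_def .
        show "2 * \<nu> \<le> \<epsilon>" by (rule \<nu>(2))
        show "4 * real (card V) * real N * ((3 * real (2 * N + 1) + 2) / (real m0 - real (2 * N + 1))) \<le> \<epsilon>" using \<gamma> unfolding L_def .
        show "\<epsilon> > 0" by (rule V(5))
      qed
      have "card (?R1 d \<kappa>1 \<times> ?R2 d \<kappa>2) \<le>
        card (?R1 d \<kappa>1 \<times> P2.coloured_count W2 V2 ct e d ?\<kappa>2)"
        unfolding card_cartesian_product by (rule mult_le_mono2[OF P2.card_coloured_count_conj[OF U W(2)]])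
      also have "\<dots> \<le> 2 * ?N d" by (rule joined_models_count[OF d1 W J])
      finally show ?thesis .
    qed
    have "real (card (?M d)) \<le>
        real (?N d) * (2 * (real k)\<^sup>2) ^ d" if d: "d \<ge> d0" for d
    proof -
      let ?E = "{..<d} \<rightarrow>\<^sub>E ct ` space M"
      let ?P = "\<lambda>\<kappa>. P1.coloured_count W1 V1 ct e d (fst \<kappa>) \<times> P2.coloured_count W2 V2 ct e d (snd \<kappa>)"
      have d1: "d \<ge> 1" using d unfolding d0_def by simp
      have fE: "finite (?E \<times> ?E)" using ct(2) by (intro finite_cartesian_product finite_PiE) simp_all
      have cE: "card ?E = k ^ d" unfolding k_def by (simp add: card_PiE)
      have fP: "finite (?P \<kappa>)" for \<kappa>
        by (rule finite_cartesian_product[OF P1.finite_coloured_count[OF W(1)] P2.finite_coloured_count[OF W(2)]])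
      have "?M d \<subseteq> (\<Union>\<kappa>\<in>?E \<times> ?E. ?P \<kappa>)"
      proof (rule subrelI)
        fix r s assume "(r, s) \<in> ?M d"
        then have rs: "r \<in> P1.model_count W1 V1 ct e d" "s \<in> P2.model_count W2 V2 ct e d" by blast+
        obtain \<kappa>1 where k1: "\<kappa>1 \<in> ?E" "r \<in> ?R1 d \<kappa>1" using subsetD[OF P1.model_count_coloured rs(1)] by blast
        obtain \<kappa>2 where k2: "\<kappa>2 \<in> ?E" "s \<in> ?R2 d \<kappa>2" using subsetD[OF P2.model_count_coloured rs(2)] by blast
        show "(r, s) \<in> (\<Union>\<kappa>\<in>?E \<times> ?E. ?P \<kappa>)"
          by (rule UN_I[of "(\<kappa>1, \<kappa>2)"]) (use k1 k2 in simp_all)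
      qed
      then have "card (?M d) \<le> card (\<Union>\<kappa>\<in>?E \<times> ?E. ?P \<kappa>)"
        by (intro card_mono finite_UN_I fE fP)
      also have "\<dots> \<le> (\<Sum>\<kappa>\<in>?E \<times> ?E. card (?P \<kappa>))" by (rule card_UN_le[OF fE])
      also have "\<dots> \<le> (\<Sum>\<kappa>\<in>?E \<times> ?E. 2 * ?N d)" by (rule sum_mono) (rule main[OF d])
      also have "\<dots> = (k ^ d * k ^ d) * (2 * ?N d)" by (simp add: card_cartesian_product cE)
      finally have "real (card (?M d)) \<le> real ((k ^ d * k ^ d) * (2 * ?N d))"
        by (rule of_nat_mono)
      also have "\<dots> = real (?N d) * (2 * ((real k)\<^sup>2) ^ d)"
        by (simp add: power2_eq_square power_mult_distrib)
      also have "\<dots> \<le> real (?N d) * (2 ^ d * ((real k)\<^sup>2) ^ d)"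
      proof (intro mult_left_mono mult_right_mono)
        show "(2::real) \<le> 2 ^ d" using power_increasing[OF d1, of "2::real"] by simp
      qed simp_all
      finally show ?thesis by (simp only: power_mult_distrib)
    qed
    moreover have "2 * (real k)\<^sup>2 \<ge> 1"
    proof -
      have "(real k)\<^sup>2 \<ge> 1" by (rule one_le_power) (use k in simp)
      then show ?thesis by linarith
    qed
    ultimately show ?thesis using P1p P2p by blast
  qed
qed

theorem model_dim_free_product_ge:
  "dim_add (P1.model_dim liminf) (P2.model_dim liminf) \<le> F.model_dim liminf"
  unfolding P1.model_dim_def P2.model_dim_def
proof (rule dim_add_SUP_le)
  fix W1 W2 assume "W1 \<in> {W. finite W \<and> W \<subseteq> carrier G1}" "W2 \<in> {W. finite W \<and> W \<subseteq> carrier G2}"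
  then have W: "finite W1" "W1 \<subseteq> carrier G1" "finite W2" "W2 \<subseteq> carrier G2" by blast+
  let ?f = "\<lambda>(V, c, \<epsilon>). liminf (\<lambda>d. log_rate d (P1.model_count W1 V c \<epsilon> d))"
  let ?g = "\<lambda>(V, c, \<epsilon>). liminf (\<lambda>d. log_rate d (P2.model_count W2 V c \<epsilon> d))"
  let ?a = "INF p\<in>P1.params. ?f p" and ?b = "INF p\<in>P2.params. ?g p"
  assume ne: "?a \<noteq> -\<infinity>" "?b \<noteq> -\<infinity>"
  let ?W = "fp_inl G1 ` W1 \<union> fp_inr G2 ` W2"
  let ?h = "\<lambda>(V, c, \<epsilon>). liminf (\<lambda>d. log_rate d (F.model_count ?W V c \<epsilon> d))"
  have fW: "finite ?W" using W by simp
  have cW: "?W \<subseteq> carrier (free_product G1 G2)"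
    using W hom_in_carrier[OF fp_inl_hom[OF grp1]] hom_in_carrier[OF fp_inr_hom[OF grp2]] by blast
  have "?a + ?b \<le> (INF p\<in>F.params. ?h p)"
  proof (rule INF_greatest)
    fix p assume p: "p \<in> F.params"
    obtain V c \<epsilon> where pp: "p = (V, c, \<epsilon>)" by (cases p)
    obtain V1 V2 ct e K d0 where P1p: "(V1, ct, e) \<in> P1.params" and P2p: "(V2, ct, e) \<in> P2.params" and K: "(1::real) \<le> K"
      and le: "\<And>d. d \<ge> d0 \<Longrightarrow> real (card (P1.model_count W1 V1 ct e d \<times> P2.model_count W2 V2 ct e d)) \<le>
      real (card (F.model_count ?W V c \<epsilon> d)) * K ^ d"
      using model_count_factors_le[OF W(1,3) p[unfolded pp]] by blast
    let ?A = "P1.model_count W1 V1 ct e" and ?B = "P2.model_count W2 V2 ct e"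
    have fA: "finite (?A d)" and fB: "finite (?B d)" for d
      using P1.finite_model_count[OF W(1)] P2.finite_model_count[OF W(3)] by blast+
    have la: "?a \<le> liminf (\<lambda>d. log_rate d (?A d))" using INF_lower[OF P1p, of ?f] by simp
    have lb: "?b \<le> liminf (\<lambda>d. log_rate d (?B d))" using INF_lower[OF P2p, of ?g] by simp
    have na: "liminf (\<lambda>d. log_rate d (?A d)) \<noteq> -\<infinity>" using la ne(1) by auto
    have nb: "liminf (\<lambda>d. log_rate d (?B d)) \<noteq> -\<infinity>" using lb ne(2) by auto
    have "?a + ?b \<le> liminf (\<lambda>d. log_rate d (?A d)) + liminf (\<lambda>d. log_rate d (?B d))" by (rule add_mono[OF la lb])
    also have "\<dots> \<le> liminf (\<lambda>d. log_rate d (?A d \<times> ?B d))" by (rule liminf_product[OF fA fB na nb])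
    also have "\<dots> \<le> ?h p"
    proof (rule ereal_le_epsilon2)
      fix r :: real assume r: "0 < r"
      have "liminf (\<lambda>d. log_rate d (?A d \<times> ?B d)) \<le> liminf (\<lambda>d. log_rate d (F.model_count ?W V c \<epsilon> d)) + ereal r"
      proof (rule limit_like_liminf[unfolded limit_like_def, rule_format])
        show "\<forall>\<^sub>F d in sequentially. log_rate d (?A d \<times> ?B d) \<le> log_rate d (F.model_count ?W V c \<epsilon> d) + ereal r"
          using eventually_log_rate_le[OF K r, where 'b = "('a + 'b) list \<times> nat \<Rightarrow> nat" and 'a = "('a \<times> nat \<Rightarrow> nat) \<times> ('b \<times> nat \<Rightarrow> nat)"]
            eventually_ge_at_top[of d0]
        proof eventually_elim
          case (elim d)
          have "K ^ d * (real d + 1) powr (0 * real d) = K ^ d" by simp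
          then have le': "real (card (?A d \<times> ?B d)) \<le> real (card (F.model_count ?W V c \<epsilon> d)) * (K ^ d * (real d + 1) powr (0 * real d))"
            using le[OF elim(2)] by (simp only:)
          show ?case by (rule elim(1)[rule_format, OF _ _ le']) (rule F.finite_model_count[OF fW] finite_cartesian_product[OF fA fB])+
        qed
      qed
      then show "liminf (\<lambda>d. log_rate d (?A d \<times> ?B d)) \<le> ?h p + ereal r" unfolding pp by simp
    qed
    finally show "?a + ?b \<le> ?h p" .
  qed
  also have "\<dots> \<le> F.model_dim liminf" unfolding F.model_dim_def by (rule SUP_upper) (use fW cW in blast)
  finally show "?a + ?b \<le> F.model_dim liminf" .
qed

end

context pmp_action
begin

lemma sofic_dim_eq_model_dim: "limit_like L \<Longrightarrow> sofic_dim_along L \<G> = model_dim L"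
  by (intro antisym sofic_dim_le_model_dim model_dim_le_sofic_dim)

lemma model_dim_liminf_le_limsup: "model_dim liminf \<le> model_dim limsup"
  unfolding model_dim_def by (intro SUP_mono' INF_mono') (auto intro: Liminf_le_Limsup split: prod.split)

end

theorem theorem6p4:
  fixes G1 :: "('a, 'm) monoid_scheme" and G2 :: "('b, 'n) monoid_scheme"
    and M :: "'x measure" and \<alpha> :: "('a + 'b) list \<Rightarrow> 'x \<Rightarrow> 'x"
  assumes "group G1" and "countable (carrier G1)"
    and "group G2" and "countable (carrier G2)"
    and "standard_prob_space M"
    and "mp_action (free_product G1 G2) M \<alpha>"
    and "approximation_regular G1 M (\<lambda>g. \<alpha> (fp_inl G1 g))"
    and "approximation_regular G2 M (\<lambda>h. \<alpha> (fp_inr G2 h))"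
  shows "approximation_regular (free_product G1 G2) M \<alpha> \<and>
    action_sofic_dim (free_product G1 G2) M \<alpha> =
      dim_add (action_sofic_dim G1 M (\<lambda>g. \<alpha> (fp_inl G1 g)))
              (action_sofic_dim G2 M (\<lambda>h. \<alpha> (fp_inr G2 h)))"
proof -
  interpret free_product_action G1 G2 M \<alpha>
    using assms by (intro free_product_action.intro) (simp_all add: standard_prob_space_def)
  let ?s = "F.model_dim limsup" and ?l = "F.model_dim liminf"
  have F: "action_sofic_dim (free_product G1 G2) M \<alpha> = ?s" "action_lower_sofic_dim (free_product G1 G2) M \<alpha> = ?l"
    unfolding action_sofic_dim_def action_lower_sofic_dim_def sofic_dim_def lower_sofic_dim_def
    by (rule F.sofic_dim_eq_model_dim limit_like_limsup limit_like_liminf)+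
  have P1: "action_sofic_dim G1 M (\<lambda>g. \<alpha> (fp_inl G1 g)) = P1.model_dim limsup"
    "action_lower_sofic_dim G1 M (\<lambda>g. \<alpha> (fp_inl G1 g)) = P1.model_dim liminf"
    unfolding action_sofic_dim_def action_lower_sofic_dim_def sofic_dim_def lower_sofic_dim_def
    by (rule P1.sofic_dim_eq_model_dim limit_like_limsup limit_like_liminf)+
  have P2: "action_sofic_dim G2 M (\<lambda>h. \<alpha> (fp_inr G2 h)) = P2.model_dim limsup"
    "action_lower_sofic_dim G2 M (\<lambda>h. \<alpha> (fp_inr G2 h)) = P2.model_dim liminf"
    unfolding action_sofic_dim_def action_lower_sofic_dim_def sofic_dim_def lower_sofic_dim_def
    by (rule P2.sofic_dim_eq_model_dim limit_like_limsup limit_like_liminf)+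
  have reg: "P1.model_dim liminf = P1.model_dim limsup" "P2.model_dim liminf = P2.model_dim limsup"
    using assms(7,8) unfolding approximation_regular_def P1 P2 by simp_all
  have upper: "?s \<le> dim_add (P1.model_dim limsup) (P2.model_dim limsup)" by (rule model_dim_free_product_le)
  have lower: "dim_add (P1.model_dim limsup) (P2.model_dim limsup) \<le> ?l"
    using model_dim_free_product_ge unfolding reg .
  have "?l \<le> ?s" by (rule F.model_dim_liminf_le_limsup)
  then have "?s = ?l" "?s = dim_add (P1.model_dim limsup) (P2.model_dim limsup)" using upper lower by auto
  then show ?thesis unfolding approximation_regular_def F P1(1) P2(1) by blast
qed

end
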